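(* Let $\lambda=\lambda(n)$ satisfy $\lambda\to\infty$ and $\lambda\le n^{1/1000}$, and let $\lambda_\star<1$ satisfy $\lambda_\star e^{-\lambda_\star}=\lambda e^{-\lambda}$. Then $\operatorname{diam}(G(n,\lambda/n))$ is two-point concentrated: there exists a function $f(n,\lambda)$ satisfying \[ f(n,\lambda) = \frac{\log n}{\log\lambda} + 2\frac{\log n}{\log(1/\lambda_\star)} +O(1) \] such that with high probability $\operatorname{diam}(G(n,\lambda/n))\in\{f(n,\lambda),f(n,\lambda)+1\}$. Furthermore, for any $\varepsilon>0$ and any such function $\lambda$ for which, for large $n$, neither $\log n/\log(1/\lambda_\star)$ nor $\log n/\log\lambda$ is within $\varepsilon$ of an integer, we have \[ \operatorname{diam}(G(n,\lambda/n)) = \left\lceil\frac{\log n}{\log\lambda}\right\rceil + 2\left\lfloor\frac{\log n}{\log(1/\lambda_\star)}\right\rfloor+1 \] with high probability.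
   Context: $G(n,p)$ is the random graph with vertex set $\{1,\dots,n\}$ in which each possible edge is present independently with probability $p$. For a graph $G$, $\operatorname{diam}(G)=\max\{d(x,y): x,y\in V(G),\ d(x,y)<\infty\}$ is the largest graph distance between two vertices in the same component. An event holds with high probability if its probability tends to $1$ as $n\to\infty$. *)

theory Defs
  imports "HOL-Probability.Probability" "HOL-Library.Extended_Nat" "HOL-Library.Landau_Symbols"
begin

definition pairs :: "nat \<Rightarrow> nat set set" where
  "pairs n = {e. e \<subseteq> {1..n} \<and> card e = 2}"

text \<open>A graph on the vertex set \<open>{1..n}\<close> is represented by its edge set, a subset of \<open>pairs n\<close>.
  Note that \<^const>\<open>bernoulli_pmf\<close> clips its parameter to the unit interval, so \<open>gnp n p\<close> is
  the usual \<open>G(n,p)\<close> only for \<open>0 \<le> p \<le> 1\<close>.\<close>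

definition gnp :: "nat \<Rightarrow> real \<Rightarrow> nat set set pmf" where
  "gnp n p = map_pmf (\<lambda>b. {e \<in> pairs n. b e})
     (Pi_pmf (pairs n) False (\<lambda>_. bernoulli_pmf p))"

definition adj_rel :: "'a set set \<Rightarrow> ('a \<times> 'a) set" where
  "adj_rel E = {(x, y). x \<noteq> y \<and> {x, y} \<in> E}"

text \<open>The relational power \<open>adj_rel E ^^ k\<close> relates the endpoints of walks of length \<open>k\<close>; the
  infimum is \<open>\<infinity>\<close> when no walk joins \<open>x\<close> and \<open>y\<close>.\<close>

definition gdist :: "'a set set \<Rightarrow> 'a \<Rightarrow> 'a \<Rightarrow> enat" where
  "gdist E x y = (INF k\<in>{k. (x, y) \<in> adj_rel E ^^ k}. enat k)"

definition diam :: "'a set \<Rightarrow> 'a set set \<Rightarrow> nat" where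
  "diam V E = Max {the_enat (gdist E x y) | x y. x \<in> V \<and> y \<in> V \<and> gdist E x y < \<infinity>}"

definition whp :: "(nat \<Rightarrow> 'a pmf) \<Rightarrow> (nat \<Rightarrow> 'a \<Rightarrow> bool) \<Rightarrow> bool" where
  "whp M P \<longleftrightarrow> (\<lambda>n. measure_pmf.prob (M n) {x. P n x}) \<longlonglongrightarrow> 1"

end

theory Submission
 imports Defs "HOL-Real_Asymp.Real_Asymp"
begin

text \<open>Write \<open>N k = n * lam_star ^ k\<close> and \<open>\<theta> m = lam ^ m / n\<close>. Exploring the graph breadth-first, the
 generating functions of the level sizes obey \<open>z (i + 1) = exp (- lam * (1 - z i))\<close>. Hence a vertex whose
 neighbourhood stays thin, but nonempty, for \<open>K\<close> generations before it starts to grow costs about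
 \<open>lam_star ^ K\<close>, and two vertices with large spheres are joined except with probability
 \<open>exp (- p * |S| * |S'|)\<close>; this bounds the probability of a diameter above \<open>2 * K + M\<close> in terms of
 \<open>N K\<close> and \<open>\<theta> M\<close>.

 For the lower bound call \<open>v\<close> an end if finite branches of height exactly \<open>k\<close> hang off \<open>v\<close>, while its few
 remaining neighbours all lead to many vertices. The branches of distinct ends are disjoint, so the
 probability that given vertices are all ends almost factorises, and a second moment argument gives about
 \<open>N k\<close> ends. Among \<open>l + 1\<close> of them explore \<open>t1\<close> levels from the first and \<open>t2\<close> levels from each of the
 others: these balls are almost disjoint, so a Chebyshev bound shows that one of them is missed by the
 next level. A 1-Lipschitz potential then certifies that the tips of the two branches are far apart.

 With \<open>k\<close> maximal subject to \<open>N k \<ge> sqrt lam\<close> and \<open>m\<close> minimal subject to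
 \<open>\<theta> m \<ge> (ln lam) powr (- 6)\<close>, the two bounds leave exactly two values.\<close>

section \<open>Random subsets\<close>

text \<open>Lengthening a branch by one generation multiplies the number of ends by
  \<open>lam_star\<close>, about \<open>lam * exp (- lam)\<close>; one more level multiplies sphere
  sizes by \<open>lam\<close>. The obstacle is that these are not the only options. An end with
  \<open>J\<close> outward neighbours instead of about \<open>lam\<close> also costs about
  \<open>exp (- lam)\<close>, but gains a factor like \<open>(lam / J) ^ J\<close>, and it shrinks
  all later spheres by \<open>J / lam\<close>, nearly the effect of an extra generation. Hence the
  lower bound carries a free parameter \<open>J\<close>: of order \<open>lam * ln lam\<close> when
  typical ends suffice, about \<open>lam powr (3/10)\<close> when branches of height
  \<open>k + 1\<close> may just fail to exist. Dually, the upper bound weighs slow beginnings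
  through Laplace parameters \<open>g\<close>, so that slow growth and thin survival are paid for
  jointly. Which pair of values occurs depends on whether the number of ends can offset an exponent
  proportional to \<theta>.

  Since \<open>lam\<close> may grow arbitrarily slowly, errors must vanish in \<open>lam\<close>
  alone: every estimate holds for all large \<open>L\<close>, uniformly in \<open>n\<close> with
  \<open>L ^ 1000 <= n\<close>, and the final error is of order \<open>1 / ln L\<close>.\<close>

definition Ex :: "'a set => real => ('a set => real) => real" where
 "Ex A q f = (\<Sum>X\<in>Pow A. q^card X*(1 - q)^card (A - X)*f X)"

lemma one_minus_pow_le:
 assumes "0 <= p" "p <= (1::real)"
 shows "(1 - p)^N <= exp (- (real N*p))"
proof -
 have "1 - p <= exp (- p)" using exp_ge_add_one_self[of "- p"] by simp
 hence "(1 - p)^N <= exp (- p)^N" using assms by (intro power_mono) auto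
 thus ?thesis by (simp add: exp_of_nat_mult[symmetric])
qed

abbreviation PE :: "'a set => real => ('a set => bool) => real" where
 "PE A q P \<equiv> Ex A q (\<lambda>X. of_bool (P X))"

lemma Ex_empty [simp]: "Ex {} q f = f {}"
 by (simp add: Ex_def)

lemma Ex_insert:
 assumes "finite A" "a \<notin> A"
 shows "Ex (insert a A) q f = q*Ex A q (\<lambda>X. f (insert a X)) + (1 - q)*Ex A q f"
proof -
 have inj: "inj_on (insert a) (Pow A)"
  using assms(2) by (auto simp: inj_on_def)
 have disj: "Pow A \<inter> insert a ` Pow A = {}"
  using assms(2) by auto
 have "Ex (insert a A) q f =
   (\<Sum>X\<in>Pow A. q^card X*(1 - q)^card (insert a A - X)*f X)
  + (\<Sum>X\<in>Pow A. q^card (insert a X)*(1 - q)^card (insert a A - insert a X)*f (insert a X))"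
  unfolding Ex_def Pow_insert using assms disj
  by (subst sum.union_disjoint) (auto simp: sum.reindex[OF inj])
 also have "(\<Sum>X\<in>Pow A. q^card X*(1 - q)^card (insert a A - X)*f X) = (1 - q)*Ex A q f"
  unfolding Ex_def sum_distrib_left
 proof (rule sum.cong[OF refl])
  fix X assume X: "X \<in> Pow A"
  have "insert a A - X = insert a (A - X)" using assms X by auto
  moreover have "card (insert a (A - X)) = Suc (card (A - X))"
   using assms by (simp add: card_insert_if)
  ultimately show "q^card X*(1 - q)^card (insert a A - X)*f X
    = (1 - q)*(q^card X*(1 - q)^card (A - X)*f X)" by simp
 qed
 also have "(\<Sum>X\<in>Pow A. q^card (insert a X)*(1 - q)^card (insert a A - insert a X)*f (insert a X))
   = q*Ex A q (\<lambda>X. f (insert a X))"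
  unfolding Ex_def sum_distrib_left
 proof (rule sum.cong[OF refl])
  fix X assume X: "X \<in> Pow A"
  have "insert a A - insert a X = A - X" using assms by auto
  moreover have "card (insert a X) = Suc (card X)"
   using assms X finite_subset[of X A] by (auto simp: card_insert_if)
  ultimately show "q^card (insert a X)*(1 - q)^card (insert a A - insert a X)*f (insert a X)
    = q*(q^card X*(1 - q)^card (A - X)*f (insert a X))" by simp
 qed
 finally show ?thesis by simp
qed

lemma Ex_cong:
 assumes "\<And>X. X \<subseteq> A ==> f X = g X"
 shows "Ex A q f = Ex A q g"
 unfolding Ex_def by (rule sum.cong) (auto simp: assms)

lemma Ex_mono:
 assumes "0 <= q" "q <= 1" "\<And>X. X \<subseteq> A ==> f X <= g X"
 shows "Ex A q f <= Ex A q g"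
 unfolding Ex_def by (rule sum_mono) (auto intro!: mult_left_mono assms simp: assms(1,2))

lemma Ex_add: "Ex A q (\<lambda>X. f X + g X) = Ex A q f + Ex A q g"
 by (simp add: Ex_def distrib_left sum.distrib)

lemma Ex_cmult: "Ex A q (\<lambda>X. c*f X) = c*Ex A q f"
 by (simp add: Ex_def sum_distrib_left mult.left_commute)

lemma Ex_multc: "Ex A q (\<lambda>X. f X*c) = Ex A q f*c"
 by (simp add: Ex_def sum_distrib_right mult.assoc)

lemma Ex_diff: "Ex A q (\<lambda>X. f X - g X) = Ex A q f - Ex A q g"
 by (simp add: Ex_def right_diff_distrib sum_subtractf)

lemma Ex_sum: "Ex A q (\<lambda>X. \<Sum>i\<in>I. f i X) = (\<Sum>i\<in>I. Ex A q (f i))"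
 unfolding Ex_def sum_distrib_left by (rule sum.swap)

lemma Ex_const [simp]: "finite A ==> Ex A q (\<lambda>_. c) = c"
proof (induction A rule: finite_induct)
 case (insert a A)
 thus ?case by (simp add: Ex_insert algebra_simps)
qed simp

lemma Ex_nonneg:
 assumes "0 <= q" "q <= 1" "\<And>X. X \<subseteq> A ==> 0 <= f X"
 shows "0 <= Ex A q f"
 unfolding Ex_def by (rule sum_nonneg) (auto intro!: mult_nonneg_nonneg assms simp: assms(1,2))

lemma Ex_le_const:
 assumes "finite A" "0 <= q" "q <= 1" "\<And>X. X \<subseteq> A ==> f X <= c"
 shows "Ex A q f <= c"
 using Ex_mono[of q A f "\<lambda>_. c"] assms by simp

text \<open>Independence of the traces of a random subset on disjoint ground sets. Together with
  \<open>Ex_insert\<close> it supplies the product structure, so that all probabilities remain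
  finite sums.\<close>

lemma Ex_union:
 assumes "finite A" "finite B" "A \<inter> B = {}"
 shows "Ex (A \<union> B) q f = Ex A q (\<lambda>X. Ex B q (\<lambda>Y. f (X \<union> Y)))"
 using assms
proof (induction A arbitrary: f rule: finite_induct)
 case (insert a A)
 hence "Ex (insert a A \<union> B) q f = q*Ex (A \<union> B) q (\<lambda>X. f (insert a X)) + (1 - q)*Ex (A \<union> B) q f"
  by (simp add: Ex_insert)
 with insert show ?case by (simp add: Ex_insert)
qed simp

lemma Ex_swap: "Ex A q (\<lambda>X. Ex B r (\<lambda>Y. f X Y)) = Ex B r (\<lambda>Y. Ex A q (\<lambda>X. f X Y))"
 unfolding Ex_def sum_distrib_left by (subst sum.swap) (simp add: mult_ac)

lemma Ex_restrict:
 assumes "finite A" "B \<subseteq> A"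
 shows "Ex A q (\<lambda>X. f (X \<inter> B)) = Ex B q f"
proof -
 have fin: "finite B" "finite (A - B)" using assms finite_subset by auto
 have "A = B \<union> (A - B)" using assms by auto
 hence "Ex A q (\<lambda>X. f (X \<inter> B)) = Ex B q (\<lambda>X. Ex (A - B) q (\<lambda>Y. f ((X \<union> Y) \<inter> B)))"
  using Ex_union[OF fin, of q "\<lambda>X. f (X \<inter> B)"] by (metis Diff_disjoint)
 also have "... = Ex B q (\<lambda>X. Ex (A - B) q (\<lambda>Y. f X))"
 proof (rule Ex_cong, rule Ex_cong)
  fix X Y assume "X \<subseteq> B" "Y \<subseteq> A - B"
  hence "(X \<union> Y) \<inter> B = X" by auto
  thus "f ((X \<union> Y) \<inter> B) = f X" by simp
 qed
 finally show ?thesis using fin by simp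
qed

lemma Ex_pow:
 assumes "finite A"
 shows "Ex A q (\<lambda>X. z^card X) = (1 - q + q*z)^card A"
 using assms
proof (induction A rule: finite_induct)
 case (insert a A)
 have "Ex A q (\<lambda>X. z^card (insert a X)) = Ex A q (\<lambda>X. z*z^card X)"
 proof (rule Ex_cong)
  fix X assume "X \<subseteq> A"
  with insert have "a \<notin> X" "finite X" using finite_subset by auto
  thus "z^card (insert a X) = z*z^card X" by simp
 qed
 with insert show ?case by (simp add: Ex_insert Ex_cmult algebra_simps)
qed simp

text \<open>The derivative in \<open>z\<close> of \<open>Ex_pow\<close>. This size-biased form is
  what turns thin survival into a product over generations.\<close>

lemma Ex_card_pow:
 assumes "finite A"
 shows "Ex A q (\<lambda>X. real (card X)*z^(card X - 1))
   = real (card A)*q*(1 - q + q*z)^(card A - 1)"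
 using assms
proof (induction A rule: finite_induct)
 case (insert a A)
 have "Ex A q (\<lambda>X. real (card (insert a X))*z^(card (insert a X) - 1))
   = Ex A q (\<lambda>X. z*(real (card X)*z^(card X - 1)) + z^card X)"
 proof (rule Ex_cong)
  fix X assume "X \<subseteq> A"
  with insert have "a \<notin> X" "finite X" using finite_subset by auto
  thus "real (card (insert a X))*z^(card (insert a X) - 1)
    = z*(real (card X)*z^(card X - 1)) + z^card X"
   by (cases "card X") (auto simp: algebra_simps)
 qed
 hence "Ex (insert a A) q (\<lambda>X. real (card X)*z^(card X - 1))
   = q*(z*Ex A q (\<lambda>X. real (card X)*z^(card X - 1)) + (1 - q + q*z)^card A)
    + (1 - q)*Ex A q (\<lambda>X. real (card X)*z^(card X - 1))"
  using insert by (simp add: Ex_insert Ex_add Ex_cmult Ex_pow)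
 also have "... = (1 - q + q*z)*(real (card A)*q*(1 - q + q*z)^(card A - 1))
    + q*(1 - q + q*z)^card A"
  using insert.IH by (simp add: algebra_simps)
 also have "... = real (card (insert a A))*q*(1 - q + q*z)^(card (insert a A) - 1)"
  using insert.hyps by (cases "card A") (auto simp: algebra_simps)
 finally show ?case .
qed simp

lemma Ex_card: "finite A ==> Ex A q (\<lambda>X. real (card X)) = real (card A)*q"
 using Ex_card_pow[of A q 1] by simp

lemma Ex_card_Int:
 assumes "finite A" "B \<subseteq> A"
 shows "Ex A q (\<lambda>X. real (card (X \<inter> B))) = real (card B)*q"
 using Ex_restrict[OF assms, of q "\<lambda>X. real (card X)"] Ex_card[of B q] assms finite_subset by auto

lemma Ex_disjoint:
 assumes "finite A" "B \<subseteq> A"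
 shows "PE A q (\<lambda>X. X \<inter> B = {}) = (1 - q)^card B"
proof -
 have fin: "finite B" using assms finite_subset by auto
 have sub: "finite X" if "X \<subseteq> B" for X using that fin finite_subset by auto
 have "PE A q (\<lambda>X. X \<inter> B = {}) = PE B q (\<lambda>X. X = {})"
  by (rule Ex_restrict[OF assms])
 also have "... = Ex B q (\<lambda>X. 0^card X)"
  by (rule Ex_cong) (auto simp: power_0_left card_eq_0_iff sub)
 also have "... = (1 - q)^card B" by (simp add: Ex_pow fin)
 finally show ?thesis .
qed

text \<open>The bridge from the product measure behind \<open>gnp\<close> to the finite sums
  \<open>Ex\<close>.\<close>

lemma prob_random_subset:
 assumes "finite A" "0 <= q" "q <= 1"
 shows "measure_pmf.prob (map_pmf (\<lambda>b. {e \<in> A. b e}) (Pi_pmf A False (\<lambda>_. bernoulli_pmf q))) {X. P X}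
  = PE A q (\<lambda>X. P X)"
proof -
 let ?M = "map_pmf (\<lambda>b. {e \<in> A. b e}) (Pi_pmf A False (\<lambda>_. bernoulli_pmf q))"
 have pm: "pmf ?M X = q^card X*(1 - q)^card (A - X)" if "X \<subseteq> A" for X
 proof -
  have finX: "finite X" using that assms finite_subset by auto
  have "pmf ?M X = measure (measure_pmf (Pi_pmf A False (\<lambda>_. bernoulli_pmf q))) ((\<lambda>b. {e \<in> A. b e}) -` {X})"
   by (simp add: pmf_map)
  also have "... = measure (measure_pmf (Pi_pmf A False (\<lambda>_. bernoulli_pmf q))) {\<lambda>e. e \<in> X}"
  proof (rule measure_prob_cong_0)
   fix b assume b: "b \<in> ((\<lambda>b. {e \<in> A. b e}) -` {X}) - {\<lambda>e. e \<in> X}"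
   show "pmf (Pi_pmf A False (\<lambda>_. bernoulli_pmf q)) b = 0"
   proof (rule pmf_Pi_outside[OF assms(1)])
    show "\<exists>x. x \<notin> A \<and> b x \<noteq> False"
     using b that by auto
   qed
  next
   fix b assume "b \<in> {\<lambda>e. e \<in> X} - ((\<lambda>b. {e \<in> A. b e}) -` {X})"
   thus "pmf (Pi_pmf A False (\<lambda>_. bernoulli_pmf q)) b = 0" using that by auto
  qed
  also have "... = pmf (Pi_pmf A False (\<lambda>_. bernoulli_pmf q)) (\<lambda>e. e \<in> X)"
   by (simp add: measure_pmf_single)
  also have "... = (\<Prod>x\<in>A. pmf (bernoulli_pmf q) (x \<in> X))"
   using that by (intro pmf_Pi'[OF assms(1)]) auto
  also have "... = (\<Prod>x\<in>X \<union> (A - X). if x \<in> X then q else 1 - q)"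
   using that assms by (intro prod.cong) (auto)
  also have "... = q^card X*(1 - q)^card (A - X)"
   using finX assms(1) by (subst prod.union_disjoint) auto
  finally show ?thesis .
 qed
 have "measure_pmf.prob ?M {X. P X} = measure_pmf.prob ?M {X \<in> Pow A. P X}"
  by (rule measure_prob_cong_0) (auto simp: pmf_eq_0_set_pmf)
 also have "... = (\<Sum>X\<in>{X \<in> Pow A. P X}. pmf ?M X)"
  using assms by (intro measure_measure_pmf_finite) auto
 also have "... = (\<Sum>X\<in>Pow A. pmf ?M X * of_bool (P X))"
  using assms(1) by (intro sum.mono_neutral_cong_left) auto
 also have "... = PE A q (\<lambda>X. P X)"
  unfolding Ex_def by (rule sum.cong) (auto simp: pm)
 finally show ?thesis .
qed

lemma finite_pairs [simp]: "finite (pairs n)"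
 unfolding pairs_def by (rule finite_subset[of _ "Pow {1..n}"]) auto

lemma prob_gnp:
 "0 <= p ==> p <= 1 ==> measure_pmf.prob (gnp n p) {E. P E} = PE (pairs n) p (\<lambda>E. P E)"
 unfolding gnp_def by (rule prob_random_subset) auto

section \<open>Breadth-first exploration\<close>

definition pr :: "'a set => 'a set set" where
 "pr W = {e. e \<subseteq> W \<and> card e = 2}"

definition cr :: "'a set => 'a set => 'a set set" where
 "cr T U = {{u, v} |u v. u \<in> U \<and> v \<in> T}"

definition nb :: "'a set set => 'a set => 'a set => 'a set" where
 "nb E T U = {u \<in> U. \<exists>v\<in>T. {u, v} \<in> E}"

lemma pairs_eq_pr: "pairs n = pr {1..n}"
 by (auto simp: pairs_def pr_def)

lemma finite_pr [simp]: "finite W ==> finite (pr W)"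
 unfolding pr_def by (rule finite_subset[of _ "Pow W"]) auto

lemma finite_cr [simp]:
 assumes "finite T" "finite U"
 shows "finite (cr T U)"
proof -
 have "cr T U = (\<lambda>(u, v). {u, v}) ` (U \<times> T)" by (auto simp: cr_def)
 with assms show ?thesis by auto
qed

lemma pr_mono: "U \<subseteq> W ==> pr U \<subseteq> pr W"
 by (auto simp: pr_def)

lemma nb_subset: "nb E T U \<subseteq> U"
 by (auto simp: nb_def)

lemma nb_empty [simp]: "nb E {} U = {}" "nb E T {} = {}" "nb {} T U = {}"
 by (auto simp: nb_def)

lemma pr_Un:
 assumes "T \<inter> U = {}"
 shows "pr (T \<union> U) = (pr T \<union> cr T U) \<union> pr U"
proof (intro equalityI subsetI)
 fix e assume "e \<in> pr (T \<union> U)"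
 then obtain x y where e: "e = {x, y}" "x \<noteq> y" "x \<in> T \<union> U" "y \<in> T \<union> U"
  by (auto simp: pr_def card_2_iff)
 show "e \<in> (pr T \<union> cr T U) \<union> pr U"
 proof (cases "x \<in> T"; cases "y \<in> T")
  assume "x \<in> T" "y \<notin> T"
  hence "e \<in> cr T U" using e unfolding cr_def by blast
  thus ?thesis by simp
 next
  assume "x \<notin> T" "y \<in> T"
  hence "e \<in> cr T U" using e unfolding cr_def by blast
  thus ?thesis by simp
 qed (use e in \<open>auto simp: pr_def card_2_iff\<close>)
next
 fix e assume e: "e \<in> (pr T \<union> cr T U) \<union> pr U"
 show "e \<in> pr (T \<union> U)"
 proof (cases "e \<in> cr T U")
  case True
  then obtain u v where "e = {u, v}" "u \<in> U" "v \<in> T" by (auto simp: cr_def)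
  moreover from this have "u \<noteq> v" using assms by auto
  ultimately show ?thesis by (auto simp: pr_def)
 qed (use e in \<open>auto simp: pr_def\<close>)
qed

lemma pr_cr_disjoint:
 assumes "T \<inter> U = {}"
 shows "pr T \<inter> cr T U = {}" "pr U \<inter> cr T U = {}" "pr T \<inter> pr U = {}"
proof -
 show "pr T \<inter> cr T U = {}" "pr U \<inter> cr T U = {}"
  using assms by (auto simp: pr_def cr_def)
 show "pr T \<inter> pr U = {}"
 proof (rule ccontr)
  assume "pr T \<inter> pr U \<noteq> {}"
  then obtain e where e: "e \<subseteq> T" "e \<subseteq> U" "card e = 2" by (auto simp: pr_def)
  hence "e \<subseteq> {}" using assms by auto
  with e(3) show False by auto
 qed
qed

lemma nb_cr_Int: "T \<inter> U = {} ==> nb (E \<inter> cr T U) T U = nb E T U"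
 by (auto simp: nb_def cr_def)

lemma nb_Int_pr: "T \<inter> U = {} ==> T \<union> U \<subseteq> W ==> nb (E \<inter> pr W) T U = nb E T U"
 by (auto simp: nb_def pr_def card_2_iff)

text \<open>Distinct vertices of \<open>U\<close> send disjoint sets of pairs to \<open>T\<close>,
  so they are adjacent to \<open>T\<close> independently, each with probability
  \<open>1 - (1 - p) ^ card T\<close>. In the induction the new block \<open>cr T {u}\<close>
  matters only through whether it is empty.\<close>

lemma nb_dist:
 assumes "finite T" "finite U" "T \<inter> U = {}"
 shows "Ex (cr T U) p (\<lambda>X. F (nb X T U)) = Ex U (1 - (1 - p)^card T) F"
 using assms(2,3)
proof (induction U arbitrary: F rule: finite_induct)
 case empty
 have "cr T {} = {}" by (auto simp: cr_def)
 thus ?case by simp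
next
 case (insert u U)
 have cr_ins: "cr T (insert u U) = cr T {u} \<union> cr T U"
  by (auto simp: cr_def)
 have disj: "cr T {u} \<inter> cr T U = {}"
  using insert by (auto simp: cr_def doubleton_eq_iff)
 have fin: "finite (cr T {u})" "finite (cr T U)" using assms insert by auto
 have nbX: "nb (X \<union> Y) T (insert u U) = (if X = {} then nb Y T U else insert u (nb Y T U))"
  if "X \<subseteq> cr T {u}" "Y \<subseteq> cr T U" for X Y
 proof -
  have Y: "{w, v} \<notin> X" if "w \<in> U" "v \<in> T" for w v
   using \<open>X \<subseteq> cr T {u}\<close> that insert by (auto simp: cr_def doubleton_eq_iff)
  have X: "{u, v} \<notin> Y" if "v \<in> T" for v
   using \<open>Y \<subseteq> cr T U\<close> that insert by (auto simp: cr_def doubleton_eq_iff)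
  have Z: "X \<noteq> {} \<longleftrightarrow> (\<exists>v\<in>T. {u, v} \<in> X)"
   using \<open>X \<subseteq> cr T {u}\<close> by (auto simp: cr_def)
  show ?thesis
   unfolding nb_def using X Y Z by (auto)
 qed
 have cardc: "card (cr T {u}) = card T"
 proof -
  have "cr T {u} = (\<lambda>v. {u, v}) ` T" by (auto simp: cr_def)
  moreover have "inj_on (\<lambda>v. {u, v}) T" by (auto simp: inj_on_def doubleton_eq_iff)
  ultimately show ?thesis by (simp add: card_image)
 qed
 have em: "PE (cr T {u}) p (\<lambda>X. X = {}) = (1 - p)^card T"
 proof -
  have "PE (cr T {u}) p (\<lambda>X. X = {}) = PE (cr T {u}) p (\<lambda>X. X \<inter> cr T {u} = {})"
   by (rule Ex_cong) (simp add: Int_absorb2)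
  with Ex_disjoint[OF fin(1) subset_refl] cardc show ?thesis by simp
 qed
 have "Ex (cr T (insert u U)) p (\<lambda>X. F (nb X T (insert u U)))
   = Ex (cr T {u}) p (\<lambda>X. Ex (cr T U) p (\<lambda>Y. F (nb (X \<union> Y) T (insert u U))))"
  unfolding cr_ins by (rule Ex_union[OF fin disj])
 also have "... = Ex (cr T {u}) p (\<lambda>X. Ex (cr T U) p (\<lambda>Y.
   F (if X = {} then nb Y T U else insert u (nb Y T U))))"
  by (intro Ex_cong) (simp add: nbX)
 also have "... = Ex (cr T {u}) p (\<lambda>X. of_bool (X = {})*Ex (cr T U) p (\<lambda>Y. F (nb Y T U))
    + (1 - of_bool (X = {}))*Ex (cr T U) p (\<lambda>Y. F (insert u (nb Y T U))))"
  by (intro Ex_cong) auto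
 also have "... = (1 - p)^card T*Ex (cr T U) p (\<lambda>Y. F (nb Y T U))
   + (1 - (1 - p)^card T)*Ex (cr T U) p (\<lambda>Y. F (insert u (nb Y T U)))"
  by (simp add: Ex_add Ex_multc Ex_diff em fin)
 also have "... = Ex (insert u U) (1 - (1 - p)^card T) F"
  using insert.hyps insert.prems insert.IH[of F] insert.IH[of "\<lambda>S. F (insert u S)"]
  by (simp add: Ex_insert)
 finally show ?case .
qed

text \<open>One exploration step. The pairs inside \<open>T\<close> integrate out, the pairs between
  \<open>T\<close> and \<open>U\<close> produce the next level, and those inside \<open>U\<close>
  are still fresh, which is why \<open>F\<close> may use them as its second argument.\<close>

lemma peel:
 assumes "finite T" "finite U" "T \<inter> U = {}"
 shows "Ex (pr (T \<union> U)) p (\<lambda>E. F (nb E T U) (E \<inter> pr U))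
   = Ex U (1 - (1 - p)^card T) (\<lambda>S. Ex (pr U) p (\<lambda>E. F S E))"
proof -
 have fin: "finite (pr T)" "finite (cr T U)" "finite (pr U)" using assms by auto
 have d: "pr T \<inter> (cr T U \<union> pr U) = {}" "cr T U \<inter> pr U = {}"
  using pr_cr_disjoint[OF assms(3)] by auto
 have eq: "pr (T \<union> U) = pr T \<union> (cr T U \<union> pr U)" using pr_Un[OF assms(3)] by auto
 have A: "nb (X \<union> (Y \<union> Z)) T U = nb Y T U" "(X \<union> (Y \<union> Z)) \<inter> pr U = Z"
  if "X \<subseteq> pr T" "Y \<subseteq> cr T U" "Z \<subseteq> pr U" for X Y Z
 proof -
  have "nb (X \<union> (Y \<union> Z)) T U = nb ((X \<union> (Y \<union> Z)) \<inter> cr T U) T U"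
   using nb_cr_Int[OF assms(3)] by metis
  also have "(X \<union> (Y \<union> Z)) \<inter> cr T U = Y" using that pr_cr_disjoint[OF assms(3)] by blast
  finally show "nb (X \<union> (Y \<union> Z)) T U = nb Y T U" .
  show "(X \<union> (Y \<union> Z)) \<inter> pr U = Z" using that pr_cr_disjoint[OF assms(3)] by blast
 qed
 have "Ex (pr (T \<union> U)) p (\<lambda>E. F (nb E T U) (E \<inter> pr U)) =
   Ex (pr T) p (\<lambda>X. Ex (cr T U) p (\<lambda>Y. Ex (pr U) p (\<lambda>Z.
    F (nb (X \<union> (Y \<union> Z)) T U) ((X \<union> (Y \<union> Z)) \<inter> pr U))))"
  unfolding eq by (subst Ex_union) (use fin d in \<open>auto simp: Ex_union\<close>)
 also have "... = Ex (pr T) p (\<lambda>X. Ex (cr T U) p (\<lambda>Y. Ex (pr U) p (\<lambda>Z. F (nb Y T U) Z)))"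
  by (intro Ex_cong) (simp add: A)
 also have "... = Ex (cr T U) p (\<lambda>Y. Ex (pr U) p (\<lambda>Z. F (nb Y T U) Z))"
  using fin by simp
 also have "... = Ex U (1 - (1 - p)^card T) (\<lambda>S. Ex (pr U) p (\<lambda>E. F S E))"
  by (rule nb_dist[OF assms])
 finally show ?thesis .
qed

text \<open>The \<open>t\<close>-th breadth-first level from the root set \<open>T\<close>, paired with the part of \<open>U\<close> still unexplored.\<close>

fun lev :: "'a set set => 'a set => 'a set => nat => 'a set \<times> 'a set" where
 "lev E T U 0 = (T, U)"
| "lev E T U (Suc t) = lev E (nb E T U) (U - nb E T U) t"

abbreviation "lv E T U t \<equiv> fst (lev E T U t)"
abbreviation "rs E T U t \<equiv> snd (lev E T U t)"

text \<open>Deferred decisions: each unexplored vertex joins the next level independently of the others, so the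
 expectation of a function of the pair \<open>lev E T U t\<close> is \<open>Run p t\<close>.\<close>

fun Run :: "real => nat => ('a set => 'a set => real) => 'a set => 'a set => real" where
 "Run p 0 H T U = H T U"
| "Run p (Suc t) H T U = Ex U (1 - (1 - p)^card T) (\<lambda>S. Run p t H S (U - S))"

lemma lev_Suc_back: "lev E T U (Suc t) =
  (nb E (lv E T U t) (rs E T U t), rs E T U t - nb E (lv E T U t) (rs E T U t))"
 by (induction t arbitrary: T U) auto

lemma lev_sub: "lv E T U t \<subseteq> T \<union> U" "rs E T U t \<subseteq> U" "T \<inter> U = {} ==> lv E T U t \<inter> rs E T U t = {}"
proof (induction t arbitrary: T U)
 case (Suc t)
 { case 1 show ?case using Suc(1)[of "nb E T U" "U - nb E T U"] nb_subset[of E T U] by auto }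
 { case 2 show ?case using Suc(2)[of "nb E T U" "U - nb E T U"] by auto }
 { case 3 show ?case using Suc(3)[of "nb E T U" "U - nb E T U"] by auto }
qed auto

lemma lev_Int_pr: "T \<inter> U = {} ==> T \<union> U \<subseteq> W ==> lev (E \<inter> pr W) T U t = lev E T U t"
proof (induction t arbitrary: T U)
 case (Suc t)
 have "nb E T U \<subseteq> U" by (rule nb_subset)
 hence "lev (E \<inter> pr W) (nb E T U) (U - nb E T U) t = lev E (nb E T U) (U - nb E T U) t"
  using Suc.prems by (intro Suc.IH) auto
 thus ?case using nb_Int_pr[OF Suc.prems] by simp
qed simp

text \<open>The Markov property of the exploration: after \<open>t\<close> levels no pair inside the
  union of the last level and the unexplored set has been examined, so given these two sets the
  pairs are again independent, and \<open>G\<close> may be any function of them.\<close>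

lemma Run_ex:
 assumes "finite T" "finite U" "T \<inter> U = {}"
 shows "Ex (pr (T \<union> U)) p (\<lambda>E. G (lv E T U t) (rs E T U t) (E \<inter> pr (lv E T U t \<union> rs E T U t)))
  = Run p t (\<lambda>T U. Ex (pr (T \<union> U)) p (G T U)) T U"
 using assms
proof (induction t arbitrary: T U)
 case 0
 show ?case by (auto intro!: Ex_cong simp: Int_absorb2)
next
 case (Suc t)
 let ?F = "\<lambda>S E. G (lv E S (U - S) t) (rs E S (U - S) t) (E \<inter> pr (lv E S (U - S) t \<union> rs E S (U - S) t))"
 have "Ex (pr (T \<union> U)) p (\<lambda>E. G (lv E T U (Suc t)) (rs E T U (Suc t)) (E \<inter> pr (lv E T U (Suc t) \<union> rs E T U (Suc t))))
   = Ex (pr (T \<union> U)) p (\<lambda>E. ?F (nb E T U) (E \<inter> pr U))"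
 proof (rule Ex_cong)
  fix E
  let ?S = "nb E T U"
  have S: "?S \<subseteq> U" by (rule nb_subset)
  have l: "lev (E \<inter> pr U) ?S (U - ?S) t = lev E ?S (U - ?S) t"
   using S by (intro lev_Int_pr) auto
  have "lv E ?S (U - ?S) t \<union> rs E ?S (U - ?S) t \<subseteq> U"
   using lev_sub(1,2)[of E ?S "U - ?S" t] S by auto
  hence "E \<inter> pr U \<inter> pr (lv E ?S (U - ?S) t \<union> rs E ?S (U - ?S) t)
    = E \<inter> pr (lv E ?S (U - ?S) t \<union> rs E ?S (U - ?S) t)"
   using pr_mono by blast
  with l show "G (lv E T U (Suc t)) (rs E T U (Suc t)) (E \<inter> pr (lv E T U (Suc t) \<union> rs E T U (Suc t)))
    = ?F (nb E T U) (E \<inter> pr U)" by simp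
 qed
 also have "... = Ex U (1 - (1 - p)^card T) (\<lambda>S. Ex (pr U) p (?F S))"
  by (rule peel[OF Suc.prems])
 also have "... = Ex U (1 - (1 - p)^card T) (\<lambda>S. Run p t (\<lambda>T U. Ex (pr (T \<union> U)) p (G T U)) S (U - S))"
 proof (rule Ex_cong)
  fix S assume S: "S \<subseteq> U"
  hence fin: "finite S" "finite (U - S)" "S \<inter> (U - S) = {}"
   using Suc.prems finite_subset by auto
  have "S \<union> (U - S) = U" using S by auto
  with Suc.IH[OF fin] show "Ex (pr U) p (?F S) = Run p t (\<lambda>T U. Ex (pr (T \<union> U)) p (G T U)) S (U - S)"
   by simp
 qed
 finally show ?case by simp
qed

lemma Run_ex':
 assumes "finite T" "finite U" "T \<inter> U = {}"
 shows "Ex (pr (T \<union> U)) p (\<lambda>E. H (lv E T U t) (rs E T U t)) = Run p t H T U"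
proof -
 have "Run p t (\<lambda>T U. Ex (pr (T \<union> U)) p (\<lambda>_. H T U)) T U = Run p t H T U"
  using assms
 proof (induction t arbitrary: T U)
  case (Suc t)
  thus ?case by (auto intro!: Ex_cong Suc.IH intro: finite_subset)
 qed simp
 thus ?thesis using Run_ex[OF assms, of p "\<lambda>T U E. H T U" t] by simp
qed

lemma step_prob:
 assumes "0 <= p" "p <= 1"
 shows "0 <= 1 - (1 - p)^k" "1 - (1 - p)^k <= (1::real)" "1 - (1 - p)^k <= real k*p"
proof -
 show "0 <= 1 - (1 - p)^k" "1 - (1 - p)^k <= (1::real)"
  using assms by (auto simp: power_le_one)
 show "1 - (1 - p)^k <= real k*p"
  using Bernoulli_inequality[of "- p" k] assms by (simp add: algebra_simps)
qed

lemma Run_mono: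
 assumes "0 <= p" "p <= 1" "T \<inter> U = {}"
  and "\<And>T' U'. T' \<subseteq> T \<union> U ==> U' \<subseteq> U ==> T' \<inter> U' = {} ==> H T' U' <= H' T' U'"
 shows "Run p t H T U <= Run p t H' T U"
 using assms(3,4)
proof (induction t arbitrary: T U)
 case (Suc t)
 show ?case
  unfolding Run.simps
 proof (rule Ex_mono)
  fix S assume "S \<subseteq> U"
  show "Run p t H S (U - S) <= Run p t H' S (U - S)"
  proof (rule Suc.IH)
   fix T' U' assume "T' \<subseteq> S \<union> (U - S)" "U' \<subseteq> U - S" "T' \<inter> U' = {}"
   thus "H T' U' <= H' T' U'" using \<open>S \<subseteq> U\<close> by (intro Suc.prems(2)) auto
  qed auto
 qed (use step_prob assms(1,2) in auto)
qed simp

lemma Run_add: "Run p t (\<lambda>T U. H T U + H' T U) T U = Run p t H T U + Run p t H' T U"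
 by (induction t arbitrary: T U) (auto simp: Ex_add)

lemma Run_cmult: "Run p t (\<lambda>T U. c*H T U) T U = c * Run p t H T U"
 by (induction t arbitrary: T U) (auto simp: Ex_cmult)

lemma Run_const: "finite U ==> Run p t (\<lambda>T U. c) T U = c"
 by (induction t arbitrary: T U) (auto cong: Ex_cong)

lemma Run_zero:
 assumes "finite U" "\<And>T' U'. U' \<subseteq> U ==> H T' U' = 0"
 shows "Run p t H T U = 0"
 using assms
proof (induction t arbitrary: T U)
 case (Suc t)
 have "Run p t H S (U - S) = 0" for S
  by (rule Suc.IH) (use Suc.prems in auto)
 thus ?case using Suc.prems by simp
qed simp

lemma Ex_0: "finite A ==> Ex A 0 f = f {}"
 by (induction A arbitrary: f rule: finite_induct) (auto simp: Ex_insert)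

lemma Run_empty: "finite U ==> Run p t H {} U = H {} U"
 by (induction t) (auto simp: Ex_0)

section \<open>Moments of the explored set\<close>

lemma Run_card_level:
 assumes "0 <= p" "p <= 1" "finite U" "real (card U)*p <= lam"
 shows "Run p t (\<lambda>T _. real (card T)) T U <= lam^t*real (card T)"
 using assms(3,4)
proof (induction t arbitrary: T U)
 case (Suc t)
 have lam: "0 <= lam" using Suc.prems assms(1) by (meson mult_nonneg_nonneg of_nat_0_le_iff order_trans)
 let ?q = "1 - (1 - p)^card T"
 have q: "0 <= ?q" "?q <= 1" "?q <= real (card T)*p" using step_prob[OF assms(1,2)] by auto
 have "Run p (Suc t) (\<lambda>T _. real (card T)) T U <= Ex U ?q (\<lambda>S. lam^t*real (card S))"
  unfolding Run.simps
 proof (rule Ex_mono[OF q(1,2)])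
  fix S assume "S \<subseteq> U"
  have "real (card (U - S))*p <= real (card U)*p"
   using assms(1) Suc.prems by (intro mult_right_mono) (auto intro: card_mono)
  thus "Run p t (\<lambda>T _. real (card T)) S (U - S) <= lam^t*real (card S)"
   using Suc.prems by (intro Suc.IH) auto
 qed
 also have "... = lam^t*(real (card U)*?q)"
  using Suc.prems by (simp add: Ex_cmult Ex_card)
 also have "... <= lam^t*(real (card U)*(real (card T)*p))"
  using q lam by (intro mult_left_mono) auto
 also have "... = lam^t*((real (card U)*p)*real (card T))" by simp
 also have "... <= lam^t*(lam*real (card T))"
  using Suc.prems lam by (intro mult_left_mono mult_right_mono) auto
 finally show ?case by (simp add: mult_ac)
qed simp

text \<open>A fixed vertex of \<open>Q\<close> is reached in the next step with probability at most
  \<open>p * card T\<close>; the expected sizes of later levels then give a geometric sum. The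
  induction charges \<open>S \<inter> Q\<close> to the first step and leaves \<open>Q - S\<close> to
  the rest.\<close>

lemma Run_hit:
 assumes "0 <= p" "p <= 1" "finite U" "real (card U)*p <= lam" "Q \<subseteq> U"
 shows "Run p t (\<lambda>_ U'. real (card (Q - U'))) T U
  <= real (card Q)*real (card T)*p*(\<Sum>i<t. lam^i)"
 using assms(3-5)
proof (induction t arbitrary: T U Q)
 case 0
 thus ?case by (simp add: Diff_eq_empty_iff[THEN iffD2])
next
 case (Suc t)
 have lam: "0 <= lam" using Suc.prems assms(1) by (meson mult_nonneg_nonneg of_nat_0_le_iff order_trans)
 have finQ: "finite Q" using Suc.prems finite_subset by auto
 let ?q = "1 - (1 - p)^card T"
 let ?s = "\<Sum>i<t. lam^i"
 have s0: "0 <= ?s" using lam by (intro sum_nonneg) auto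
 have q: "0 <= ?q" "?q <= 1" "?q <= real (card T)*p" using step_prob[OF assms(1,2)] by auto
 have "Run p (Suc t) (\<lambda>_ U'. real (card (Q - U'))) T U
   <= Ex U ?q (\<lambda>S. real (card (S \<inter> Q)) + (real (card Q)*p*?s)*real (card S))"
  unfolding Run.simps
 proof (rule Ex_mono[OF q(1,2)])
  fix S assume S: "S \<subseteq> U"
  have pU: "real (card (U - S))*p <= lam"
  proof -
   have "real (card (U - S))*p <= real (card U)*p"
    using assms(1) Suc.prems by (intro mult_right_mono) (auto intro: card_mono)
   with Suc.prems show ?thesis by simp
  qed
  have "Run p t (\<lambda>_ U'. real (card (Q - U'))) S (U - S)
    <= Run p t (\<lambda>_ U'. real (card (S \<inter> Q)) + real (card ((Q - S) - U'))) S (U - S)"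
  proof (rule Run_mono[OF assms(1,2)])
   fix T' U' assume "U' \<subseteq> U - S"
   have "card (Q - U') <= card ((S \<inter> Q) \<union> ((Q - S) - U'))"
    using finQ by (intro card_mono) auto
   also have "... <= card (S \<inter> Q) + card ((Q - S) - U')" by (rule card_Un_le)
   finally show "real (card (Q - U')) <= real (card (S \<inter> Q)) + real (card ((Q - S) - U'))" by linarith
  qed auto
  also have "... = real (card (S \<inter> Q)) + Run p t (\<lambda>_ U'. real (card ((Q - S) - U'))) S (U - S)"
   using Suc.prems by (simp add: Run_add Run_const)
  also have "... <= real (card (S \<inter> Q)) + real (card (Q - S))*real (card S)*p*?s"
   using Suc.prems pU by (intro add_left_mono Suc.IH) auto
  also have "... <= real (card (S \<inter> Q)) + real (card Q)*real (card S)*p*?s"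
   using assms(1) finQ s0 by (intro add_left_mono mult_right_mono) (auto intro: card_mono)
  finally show "Run p t (\<lambda>_ U'. real (card (Q - U'))) S (U - S)
    <= real (card (S \<inter> Q)) + (real (card Q)*p*?s)*real (card S)" by (simp add: mult_ac)
 qed
 also have "... = (real (card Q) + (real (card Q)*p*?s)*real (card U))*?q"
  unfolding Ex_add Ex_cmult
  using Suc.prems by (simp only: Ex_card Ex_card_Int) (simp add: distrib_right mult.assoc)
 also have "... <= (real (card Q) + (real (card Q)*?s)*lam)*(real (card T)*p)"
 proof (rule mult_mono)
  have "(real (card Q)*?s)*(real (card U)*p) <= (real (card Q)*?s)*lam"
   using Suc.prems s0 by (intro mult_left_mono) auto
  thus "real (card Q) + (real (card Q)*p*?s)*real (card U) <= real (card Q) + (real (card Q)*?s)*lam"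
   by (simp add: mult_ac)
 qed (use q s0 lam in auto)
 also have "... = real (card Q)*real (card T)*p*(1 + lam*?s)"
  by (simp add: algebra_simps)
 also have "1 + lam*?s = (\<Sum>i<Suc t. lam^i)"
  by (subst sum.lessThan_Suc_shift) (simp add: sum_distrib_left)
 finally show ?case .
qed

text \<open>An exponential moment of the number of explored vertices. One generation turns a rate
  \<open>x\<close> per root into at most \<open>4 * lam * x\<close> as long as the new rate is at
  most 1, because \<open>exp (2 * x) - 1 <= 4 * x\<close> for \<open>x <= 1/4\<close>.\<close>

lemma Run_explored:
 assumes "0 <= p" "p <= 1" "finite U" "real (card U)*p <= lam" "1 <= lam"
  and "0 <= e" "e*(4*lam)^t <= 1"
 shows "Run p t (\<lambda>_ U'. exp (- (e*real (card U')))) T U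
  <= exp (real (card T)*e*(4*lam)^t - e*real (card U))"
 using assms(3,4,7)
proof (induction t arbitrary: T U)
 case 0
 thus ?case using assms(6) by simp
next
 case (Suc t)
 let ?q = "1 - (1 - p)^card T"
 have q: "0 <= ?q" "?q <= 1" "?q <= real (card T)*p" using step_prob[OF assms(1,2)] by auto
 define x where "x = e*(4*lam)^t"
 have x0: "0 <= x" using assms(5,6) by (simp add: x_def)
 have x1: "x*(4*lam) <= 1" using Suc.prems(3) by (simp add: x_def mult_ac)
 have "x*4 <= x*(4*lam)" using x0 assms(5) by (intro mult_left_mono) auto
 from order_trans[OF this x1] have x14: "4*x <= 1" by simp
 have ex: "e <= x"
 proof -
  have "1 <= (4*lam)^t" using assms(5) by (intro one_le_power) auto
  thus ?thesis unfolding x_def using assms(6) by (metis mult_left_mono mult.right_neutral)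
 qed
 have "Run p (Suc t) (\<lambda>_ U'. exp (- (e*real (card U')))) T U
  <= Ex U ?q (\<lambda>S. exp (- (e*real (card U)))*exp (x + e)^card S)"
  unfolding Run.simps
 proof (rule Ex_mono[OF q(1,2)])
  fix S assume S: "S \<subseteq> U"
  have "real (card (U - S))*p <= real (card U)*p"
   using assms(1) Suc.prems by (intro mult_right_mono) (auto intro: card_mono)
  hence "Run p t (\<lambda>_ U'. exp (- (e*real (card U')))) S (U - S)
    <= exp (real (card S)*e*(4*lam)^t - e*real (card (U - S)))"
   using Suc.prems x14 x0 by (intro Suc.IH) (auto simp: x_def)
  also have "real (card (U - S)) = real (card U) - real (card S)"
   using S Suc.prems by (simp add: card_Diff_subset card_mono finite_subset of_nat_diff)
  also have "exp (real (card S)*e*(4*lam)^t - e*(real (card U) - real (card S)))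
    = exp (- (e*real (card U)))*exp (x + e)^card S"
   by (simp add: x_def exp_of_nat_mult[symmetric] exp_add[symmetric] algebra_simps)
  finally show "Run p t (\<lambda>_ U'. exp (- (e*real (card U')))) S (U - S)
    <= exp (- (e*real (card U)))*exp (x + e)^card S" .
 qed
 also have "... = exp (- (e*real (card U)))*(1 + ?q*(exp (x + e) - 1))^card U"
  unfolding Ex_cmult using Suc.prems by (simp add: Ex_pow algebra_simps)
 also have "... <= exp (- (e*real (card U)))*exp (real (card T)*x*(4*lam))"
 proof (rule mult_left_mono)
  have "exp (x + e) <= exp (2*x)" using ex by simp
  also have "... <= 1 + 2*x + (2*x)^2" using x0 x14 by (intro exp_bound) auto
  also have "(2*x)^2 <= 2*x"
   using mult_right_mono[OF x14 x0] x0 by (simp add: power2_eq_square)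
  finally have ge: "exp (x + e) - 1 <= 4*x" by simp
  have ge0: "0 <= exp (x + e) - 1" using x0 assms(6) by simp
  have "1 + ?q*(exp (x + e) - 1) <= exp (?q*(exp (x + e) - 1))"
   by (rule exp_ge_add_one_self)
  hence "(1 + ?q*(exp (x + e) - 1))^card U <= exp (?q*(exp (x + e) - 1))^card U"
   using q ge0 by (intro power_mono) auto
  also have "... = exp (real (card U)*(?q*(exp (x + e) - 1)))" by (simp add: exp_of_nat_mult)
  also have "... <= exp (real (card U)*((real (card T)*p)*(4*x)))"
   using q ge ge0 assms(1) by (intro iffD2[OF exp_le_cancel_iff] mult_left_mono mult_mono) auto
  also have "... = exp ((real (card U)*p)*(real (card T)*(4*x)))" by (simp add: mult_ac)
  also have "... <= exp (lam*(real (card T)*(4*x)))"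
   using Suc.prems x0 by (intro iffD2[OF exp_le_cancel_iff] mult_right_mono) auto
  also have "... = exp (real (card T)*x*(4*lam))" by (simp add: mult_ac)
  finally show "(1 + ?q*(exp (x + e) - 1))^card U <= exp (real (card T)*x*(4*lam))" .
 qed simp
 also have "... = exp (real (card T)*e*(4*lam)^Suc t - e*real (card U))"
  by (simp add: x_def exp_add[symmetric] mult_ac)
 finally show ?case .
qed

text \<open>Markov's inequality for \<open>Run_explored\<close> at the largest admissible rate
  \<open>1 / (4 * lam) ^ t\<close>.\<close>

lemma Run_cap:
 assumes "0 <= p" "p <= 1" "finite U" "real (card U)*p <= lam" "1 <= lam"
  and "real u + B <= real (card U)"
 shows "Run p t (\<lambda>_ U'. of_bool (card U' < u)) T U <= exp (real (card T) - B/(4*lam)^t)"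
proof -
 define e where "e = 1/(4*lam)^t"
 have e: "0 <= e" "e*(4*lam)^t = 1" using assms(5) by (auto simp: e_def)
 have mono: "Run p t (\<lambda>_ U'. of_bool (card U' < u)) T U
   <= Run p t (\<lambda>_ U'. exp (e*real u)*exp (- (e*real (card U')))) T U"
  using assms(3)
 proof (induction t arbitrary: T U)
  case 0
  show ?case using e(1) by (auto simp: exp_add[symmetric] mult_left_mono)
 next
  case (Suc t)
  thus ?case unfolding Run.simps
   by (intro Ex_mono) (use step_prob[OF assms(1,2)] in auto)
 qed
 also have "... = exp (e*real u) * Run p t (\<lambda>_ U'. exp (- (e*real (card U')))) T U"
  by (rule Run_cmult)
 also have "... <= exp (e*real u)*exp (real (card T)*e*(4*lam)^t - e*real (card U))"
  using assms e by (intro mult_left_mono Run_explored) auto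
 also have "... = exp (real (card T) - e*(real (card U) - real u))"
  using e(2) by (simp add: exp_add[symmetric] mult.assoc algebra_simps)
 also have "... <= exp (real (card T) - e*B)"
  using assms(6) e(1) by (simp add: mult_left_mono)
 finally show ?thesis by (simp add: e_def)
qed

text \<open>The generating function, at \<open>z\<close>, of the generations of a branching process with Poisson offspring of mean \<open>k\<close>.\<close>

primrec zit :: "real => real => nat => real" where
 "zit k z 0 = z"
| "zit k z (Suc i) = exp (- (k*(1 - zit k z i)))"

lemma zit_01:
 assumes "0 <= k" "0 <= z" "z <= 1"
 shows "0 <= zit k z i" "zit k z i <= 1"
 by (induction i) (use assms in auto)

text \<open>For \<open>a\<close> active and at least \<open>u0\<close> unexplored vertices, \<open>k\<close> is a lower bound for the
 offspring mean, even when one unexplored vertex is set aside.\<close>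

definition offspring_lb :: "real => real => nat => nat => bool" where
 "offspring_lb p k m u0 \<longleftrightarrow> 0 <= k \<and> 1 <= u0 \<and>
   (\<forall>a u. a <= m --> u0 <= u --> k*real a <= (real u - 1)*(1 - (1 - p)^a))"

section \<open>Comparison with a Poisson branching process\<close>

text \<open>A binomial generating function lies below the Poisson one. The version with exponent
  \<open>u - 1\<close> is needed after size biasing, where \<open>Ex_card_pow\<close> uses up one
  vertex.\<close>

lemma offspring_pow:
 assumes "offspring_lb p k m u0" "0 <= p" "p <= 1" "a <= m" "u0 <= u" "0 <= z" "z <= 1"
 shows "(1 - (1 - (1 - p)^a) + (1 - (1 - p)^a)*z)^(u - 1) <= exp (- (k*(1 - z)))^a"
  and "(1 - (1 - (1 - p)^a) + (1 - (1 - p)^a)*z)^u <= exp (- (k*(1 - z)))^a"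
proof -
 let ?q = "1 - (1 - p)^a"
 have q: "0 <= ?q" "?q <= 1" using step_prob[OF assms(2,3)] by auto
 have u: "1 <= u" using assms(1,5) by (auto simp: offspring_lb_def)
 have b: "0 <= 1 - ?q + ?q*z" using q assms(6) by simp
 have b1: "1 - ?q + ?q*z <= 1" using mult_left_le[OF assms(7) q(1)] by linarith
 have "1 - ?q + ?q*z <= exp (- (?q*(1 - z)))"
  using exp_ge_add_one_self[of "- (?q*(1 - z))"] by (simp add: algebra_simps)
 hence "(1 - ?q + ?q*z)^(u - 1) <= exp (- (?q*(1 - z)))^(u - 1)"
  using b by (intro power_mono) auto
 also have "... = exp (- ((real u - 1)*?q*(1 - z)))"
  using u by (simp add: exp_of_nat_mult[symmetric] of_nat_diff algebra_simps)
 also have "... <= exp (- (k*real a*(1 - z)))"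
  using assms unfolding offspring_lb_def by (simp add: mult_right_mono)
 also have "... = exp (- (k*(1 - z)))^a"
  by (simp add: exp_of_nat_mult[symmetric] algebra_simps)
 finally show *: "(1 - ?q + ?q*z)^(u - 1) <= exp (- (k*(1 - z)))^a" .
 have "(1 - ?q + ?q*z)^u <= (1 - ?q + ?q*z)^(u - 1)"
  using b b1 by (intro power_decreasing) auto
 with * show "(1 - ?q + ?q*z)^u <= exp (- (k*(1 - z)))^a" by linarith
qed

text \<open>While at least \<open>u0\<close> of the at most \<open>u0 + m\<close> vertices remain
  unexplored, no later level exceeds \<open>m\<close>, so \<open>offspring_lb\<close> applies at
  every step. The indicator at the final time covers all earlier times because the unexplored set
  only shrinks.\<close>

lemma Run_pow:
 assumes "offspring_lb p k m u0" "0 <= p" "p <= 1" "0 <= z" "z <= 1"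
  and "finite U" "card T <= m" "card U <= u0 + m"
 shows "Run p s (\<lambda>T U. of_bool (u0 <= card U)*z^card T) T U <= zit k z s^card T"
 using assms(6-8)
proof (induction s arbitrary: T U)
 case 0
 thus ?case using assms(4,5) by simp
next
 case (Suc s)
 let ?H = "\<lambda>T U. of_bool (u0 <= card U)*z^card T :: real"
 let ?q = "1 - (1 - p)^card T"
 have q: "0 <= ?q" "?q <= 1" using step_prob[OF assms(2,3)] by auto
 have k: "0 <= k" using assms(1) by (simp add: offspring_lb_def)
 note z01 = zit_01[OF k assms(4,5)]
 have zero: "Run p t ?H S U' = 0" if "card U' < u0" "finite U'" for t S U'
  by (rule Run_zero) (use that card_mono[of U'] in \<open>auto simp: not_le intro: le_less_trans\<close>)
 show ?case
 proof (cases "u0 <= card U")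
  case False
  thus ?thesis using zero[of U "Suc s" T] Suc.prems z01 by (auto simp: not_le)
 next
  case True
  have "Run p (Suc s) ?H T U <= Ex U ?q (\<lambda>S. zit k z s^card S)"
   unfolding Run.simps
  proof (rule Ex_mono[OF q])
   fix S assume S: "S \<subseteq> U"
   show "Run p s ?H S (U - S) <= zit k z s^card S"
   proof (cases "u0 <= card (U - S)")
    case True
    have "card (U - S) = card U - card S"
     using S Suc.prems by (simp add: card_Diff_subset finite_subset)
    moreover from this have "card S <= m"
     using True Suc.prems assms(1) by (auto simp: offspring_lb_def)
    ultimately show ?thesis using True Suc.prems by (intro Suc.IH) (auto)
   qed (use zero[of "U - S" s S] Suc.prems z01 in auto)
  qed
  also have "... = (1 - ?q + ?q*zit k z s)^card U" using Suc.prems by (simp add: Ex_pow)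
  also have "... <= exp (- (k*(1 - zit k z s)))^card T"
   by (rule offspring_pow[OF assms(1-3)]) (use Suc.prems True z01 in auto)
  finally show ?thesis by simp
 qed
qed

text \<open>Bounding \<open>1\<close> by \<open>card T\<close> on the last \<open>K\<close> generations is harmless, as conditionally on thin
 survival these generations have about one member each.\<close>

lemma Run_thin:
 assumes "offspring_lb p k m u0" "0 <= p" "p <= 1" "0 <= z" "z <= 1"
  and "finite U" "card T <= m" "finite T" "card U <= u0 + m" "real (card U)*p <= lam"
 shows "Run p (K + s) (\<lambda>T U. of_bool (T \<noteq> {} \<and> u0 <= card U)*z^card T) T U
  <= zit k z s*(\<Prod>i\<in>{s<..s + K}. lam*zit k z i)*(real (card T)*zit k z (s + K)^(card T - 1))"
 using assms(6-10)
proof (induction K arbitrary: T U)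
 case 0
 let ?H = "\<lambda>T U. of_bool (T \<noteq> {} \<and> u0 <= card U)*z^card T :: real"
 have k: "0 <= k" using assms(1) by (simp add: offspring_lb_def)
 note z01 = zit_01[OF k assms(4,5)]
 show ?case
 proof (cases "T = {}")
  case True
  thus ?thesis using Run_empty[of U p s ?H] 0 by simp
 next
  case False
  hence c: "1 <= card T" using 0 by (simp add: Suc_le_eq card_gt_0_iff)
  have "Run p s ?H T U <= zit k z s^card T"
  proof -
   have "Run p s ?H T U <= Run p s (\<lambda>T U. of_bool (u0 <= card U)*z^card T) T U"
   proof (cases s)
    case 0 thus ?thesis using assms(4) by simp
   next
    case (Suc s')
    have *: "Run p t ?H T' U' <= Run p t (\<lambda>T U. of_bool (u0 <= card U)*z^card T) T' U'" for t T' U'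
     by (induction t arbitrary: T' U') (use assms(4) step_prob[OF assms(2,3)] in \<open>auto intro!: Ex_mono\<close>)
    show ?thesis by (rule *)
   qed
   also have "... <= zit k z s^card T"
    by (rule Run_pow[OF assms(1-5)]) (use 0 in auto)
   finally show ?thesis .
  qed
  also have "... = zit k z s*zit k z s^(card T - 1)" using c by (cases "card T") auto
  also have "... <= zit k z s*(real (card T)*zit k z s^(card T - 1))"
  proof (rule mult_left_mono)
   have "1*zit k z s^(card T - 1) <= real (card T)*zit k z s^(card T - 1)"
    using c z01 by (intro mult_right_mono) auto
   thus "zit k z s^(card T - 1) <= real (card T)*zit k z s^(card T - 1)" by simp
  qed (use z01 in auto)
  finally show ?thesis by simp
 qed
next
 case (Suc K)
 let ?H = "\<lambda>T U. of_bool (T \<noteq> {} \<and> u0 <= card U)*z^card T :: real"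
 let ?q = "1 - (1 - p)^card T"
 let ?z = "zit k z (s + K)"
 define B where "B = zit k z s*(\<Prod>i\<in>{s<..s + K}. lam*zit k z i)"
 have q: "0 <= ?q" "?q <= 1" "?q <= real (card T)*p" using step_prob[OF assms(2,3)] by auto
 have k: "0 <= k" using assms(1) by (simp add: offspring_lb_def)
 note z01 = zit_01[OF k assms(4,5)]
 have lam: "0 <= lam" using Suc.prems assms(2) by (meson mult_nonneg_nonneg of_nat_0_le_iff order_trans)
 have B0: "0 <= B" unfolding B_def using z01 lam by (intro mult_nonneg_nonneg prod_nonneg) auto
 have zero: "Run p t ?H S U' = 0" if "card U' < u0" "finite U'" for t S U'
  by (rule Run_zero) (use that card_mono[of U'] in \<open>auto simp: not_le intro: le_less_trans\<close>)
 have step: "zit k z s*(\<Prod>i\<in>{s<..s + Suc K}. lam*zit k z i) = B*(lam*zit k z (s + Suc K))"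
 proof -
  have "{s<..s + Suc K} = insert (s + Suc K) {s<..s + K}" by auto
  thus ?thesis by (simp add: B_def)
 qed
 show ?case
 proof (cases "u0 <= card U")
  case False
  have "0 <= B*(lam*zit k z (s + Suc K))*(real (card T)*zit k z (s + Suc K)^(card T - 1))"
   using B0 lam z01 by (intro mult_nonneg_nonneg) (auto simp del: zit.simps)
  moreover have "Run p (Suc K + s) ?H T U = 0" by (rule zero) (use False Suc.prems in auto)
  ultimately show ?thesis unfolding step by simp
 next
  case True
  have "Run p (Suc K + s) ?H T U <= Ex U ?q (\<lambda>S. B*(real (card S)*?z^(card S - 1)))"
   unfolding Run.simps add_Suc
  proof (rule Ex_mono[OF q(1,2)])
   fix S assume S: "S \<subseteq> U"
   show "Run p (K + s) ?H S (U - S) <= B*(real (card S)*?z^(card S - 1))"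
   proof (cases "u0 <= card (U - S)")
    case True
    have cU: "card (U - S) = card U - card S"
     using S Suc.prems by (simp add: card_Diff_subset finite_subset)
    moreover have "card S <= m"
     using True Suc.prems assms(1) cU by (auto simp: offspring_lb_def)
    moreover have "real (card (U - S))*p <= real (card U)*p"
     using assms(2) Suc.prems by (intro mult_right_mono) (auto intro: card_mono)
    ultimately show ?thesis using True Suc.prems S unfolding B_def
     by (intro Suc.IH) (auto intro: finite_subset)
   next
    case False
    have "0 <= B*(real (card S)*?z^(card S - 1))"
     using B0 z01 by (intro mult_nonneg_nonneg) auto
    thus ?thesis using zero[of "U - S" "K + s" S] Suc.prems False by auto
   qed
  qed
  \<comment> \<open>The bound carried through the induction is linear in \<open>card S\<close>, so
    \<open>Ex_card_pow\<close> applies. Its prefactor is at most \<open>lam * card T\<close>, and of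
    the resulting power of the next iterate one factor joins the product.\<close>
  also have "... = B*(real (card U)*?q*(1 - ?q + ?q*?z)^(card U - 1))"
   by (simp only: Ex_cmult Ex_card_pow[OF Suc.prems(1)])
  also have "... <= B*((real (card U)*(real (card T)*p))*exp (- (k*(1 - ?z)))^card T)"
   using B0 q z01 Suc.prems True assms(2)
   by (intro mult_left_mono mult_mono offspring_pow[OF assms(1-3)]) auto
  also have "... = B*((real (card U)*p)*(real (card T)*exp (- (k*(1 - ?z)))^card T))"
   by simp
  also have "... <= B*(lam*(real (card T)*exp (- (k*(1 - ?z)))^card T))"
   using B0 Suc.prems by (intro mult_left_mono mult_right_mono) auto
  also have "... = B*(lam*zit k z (s + Suc K))*(real (card T)*zit k z (s + Suc K)^(card T - 1))"
   by (cases "card T") auto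
  finally show ?thesis unfolding step .
 qed
qed

section \<open>Iterates of the Poisson generating function\<close>

text \<open>Starting from Laplace parameter \<open>h\<close>, each generation multiplies the
  exponent by \<open>k\<close> until it is of order \<open>k\<close>. The correction is chosen to
  reproduce itself: with \<open>x = k^l * h\<close>, the next exponent
  \<open>k * (x * (1 - x))\<close> is again of the stated form, so the errors do not
  accumulate.\<close>

lemma zit_le_exp:
 assumes "2 <= k" "0 <= h" "k^l*h <= k" "0 <= z" "z <= exp (- h)" "z <= 1"
 shows "zit k z l <= exp (- (k^l*h*(1 - k^l*h/k)))"
 using assms(3)
proof (induction l)
 case 0
 have "h*(1 - h/k) <= h*1" using assms(1,2) by (intro mult_left_mono) auto
 hence "exp (- h) <= exp (- (h*(1 - h/k)))" by simp
 with assms(5) have "z <= exp (- (h*(1 - h/k)))" by (rule order_trans)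
 thus ?case by simp
next
 case (Suc l)
 define x where "x = k^l*h"
 have x0: "0 <= x" using assms(1,2) by (simp add: x_def)
 have kx: "x <= 1" using Suc.prems assms(1) by (simp add: x_def)
 hence "x <= k" using assms(1) by simp
 hence IH: "zit k z l <= exp (- (x*(1 - x/k)))" using Suc.IH by (simp add: x_def)
 define v where "v = x*(1 - x/k)"
 have xk: "0 <= 1 - x/k" using \<open>x <= k\<close> assms(1) by simp
 have v0: "0 <= v" using xk x0 by (simp add: v_def)
 have vx: "v <= x" unfolding v_def using x0 assms(1) by (intro mult_left_le) auto
 \<comment> \<open>Follows from the quadratic lower bound for \<open>exp v\<close>, since the
   product of the two quadratics is \<open>1 + v ^ 4 / 4\<close>.\<close>
 have "exp (- v) <= 1 - v + v^2/2"
 proof -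
  have v1: "v <= 1" using vx kx by simp
  have "1 <= (1 - v + v^2/2)*exp v"
  proof -
   have "1 + v + v^2/2 <= exp v" using exp_lower_Taylor_quadratic[OF v0] by simp
   hence "(1 - v + v^2/2)*(1 + v + v^2/2) <= (1 - v + v^2/2)*exp v"
    using v1 by (intro mult_left_mono) auto
   moreover have "(1 - v + v^2/2)*(1 + v + v^2/2) = 1 + v ^ 4/4"
    by (simp add: field_simps power2_eq_square power4_eq_xxxx)
   ultimately show ?thesis by (smt (verit) zero_le_power_eq_numeral zero_le_power v0 divide_nonneg_nonneg)
  qed
  thus ?thesis by (simp add: exp_minus field_simps)
 qed
 hence "v - v^2/2 <= 1 - zit k z l" using IH unfolding v_def by linarith
 moreover have "v * (1 - x/2) <= v - v^2/2"
  using mult_left_mono[OF vx v0] by (simp add: algebra_simps power2_eq_square)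
 moreover have "x*(1 - x) <= v * (1 - x/2)"
 proof -
  have "1 - x/2 - x/2 <= 1 - x/k - x/2"
   using divide_left_mono[of 2 k x] assms(1) x0 by simp
  also have "... <= (1 - x/k)*(1 - x/2)"
   using x0 assms(1) by (simp add: algebra_simps)
  finally have "x*(1 - x) <= x*((1 - x/k)*(1 - x/2))"
   using x0 by (intro mult_left_mono) auto
  thus ?thesis by (simp add: v_def mult_ac)
 qed
 ultimately have "x*(1 - x) <= 1 - zit k z l" by linarith
 hence "k*(x*(1 - x)) <= k*(1 - zit k z l)" using assms(1) by (intro mult_left_mono) auto
 moreover have "k^Suc l*h*(1 - k^Suc l*h/k) = k*(x*(1 - x))"
  using assms(1) by (simp add: x_def mult.assoc)
 ultimately show ?case by (simp only: zit.simps exp_le_cancel_iff neg_le_iff_le)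
qed

text \<open>One generation past the linear regime: about \<open>k\<close> children each contribute a
  transform of at most \<open>exp (- g)\<close>, and the exponent saturates at
  \<open>k\<close>.\<close>

lemma zit_saturate:
 assumes "2 <= k" "0 <= h" "k^l*h <= k" "0 <= z" "z <= exp (- h)" "z <= 1"
  and "g <= k^l*h*(1 - k^l*h/k)"
 shows "zit k z (Suc l) <= exp (- (k*(1 - exp (- g))))"
proof -
 have "zit k z l <= exp (- g)"
  using zit_le_exp[OF assms(1-6)] assms(7) by (meson exp_le_cancel_iff neg_le_iff_le order_trans)
 hence "k*(1 - exp (- g)) <= k*(1 - zit k z l)" using assms(1) by (intro mult_left_mono) auto
 thus ?thesis by simp
qed

lemma zit_half:
 assumes "2 <= k" "0 <= z" "z <= 1" "zit k z s <= 1/2" "s < i"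
 shows "zit k z i <= exp (- k/2)"
 using assms(5)
proof (induction i)
 case (Suc i)
 have half: "exp (- k/2) <= 1/2"
 proof -
  have "2 <= exp (1::real)" using exp_ge_add_one_self[of 1] by simp
  hence "exp (- 1 :: real) <= 1/2" by (simp add: exp_minus field_simps)
  moreover have "exp (- k/2) <= exp (- 1)" using assms(1) by simp
  ultimately show ?thesis by linarith
 qed
 have "zit k z i <= 1/2"
  using Suc half assms(4) by (cases "s = i") auto
 hence "k*(1/2) <= k*(1 - zit k z i)" using assms(1) by (intro mult_left_mono) auto
 thus ?case by simp
qed simp

text \<open>\<open>q\<close> is the fixed point for mean \<open>lam\<close>, while the iteration
  runs with the smaller mean \<open>k\<close>. The excess \<open>D\<close> over \<open>q\<close>
  contracts by about \<open>lam * exp (- k/2)\<close> per generation and is therefore summable; the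
  mismatch of the means contributes \<open>K * (lam - k)\<close>, at most 1/4, to the
  exponent.\<close>

lemma zit_prod_upper:
 assumes k: "2 <= k" "k <= lam" and z: "0 <= z" "z <= 1" "zit k z s <= 1/2"
  and q: "0 < q" "q = exp (- (lam*(1 - q)))"
  and small: "2*lam^2*exp (- k/2) <= 1/4" "real K*(lam - k) <= 1/4"
 shows "(\<Prod>i\<in>{s<..s + K}. lam*zit k z i) <= (lam*q)^K*exp (lam*zit k z s + 1)"
proof -
 define D where "D i = max 0 (zit k z i - q)" for i
 define del where "del = lam - k"
 define eta where "eta = exp (- k/2)"
 have del0: "0 <= del" using k by (simp add: del_def)
 have eta0: "0 < eta" by (simp add: eta_def)
 have lam2: "2 <= lam" using k by simp
 have z01: "0 <= zit k z i" "zit k z i <= 1" for i using zit_01[of k z i] k z by auto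
 have D0: "0 <= D i" for i by (simp add: D_def)
 have X: "zit k z (Suc i) <= q*exp (del + lam*D i)" for i
 proof -
  have "lam*(1 - q) - k*(1 - zit k z i) = del*(1 - zit k z i) + lam*(zit k z i - q)"
   by (simp add: del_def algebra_simps)
  also have "... <= del*1 + lam*D i"
   using del0 z01 lam2 by (intro add_mono mult_left_mono) (auto simp: D_def)
  finally have "exp (- (k*(1 - zit k z i))) <= exp (- (lam*(1 - q)))*exp (del + lam*D i)"
   by (simp add: exp_add[symmetric])
  with q(2) show ?thesis by simp
 qed
 have DS: "D (Suc i) <= eta*(del + lam*D i)" if "s <= i" for i
 proof (cases "zit k z (Suc i) <= q")
  case True
  thus ?thesis using eta0 del0 lam2 D0 by (simp add: D_def)
 next
  case False
  let ?Y = "del + lam*D i"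
  \<comment> \<open>From \<open>zit <= q * exp Y\<close> follows \<open>zit * (1 - Y) <= q\<close>,
    so the excess is at most \<open>zit * Y\<close>; the smallness \<open>eta\<close> of the iterate
    supplies the contraction.\<close>
  have "zit k z (Suc i)*(1 + - ?Y) <= zit k z (Suc i)*exp (- ?Y)"
   by (rule mult_left_mono[OF exp_ge_add_one_self z01(1)])
  also have "... <= q*exp ?Y*exp (- ?Y)" using X[of i] by (intro mult_right_mono) auto
  also have "... = q" by (simp add: mult.assoc exp_add[symmetric])
  finally have "zit k z (Suc i) - q <= zit k z (Suc i)*?Y" by (simp add: algebra_simps del: zit.simps)
  also have "... <= eta*?Y"
   using zit_half[OF k(1) z(1-3), of "Suc i"] that del0 lam2 D0 unfolding eta_def
   by (intro mult_right_mono) (auto simp del: zit.simps)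
  finally show ?thesis using False by (simp add: D_def del: zit.simps)
 qed
 define S where "S n = (\<Sum>i\<in>{s..<s + n}. D i)" for n
 have S0: "0 <= S n" for n unfolding S_def by (intro sum_nonneg) (auto simp: D0)
 have Sbound: "S n <= D s + eta*(real n*del + lam * S n)" for n
 proof (induction n)
  case 0 thus ?case using D0 eta0 by (simp add: S_def)
 next
  case (Suc n)
  show ?case
  proof (cases n)
   case 0 thus ?thesis using D0[of s] eta0 del0 lam2 by (simp add: S_def)
  next
   case (Suc n')
   have e1: "S (Suc n) = S n + D (s + n)" by (simp add: S_def)
   have e2: "S n = S n' + D (s + n')" by (simp add: S_def Suc)
   have e3: "D (s + n) <= eta*(del + lam*D (s + n'))" using DS[of "s + n'"] Suc by simp
   have aux: "S m <= D s + eta*(real (m - 1)*del + lam * S (m - 1))" for m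
   proof (induction m)
    case 0 thus ?case using D0 eta0 by (simp add: S_def)
   next
    case (Suc m)
    show ?case
    proof (cases m)
     case 0 thus ?thesis by (simp add: S_def)
    next
     case (Suc m')
     have "S (Suc m) = S m + D (s + m)" by (simp add: S_def)
     also have "... <= D s + eta*(real m'*del + lam * S m') + eta*(del + lam*D (s + m'))"
      using Suc.IH DS[of "s + m'"] Suc by simp
     also have "... = D s + eta*(real m*del + lam*(S m' + D (s + m')))"
      using Suc by (simp add: algebra_simps)
     also have "S m' + D (s + m') = S m" using Suc by (simp add: S_def)
     finally show ?thesis by simp
    qed
   qed
   have "S (Suc n) <= D s + eta*(real n*del + lam * S n)" using aux[of "Suc n"] by simp
   also have "... <= D s + eta*(real (Suc n)*del + lam * S (Suc n))"
    using eta0 del0 lam2 D0[of "s + n"] e1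
    by (intro add_left_mono mult_left_mono add_mono mult_right_mono) auto
   finally show ?thesis .
  qed
 qed
 have le: "lam*eta <= 1/16"
 proof -
  have "2*lam*(lam*eta) <= 1/4" using small(1) by (simp add: eta_def power2_eq_square mult_ac)
  moreover have "4*(lam*eta) <= 2*lam*(lam*eta)" using lam2 eta0 by (intro mult_right_mono) auto
  ultimately show ?thesis by linarith
 qed
 have Ds: "D s <= zit k z s" "D s <= 1" using q(1) z01[of s] by (auto simp: D_def)
 have "real K*del + lam * S K <= lam*zit k z s + 1"
 proof -
  define a where "a = lam * S K"
  have a0: "0 <= a" using lam2 S0 by (simp add: a_def)
  have "lam * S K <= lam*(D s + eta*(real K*del + lam * S K))"
   using Sbound[of K] lam2 by (intro mult_left_mono) auto
  \<comment> \<open>A self-bounding inequality. It is solved crudely (\<open>a2\<close>, with a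
    factor 2) and the result is inserted again, which restores the coefficient 1 of
    \<open>lam * D s\<close>.\<close>
  hence a1: "a <= lam*D s + (lam*eta)*(real K*del + a)" by (simp add: a_def algebra_simps)
  have "(lam*eta)*(real K*del + a) <= 1/16*(real K*del + a)"
   using le a0 del0 by (intro mult_right_mono) auto
  from order_trans[OF a1 add_left_mono[OF this]]
  have "a <= lam*D s + 1/16*(real K*del + a)" .
  moreover have "0 <= lam*D s" "0 <= real K*del" using D0 lam2 del0 by auto
  ultimately have a2: "a <= 2*(lam*D s) + real K*del"
   by (simp add: field_simps)
  have "(lam*eta)*(real K*del + a) <= (lam*eta)*(2*lam*D s + 1/2)"
   using a2 small(2) lam2 eta0 by (intro mult_left_mono) (auto simp: del_def)
  also have "... = (2*lam^2*eta)*D s + lam*eta/2" by (simp add: algebra_simps power2_eq_square)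
  also have "... <= 1/4*1 + 1/32"
   using small(1) Ds D0[of s] le eta0 by (intro add_mono mult_mono) (auto simp: eta_def)
  finally have "a <= lam*D s + 9/32" using a1 by linarith
  moreover have "lam*D s <= lam*zit k z s" using Ds lam2 by (intro mult_left_mono) auto
  ultimately show ?thesis using small(2) unfolding a_def del_def by linarith
 qed
 moreover have "(\<Prod>i\<in>{s<..s + n}. lam*zit k z i) <= (lam*q)^n*exp (real n*del + lam * S n)" for n
 proof (induction n)
  case 0 thus ?case by (simp add: S_def)
 next
  case (Suc n)
  have "{s<..s + Suc n} = insert (s + Suc n) {s<..s + n}" by auto
  hence "(\<Prod>i\<in>{s<..s + Suc n}. lam*zit k z i) = (lam*zit k z (Suc (s + n)))*(\<Prod>i\<in>{s<..s + n}. lam*zit k z i)"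
   by simp
  also have "... <= (lam*(q*exp (del + lam*D (s + n))))*((lam*q)^n*exp (real n*del + lam * S n))"
   using lam2 z01 X[of "s + n"] q(1) by (intro mult_mono Suc.IH mult_left_mono prod_nonneg) (auto simp del: zit.simps)
  also have "... = (lam*q)^Suc n*exp (real (Suc n)*del + lam * S (Suc n))"
   by (simp add: S_def exp_add[symmetric] algebra_simps)
  finally show ?case .
 qed
 ultimately show ?thesis
  using lam2 q(1) by (meson exp_le_cancel_iff mult_left_mono mult_nonneg_nonneg order_trans
    zero_le_power less_imp_le order_trans[OF zero_le_numeral])
qed

lemma zit0_le_fixpoint:
 assumes "0 <= lam" "0 < q" "q = exp (- (lam*(1 - q)))"
 shows "zit lam 0 i <= q"
proof (induction i)
 case (Suc i)
 have "lam*(1 - q) <= lam*(1 - zit lam 0 i)" using Suc assms(1) by (intro mult_left_mono) auto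
 hence "zit lam 0 (Suc i) <= exp (- (lam*(1 - q)))" by simp
 with assms(3) show ?case by simp
qed (use assms in auto)

text \<open>Near the fixed point the iteration has slope at most \<open>lam * q <= 1/2\<close>, so
  the gap \<open>q - zit lam 0 i\<close> at least halves each time and all gaps add up to at most
  \<open>2 * q\<close>. Each factor is \<open>q\<close> times the exponential of
  \<open>- lam\<close> times the preceding gap.\<close>

lemma zit0_prod_lower:
 assumes "0 <= lam" "0 < q" "q = exp (- (lam*(1 - q)))" "lam*q <= 1/2"
 shows "q^k*exp (- (2*lam*q)) <= (\<Prod>i\<in>{0<..k}. zit lam 0 i)"
proof -
 define y where "y = zit lam 0"
 have yq: "y i <= q" for i unfolding y_def by (rule zit0_le_fixpoint[OF assms(1-3)])
 have yS: "y (Suc i) = q*exp (- (lam*(q - y i)))" for i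
 proof -
  have "y (Suc i) = exp (- (lam*(1 - q)) + - (lam*(q - y i)))" by (simp add: y_def algebra_simps)
  thus ?thesis using assms(3) by (simp only: exp_add)
 qed
 have dS: "q - y (Suc i) <= 1/2*(q - y i)" for i
 proof -
  have "q*(1 + - (lam*(q - y i))) <= q*exp (- (lam*(q - y i)))"
   by (rule mult_left_mono[OF exp_ge_add_one_self]) (use assms(2) in simp)
  hence "q - y (Suc i) <= (lam*q)*(q - y i)" unfolding yS by (simp add: algebra_simps)
  also have "... <= 1/2*(q - y i)" using assms(4) yq by (intro mult_right_mono) auto
  finally show ?thesis .
 qed
 have sumb: "(\<Sum>i<k. q - y i) + (q - y k)*2 <= 2*q" for k
 proof (induction k)
  case 0 thus ?case by (simp add: y_def)
 next
  case (Suc k) thus ?case using dS[of k] by simp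
 qed
 have pr: "(\<Prod>i\<in>{0<..k}. y i) = q^k*exp (- (lam*(\<Sum>i<k. q - y i)))" for k
 proof (induction k)
  case (Suc k)
  have "{0<..Suc k} = insert (Suc k) {0<..k}" by auto
  hence "(\<Prod>i\<in>{0<..Suc k}. y i) = y (Suc k)*(\<Prod>i\<in>{0<..k}. y i)" by simp
  thus ?case unfolding Suc yS by (simp add: exp_add[symmetric] algebra_simps)
 qed simp
 have "(\<Sum>i<k. q - y i) <= 2*q"
  by (rule order_trans[OF _ sumb[of k]]) (use yq[of k] in simp)
 hence "lam*(\<Sum>i<k. q - y i) <= 2*lam*q" using mult_left_mono[OF _ assms(1)] by fastforce
 hence "q^k*exp (- (2*lam*q)) <= q^k*exp (- (lam*(\<Sum>i<k. q - y i)))"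
  using assms(2) by (intro mult_left_mono) auto
 with pr show ?thesis by (simp add: y_def)
qed

text \<open>The bound 1/4 reproduces itself: an iterate of at most 1/4 makes the next one at most
  \<open>exp (- 3/4 * k)\<close>, hence at most \<open>exp (- 3/2)\<close>.\<close>

lemma zit0_small:
 assumes "2 <= k"
 shows "zit k 0 i <= exp (- (3/4 * k))"
proof (induction i)
 case (Suc i)
 have "exp (- (3/4 * k)) <= exp (- (3/2))" using assms by simp
 also have "exp (- (3/2)) <= (1/4::real)"
 proof -
  have "1 + 3/2 + (3/2)^2/2 <= exp (3/2 :: real)" using exp_lower_Taylor_quadratic[of "3/2"] by simp
  hence "3.6 <= exp (3/2 :: real)" by (simp add: power2_eq_square)
  moreover have "exp (3/2 :: real) = exp (1/2)^3" by (simp add: exp_of_nat_mult[symmetric])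
  \<comment> \<open>The quadratic Taylor bound at \<open>3/2\<close> stays below 4; cubing the one
    at \<open>1/2\<close> gives \<open>1.6 ^ 3 > 4\<close>.\<close>
  moreover have "1.6 <= exp (1/2 :: real)"
   using exp_lower_Taylor_quadratic[of "1/2"] by (simp add: power2_eq_square)
  ultimately have "4 <= exp (3/2 :: real)" 
   using power_mono[of "1.6::real" "exp (1/2)" 3] by (simp add: power3_eq_cube)
  thus ?thesis by (simp add: exp_minus field_simps)
 qed
 finally have "zit k 0 i <= 1/4" using Suc by linarith
 hence "k*(3/4) <= k*(1 - zit k 0 i)" using assms by (intro mult_left_mono) auto
 thus ?case by simp
qed simp

section \<open>Distances and the upper bound\<close>

lemma adj_rel_sym: "(x, y) \<in> adj_rel E \<longleftrightarrow> (y, x) \<in> adj_rel E"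
 unfolding adj_rel_def by (simp add: insert_commute[of x y] eq_commute[of x y])

lemma relpow_adj_sym: "(x, y) \<in> adj_rel E ^^ k ==> (y, x) \<in> adj_rel E ^^ k"
proof (induction k arbitrary: y)
 case (Suc k)
 then obtain z where "(x, z) \<in> adj_rel E ^^ k" "(z, y) \<in> adj_rel E" by auto
 from relpow_Suc_I2[OF iffD1[OF adj_rel_sym this(2)] Suc.IH[OF this(1)]] show ?case .
qed simp

lemma adj_rel_pr: "(x, y) \<in> adj_rel (E \<inter> pr W) \<longleftrightarrow> {x, y} \<in> E \<and> x \<noteq> y \<and> x \<in> W \<and> y \<in> W"
 by (auto simp: adj_rel_def pr_def)

lemma relpow_add_I: "(x, y) \<in> R ^^ i ==> (y, z) \<in> R ^^ j ==> (x, z) \<in> R ^^ (i + j)"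
 unfolding relpow_add by (rule relcompI)

lemma relpow_split: "(x, z) \<in> R ^^ (i + j) ==> \<exists>y. (x, y) \<in> R ^^ i \<and> (y, z) \<in> R ^^ j"
 unfolding relpow_add by (blast elim: relcompE)

text \<open>The dictionary between exploration and distance: levels are spheres around
  \<open>T\<close>, and unexplored sets are complements of balls, in the graph induced on
  \<open>T \<union> U\<close>.\<close>

lemma lev_char:
 fixes E :: "'a set set"
 assumes "T \<inter> U = {}"
 defines "A \<equiv> adj_rel (E \<inter> pr (T \<union> U))"
 shows "rs E T U t = {u \<in> U. \<forall>k\<le>t. \<forall>v\<in>T. (v, u) \<notin> A ^^ k}"
  and "lv E T U t = {u \<in> T \<union> U. (\<exists>v\<in>T. (v, u) \<in> A ^^ t) \<and> (\<forall>k<t. \<forall>v\<in>T. (v, u) \<notin> A ^^ k)}"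
proof (induction t)
 case 0
 { case 1 show ?case using assms(1) by auto }
 { case 2 show ?case by auto }
next
 case (Suc t)
 let ?L = "lv E T U t" and ?R = "rs E T U t"
 have key: "u \<in> nb E ?L ?R \<longleftrightarrow> (\<exists>v\<in>T. (v, u) \<in> A ^^ Suc t)" if u: "u \<in> ?R" for u
 proof
  assume "u \<in> nb E ?L ?R"
  then obtain w where w: "w \<in> ?L" "{u, w} \<in> E" by (auto simp: nb_def)
  have "u \<noteq> w" "w \<in> T \<union> U" "u \<in> T \<union> U"
   using lev_sub(1,2)[of E T U t] lev_sub(3)[of T U E t] assms(1) w(1) u by auto
  hence "(w, u) \<in> A" using w(2) by (simp add: A_def adj_rel_pr insert_commute)
  moreover obtain v where "v \<in> T" "(v, w) \<in> A ^^ t" using w(1) Suc(2) by auto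
  ultimately show "\<exists>v\<in>T. (v, u) \<in> A ^^ Suc t" by auto
 next
  assume "\<exists>v\<in>T. (v, u) \<in> A ^^ Suc t"
  then obtain v w where vw: "v \<in> T" "(v, w) \<in> A ^^ t" "(w, u) \<in> A" by auto
  have no: "(v', u) \<notin> A ^^ k" if "k <= t" "v' \<in> T" for k v' using u Suc(1) that by auto
  have "(v', w) \<notin> A ^^ k" if "k < t" "v' \<in> T" for k v'
  proof
   assume "(v', w) \<in> A ^^ k"
   hence "(v', u) \<in> A ^^ Suc k" using vw(3) by auto
   with no[of "Suc k" v'] that show False by simp
  qed
  moreover have "w \<in> T \<union> U" "{u, w} \<in> E"
   using vw(3) by (auto simp: A_def adj_rel_pr insert_commute)
  ultimately have "w \<in> ?L" using vw Suc(2) by auto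
  with \<open>{u, w} \<in> E\<close> u show "u \<in> nb E ?L ?R" by (auto simp: nb_def)
 qed
 { case 1
  have "rs E T U (Suc t) = {u \<in> ?R. u \<notin> nb E ?L ?R}" by (auto simp: lev_Suc_back simp del: lev.simps)
  also have "... = {u \<in> ?R. \<not> (\<exists>v\<in>T. (v, u) \<in> A ^^ Suc t)}" using key by auto
  also have "... = {u \<in> U. \<forall>k\<le>Suc t. \<forall>v\<in>T. (v, u) \<notin> A ^^ k}"
   unfolding Suc(1) by (auto simp: le_Suc_eq simp del: relpow.simps)
  finally show ?case .
 }
 { case 2
  have "lv E T U (Suc t) = {u \<in> ?R. u \<in> nb E ?L ?R}"
   using nb_subset[of E ?L ?R] by (auto simp: lev_Suc_back simp del: lev.simps)
  also have "... = {u \<in> ?R. \<exists>v\<in>T. (v, u) \<in> A ^^ Suc t}" using key by auto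
  also have "... = {u \<in> T \<union> U. (\<exists>v\<in>T. (v, u) \<in> A ^^ Suc t) \<and> (\<forall>k<Suc t. \<forall>v\<in>T. (v, u) \<notin> A ^^ k)}"
  proof -
   have "u \<notin> T" if "\<forall>k<Suc t. \<forall>v\<in>T. (v, u) \<notin> A ^^ k" for u
    using that[rule_format, of 0 u] by auto
   thus ?thesis unfolding Suc(1) by (auto simp: less_Suc_eq_le simp del: relpow.simps)
  qed
  finally show ?case .
 }
qed

lemma gdist_le: "(x, y) \<in> adj_rel E ^^ k ==> gdist E x y <= enat k"
 unfolding gdist_def by (rule INF_lower) simp

lemma gdist_attained:
 assumes "gdist E x y = enat d"
 shows "(x, y) \<in> adj_rel E ^^ d"
proof -
 let ?S = "enat ` {k. (x, y) \<in> adj_rel E ^^ k}"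
 have "?S \<noteq> {}"
 proof
  assume "?S = {}"
  hence "gdist E x y = Inf {}" unfolding gdist_def by simp
  with assms show False by (simp add: Inf_enat_def)
 qed
 then obtain k where "k \<in> ?S" by blast
 hence "Inf ?S \<in> ?S" by (rule wellorder_InfI)
 thus ?thesis using assms unfolding gdist_def by auto
qed

lemma diam_set:
 assumes "finite V"
 shows "finite {the_enat (gdist E x y) |x y. x \<in> V \<and> y \<in> V \<and> gdist E x y < \<infinity>}"
 by (rule finite_subset[of _ "(\<lambda>(x, y). the_enat (gdist E x y)) ` (V \<times> V)"]) (use assms in auto)

lemma diam_leI:
 assumes "finite V" "V \<noteq> {}"
  and "\<And>x y k. x \<in> V ==> y \<in> V ==> (x, y) \<in> adj_rel E ^^ k ==> \<exists>j\<le>r. (x, y) \<in> adj_rel E ^^ j"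
 shows "diam V E <= r"
proof -
 obtain v where v: "v \<in> V" using assms(2) by auto
 have "(v, v) \<in> adj_rel E ^^ 0" by simp
 from gdist_le[OF this] have "gdist E v v < \<infinity>"
  by (cases "gdist E v v") auto
 hence ne: "{the_enat (gdist E x y) |x y. x \<in> V \<and> y \<in> V \<and> gdist E x y < \<infinity>} \<noteq> {}" using v by blast
 show ?thesis
  unfolding diam_def
 proof (subst Max_le_iff[OF diam_set[OF assms(1)] ne], safe)
  fix x y assume xy: "x \<in> V" "y \<in> V" "gdist E x y < \<infinity>"
  then obtain d where d: "gdist E x y = enat d" by auto
  from assms(3)[OF xy(1,2) gdist_attained[OF d]] obtain j where "j <= r" "(x, y) \<in> adj_rel E ^^ j" by blast
  thus "the_enat (gdist E x y) <= r" using gdist_le[of x y j E] d by simp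
 qed
qed

lemma diam_gtI:
 assumes "finite V" "x \<in> V" "y \<in> V" "(x, y) \<in> adj_rel E ^^ k"
  and "\<And>j. j <= r ==> (x, y) \<notin> adj_rel E ^^ j"
 shows "r < diam V E"
proof -
 obtain d where d: "gdist E x y = enat d"
  using gdist_le[OF assms(4)] by (cases "gdist E x y") auto
 have "r < d" using gdist_attained[OF d] assms(5)[of d] by (metis not_le)
 also have "d = the_enat (gdist E x y)" using d by simp
 also have "... <= diam V E"
  unfolding diam_def
 proof (rule Max_ge[OF diam_set[OF assms(1)]])
  have "gdist E x y < \<infinity>" using d by simp
  thus "the_enat (gdist E x y) \<in> {the_enat (gdist E x y) |x y. x \<in> V \<and> y \<in> V \<and> gdist E x y < \<infinity>}"
   using assms(2,3) by blast
 qed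
 finally show ?thesis .
qed

text \<open>The ball of radius \<open>t'\<close> around \<open>y\<close> lies in the part not
  reached from \<open>x\<close>, so exploring from \<open>y\<close> inside \<open>R\<close> or in
  the whole graph gives the same level. The first view makes the two explorations independent; the
  second allows the sphere of \<open>y\<close> to be bounded by a union bound over single vertices.
  The \<open>+ 1\<close> in the hypothesis excludes an edge between the two spheres.\<close>

lemma far_pair_levels:
 fixes E :: "'a set set"
 assumes E: "E \<subseteq> pr V" and V: "x \<in> V" "y \<in> V" and k: "(x, y) \<in> adj_rel E ^^ k"
  and far: "\<And>j. j <= t + t' + 1 ==> (x, y) \<notin> adj_rel E ^^ j"
 defines "L \<equiv> lv E {x} (V - {x}) t" and "R \<equiv> rs E {x} (V - {x}) t"
 defines "L' \<equiv> lv E {y} (R - {y}) t'" and "R' \<equiv> rs E {y} (R - {y}) t'"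
 shows "L \<noteq> {}" "y \<in> R" "L' = lv E {y} (V - {y}) t'" "R \<inter> rs E {y} (V - {y}) t' \<subseteq> R'"
  "nb E L R \<inter> L' = {}"
proof -
 define A where "A = adj_rel E"
 have EV: "E \<inter> pr V = E" using E by auto
 have Vx: "{x} \<union> (V - {x}) = V" "{y} \<union> (V - {y}) = V" using V by auto
 have dx: "{x} \<inter> (V - {x}) = {}" "{y} \<inter> (V - {y}) = {}" by auto
 have R: "R = {u \<in> V. \<forall>k\<le>t. (x, u) \<notin> A ^^ k}"
 proof -
  have S1: "rs E {x} (V - {x}) t = {u \<in> V - {x}. \<forall>k\<le>t. (x, u) \<notin> A ^^ k}"
   using lev_char(1)[OF dx(1), of E t] unfolding Vx EV A_def by simp
  have S2: "u \<in> V - {x} \<and> (\<forall>k\<le>t. (x, u) \<notin> A ^^ k) \<longleftrightarrow> u \<in> V \<and> (\<forall>k\<le>t. (x, u) \<notin> A ^^ k)" for u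
  proof -
   have "u \<noteq> x" if "\<forall>k\<le>t. (x, u) \<notin> A ^^ k"
    using that[rule_format, of 0] by auto
   thus ?thesis by blast
  qed
  show ?thesis unfolding R_def S1 S2 ..
 qed
 have L: "L = {u \<in> V. (x, u) \<in> A ^^ t \<and> (\<forall>k<t. (x, u) \<notin> A ^^ k)}"
  unfolding L_def using lev_char(2)[OF dx(1), of E t] unfolding Vx EV A_def by simp
 have LV': "lv E {y} (V - {y}) t' = {u \<in> V. (y, u) \<in> A ^^ t' \<and> (\<forall>k<t'. (y, u) \<notin> A ^^ k)}"
  using lev_char(2)[OF dx(2), of E t'] unfolding Vx EV A_def by simp
 have RV': "rs E {y} (V - {y}) t' = {u \<in> V - {y}. \<forall>k\<le>t'. (y, u) \<notin> A ^^ k}"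
  using lev_char(1)[OF dx(2), of E t'] unfolding Vx EV A_def by simp
 have Asym: "(u, w) \<in> A ^^ j ==> (w, u) \<in> A ^^ j" for u w j
  unfolding A_def by (rule relpow_adj_sym)
 have AV: "u \<in> V ==> (u, w) \<in> A ^^ j ==> w \<in> V" for u w j
 proof (induction j arbitrary: w)
  case (Suc j)
  then obtain z where "(z, w) \<in> A" by auto
  thus ?case using E by (auto simp: A_def adj_rel_def pr_def)
 qed auto
 have "(x, y) \<notin> A ^^ k" if "k <= t" for k using far[of k] that by (simp add: A_def)
 thus "y \<in> R" unfolding R using V by blast
 show "L \<noteq> {}"
 proof -
  define d where "d = (LEAST d. (x, y) \<in> A ^^ d)"
  have d: "(x, y) \<in> A ^^ d" unfolding d_def A_def by (rule LeastI[of "\<lambda>d. (x, y) \<in> adj_rel E ^^ d", OF k])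
  have dmin: "d <= j" if "(x, y) \<in> A ^^ j" for j unfolding d_def by (rule Least_le) (rule that)
  have "t < d"
  proof (rule ccontr)
   assume "\<not> t < d"
   hence "d <= t + t' + 1" by linarith
   from far[OF this] d show False unfolding A_def by blast
  qed
  hence "d = t + (d - t)" by simp
  with d have "(x, y) \<in> A ^^ (t + (d - t))" by metis
  from relpow_split[OF this] obtain w where w: "(x, w) \<in> A ^^ t" "(w, y) \<in> A ^^ (d - t)" by blast
  have "(x, w) \<notin> A ^^ j" if "j < t" for j
  proof
   assume "(x, w) \<in> A ^^ j"
   from dmin[OF relpow_add_I[OF this w(2)]] that \<open>t < d\<close> show False by linarith
  qed
  hence "w \<in> L" unfolding L using w(1) AV[OF V(1) w(1)] by simp
  thus ?thesis by auto
 qed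
 \<comment> \<open>A vertex within \<open>t'\<close> of \<open>y\<close> and within \<open>t\<close>
   of \<open>x\<close> would join them by a short walk. Hence walks from \<open>y\<close> of length
   up to \<open>t'\<close> never leave \<open>R\<close>.\<close>
 have inR: "u \<in> R" if u: "(y, u) \<in> A ^^ j" "j <= t'" for u j
 proof -
  have "(x, u) \<notin> A ^^ i" if "i <= t" for i
  proof
   assume "(x, u) \<in> A ^^ i"
   hence "(x, y) \<in> A ^^ (i + j)" by (rule relpow_add_I[OF _ Asym[OF u(1)]])
   moreover have "i + j <= t + t' + 1" using that u(2) by linarith
   ultimately show False using far unfolding A_def by blast
  qed
  with AV[OF V(2) u(1)] show ?thesis unfolding R by blast
 qed
 define AR where "AR = adj_rel (E \<inter> pr R)"
 have AR_A: "(y, u) \<in> AR ^^ j ==> (y, u) \<in> A ^^ j" for u j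
 proof (induction j arbitrary: u)
  case (Suc j)
  thus ?case by (auto simp: AR_def A_def adj_rel_def)
 qed auto
 have A_AR: "(y, u) \<in> A ^^ j ==> j <= t' ==> (y, u) \<in> AR ^^ j" for u j
 proof (induction j arbitrary: u)
  case (Suc j)
  then obtain w where w: "(y, w) \<in> A ^^ j" "(w, u) \<in> A" by auto
  have "w \<in> R" "u \<in> R" using inR[OF w(1)] inR[OF Suc.prems] Suc.prems(2) by auto
  hence "(w, u) \<in> AR" using w(2) unfolding AR_def adj_rel_pr by (simp add: A_def adj_rel_def)
  with Suc.IH[OF w(1)] Suc.prems show ?case by auto
 qed auto
 have yR: "insert y R = R" using \<open>y \<in> R\<close> by auto
 have yd: "{y} \<inter> (R - {y}) = {}" by simp
 have L': "L' = {u \<in> R. (y, u) \<in> AR ^^ t' \<and> (\<forall>k<t'. (y, u) \<notin> AR ^^ k)}"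
  unfolding L'_def AR_def using lev_char(2)[OF yd, of E t'] by (simp add: yR)
 have R': "R' = {u \<in> R - {y}. \<forall>k\<le>t'. (y, u) \<notin> AR ^^ k}"
  unfolding R'_def AR_def using lev_char(1)[OF yd, of E t'] by (simp add: yR)
 show "L' = lv E {y} (V - {y}) t'"
  unfolding L' LV'
 proof (rule Collect_cong)
  fix u
  have eq: "(y, u) \<in> AR ^^ j \<longleftrightarrow> (y, u) \<in> A ^^ j" if "j <= t'" for j
   using AR_A[of u j] A_AR[of u j] that by blast
  have "((y, u) \<in> AR ^^ t' \<and> (\<forall>k<t'. (y, u) \<notin> AR ^^ k))
    = ((y, u) \<in> A ^^ t' \<and> (\<forall>k<t'. (y, u) \<notin> A ^^ k))"
   by (simp add: eq)
  moreover have "u \<in> V" if "u \<in> R" using that unfolding R by simp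
  moreover have "u \<in> R" if "(y, u) \<in> A ^^ t'" using inR[OF that] by simp
  ultimately show "(u \<in> R \<and> (y, u) \<in> AR ^^ t' \<and> (\<forall>k<t'. (y, u) \<notin> AR ^^ k))
    = (u \<in> V \<and> (y, u) \<in> A ^^ t' \<and> (\<forall>k<t'. (y, u) \<notin> A ^^ k))"
   by argo
 qed
 show "R \<inter> rs E {y} (V - {y}) t' \<subseteq> R'"
 proof
  fix u assume "u \<in> R \<inter> rs E {y} (V - {y}) t'"
  hence u: "u \<in> R" "u \<noteq> y" "\<forall>k\<le>t'. (y, u) \<notin> A ^^ k" unfolding RV' by simp_all
  have "(y, u) \<notin> AR ^^ k" if "k <= t'" for k using AR_A[of u k] u(3) that by blast
  with u show "u \<in> R'" unfolding R' by simp
 qed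
 show "nb E L R \<inter> L' = {}"
 proof (rule ccontr)
  assume "nb E L R \<inter> L' \<noteq> {}"
  then obtain u where "u \<in> nb E L R" and uL': "u \<in> L'" by blast
  then obtain w where u: "u \<in> R" "w \<in> L" "{u, w} \<in> E" unfolding nb_def by blast
  have "L \<inter> R = {}" unfolding L_def R_def by (rule lev_sub(3)[OF dx(1)])
  hence "w \<noteq> u" using u by blast
  hence "(w, u) \<in> A" using u(3) unfolding A_def adj_rel_def by (simp add: insert_commute)
  moreover have "(x, w) \<in> A ^^ t" using u(2) unfolding L by simp
  ultimately have "(x, u) \<in> A ^^ (Suc t)" by (rule relpow_Suc_I[rotated])
  moreover have "(y, u) \<in> A ^^ t'" using uL' AR_A unfolding L' by blast
  ultimately have "(x, y) \<in> A ^^ (Suc t + t')" by (rule relpow_add_I[OF _ Asym])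
  moreover have "Suc t + t' <= t + t' + 1" by simp
  ultimately show False using far unfolding A_def by blast
 qed
qed

text \<open>The second exploration runs on unexamined pairs inside \<open>U\<close>. The pairs
  joining the two last levels belong to neither exploration; to see that they are all absent, one
  further level \<open>S\<close> is peeled off from \<open>T\<close> and required to avoid the
  sphere around \<open>y\<close>.\<close>

lemma pair_Run:
 fixes V :: "'a set"
 assumes "finite V" "x \<in> V"
 shows "PE (pr V) p (\<lambda>E. P (lv E {x} (V - {x}) t) (rs E {x} (V - {x}) t) \<and> y \<in> rs E {x} (V - {x}) t
    \<and> P' (lv E {y} (rs E {x} (V - {x}) t - {y}) t') (rs E {y} (rs E {x} (V - {x}) t - {y}) t')
    \<and> nb E (lv E {x} (V - {x}) t) (rs E {x} (V - {x}) t) \<inter> lv E {y} (rs E {x} (V - {x}) t - {y}) t' = {})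
  = Run p t (\<lambda>T U. of_bool (P T U \<and> y \<in> U) *
    Run p t' (\<lambda>T' U'. of_bool (P' T' U')*((1 - p)^card T)^card T') {y} (U - {y})) {x} (V - {x})"
proof -
 define G where "G T U E = (of_bool (P T U \<and> y \<in> U \<and> P' (lv E {y} (U - {y}) t') (rs E {y} (U - {y}) t')
   \<and> nb E T U \<inter> lv E {y} (U - {y}) t' = {}) :: real)" for T U :: "'a set" and E
 have Vx: "{x} \<union> (V - {x}) = V" using assms by auto
 have "Ex (pr V) p (\<lambda>E. G (lv E {x} (V - {x}) t) (rs E {x} (V - {x}) t) E)
   = Ex (pr ({x} \<union> (V - {x}))) p (\<lambda>E. G (lv E {x} (V - {x}) t) (rs E {x} (V - {x}) t)
     (E \<inter> pr (lv E {x} (V - {x}) t \<union> rs E {x} (V - {x}) t)))"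
  unfolding Vx
 proof (rule Ex_cong)
  fix E
  let ?T = "lv E {x} (V - {x}) t" and ?U = "rs E {x} (V - {x}) t"
  have d: "?T \<inter> ?U = {}" by (rule lev_sub(3)) auto
  have n: "nb (E \<inter> pr (?T \<union> ?U)) ?T ?U = nb E ?T ?U" using d by (intro nb_Int_pr) auto
  show "G ?T ?U E = G ?T ?U (E \<inter> pr (?T \<union> ?U))"
  proof (cases "y \<in> ?U")
   case True
   hence "lev (E \<inter> pr (?T \<union> ?U)) {y} (?U - {y}) t' = lev E {y} (?U - {y}) t'"
    by (intro lev_Int_pr) auto
   with n show ?thesis by (simp add: G_def)
  qed (simp add: G_def)
 qed
 also have "... = Run p t (\<lambda>T U. Ex (pr (T \<union> U)) p (G T U)) {x} (V - {x})"
  using assms by (intro Run_ex) auto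
 also have "... = Run p t (\<lambda>T U. of_bool (P T U \<and> y \<in> U) *
    Run p t' (\<lambda>T' U'. of_bool (P' T' U')*((1 - p)^card T)^card T') {y} (U - {y})) {x} (V - {x})"
  (is "Run p t ?H1 _ _ = Run p t ?H2 _ _")
 proof -
  have eq: "?H1 T U = ?H2 T U" if fin: "finite T" "finite U" "T \<inter> U = {}" for T U
  proof (cases "P T U \<and> y \<in> U")
   case False
   hence "G T U = (\<lambda>_. 0)" by (auto simp: G_def)
   thus ?thesis using False fin by simp
  next
   case True
   have yU: "{y} \<union> (U - {y}) = U" using True by auto
   let ?g = "\<lambda>S E. of_bool (P' (lv E {y} (U - {y}) t') (rs E {y} (U - {y}) t')) *
     of_bool (S \<inter> lv E {y} (U - {y}) t' = {}) :: real"
   have "?H1 T U = Ex (pr (T \<union> U)) p (\<lambda>E. ?g (nb E T U) (E \<inter> pr U))"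
   proof (rule Ex_cong)
    fix E
    have "lev (E \<inter> pr U) {y} (U - {y}) t' = lev E {y} (U - {y}) t'"
     using True by (intro lev_Int_pr) auto
    thus "G T U E = ?g (nb E T U) (E \<inter> pr U)" using True by (simp add: G_def)
   qed
   also have "... = Ex U (1 - (1 - p)^card T) (\<lambda>S. Ex (pr U) p (?g S))"
    by (rule peel[OF fin])
   also have "... = Ex (pr U) p (\<lambda>E. of_bool (P' (lv E {y} (U - {y}) t') (rs E {y} (U - {y}) t')) *
      ((1 - p)^card T)^card (lv E {y} (U - {y}) t'))"
    unfolding Ex_swap[of U] Ex_cmult
   proof (rule Ex_cong)
    fix E
    have "lv E {y} (U - {y}) t' \<subseteq> U" using lev_sub(1)[of E "{y}" "U - {y}" t'] yU by auto
    from Ex_disjoint[OF fin(2) this, of "1 - (1 - p)^card T"]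
    show "of_bool (P' (lv E {y} (U - {y}) t') (rs E {y} (U - {y}) t')) *
      PE U (1 - (1 - p)^card T) (\<lambda>S. S \<inter> lv E {y} (U - {y}) t' = {})
     = of_bool (P' (lv E {y} (U - {y}) t') (rs E {y} (U - {y}) t')) *
      ((1 - p)^card T)^card (lv E {y} (U - {y}) t')" by simp
   qed
   also have "... = Run p t' (\<lambda>T' U'. of_bool (P' T' U')*((1 - p)^card T)^card T') {y} (U - {y})"
    using Run_ex'[of "{y}" "U - {y}" p "\<lambda>T' U'. of_bool (P' T' U')*((1 - p)^card T)^card T'" t'] fin yU
    by simp
   finally show ?thesis using True by simp
  qed
  have "Run p t ?H1 T U = Run p t ?H2 T U" if "finite T" "finite U" "T \<inter> U = {}" for T U
   using that
  proof (induction t arbitrary: T U)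
   case 0 thus ?case using eq by simp
  next
   case (Suc t)
   thus ?case unfolding Run.simps by (intro Ex_cong Suc.IH) (auto intro: finite_subset)
  qed
  thus ?thesis using assms by simp
 qed
 finally show ?thesis unfolding G_def by (simp add: conj_assoc)
qed

text \<open>After \<open>s\<close> generations of growth, staying thin costs a factor \<open>lam * zit k z i\<close>, close to \<open>lam_star\<close>, for
 each of \<open>K\<close> further generations.\<close>

definition thinb :: "real => real => nat => real => nat => real" where
 "thinb lam k K z s = zit k z s*(\<Prod>i\<in>{s<..s + K}. lam*zit k z i)"

lemma thinb_nonneg:
 assumes "0 <= k" "0 <= z" "z <= 1" "0 <= lam"
 shows "0 <= thinb lam k K z s"
 unfolding thinb_def using zit_01[OF assms(1-3)] assms(4)
 by (intro mult_nonneg_nonneg prod_nonneg) auto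

lemma Ex_Bex_le:
 assumes "finite I" "0 <= q" "q <= 1"
 shows "PE A q (\<lambda>X. \<exists>i\<in>I. P i X) <= (\<Sum>i\<in>I. PE A q (\<lambda>X. P i X))"
 unfolding Ex_sum[symmetric]
proof (rule Ex_mono[OF assms(2,3)])
 fix X
 show "of_bool (\<exists>i\<in>I. P i X) <= (\<Sum>i\<in>I. of_bool (P i X) :: real)"
 proof (cases "\<exists>i\<in>I. P i X")
  case True
  then obtain i where "i \<in> I" "P i X" by blast
  hence "of_bool (P i X) <= (\<Sum>i\<in>I. of_bool (P i X) :: real)"
   using assms(1) by (intro member_le_sum) auto
  with \<open>P i X\<close> show ?thesis using True by simp
 qed (simp add: sum_nonneg)
qed

text \<open>A larger diameter forces a sphere that survives but stays below its threshold, or an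
  exploration using more than \<open>m\<close> vertices, or two large spheres with no edge between
  them. In the last case the missing edges are not estimated separately from survival: both factors
  \<open>thinb\<close> are kept, so the price of a thin beginning is paid twice.\<close>

lemma upper_main:
 fixes n m K s s' :: nat and p k lam h h' A A' :: real
 assumes p: "0 <= p" "p <= 1" and n: "1 <= n" "m <= n" "1 <= m"
  and off: "offspring_lb p k (2*m) (n - 2*m)"
  and lam: "real n*p <= lam" "1 <= lam" and h: "0 <= h" "0 <= h'" and A: "0 <= A" "0 <= A'"
 shows "PE (pairs n) p (\<lambda>E. 2*K + s + s' + 1 < diam {1..n} E)
  <= real n*(exp (h*A)*thinb lam k K (exp (- h)) s + exp (h'*A')*thinb lam k K (exp (- h')) s'
    + exp (1 - real (m - 1)/(4*lam)^(K + s)) + exp (1 - real (m - 1)/(4*lam)^(K + s')))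
   + real n^2*(thinb lam k K (exp (- (p*A'/2))) s*thinb lam k K (exp (- (p*A/2))) s')" (is "_ <= ?rhs")
proof -
 let ?V = "{1..n}"
 let ?u0 = "n - 2*m"
 let ?T = "thinb lam k K" and ?c = "\<lambda>t. exp (1 - real (m - 1)/(4*lam)^t)"
 let ?L = "\<lambda>E x. lv E {x} (?V - {x})" and ?R = "\<lambda>E x. rs E {x} (?V - {x})"
 have k0: "0 <= k" using off by (simp add: offspring_lb_def)
 define thin where "thin x t A E \<longleftrightarrow> ?L E x t \<noteq> {} \<and> real (card (?L E x t)) < A
   \<and> ?u0 <= card (?R E x t)" for x t A E
 define cap where "cap x t E \<longleftrightarrow> card (?R E x t) < n - m" for x t E
 define P where "P A T U \<longleftrightarrow> T \<noteq> {} \<and> A <= real (card T) \<and> ?u0 <= card U" for A and T U :: "nat set"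
 define pairev where "pairev x y E \<longleftrightarrow>
   P A (?L E x (K + s)) (?R E x (K + s)) \<and> y \<in> ?R E x (K + s)
    \<and> P A' (lv E {y} (?R E x (K + s) - {y}) (K + s')) (rs E {y} (?R E x (K + s) - {y}) (K + s'))
    \<and> nb E (?L E x (K + s)) (?R E x (K + s)) \<inter> lv E {y} (?R E x (K + s) - {y}) (K + s') = {}"
  for x y E
 have run1: "Run p (K + s) (\<lambda>T U. of_bool (T \<noteq> {} \<and> ?u0 <= card U)*z^card T) {y} U <= ?T z s"
  if "0 <= z" "z <= 1" "U \<subseteq> ?V - {x}" for z U x and y :: nat and s
 proof -
  have cU: "finite U" "card U <= n" using that(3) card_mono[of ?V U] finite_subset[of U ?V] by auto
  have "real (card U)*p <= lam"
   using lam(1) cU p by (meson mult_right_mono of_nat_le_iff order_trans)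
  from Run_thin[OF off p that(1,2), of U "{y}" lam K s] this show ?thesis
   using cU n by (auto simp: thinb_def)
 qed
 have thin_le: "PE (pr ?V) p (\<lambda>E. thin x (K + s) A E) <= exp (h*A)*?T (exp (- h)) s"
  if "x \<in> ?V" "0 <= h" for x s A h
 proof -
  have Vx: "{x} \<union> (?V - {x}) = ?V" using that by auto
  have "PE (pr ?V) p (\<lambda>E. thin x (K + s) A E)
    = Run p (K + s) (\<lambda>T U. of_bool (T \<noteq> {} \<and> real (card T) < A \<and> ?u0 <= card U)) {x} (?V - {x})"
   using Run_ex'[of "{x}" "?V - {x}" p "\<lambda>T U. of_bool (T \<noteq> {} \<and> real (card T) < A \<and> ?u0 <= card U)" "K + s"] Vx
   by (simp add: thin_def)
  also have "... <= Run p (K + s) (\<lambda>T U. exp (h*A)*(of_bool (T \<noteq> {} \<and> ?u0 <= card U)*exp (- h)^card T)) {x} (?V - {x})"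
  proof (rule Run_mono[OF p])
   fix T U :: "nat set"
   show "of_bool (T \<noteq> {} \<and> real (card T) < A \<and> ?u0 <= card U)
     <= exp (h*A)*(of_bool (T \<noteq> {} \<and> ?u0 <= card U)*exp (- h)^card T)"
   proof (cases "T \<noteq> {} \<and> real (card T) < A \<and> ?u0 <= card U")
    case True
    hence "0 <= h*(A - real (card T))" using that by auto
    hence "1 <= exp (h*A)*exp (- h)^card T"
     by (simp add: exp_of_nat_mult[symmetric] exp_add[symmetric] algebra_simps)
    thus ?thesis using True by simp
   qed auto
  qed auto
  also have "... = exp (h*A) * Run p (K + s) (\<lambda>T U. of_bool (T \<noteq> {} \<and> ?u0 <= card U)*exp (- h)^card T) {x} (?V - {x})"
   by (rule Run_cmult)
  also have "... <= exp (h*A)*?T (exp (- h)) s"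
   using that by (intro mult_left_mono run1) auto
  finally show ?thesis .
 qed
 have cap_le: "PE (pr ?V) p (\<lambda>E. cap x t E) <= ?c t"
  if "x \<in> ?V" for x t
 proof -
  have Vx: "{x} \<union> (?V - {x}) = ?V" using that by auto
  have c: "card (?V - {x}) = n - 1" using that by simp
  have "real (card (?V - {x}))*p <= real n*p"
   unfolding c using p by (intro mult_right_mono) auto
  hence pl: "real (card (?V - {x}))*p <= lam" using lam(1) by linarith
  have B: "real (n - m) + real (m - 1) <= real (card (?V - {x}))" using c n by simp
  have "PE (pr ?V) p (\<lambda>E. cap x t E)
    = Run p t (\<lambda>_ U. of_bool (card U < n - m)) {x} (?V - {x})"
   using Run_ex'[of "{x}" "?V - {x}" p "\<lambda>_ U. of_bool (card U < n - m)" t] Vx by (simp add: cap_def)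
  also have "... <= exp (real (card {x}) - real (m - 1)/(4*lam)^t)"
   by (rule Run_cap[OF p _ pl lam(2) B]) simp
  finally show ?thesis by simp
 qed
 have pair_le: "PE (pr ?V) p (\<lambda>E. pairev x y E)
   <= ?T (exp (- (p*A'/2))) s*?T (exp (- (p*A/2))) s'"
  if "x \<in> ?V" for x y
 proof -
  let ?z = "exp (- (p*A'/2))" and ?z' = "exp (- (p*A/2))"
  have z: "0 <= ?z" "?z <= 1" "0 <= ?z'" "?z' <= 1" using p A by auto
  have B0: "0 <= ?T ?z' s'" using lam by (intro thinb_nonneg k0 z) auto
  have "PE (pr ?V) p (\<lambda>E. pairev x y E) = Run p (K + s) (\<lambda>T U. of_bool (P A T U \<and> y \<in> U) *
    Run p (K + s') (\<lambda>T' U'. of_bool (P A' T' U')*((1 - p)^card T)^card T') {y} (U - {y})) {x} (?V - {x})"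
   unfolding pairev_def by (rule pair_Run) (use that in auto)
  also have "... <= Run p (K + s) (\<lambda>T U. ?T ?z' s'*(of_bool (T \<noteq> {} \<and> ?u0 <= card U)*?z^card T)) {x} (?V - {x})"
  proof (rule Run_mono[OF p])
   fix T U :: "nat set" assume U: "U \<subseteq> ?V - {x}"
   show "of_bool (P A T U \<and> y \<in> U) *
    Run p (K + s') (\<lambda>T' U'. of_bool (P A' T' U')*((1 - p)^card T)^card T') {y} (U - {y})
    <= ?T ?z' s'*(of_bool (T \<noteq> {} \<and> ?u0 <= card U)*?z^card T)"
   proof (cases "P A T U \<and> y \<in> U")
    case False
    have "0 <= ?T ?z' s'*(of_bool (T \<noteq> {} \<and> ?u0 <= card U)*?z^card T)"
     using B0 by simp
    with False show ?thesis by (simp only: of_bool_eq mult_zero_left)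
   next
    case True
    have "Run p (K + s') (\<lambda>T' U'. of_bool (P A' T' U')*((1 - p)^card T)^card T') {y} (U - {y})
      <= Run p (K + s') (\<lambda>T' U'. ?z^card T*(of_bool (T' \<noteq> {} \<and> ?u0 <= card U')*?z'^card T')) {y} (U - {y})"
    proof (rule Run_mono[OF p])
     fix T' U' :: "nat set"
     show "of_bool (P A' T' U')*((1 - p)^card T)^card T'
       <= ?z^card T*(of_bool (T' \<noteq> {} \<and> ?u0 <= card U')*?z'^card T')"
     proof (cases "P A' T' U'")
      case P': True
      define a b where "a = real (card T)" and "b = real (card T')"
      have ab: "A <= a" "A' <= b" "0 <= a" "0 <= b" using True P' by (auto simp: P_def a_def b_def)
      have "(1 - p)^(card T*card T') <= exp (- (p*(a * b)))"
       using one_minus_pow_le[OF p, of "card T*card T'"] by (simp add: a_def b_def mult_ac)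
      \<comment> \<open>\<open>a * b\<close> is at least \<open>A' * a\<close> and at least
        \<open>A * b\<close>, hence at least their mean. This splits the bound into a factor in
        \<open>a\<close> and a factor in \<open>b\<close>, so that a generating function can be
        applied to each exploration.\<close>
      also have "... <= exp (- (p*((A'*a + A * b)/2)))"
      proof -
       have "A'*a <= a * b" "A * b <= a * b" using mult_right_mono[OF ab(2,3)] mult_right_mono[OF ab(1,4)] by (simp_all add: mult.commute)
       hence "p*((A'*a + A * b)/2) <= p*(a * b)" using p by (intro mult_left_mono) auto
       thus ?thesis by simp
      qed
      also have "... = ?z^card T*?z'^card T'"
       by (simp add: exp_of_nat_mult[symmetric] exp_add[symmetric] a_def b_def field_simps)
      finally show ?thesis using P' by (simp add: P_def power_mult)
     qed (use z in auto)
    qed auto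
    also have "... = ?z^card T * Run p (K + s') (\<lambda>T' U'. of_bool (T' \<noteq> {} \<and> ?u0 <= card U')*?z'^card T') {y} (U - {y})"
     by (rule Run_cmult)
    also have "... <= ?z^card T*?T ?z' s'"
     using z U by (intro mult_left_mono run1[of _ _ x]) auto
    finally show ?thesis using True by (simp add: P_def mult.commute)
   qed
  qed auto
  also have "... = ?T ?z' s' * Run p (K + s) (\<lambda>T U. of_bool (T \<noteq> {} \<and> ?u0 <= card U)*?z^card T) {x} (?V - {x})"
   by (rule Run_cmult)
  also have "... <= ?T ?z' s'*?T ?z s"
   using B0 z by (intro mult_left_mono run1[of _ _ x]) auto
  finally show ?thesis by (simp add: mult.commute)
 qed
 have cover: "(\<exists>x\<in>?V. thin x (K + s) A E \<or> thin x (K + s') A' E \<or> cap x (K + s) E \<or> cap x (K + s') E)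
   \<or> (\<exists>x\<in>?V. \<exists>y\<in>?V. pairev x y E)"
  if E: "E \<subseteq> pr ?V" and d: "2*K + s + s' + 1 < diam ?V E" for E
 proof (rule ccontr)
  assume no: "\<not> ?thesis"
  have "diam ?V E <= 2*K + s + s' + 1"
  proof (rule diam_leI)
   fix x y l assume xy: "x \<in> ?V" "y \<in> ?V" and l: "(x, y) \<in> adj_rel E ^^ l"
   show "\<exists>j\<le>2*K + s + s' + 1. (x, y) \<in> adj_rel E ^^ j"
   proof (rule ccontr)
    assume "\<not> (\<exists>j\<le>2*K + s + s' + 1. (x, y) \<in> adj_rel E ^^ j)"
    hence far: "(x, y) \<notin> adj_rel E ^^ j" if "j <= (K + s) + (K + s') + 1" for j
     using that by (auto simp: algebra_simps mult_2)
    have far': "(y, x) \<notin> adj_rel E ^^ j" if "j <= (K + s') + (K + s) + 1" for j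
     using far[of j] that relpow_adj_sym[of y x j E] by (auto simp: algebra_simps)
    note F = far_pair_levels[where t = "K + s" and t' = "K + s'", OF E xy l far]
    note F' = far_pair_levels(1)[where t = "K + s'" and t' = "K + s", OF E xy(2,1) relpow_adj_sym[OF l] far']
    let ?Lx = "?L E x (K + s)" and ?Rx = "?R E x (K + s)" and ?R2 = "?R E y (K + s')"
    have R: "n - m <= card ?Rx" "n - m <= card ?R2" using no xy by (auto simp: cap_def not_less)
    have RV: "?Rx \<subseteq> ?V" "?R2 \<subseteq> ?V"
     using lev_sub(2)[of E "{x}" "?V - {x}" "K + s"] lev_sub(2)[of E "{y}" "?V - {y}" "K + s'"] by auto
    have fin: "finite ?Rx" "finite ?R2" using RV finite_subset by auto
    \<comment> \<open>In the whole graph each exploration leaves at least \<open>n - m\<close>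
      vertices, so at least \<open>n - 2 * m\<close> are left by both; the offspring bound is
      therefore required down to that size.\<close>
    have "card (?Rx \<union> ?R2) <= n" using RV card_mono[of ?V "?Rx \<union> ?R2"] by simp
    moreover have "card ?Rx + card ?R2 = card (?Rx \<union> ?R2) + card (?Rx \<inter> ?R2)"
     by (rule card_Un_Int[OF fin])
    moreover have "card (?Rx \<inter> ?R2) <= card (rs E {y} (?Rx - {y}) (K + s'))"
    proof (rule card_mono[OF _ F(4)])
     show "finite (rs E {y} (?Rx - {y}) (K + s'))"
      using lev_sub(2)[of E "{y}" "?Rx - {y}" "K + s'"] fin(1) by (auto intro: finite_subset)
    qed
    ultimately have R': "?u0 <= card (rs E {y} (?Rx - {y}) (K + s'))" using R n by linarith
    have a: "A <= real (card ?Lx)" using no xy F(1) R by (auto simp: thin_def not_less)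
    have a': "A' <= real (card (?L E y (K + s')))" using no xy F' R by (auto simp: thin_def not_less)
    have "pairev x y E"
     unfolding pairev_def P_def F(3) using F(1,2,5) F' a a' R R' F(3) by auto
    with no xy show False by blast
   qed
  qed (use n in auto)
  with d show False by simp
 qed
 let ?G = "\<lambda>E. of_bool (\<exists>x\<in>?V. thin x (K + s) A E) + of_bool (\<exists>x\<in>?V. thin x (K + s') A' E)
     + of_bool (\<exists>x\<in>?V. cap x (K + s) E) + of_bool (\<exists>x\<in>?V. cap x (K + s') E)
     + of_bool (\<exists>xy\<in>?V \<times> ?V. pairev (fst xy) (snd xy) E) :: real"
 have "PE (pairs n) p (\<lambda>E. 2*K + s + s' + 1 < diam ?V E)
   <= Ex (pr ?V) p ?G"
  unfolding pairs_eq_pr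
 proof (rule Ex_mono[OF p])
  fix E assume "E \<subseteq> pr ?V"
  from cover[OF this] show "of_bool (2*K + s + s' + 1 < diam ?V E) <= ?G E"
   by (auto simp: of_bool_def)
 qed
 also have "... <= (\<Sum>x\<in>?V. exp (h*A)*?T (exp (- h)) s) + (\<Sum>x\<in>?V. exp (h'*A')*?T (exp (- h')) s')
   + (\<Sum>x\<in>?V. ?c (K + s)) + (\<Sum>x\<in>?V. ?c (K + s'))
   + (\<Sum>xy\<in>?V \<times> ?V. ?T (exp (- (p*A'/2))) s*?T (exp (- (p*A/2))) s')"
  unfolding Ex_add
  by (intro add_mono order_trans[OF Ex_Bex_le[OF _ p]] sum_mono thin_le cap_le pair_le) (use h in auto)
 also have "... = ?rhs"
  by (simp add: power2_eq_square algebra_simps)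
 finally show ?thesis .
qed

section \<open>Ends\<close>

text \<open>The graph induced on \<open>insert v C\<close> is connected and \<open>v\<close> has
  eccentricity exactly \<open>k\<close> in it.\<close>

definition Sh :: "nat => 'a set set => 'a => 'a set => bool" where
 "Sh k E v C \<longleftrightarrow> lv E {v} C k \<noteq> {} \<and> rs E {v} C k = {}"

text \<open>Inside \<open>W\<close>, the set \<open>C\<close> is a union of components of the graph
  without \<open>v\<close>, each attached to \<open>v\<close>, and \<open>N\<close> collects the
  other neighbours of \<open>v\<close>. The ambient set \<open>W\<close> is a parameter because ends
  will be removed one at a time.\<close>

definition St :: "nat => 'a set set => 'a set => 'a => 'a set => 'a set => bool" where
 "St k E W v C N \<longleftrightarrow> v \<in> W \<and> C \<subseteq> W - {v} \<and> Sh k E v C \<and> nb E C (W - insert v C) = {}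
   \<and> nb E {v} (W - insert v C) = N"

text \<open>\<open>u\<close> reaches at least \<open>M\<close> other vertices within
  \<open>M\<close> steps. The same number serves for both, since a search whose level
  \<open>M\<close> is nonempty has found \<open>M\<close> vertices
  (\<open>lev_nonempty_card\<close>).\<close>

definition alive :: "nat => 'a set set => 'a set => 'a => bool" where
 "alive M E W u \<longleftrightarrow> M <= card (W - {u} - rs E {u} (W - {u}) M)"

text \<open>An end \<open>v\<close> of height \<open>k\<close>: the small branches at \<open>v\<close> form \<open>C\<close>, the remaining neighbours \<open>N\<close>
 of \<open>v\<close> all lead to more than \<open>M\<close> vertices.\<close>

definition is_end :: "nat => nat => nat => 'a set set => 'a set => 'a => 'a set => 'a set => bool" where
 "is_end k M J E V v C N \<longleftrightarrow> St k E V v C N \<and> card C <= M \<and> N \<noteq> {} \<and> card N <= J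
   \<and> (\<forall>u\<in>N. alive M E (V - insert v C) u)"

section \<open>Branches of distinct ends are disjoint\<close>

lemma St_stay:
 assumes "St k E W v C N" "a \<in> C" "b \<in> W" "{a, b} \<in> E"
 shows "b \<in> insert v C"
proof (rule ccontr)
 assume "b \<notin> insert v C"
 hence "b \<in> nb E C (W - insert v C)"
  using assms by (auto simp: nb_def insert_commute intro!: bexI[of _ a])
 thus False using assms(1) by (simp add: St_def)
qed

lemma Sh_reach:
 assumes "Sh k E v C" "v \<notin> C" "u \<in> C"
 shows "\<exists>j\<le>k. (v, u) \<in> adj_rel (E \<inter> pr (insert v C)) ^^ j"
proof -
 have d: "{v} \<inter> C = {}" using assms by auto
 have "u \<notin> rs E {v} C k" using assms(1) by (simp add: Sh_def)
 thus ?thesis unfolding lev_char(1)[OF d] using assms(3) by auto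
qed

lemma Sh_top:
 assumes "Sh k E v C" "v \<notin> C"
 shows "\<exists>x\<in>insert v C. (v, x) \<in> adj_rel (E \<inter> pr (insert v C)) ^^ k
  \<and> (\<forall>j<k. (v, x) \<notin> adj_rel (E \<inter> pr (insert v C)) ^^ j)"
proof -
 have d: "{v} \<inter> C = {}" using assms by auto
 have "lv E {v} C k \<noteq> {}" using assms(1) by (simp add: Sh_def)
 thus ?thesis unfolding lev_char(2)[OF d] by auto
qed

text \<open>Everything reached from \<open>u\<close> stays in the closed set \<open>X\<close>, so at
  most \<open>card X - 1 < M\<close> other vertices are found. This is how aliveness is exploited:
  no small closed set contains an alive vertex.\<close>

lemma alive_closed:
 assumes "alive M E W u" "u \<in> W" "u \<in> X" "finite X" "card X <= M"
  and closed: "\<And>a b. a \<in> X ==> a \<in> W ==> b \<in> W ==> {a, b} \<in> E ==> b \<in> X"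
 shows False
proof -
 have d: "{u} \<inter> (W - {u}) = {}" by auto
 have W: "{u} \<union> (W - {u}) = W" using assms(2) by auto
 have reach: "(u, w) \<in> adj_rel (E \<inter> pr W) ^^ j ==> w \<in> X" for j w
 proof (induction j arbitrary: w)
  case 0 thus ?case using assms(3) by simp
 next
  case (Suc j)
  from Suc.prems obtain z where z: "(u, z) \<in> adj_rel (E \<inter> pr W) ^^ j"
   "(z, w) \<in> adj_rel (E \<inter> pr W)" by auto
  have "{z, w} \<in> E" "z \<in> W" "w \<in> W" using z(2) unfolding adj_rel_pr by auto
  with Suc.IH[OF z(1)] closed show ?case by blast
 qed
 have "W - {u} - rs E {u} (W - {u}) M \<subseteq> X - {u}"
  unfolding lev_char(1)[OF d] W using reach by auto
 hence "card (W - {u} - rs E {u} (W - {u}) M) <= card (X - {u})"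
  using assms(4) by (intro card_mono) auto
 also have "... < card X" using assms(3,4) by (intro psubset_card_mono) auto
 finally show False using assms(1,5) by (simp add: alive_def)
qed

lemma St_vC: "St k E W v C N ==> v \<notin> C" "St k E W v C N ==> C \<subseteq> W" "St k E W v C N ==> v \<in> W"
 "St k E W v C N ==> Sh k E v C"
 by (auto simp: St_def)

lemma St_nbr: "St k E W v C N ==> u \<in> N \<longleftrightarrow> u \<in> W \<and> u \<notin> insert v C \<and> {u, v} \<in> E"
 by (auto simp: St_def nb_def)

lemma is_end_alive:
 assumes "is_end k M J E V v C N" "finite V" "u \<in> N" "u \<in> X" "X \<subseteq> V" "card X <= M"
  and "\<And>a b. a \<in> X ==> b \<in> V ==> b \<notin> insert v C ==> {a, b} \<in> E ==> b \<in> X"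
 shows False
proof (rule alive_closed[of M E "V - insert v C" u X])
 have S: "St k E V v C N" using assms(1) by (simp add: is_end_def)
 show "alive M E (V - insert v C) u" using assms(1,3) by (simp add: is_end_def)
 show "u \<in> V - insert v C" using St_nbr[OF S, of u] assms(3) by simp
 show "finite X" using assms(2,5) finite_subset by blast
qed (use assms in auto)

text \<open>Follow a walk from \<open>v\<close> inside \<open>C\<close>. A step out of
  \<open>C'\<close> would lead from \<open>v\<close> to a vertex of \<open>N'\<close>; but this
  vertex lies in \<open>C\<close>, which is small and has no contact with the outside except through
  \<open>v\<close>, so it cannot be alive.\<close>

lemma end_unique_sub:
 assumes e: "is_end k M J E V v C N" "is_end k M J E V v C' N'" and V: "finite V"
 shows "C \<subseteq> C'"
proof
 fix u assume "u \<in> C"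
 have S: "St k E V v C N" "St k E V v C' N'" using e by (auto simp: is_end_def)
 have cM: "card C <= M" using e by (auto simp: is_end_def)
 have "(v, u) \<in> adj_rel (E \<inter> pr (insert v C)) ^^ j ==> u \<in> C ==> u \<in> C'" for j u
 proof (induction j arbitrary: u)
  case 0 thus ?case using St_vC(1)[OF S(1)] by simp
 next
  case (Suc j)
  from Suc.prems obtain w where w: "(v, w) \<in> adj_rel (E \<inter> pr (insert v C)) ^^ j"
   "(w, u) \<in> adj_rel (E \<inter> pr (insert v C))" by auto
  have wu: "{w, u} \<in> E" "w \<in> insert v C" using w(2) unfolding adj_rel_pr by auto
  have uV: "u \<in> V" "u \<noteq> v" using Suc.prems St_vC[OF S(1)] by auto
  show ?case
  proof (cases "w = v")
   case False
   hence "w \<in> C'" using Suc.IH[OF w(1)] wu by auto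
   from St_stay[OF S(2) this uV(1) wu(1)] uV show ?thesis by simp
  next
   case True
   show ?thesis
   proof (rule ccontr)
    assume "u \<notin> C'"
    hence "u \<in> N'" using St_nbr[OF S(2), of u] uV wu True by (simp add: insert_commute)
    thus False
    proof (rule is_end_alive[OF e(2) V _ Suc.prems(2) St_vC(2)[OF S(1)] cM])
     fix a b assume "a \<in> C" "b \<in> V" "b \<notin> insert v C'" "{a, b} \<in> E"
     with St_stay[OF S(1), of a b] show "b \<in> C" by auto
    qed
   qed
  qed
 qed
 with Sh_reach[OF St_vC(4)[OF S(1)] St_vC(1)[OF S(1)] \<open>u \<in> C\<close>] \<open>u \<in> C\<close> show "u \<in> C'" by blast
qed

lemma end_unique:
 assumes "is_end k M J E V v C N" "is_end k M J E V v C' N'" "finite V"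
 shows "C = C' \<and> N = N'"
proof -
 have "C = C'" using end_unique_sub[OF assms] end_unique_sub[OF assms(2,1,3)] by blast
 with assms show ?thesis by (auto simp: is_end_def St_def)
qed

text \<open>If \<open>v\<close> also lies in \<open>C'\<close>, a vertex of \<open>N\<close> is
  forced into the small closed set \<open>C'\<close> and cannot be alive. Otherwise the whole branch
  at \<open>v'\<close> lies in \<open>C\<close>, strictly farther from \<open>v\<close> than from
  \<open>v'\<close>, and its top at distance \<open>k\<close> from \<open>v'\<close> contradicts the
  height of \<open>C\<close>. This is why the height is required to be exactly
  \<open>k\<close>.\<close>

lemma end_not_inside:
 assumes e: "is_end k M J E V v C N" "is_end k M J E V v' C' N'" and V: "finite V" and ne: "v \<noteq> v'"
 shows "v' \<notin> C"
proof
 assume v'C: "v' \<in> C"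
 have S: "St k E V v C N" "St k E V v' C' N'" using e by (auto simp: is_end_def)
 have cM: "card C' <= M" using e by (auto simp: is_end_def)
 show False
 proof (cases "v \<in> C'")
  case True
  obtain u where u: "u \<in> N" using e(1) by (auto simp: is_end_def)
  have uV: "u \<in> V" "u \<notin> insert v C" "{u, v} \<in> E" using St_nbr[OF S(1), of u] u by auto
  have "u \<in> C'" using St_stay[OF S(2) True uV(1)] uV v'C by (auto simp: insert_commute)
  thus False
  proof (rule is_end_alive[OF e(1) V u _ St_vC(2)[OF S(2)] cM])
   fix a b assume "a \<in> C'" "b \<in> V" "b \<notin> insert v C" "{a, b} \<in> E"
   with St_stay[OF S(2), of a b] v'C show "b \<in> C'" by auto
  qed
 next
  case False
  have vD': "v \<notin> insert v' C'" using False ne by auto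
  have sub: "u \<in> C' ==> (v', u) \<in> adj_rel (E \<inter> pr (insert v' C')) ^^ j ==> u \<in> C" for u j
  proof (induction j arbitrary: u)
   case 0 thus ?case using v'C by simp
  next
   case (Suc j)
   from Suc.prems obtain w where w: "(v', w) \<in> adj_rel (E \<inter> pr (insert v' C')) ^^ j"
    "(w, u) \<in> adj_rel (E \<inter> pr (insert v' C'))" by auto
   have wu: "{w, u} \<in> E" "w \<in> insert v' C'" using w(2) unfolding adj_rel_pr by auto
   have "w \<in> C" using Suc.IH[OF _ w(1)] wu v'C by auto
   from St_stay[OF S(1) this _ wu(1)] Suc.prems(1) St_vC(2)[OF S(2)] False show ?case by auto
  qed
  define A A' where "A = adj_rel (E \<inter> pr (insert v C))" and "A' = adj_rel (E \<inter> pr (insert v' C'))"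
  \<comment> \<open>A walk from \<open>v\<close> can enter the branch at \<open>v'\<close> only
    through \<open>v'\<close>, because \<open>C'\<close> has no other contact with the outside;
    hence the strict gain in length.\<close>
  have longer: "(v, u) \<in> A ^^ j ==> u \<in> insert v' C' ==> \<exists>i<j. (v', u) \<in> A' ^^ i" for u j
  proof (induction j arbitrary: u)
   case 0 thus ?case using vD' by auto
  next
   case (Suc j)
   from Suc.prems obtain w where w: "(v, w) \<in> A ^^ j" "(w, u) \<in> A" by auto
   have wu: "{w, u} \<in> E" "w \<in> insert v C" "w \<noteq> u" using w(2) unfolding A_def adj_rel_pr by auto
   show ?case
   proof (cases "w \<in> insert v' C'")
    case True
    from Suc.IH[OF w(1) this] obtain i where i: "i < j" "(v', w) \<in> A' ^^ i" by blast
    have "(w, u) \<in> A'" unfolding A'_def adj_rel_pr using True Suc.prems(2) wu by auto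
    with i(2) have "(v', u) \<in> A' ^^ Suc i" by auto
    with i(1) show ?thesis by (intro exI[of _ "Suc i"]) simp
   next
    case False
    have "u \<notin> C'"
    proof
     assume "u \<in> C'"
     moreover have "w \<in> V" using wu(2) St_vC(2,3)[OF S(1)] by auto
     ultimately have "w \<in> insert v' C'" using St_stay[OF S(2), of u w] wu(1) by (simp add: insert_commute)
     with False show False by simp
    qed
    with Suc.prems(2) have "u = v'" by simp
    thus ?thesis by (intro exI[of _ 0]) simp
   qed
  qed
  obtain x where x: "x \<in> insert v' C'" "(v', x) \<in> A' ^^ k" "\<forall>j<k. (v', x) \<notin> A' ^^ j"
   using Sh_top[OF St_vC(4)[OF S(2)] St_vC(1)[OF S(2)]] unfolding A'_def by blast
  have "x \<in> C"
  proof (cases "x = v'")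
   case True thus ?thesis using v'C by simp
  next
   case False
   with x(1) have "x \<in> C'" by simp
   with sub[OF this] x(2) show ?thesis unfolding A'_def by blast
  qed
  from Sh_reach[OF St_vC(4)[OF S(1)] St_vC(1)[OF S(1)] this] obtain j where j: "j <= k" "(v, x) \<in> A ^^ j"
   unfolding A_def by blast
  from longer[OF j(2) x(1)] j(1) x(3) show False by (meson order_less_le_trans)
 qed
qed

text \<open>Neither end lies in the branches of the other by \<open>end_not_inside\<close>. Walking
  back towards \<open>v\<close> from a common vertex of \<open>C\<close> and \<open>C'\<close>
  therefore never leaves either set, and so never arrives.\<close>

lemma end_disjoint:
 assumes e: "is_end k M J E V v C N" "is_end k M J E V v' C' N'" and V: "finite V" and ne: "v \<noteq> v'"
 shows "insert v C \<inter> insert v' C' = {}" "N \<inter> C' = {}"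
proof -
 have S: "St k E V v C N" "St k E V v' C' N'" using e by (auto simp: is_end_def)
 have n1: "v' \<notin> C" by (rule end_not_inside[OF e V ne])
 have n2: "v \<notin> C'" by (rule end_not_inside[OF e(2,1) V]) (use ne in simp)
 have "(v, u) \<in> adj_rel (E \<inter> pr (insert v C)) ^^ j ==> u \<in> C ==> u \<notin> C'" for u j
 proof (induction j arbitrary: u)
  case 0 thus ?case using St_vC(1)[OF S(1)] by simp
 next
  case (Suc j)
  from Suc.prems obtain w where w: "(v, w) \<in> adj_rel (E \<inter> pr (insert v C)) ^^ j"
   "(w, u) \<in> adj_rel (E \<inter> pr (insert v C))" by auto
  have wu: "{w, u} \<in> E" "w \<in> insert v C" using w(2) unfolding adj_rel_pr by auto
  have wV: "w \<in> V" using wu(2) St_vC(2,3)[OF S(1)] by auto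
  show ?case
  proof
   assume "u \<in> C'"
   from St_stay[OF S(2) this wV] wu(1) have "w \<in> insert v' C'" by (simp add: insert_commute)
   with wu(2) n1 n2 ne have "w \<in> C" "w \<in> C'" by auto
   with Suc.IH[OF w(1)] show False by simp
  qed
 qed
 with Sh_reach[OF St_vC(4)[OF S(1)] St_vC(1)[OF S(1)]] have "C \<inter> C' = {}" by blast
 with n1 n2 ne show "insert v C \<inter> insert v' C' = {}" by auto
 show "N \<inter> C' = {}"
 proof (rule ccontr)
  assume "N \<inter> C' \<noteq> {}"
  then obtain u where u: "u \<in> N" "u \<in> C'" by blast
  hence "{u, v} \<in> E" using St_nbr[OF S(1), of u] by simp
  from St_stay[OF S(2) u(2) St_vC(3)[OF S(1)] this] n2 ne show False by simp
 qed
qed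

lemma Sh_Int_pr: "insert v C \<subseteq> W ==> v \<notin> C ==> Sh k (E \<inter> pr W) v C = Sh k E v C"
 unfolding Sh_def by (subst (1 2) lev_Int_pr) auto

lemma St_Int_pr: "St k (E \<inter> pr W) W v C N = St k E W v C N"
proof (cases "v \<in> W \<and> C \<subseteq> W - {v}")
 case True
 hence "Sh k (E \<inter> pr W) v C = Sh k E v C" by (intro Sh_Int_pr) auto
 moreover have "nb (E \<inter> pr W) C (W - insert v C) = nb E C (W - insert v C)"
  using True by (intro nb_Int_pr) auto
 moreover have "nb (E \<inter> pr W) {v} (W - insert v C) = nb E {v} (W - insert v C)"
  using True by (intro nb_Int_pr) auto
 ultimately show ?thesis by (simp add: St_def)
qed (auto simp: St_def)

section \<open>Probabilities of branch structures\<close>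

definition gsh :: "nat => real => 'a => 'a set => real" where
 "gsh k p v C = PE (pr (insert v C)) p (\<lambda>E. Sh k E v C)"

lemma gsh_nonneg: "0 <= p ==> p <= 1 ==> 0 <= gsh k p v C"
 unfolding gsh_def by (intro Ex_nonneg) auto

lemma cr_Un: "cr (A \<union> B) U = cr A U \<union> cr B U"
 by (auto simp: cr_def)

lemma cr_disjoint: "A \<inter> B = {} ==> (A \<union> B) \<inter> U = {} ==> cr A U \<inter> cr B U = {}"
 by (auto simp: cr_def doubleton_eq_iff)

text \<open>The pairs inside \<open>W\<close> fall into four independent blocks: inside
  \<open>insert v C\<close>, between \<open>C\<close> and \<open>U\<close>, between \<open>v\<close>
  and \<open>U\<close>, and inside \<open>U\<close>. The branch condition uses only the first two,
  so the neighbours of \<open>v\<close> and the graph on \<open>U\<close> stay fresh.\<close>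

lemma peel_end:
 assumes W: "finite W" "v \<in> W" "C \<subseteq> W - {v}"
 defines "U \<equiv> W - insert v C"
 shows "Ex (pr W) p (\<lambda>E. of_bool (Sh k E v C \<and> nb E C U = {})*F (nb E {v} U) (E \<inter> pr U))
  = gsh k p v C*(1 - p)^(card C*card U)*Ex U p (\<lambda>N. Ex (pr U) p (F N))"
proof -
 let ?D = "insert v C"
 have C: "finite C" "v \<notin> C" using W finite_subset by auto
 have fU: "finite U" "finite ?D" "?D \<inter> U = {}" using W C by (auto simp: U_def)
 have WD: "W = ?D \<union> U" using W by (auto simp: U_def)
 have crD: "cr ?D U = cr C U \<union> cr {v} U" using cr_Un[of C "{v}" U] by simp
 have dcr: "cr C U \<inter> cr {v} U = {}"
  using fU C by (intro cr_disjoint) auto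
 have dd: "pr ?D \<inter> (cr ?D U \<union> pr U) = {}" "cr ?D U \<inter> pr U = {}"
  using pr_cr_disjoint[OF fU(3)] by auto
 have prW: "pr W = pr ?D \<union> (cr C U \<union> (cr {v} U \<union> pr U))"
  unfolding WD pr_Un[OF fU(3)] crD by auto
 have d1: "pr ?D \<inter> (cr C U \<union> (cr {v} U \<union> pr U)) = {}" "cr C U \<inter> (cr {v} U \<union> pr U) = {}" "cr {v} U \<inter> pr U = {}"
  using dd dcr unfolding crD by auto
 have fin: "finite (pr ?D)" "finite (cr C U)" "finite (cr {v} U)" "finite (pr U)"
  using fU C by auto
 have val: "Sh k (X \<union> (Y \<union> (Z \<union> E'))) v C = Sh k X v C"
   "nb (X \<union> (Y \<union> (Z \<union> E'))) C U = nb Y C U"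
   "nb (X \<union> (Y \<union> (Z \<union> E'))) {v} U = nb Z {v} U"
   "(X \<union> (Y \<union> (Z \<union> E'))) \<inter> pr U = E'"
  if s: "X \<subseteq> pr ?D" "Y \<subseteq> cr C U" "Z \<subseteq> cr {v} U" "E' \<subseteq> pr U" for X Y Z E'
 proof -
  let ?E = "X \<union> (Y \<union> (Z \<union> E'))"
  have "?E \<inter> pr ?D = X" using s d1 by blast
  thus "Sh k ?E v C = Sh k X v C" using Sh_Int_pr[of v C ?D k ?E] C by simp
  have "?E \<inter> cr C U = Y" using s d1 by blast
  thus "nb ?E C U = nb Y C U" using nb_cr_Int[of C U ?E] fU(3) by (metis Int_insert_left_if0 insert_disjoint(1))
  have "?E \<inter> cr {v} U = Z" using s d1 by blast
  thus "nb ?E {v} U = nb Z {v} U" using nb_cr_Int[of "{v}" U ?E] fU(3) by (metis Int_insert_left_if0 inf_bot_left insert_disjoint(1))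
  show "?E \<inter> pr U = E'" using s d1 by blast
 qed
 let ?f = "\<lambda>E. of_bool (Sh k E v C \<and> nb E C U = {})*F (nb E {v} U) (E \<inter> pr U)"
 have "Ex (pr W) p ?f = Ex (pr ?D) p (\<lambda>X. Ex (cr C U) p (\<lambda>Y. Ex (cr {v} U) p (\<lambda>Z. Ex (pr U) p (\<lambda>E'. ?f (X \<union> (Y \<union> (Z \<union> E')))))))"
  unfolding prW using fin d1 by (simp only: Ex_union finite_UnI)
 also have "... = Ex (pr ?D) p (\<lambda>X. Ex (cr C U) p (\<lambda>Y. Ex (cr {v} U) p (\<lambda>Z. Ex (pr U) p (\<lambda>E'.
   of_bool (Sh k X v C)*(of_bool (nb Y C U = {})*F (nb Z {v} U) E')))))"
  by (intro Ex_cong) (simp add: val)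
 also have "... = gsh k p v C*(PE (cr C U) p (\<lambda>Y. nb Y C U = {})*Ex (cr {v} U) p (\<lambda>Z. Ex (pr U) p (F (nb Z {v} U))))"
  unfolding Ex_cmult Ex_multc gsh_def ..
 also have "PE (cr C U) p (\<lambda>Y. nb Y C U = {}) = (1 - p)^(card C*card U)"
 proof -
  have "PE (cr C U) p (\<lambda>Y. nb Y C U = {}) = PE U (1 - (1 - p)^card C) (\<lambda>S. S = {})"
   using C fU by (intro nb_dist) auto
  also have "... = PE U (1 - (1 - p)^card C) (\<lambda>S. S \<inter> U = {})"
   by (rule Ex_cong) (simp add: Int_absorb2)
  also have "... = (1 - p)^(card C*card U)"
   using Ex_disjoint[OF fU(1), of U] by (simp add: power_mult)
  finally show ?thesis .
 qed
 also have "Ex (cr {v} U) p (\<lambda>Z. Ex (pr U) p (F (nb Z {v} U))) = Ex U p (\<lambda>N. Ex (pr U) p (F N))"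
  using nb_dist[of "{v}" U p "\<lambda>N. Ex (pr U) p (F N)"] fU by simp
 finally show ?thesis by (simp add: mult.assoc)
qed

text \<open>The expected number of admissible branch sets at \<open>v\<close> in \<open>W\<close>,
  with no condition on the further neighbours of \<open>v\<close>. Several sets \<open>C\<close> may
  satisfy \<open>St\<close> at once, so this is an expectation and not a probability.\<close>

definition sig :: "nat => nat => real => 'a set => 'a => real" where
 "sig k M p W v = (\<Sum>C\<in>{C. C \<subseteq> W - {v} \<and> card C <= M}. gsh k p v C*(1 - p)^(card C*card (W - insert v C)))"

definition tau :: "real => nat => 'a set => real" where
 "tau p J U = PE U p (\<lambda>N. card N <= J)"

lemma sig_nonneg: "0 <= p ==> p <= 1 ==> 0 <= sig k M p W v"
 unfolding sig_def by (intro sum_nonneg mult_nonneg_nonneg gsh_nonneg) auto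

lemma tau_nonneg: "0 <= p ==> p <= 1 ==> 0 <= tau p J W"
 unfolding tau_def by (intro Ex_nonneg) auto

abbreviation has_branch :: "nat => nat => 'a set => 'a => ('a set => 'a set => 'a set set => bool) => 'a set set => bool" where
 "has_branch k M W v R E \<equiv> \<exists>C. C \<subseteq> W - {v} \<and> card C <= M \<and> Sh k E v C \<and> nb E C (W - insert v C) = {}
    \<and> R C (nb E {v} (W - insert v C)) (E \<inter> pr (W - insert v C))"

lemma Ex_St_le:
 assumes W: "finite W" "v \<in> W" and p: "0 <= p" "p <= 1"
  and B: "\<And>C. C \<subseteq> W - {v} ==> card C <= M ==>
   Ex (W - insert v C) p (\<lambda>N. PE (pr (W - insert v C)) p (\<lambda>E. R C N E)) <= B"
 shows "PE (pr W) p (\<lambda>E. has_branch k M W v R E)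
   <= sig k M p W v * B"
proof -
 let ?I = "{C. C \<subseteq> W - {v} \<and> card C <= M}"
 have fin: "finite ?I" by (rule finite_subset[of _ "Pow W"]) (use W in auto)
 have "PE (pr W) p (\<lambda>E. has_branch k M W v R E)
   = PE (pr W) p (\<lambda>E. \<exists>C\<in>?I. Sh k E v C \<and> nb E C (W - insert v C) = {}
    \<and> R C (nb E {v} (W - insert v C)) (E \<inter> pr (W - insert v C)))"
  by (rule Ex_cong) (rule arg_cong[of _ _ of_bool], auto)
 also have "... <= (\<Sum>C\<in>?I. PE (pr W) p (\<lambda>E. Sh k E v C \<and> nb E C (W - insert v C) = {}
    \<and> R C (nb E {v} (W - insert v C)) (E \<inter> pr (W - insert v C))))"
  by (rule Ex_Bex_le[OF fin p])
 also have "... <= (\<Sum>C\<in>?I. gsh k p v C*(1 - p)^(card C*card (W - insert v C))*B)"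
 proof (rule sum_mono)
  fix C assume C: "C \<in> ?I"
  have "PE (pr W) p (\<lambda>E. Sh k E v C \<and> nb E C (W - insert v C) = {}
    \<and> R C (nb E {v} (W - insert v C)) (E \<inter> pr (W - insert v C)))
   = Ex (pr W) p (\<lambda>E. of_bool (Sh k E v C \<and> nb E C (W - insert v C) = {})
    * of_bool (R C (nb E {v} (W - insert v C)) (E \<inter> pr (W - insert v C))))"
   by (rule Ex_cong) (auto simp: of_bool_def)
  also have "... = gsh k p v C*(1 - p)^(card C*card (W - insert v C)) *
    Ex (W - insert v C) p (\<lambda>N. PE (pr (W - insert v C)) p (\<lambda>E. R C N E))"
   by (rule peel_end) (use W C in auto)
  also have "... <= gsh k p v C*(1 - p)^(card C*card (W - insert v C))*B"
   using C p by (intro mult_left_mono B mult_nonneg_nonneg gsh_nonneg) auto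
  finally show "PE (pr W) p (\<lambda>E. Sh k E v C \<and> nb E C (W - insert v C) = {}
    \<and> R C (nb E {v} (W - insert v C)) (E \<inter> pr (W - insert v C)))
   <= gsh k p v C*(1 - p)^(card C*card (W - insert v C))*B" .
 qed
 also have "... = sig k M p W v * B" by (simp add: sig_def sum_distrib_right)
 finally show ?thesis .
qed

text \<open>To return from \<open>U\<close> to \<open>V\<close>, demand in addition that there are
  no neighbours in \<open>V - U\<close>, at a cost of \<open>(1 - p) ^ card (V - U)\<close>. The
  other inequality is monotonicity.\<close>

lemma tau_sub:
 assumes "finite V" "U \<subseteq> V" "0 <= p" "p < 1"
 shows "PE U p (\<lambda>N. card N <= J) <= tau p J V/(1 - p)^card (V - U)"
  and "tau p J V <= PE U p (\<lambda>N. card N <= J)"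
proof -
 have fU: "finite U" using assms finite_subset by auto
 have V: "V = U \<union> (V - U)" using assms by auto
 have split: "tau p J V = Ex U p (\<lambda>X. PE (V - U) p (\<lambda>Y. card (X \<union> Y) <= J))"
  unfolding tau_def by (subst V, rule Ex_union) (use assms fU in auto)
 have "PE U p (\<lambda>N. card N <= J)*(1 - p)^card (V - U)
   = Ex U p (\<lambda>X. Ex (V - U) p (\<lambda>Y. of_bool (card X <= J) * of_bool (Y \<inter> (V - U) = {})))"
  using assms by (simp add: Ex_cmult Ex_disjoint Ex_multc)
 also have "... <= tau p J V"
  unfolding split using assms
  by (intro Ex_mono) (auto simp: of_bool_def Int_absorb2)
 finally show "PE U p (\<lambda>N. card N <= J) <= tau p J V/(1 - p)^card (V - U)"
  using assms by (simp add: field_simps)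
 have "tau p J V <= Ex U p (\<lambda>X. PE (V - U) p (\<lambda>Y. card X <= J))"
  unfolding split
 proof (intro Ex_mono)
  fix X Y assume "X \<subseteq> U" "Y \<subseteq> V - U"
  hence "card X <= card (X \<union> Y)" using assms(1) fU by (intro card_mono) (auto intro: finite_subset)
  thus "of_bool (card (X \<union> Y) <= J) <= (of_bool (card X <= J) :: real)" by (auto simp: of_bool_def)
 qed (use assms in auto)
 thus "tau p J V <= PE U p (\<lambda>N. card N <= J)" using assms by simp
qed

text \<open>Removing at most \<open>x\<close> vertices drops at most \<open>M * x\<close> forbidden
  pairs for each candidate \<open>C\<close>, and leaves fewer candidates.\<close>

lemma sig_sub:
 assumes "finite V" "W \<subseteq> V" "card (V - W) <= x" "0 <= p" "p < 1"
 shows "sig k M p W v <= sig k M p V v / (1 - p)^(M*x)"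
proof -
 have "sig k M p W v <= (\<Sum>C\<in>{C. C \<subseteq> W - {v} \<and> card C <= M}. gsh k p v C*(1 - p)^(card C*card (V - insert v C))/(1 - p)^(M*x))"
  unfolding sig_def
 proof (rule sum_mono)
  fix C assume C: "C \<in> {C. C \<subseteq> W - {v} \<and> card C <= M}"
  have "card (V - insert v C) <= card ((W - insert v C) \<union> (V - W))"
   using assms finite_subset[of W V] by (intro card_mono) auto
  also have "... <= card (W - insert v C) + x" using card_Un_le[of "W - insert v C" "V - W"] assms(3) by linarith
  finally have "card C*card (V - insert v C) <= card C*card (W - insert v C) + card C*x"
   by (metis add_mult_distrib2 mult_le_mono2)
  also have "card C*x <= M*x" using C by simp
  finally have "(1 - p)^(card C*card (W - insert v C) + M*x) <= (1 - p)^(card C*card (V - insert v C))"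
   using assms by (intro power_decreasing) auto
  hence "(1 - p)^(card C*card (W - insert v C)) <= (1 - p)^(card C*card (V - insert v C))/(1 - p)^(M*x)"
   using assms by (simp add: power_add field_simps)
  thus "gsh k p v C*(1 - p)^(card C*card (W - insert v C))
   <= gsh k p v C*(1 - p)^(card C*card (V - insert v C))/(1 - p)^(M*x)"
   using mult_left_mono[OF _ gsh_nonneg[of p k v C]] assms by fastforce
 qed
 also have "... <= (\<Sum>C\<in>{C. C \<subseteq> V - {v} \<and> card C <= M}. gsh k p v C*(1 - p)^(card C*card (V - insert v C))/(1 - p)^(M*x))"
 proof (rule sum_mono2)
  show "finite {C. C \<subseteq> V - {v} \<and> card C <= M}" by (rule finite_subset[of _ "Pow V"]) (use assms in auto)
 qed (use assms in \<open>auto intro!: divide_nonneg_nonneg mult_nonneg_nonneg gsh_nonneg\<close>)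
 also have "... = sig k M p V v / (1 - p)^(M*x)"
  by (simp add: sig_def sum_divide_distrib)
 finally show ?thesis .
qed

text \<open>The ends of a list are removed one after the other, each together with its branches. \<open>tupB\<close> also
 collects their neighbour sets and stops doing so (\<open>tup0\<close>) at the first overlap.\<close>

fun tup0 :: "nat => nat => nat => 'a set set => 'a set => 'a list => bool" where
 "tup0 k M J E W [] \<longleftrightarrow> True"
| "tup0 k M J E W (v # vs) \<longleftrightarrow> (\<exists>C N. St k E W v C N \<and> card C <= M \<and> card N <= J \<and> C \<inter> set vs = {}
   \<and> tup0 k M J E (W - insert v C) vs)"

fun tupB :: "nat => nat => nat => ('a set list => 'a set => 'a set set => bool) => 'a set set => 'a set
  => 'a list => 'a set list => bool" where
 "tupB k M J Bad E W [] acc \<longleftrightarrow> Bad acc W (E \<inter> pr W)"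
| "tupB k M J Bad E W (v # vs) acc \<longleftrightarrow> (\<exists>C N. St k E W v C N \<and> card C <= M \<and> card N <= J
   \<and> C \<inter> (set vs \<union> \<Union>(set acc)) = {}
   \<and> (if N \<inter> (set vs \<union> \<Union>(set acc)) = {} then N \<noteq> {} \<and> tupB k M J Bad E (W - insert v C) vs (acc @ [N])
    else tup0 k M J E (W - insert v C) vs))"

text \<open>The denominator pays for the edges to the at most \<open>x\<close> vertices removed before \<open>v\<close>.\<close>

definition swt :: "nat => nat => nat => nat => real => 'a set => 'a => real" where
 "swt k M J x p V v = sig k M p V v * tau p J V/(1 - p)^(Suc M*x)"

lemma swt_nonneg: "0 <= p ==> p < 1 ==> 0 <= swt k M J x p V v"
 unfolding swt_def by (intro divide_nonneg_nonneg mult_nonneg_nonneg sig_nonneg tau_nonneg) auto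

lemma swt_prod_nonneg: "0 <= p ==> p < 1 ==> 0 <= prod_list (map (swt k M J x p V) vs)"
 by (induction vs) (auto simp: swt_nonneg)

lemma tup0_Int_pr: "tup0 k M J (E \<inter> pr W) W vs = tup0 k M J E W vs"
proof (induction vs arbitrary: E W)
 case (Cons v vs)
 have "tup0 k M J (E \<inter> pr W) (W - insert v C) vs = tup0 k M J E (W - insert v C) vs" for C
 proof -
  have "tup0 k M J (E \<inter> pr W) (W - insert v C) vs
    = tup0 k M J (E \<inter> pr W \<inter> pr (W - insert v C)) (W - insert v C) vs"
   by (rule Cons.IH[symmetric])
  also have "E \<inter> pr W \<inter> pr (W - insert v C) = E \<inter> pr (W - insert v C)"
   using pr_mono[of "W - insert v C" W] by blast
  also have "tup0 k M J (E \<inter> pr (W - insert v C)) (W - insert v C) vs = tup0 k M J E (W - insert v C) vs"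
   by (rule Cons.IH)
  finally show ?thesis .
 qed
 thus ?case by (simp only: tup0.simps St_Int_pr)
qed simp

lemma tupB_Int_pr: "tupB k M J Bad (E \<inter> pr W) W vs acc = tupB k M J Bad E W vs acc"
proof (induction vs arbitrary: E W acc)
 case Nil thus ?case by (simp add: Int_assoc)
next
 case (Cons v vs)
 have e: "E \<inter> pr W \<inter> pr (W - insert v C) = E \<inter> pr (W - insert v C)" for C
  using pr_mono[of "W - insert v C" W] by blast
 have "tupB k M J Bad (E \<inter> pr W) (W - insert v C) vs acc = tupB k M J Bad E (W - insert v C) vs acc" for C acc
  using Cons.IH[of "E \<inter> pr W" "W - insert v C" acc, unfolded e] Cons.IH[of E "W - insert v C" acc] by (rule trans[OF sym])
 moreover have "tup0 k M J (E \<inter> pr W) (W - insert v C) vs = tup0 k M J E (W - insert v C) vs" for C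
  using tup0_Int_pr[of k M J "E \<inter> pr W" "W - insert v C" vs, unfolded e] tup0_Int_pr[of k M J E "W - insert v C" vs]
  by (rule trans[OF sym])
 ultimately show ?case by (simp only: tupB.simps St_Int_pr)
qed

lemma card_Diff_step:
 assumes "finite V" "W \<subseteq> V" "C \<subseteq> W" "card C <= M"
 shows "card (V - (W - insert v C)) <= card (V - W) + Suc M"
proof -
 have C: "finite C" using assms by (meson finite_subset)
 have "card (V - (W - insert v C)) <= card ((V - W) \<union> insert v C)"
  using assms C by (intro card_mono) auto
 also have "... <= card (V - W) + card (insert v C)" by (rule card_Un_le)
 also have "card (insert v C) <= Suc M" using assms(4) C by (simp add: card_insert_if)
 finally show ?thesis by simp
qed

lemma Ex_of_bool_conj: "PE A q (\<lambda>X. b \<and> P X) = of_bool b*PE A q (\<lambda>X. P X)"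
 by (cases b) (auto simp: Ex_def)

lemma of_bool_le: "(P ==> Q) ==> of_bool P <= (of_bool Q :: real)"
 by (auto simp: of_bool_def)

text \<open>Each removal takes away at most \<open>M + 1\<close> vertices, so the ambient set always
  misses at most \<open>x\<close> vertices of \<open>V\<close>, and \<open>swt\<close> already
  contains the price of comparing such a set with \<open>V\<close>.\<close>

lemma tup0_bound:
 assumes V: "finite V" and p: "0 <= p" "p < 1"
  and "W \<subseteq> V" "distinct vs" "set vs \<subseteq> W" "card (V - W) + length vs * Suc M + 1 <= x"
 shows "PE (pr W) p (\<lambda>E. tup0 k M J E W vs) <= prod_list (map (swt k M J x p V) vs)"
 using assms(4-7)
proof (induction vs arbitrary: W)
 case Nil
 have "finite W" using Nil(1) V finite_subset by auto
 thus ?case by simp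
next
 case (Cons v vs)
 let ?P = "prod_list (map (swt k M J x p V) vs)"
 let ?B = "tau p J V/(1 - p)^x*?P"
 have fW: "finite W" using Cons.prems(1) V finite_subset by auto
 have p1: "p <= 1" using p by simp
 have P0: "0 <= ?P" by (rule swt_prod_nonneg[OF p])
 define R where "R C N E \<longleftrightarrow> card N <= J \<and> set vs \<subseteq> W - insert v C \<and> tup0 k M J E (W - insert v C) vs"
  for C and N :: "'a set" and E
 have "PE (pr W) p (\<lambda>E. tup0 k M J E W (v # vs))
  <= PE (pr W) p (\<lambda>E. has_branch k M W v R E)"
 proof (rule Ex_mono[OF p(1) p1])
  fix E
  have "has_branch k M W v R E" if t: "tup0 k M J E W (v # vs)"
  proof -
   from t obtain C N where C: "St k E W v C N" "card C <= M" "card N <= J" "C \<inter> set vs = {}"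
    "tup0 k M J E (W - insert v C) vs" unfolding tup0.simps by blast
   have "set vs \<subseteq> W - insert v C" using C(4) Cons.prems(2,3) by auto
   with C have "R C (nb E {v} (W - insert v C)) (E \<inter> pr (W - insert v C))"
    unfolding R_def tup0_Int_pr by (simp add: St_def)
   with C show ?thesis unfolding St_def by blast
  qed
  thus "of_bool (tup0 k M J E W (v # vs)) <= (of_bool (has_branch k M W v R E) :: real)"
   by (auto simp: of_bool_def)
 qed
 also have "... <= sig k M p W v * ?B"
 proof (rule Ex_St_le[OF fW _ p(1) p1])
  show "v \<in> W" using Cons.prems by simp
  fix C assume C: "C \<subseteq> W - {v}" "card C <= M"
  let ?U = "W - insert v C"
  have cU: "card (V - ?U) <= card (V - W) + Suc M" using C by (intro card_Diff_step V Cons.prems(1)) auto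
  have "Ex ?U p (\<lambda>N. PE (pr ?U) p (\<lambda>E. R C N E))
    = Ex ?U p (\<lambda>N. of_bool (card N <= J)*(of_bool (set vs \<subseteq> ?U)*PE (pr ?U) p (\<lambda>E. tup0 k M J E ?U vs)))"
   unfolding R_def Ex_of_bool_conj ..
  also have "... = PE ?U p (\<lambda>N. card N <= J)*(of_bool (set vs \<subseteq> ?U)*PE (pr ?U) p (\<lambda>E. tup0 k M J E ?U vs))"
   by (rule Ex_multc)
  also have "... <= tau p J V/(1 - p)^x*?P"
  proof (rule mult_mono)
   have "PE ?U p (\<lambda>N. card N <= J) <= tau p J V/(1 - p)^card (V - ?U)"
    by (rule tau_sub[OF V _ p]) (use Cons.prems in auto)
   also have "... <= tau p J V/(1 - p)^x"
    using cU Cons.prems(4) p tau_nonneg[of p J V] by (intro divide_left_mono power_decreasing) auto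
   finally show "PE ?U p (\<lambda>N. card N <= J) <= tau p J V/(1 - p)^x" .
   show "of_bool (set vs \<subseteq> ?U)*PE (pr ?U) p (\<lambda>E. tup0 k M J E ?U vs) <= ?P"
   proof (cases "set vs \<subseteq> ?U")
    case True
    have "PE (pr ?U) p (\<lambda>E. tup0 k M J E ?U vs) <= ?P"
     by (rule Cons.IH) (use Cons.prems True cU in auto)
    with True show ?thesis by simp
   qed (use P0 in auto)
   show "0 <= of_bool (set vs \<subseteq> ?U)*PE (pr ?U) p (\<lambda>E. tup0 k M J E ?U vs)"
    using p by (intro mult_nonneg_nonneg Ex_nonneg) auto
   show "0 <= tau p J V/(1 - p)^x" using p tau_nonneg[of p J V] by simp
  qed
  finally show "Ex ?U p (\<lambda>N. PE (pr ?U) p (\<lambda>E. R C N E)) <= ?B" .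
 qed
 also have "... <= sig k M p V v / (1 - p)^(M*x)*?B"
  using Cons.prems p P0 tau_nonneg[of p J V] by (intro mult_right_mono sig_sub[OF V _ _ p]) auto
 also have "... = prod_list (map (swt k M J x p V) (v # vs))"
  by (simp add: swt_def power_add mult_ac)
 finally show ?case .
qed

definition acc_ok :: "nat => 'a set list => 'a set => bool" where
 "acc_ok J acc W \<longleftrightarrow> (\<forall>N\<in>set acc. N \<subseteq> W \<and> N \<noteq> {} \<and> card N <= J) \<and>
   (\<forall>i<length acc. \<forall>j<i. acc ! i \<inter> acc ! j = {})"

text \<open>The graph on the vertices left at the end has not been examined, so there the bad event
  has conditional probability at most \<open>e\<close>. The extra term pays for overlaps: each of
  the at most \<open>L * Suc J\<close> later ends and collected neighbours is hit by a new
  \<open>N\<close> at a cost of a factor \<open>p\<close>.\<close>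

lemma tupB_bound:
 assumes V: "finite V" and p: "0 <= p" "p < 1" and c0: "0 <= e"
  and Bad: "\<And>acc W. acc_ok J acc W ==> W \<subseteq> V ==> card (V - W) <= x ==> length acc = L
    ==> PE (pr W) p (\<lambda>E. Bad acc W E) <= e"
  and "W \<subseteq> V" "distinct vs" "set vs \<subseteq> W" "card (V - W) + length vs * Suc M + 1 <= x"
  and "acc_ok J acc W" "\<Union>(set acc) \<inter> set vs = {}" "length acc + length vs = L"
 shows "PE (pr W) p (\<lambda>E. tupB k M J Bad E W vs acc)
   <= prod_list (map (swt k M J x p V) vs)*(e + real (length vs)*(real (L * Suc J)*p))"
 using assms(6-12)
proof (induction vs arbitrary: W acc)
 case Nil
 have "PE (pr W) p (\<lambda>E. tupB k M J Bad E W [] acc) = PE (pr W) p (\<lambda>E. Bad acc W E)"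
  by (rule Ex_cong) (simp add: Int_absorb2)
 with Bad[OF Nil(5,1)] Nil show ?case by simp
next
 case (Cons v vs)
 let ?P = "prod_list (map (swt k M J x p V) vs)"
 let ?t = "tau p J V/(1 - p)^x"
 let ?c = "real (L * Suc J)*p"
 let ?eb = "e + real (length vs)*?c"
 let ?Q = "set vs \<union> \<Union>(set acc)"
 have fW: "finite W" using Cons.prems(1) V finite_subset by auto
 have p1: "p <= 1" using p by simp
 have P0: "0 <= ?P" by (rule swt_prod_nonneg[OF p])
 have eb0: "0 <= ?eb" "0 <= ?c" using c0 p by auto
 have t0: "0 <= ?t" using p tau_nonneg[of p J V] by simp
 have QW: "?Q \<subseteq> W" using Cons.prems(3,5) by (auto simp: acc_ok_def)
 have cQ: "card ?Q <= L * Suc J"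
 proof -
  have "card (\<Union>(set acc)) <= (\<Sum>N\<in>set acc. card N)" by (rule card_Union_le_sum_card)
  also have "... <= (\<Sum>N\<in>set acc. J)" using Cons.prems(5) by (intro sum_mono) (auto simp: acc_ok_def)
  also have "... <= length acc*J" using card_length[of acc] by simp
  finally have "card ?Q <= length vs + length acc*J"
   using card_Un_le[of "set vs" "\<Union>(set acc)"] card_length[of vs] by linarith
  also have "... <= L + L*J" using Cons.prems(7) by (intro add_mono mult_right_mono) auto
  finally show ?thesis by simp
 qed
 define R where "R C N E \<longleftrightarrow> card N <= J \<and> C \<inter> ?Q = {} \<and>
   (if N \<inter> ?Q = {} then N \<noteq> {} \<and> tupB k M J Bad E (W - insert v C) vs (acc @ [N])
   else tup0 k M J E (W - insert v C) vs)" for C and N :: "'a set" and E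
 have e: "e + real (length (v # vs))*?c = ?eb + ?c" by (simp add: algebra_simps)
 have "PE (pr W) p (\<lambda>E. tupB k M J Bad E W (v # vs) acc)
  <= PE (pr W) p (\<lambda>E. has_branch k M W v R E)"
 proof (rule Ex_mono[OF p(1) p1])
  fix E
  have "has_branch k M W v R E" if t: "tupB k M J Bad E W (v # vs) acc"
  proof -
   from t obtain C N where C: "St k E W v C N" "card C <= M" "card N <= J" "C \<inter> ?Q = {}"
    "if N \<inter> ?Q = {} then N \<noteq> {} \<and> tupB k M J Bad E (W - insert v C) vs (acc @ [N])
    else tup0 k M J E (W - insert v C) vs" unfolding tupB.simps by blast
   have N: "nb E {v} (W - insert v C) = N" using C(1) by (simp add: St_def)
   have "R C (nb E {v} (W - insert v C)) (E \<inter> pr (W - insert v C))"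
    unfolding R_def tup0_Int_pr tupB_Int_pr N using C(3,4,5) by simp
   with C show ?thesis unfolding St_def by blast
  qed
  thus "of_bool (tupB k M J Bad E W (v # vs) acc) <= (of_bool (has_branch k M W v R E) :: real)"
   by (rule of_bool_le)
 qed
 also have "... <= sig k M p W v * (?t*(?P*(?eb + ?c)))"
 proof (rule Ex_St_le[OF fW _ p(1) p1])
  show "v \<in> W" using Cons.prems by simp
  fix C assume C: "C \<subseteq> W - {v}" "card C <= M"
  let ?U = "W - insert v C"
  have fU: "finite ?U" using fW by auto
  have cU: "card (V - ?U) <= card (V - W) + Suc M" using C by (intro card_Diff_step V Cons.prems(1)) auto
  show "Ex ?U p (\<lambda>N. PE (pr ?U) p (\<lambda>E. R C N E)) <= ?t*(?P*(?eb + ?c))"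
  proof (cases "C \<inter> ?Q = {}")
   case False
   hence "R C N E = False" for N E by (simp only: R_def) simp
   hence "Ex ?U p (\<lambda>N. PE (pr ?U) p (\<lambda>E. R C N E)) = 0" using fU by simp
   also have "0 <= ?t*(?P*(?eb + ?c))" using t0 P0 eb0 by (intro mult_nonneg_nonneg) auto
   finally show ?thesis .
  next
   case True
   have QU: "?Q \<subseteq> ?U" using True QW Cons.prems(2,6) by auto
   have "Ex ?U p (\<lambda>N. PE (pr ?U) p (\<lambda>E. R C N E))
    <= Ex ?U p (\<lambda>N. of_bool (card N <= J)*(?P*?eb) + (\<Sum>u\<in>?Q. of_bool (u \<in> N \<and> card N <= J))*?P)"
   proof (rule Ex_mono[OF p(1) p1])
    fix N assume N: "N \<subseteq> ?U"
    have s0: "0 <= (\<Sum>u\<in>?Q. of_bool (u \<in> N \<and> card N <= J) :: real)" by (intro sum_nonneg) auto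
    have rhs0: "0 <= of_bool (card N <= J)*(?P*?eb) + (\<Sum>u\<in>?Q. of_bool (u \<in> N \<and> card N <= J))*?P"
     by (intro add_nonneg_nonneg mult_nonneg_nonneg s0 P0 eb0(1)) simp
    show "PE (pr ?U) p (\<lambda>E. R C N E)
      <= of_bool (card N <= J)*(?P*?eb) + (\<Sum>u\<in>?Q. of_bool (u \<in> N \<and> card N <= J))*?P"
    proof (cases "card N <= J")
     case False
     hence "R C N E = False" for E by (simp only: R_def) simp
     hence "PE (pr ?U) p (\<lambda>E. R C N E) = 0" using fU by simp
     with rhs0 show ?thesis by linarith
    next
     case cN: True
     show ?thesis
     proof (cases "N \<inter> ?Q = {}")
      case NQ: True
      show ?thesis
      proof (cases "N = {}")
       case True
       hence "R C N E = False" for E using NQ by (simp only: R_def) simp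
       hence "PE (pr ?U) p (\<lambda>E. R C N E) = 0" using fU by simp
       with rhs0 show ?thesis by linarith
      next
       case False
       have "PE (pr ?U) p (\<lambda>E. R C N E) = PE (pr ?U) p (\<lambda>E. tupB k M J Bad E ?U vs (acc @ [N]))"
        by (rule Ex_cong) (use cN NQ False True in \<open>simp add: R_def\<close>)
       also have "... <= ?P*?eb"
       proof (rule Cons.IH)
        show "acc_ok J (acc @ [N]) ?U"
         using Cons.prems(5) QU N False cN NQ
         unfolding acc_ok_def
         by (auto simp: nth_append less_Suc_eq)
        show "\<Union> (set (acc @ [N])) \<inter> set vs = {}" using Cons.prems(6) NQ by auto
       qed (use Cons.prems QU cU in auto)
       finally have "PE (pr ?U) p (\<lambda>E. R C N E) <= ?P*?eb" .
       moreover have "0 <= (\<Sum>u\<in>?Q. of_bool (u \<in> N \<and> card N <= J))*?P"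
        by (rule mult_nonneg_nonneg[OF s0 P0])
       ultimately show ?thesis using cN by simp
      qed
     next
      case NQ: False
      then obtain u where u: "u \<in> N" "u \<in> ?Q" by blast
      have "PE (pr ?U) p (\<lambda>E. R C N E) = PE (pr ?U) p (\<lambda>E. tup0 k M J E ?U vs)"
       by (rule Ex_cong) (use cN NQ True in \<open>simp add: R_def\<close>)
      also have "... <= ?P"
       by (rule tup0_bound[OF V p]) (use Cons.prems QU cU in auto)
      also have "... <= (\<Sum>u\<in>?Q. of_bool (u \<in> N \<and> card N <= J))*?P"
      proof -
       have "finite ?Q" using QW fW finite_subset by blast
       hence "of_bool (u \<in> N \<and> card N <= J) <= (\<Sum>u\<in>?Q. of_bool (u \<in> N \<and> card N <= J) :: real)"
        using u by (intro member_le_sum) auto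
       hence "1 <= (\<Sum>u\<in>?Q. of_bool (u \<in> N \<and> card N <= J) :: real)" using u cN by simp
       from mult_right_mono[OF this P0] show ?thesis by simp
      qed
      finally have "PE (pr ?U) p (\<lambda>E. R C N E) <= (\<Sum>u\<in>?Q. of_bool (u \<in> N \<and> card N <= J))*?P" .
      moreover have "0 <= of_bool (card N <= J)*(?P*?eb)"
       by (intro mult_nonneg_nonneg P0 eb0(1)) simp
      ultimately show ?thesis by linarith
     qed
    qed
   qed
   also have "... = PE ?U p (\<lambda>N. card N <= J)*(?P*?eb)
     + (\<Sum>u\<in>?Q. PE ?U p (\<lambda>N. u \<in> N \<and> card N <= J))*?P"
    by (simp only: Ex_add Ex_multc Ex_sum)
   also have "... <= ?t*(?P*?eb) + (real (L * Suc J)*(p*?t))*?P"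
   proof (intro add_mono mult_right_mono)
    have tle: "tau p J V/(1 - p)^d <= ?t" if "d <= x" for d
     using that p tau_nonneg[of p J V] by (intro divide_left_mono power_decreasing) auto
    have "PE ?U p (\<lambda>N. card N <= J) <= tau p J V/(1 - p)^card (V - ?U)"
     by (rule tau_sub[OF V _ p]) (use Cons.prems in auto)
    also have "... <= ?t" by (rule tle) (use cU Cons.prems(4) in auto)
    finally show "PE ?U p (\<lambda>N. card N <= J) <= ?t" .
    \<comment> \<open>Once \<open>u\<close> has been put into \<open>N\<close>, at cost
      \<open>p\<close>, the remaining members still number at most \<open>J\<close>, so the usual
      factor survives.\<close>
    have each: "PE ?U p (\<lambda>N. u \<in> N \<and> card N <= J) <= p*?t" if u: "u \<in> ?Q" for u
    proof -
     let ?U' = "?U - {u}"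
     have uU: "?U = insert u ?U'" "u \<notin> ?U'" using u QU by auto
     have "PE ?U p (\<lambda>N. u \<in> N \<and> card N <= J)
       = p*PE ?U' p (\<lambda>N. u \<in> insert u N \<and> card (insert u N) <= J) + (1 - p)*PE ?U' p (\<lambda>N. u \<in> N \<and> card N <= J)"
      by (subst uU(1), rule Ex_insert) (use fU in auto)
     also have "PE ?U' p (\<lambda>N. u \<in> N \<and> card N <= J) = Ex ?U' p (\<lambda>N. 0)"
      by (rule Ex_cong) auto
     finally have eq: "PE ?U p (\<lambda>N. u \<in> N \<and> card N <= J)
       = p*PE ?U' p (\<lambda>N. u \<in> insert u N \<and> card (insert u N) <= J)" using fU by simp
     have "PE ?U' p (\<lambda>N. u \<in> insert u N \<and> card (insert u N) <= J) <= PE ?U' p (\<lambda>N. card N <= J)"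
     proof (rule Ex_mono[OF p(1) p1])
      fix N assume "N \<subseteq> ?U'"
      hence "card N <= card (insert u N)" using fU by (intro card_mono) (auto intro: finite_subset)
      thus "of_bool (u \<in> insert u N \<and> card (insert u N) <= J) <= (of_bool (card N <= J) :: real)"
       by (auto simp: of_bool_def)
     qed
     also have "... <= tau p J V/(1 - p)^card (V - ?U')"
      by (rule tau_sub[OF V _ p]) (use Cons.prems in auto)
     also have "... <= ?t"
     proof (rule tle)
      have "V - ?U' = insert u (V - ?U)" using u QW Cons.prems(1) by auto
      hence "card (V - ?U') <= Suc (card (V - ?U))" using V by (simp add: card_insert_if)
      thus "card (V - ?U') <= x" using cU Cons.prems(4) by simp
     qed
     finally show ?thesis unfolding eq by (rule mult_left_mono[OF _ p(1)])
    qed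
    have "(\<Sum>u\<in>?Q. PE ?U p (\<lambda>N. u \<in> N \<and> card N <= J)) <= (\<Sum>u\<in>?Q. p*?t)"
     by (rule sum_mono) (rule each)
    also have "... = real (card ?Q)*(p*?t)" by simp
    also have "... <= real (L * Suc J)*(p*?t)"
    proof (rule mult_right_mono)
     show "real (card ?Q) <= real (L * Suc J)" using cQ by (simp only: of_nat_le_iff)
     show "0 <= p*?t" by (rule mult_nonneg_nonneg[OF p(1) t0])
    qed
    finally show "(\<Sum>u\<in>?Q. PE ?U p (\<lambda>N. u \<in> N \<and> card N <= J)) <= real (L * Suc J)*(p*?t)" .
   qed (use P0 eb0 in \<open>auto intro: mult_nonneg_nonneg\<close>)
   also have "... = ?t*(?P*(?eb + ?c))"
   proof -
    have "t*(P * b) + (l*(q*t))*P = t*(P*(b + l*q))" for t P b l q :: real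
     by (simp add: algebra_simps)
    thus ?thesis .
   qed
   finally show ?thesis .
  qed
 qed
 also have "... <= sig k M p V v / (1 - p)^(M*x)*(?t*(?P*(?eb + ?c)))"
  using Cons.prems p P0 t0 eb0 by (intro mult_right_mono sig_sub[OF V _ _ p] mult_nonneg_nonneg) auto
 also have "... = prod_list (map (swt k M J x p V) (v # vs))*(e + real (length (v # vs))*?c)"
  unfolding e by (simp add: swt_def power_add mult_ac)
 finally show ?case .
qed

section \<open>Moments over lists of ends\<close>

lemma sum_prod_lists:
 fixes s :: "'a => real"
 assumes "finite V"
 shows "(\<Sum>xs\<in>{xs. set xs \<subseteq> V \<and> length xs = k}. prod_list (map s xs)) = (sum s V)^k"
proof (induction k)
 case 0
 have "{xs. set xs \<subseteq> V \<and> length xs = 0} = {[]}" by auto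
 thus ?case by simp
next
 case (Suc k)
 let ?L = "{xs. set xs \<subseteq> V \<and> length xs = k}"
 have inj: "inj_on (\<lambda>(xs, n). n # xs) (?L \<times> V)" by (auto simp: inj_on_def)
 have "(\<Sum>xs\<in>{xs. set xs \<subseteq> V \<and> length xs = Suc k}. prod_list (map s xs))
   = (\<Sum>(xs, v)\<in>?L \<times> V. s v * prod_list (map s xs))"
  unfolding lists_length_Suc_eq by (subst sum.reindex[OF inj]) (auto intro: sum.cong)
 also have "... = (\<Sum>xs\<in>?L. \<Sum>v\<in>V. s v * prod_list (map s xs))"
  by (rule sum.cartesian_product[symmetric])
 also have "... = (\<Sum>xs\<in>?L. sum s V*prod_list (map s xs))"
  by (simp add: sum_distrib_right)
 also have "... = sum s V*(\<Sum>xs\<in>?L. prod_list (map s xs))"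
  by (simp add: sum_distrib_left)
 finally show ?case using Suc by simp
qed

lemma prod_interval_lower:
 "k <= n ==> (real n - real k + 1)^k <= real (\<Prod>{n - k + 1..n})"
proof -
 assume k: "k <= n"
 have "(real n - real k + 1)^k = (\<Prod>i\<in>{n - k + 1..n}. real n - real k + 1)" using k by simp
 also have "... <= (\<Prod>i\<in>{n - k + 1..n}. real i)"
  using k by (intro prod_mono) auto
 also have "... = real (\<Prod>{n - k + 1..n})" by simp
 finally show ?thesis .
qed

text \<open>If \<open>B\<close> occurs, then either there are few ends, or every \<open>(l + 1)\<close>-list of ends is counted by the
 hypothesis \<open>many\<close>.\<close>

lemma list_moment:
 fixes s :: "'v => real" and ends :: "'a set => 'v set"
 assumes A: "finite A" and q: "0 <= q" "q <= 1" and V: "finite V"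
  and sub: "\<And>X. ends X \<subseteq> V" and s0: "\<And>v. 0 <= s v"
  and one: "\<And>v. v \<in> V ==> PE A q (\<lambda>X. v \<in> ends X) <= s v"
  and low: "\<And>v. v \<in> V ==> (1 - eta) * s v <= PE A q (\<lambda>X. v \<in> ends X)"
  and two: "\<And>v w. v \<in> V ==> w \<in> V ==> v \<noteq> w ==>
   PE A q (\<lambda>X. v \<in> ends X \<and> w \<in> ends X) <= s v * s w"
  and many: "\<And>vs. distinct vs ==> length vs = Suc l ==> set vs \<subseteq> V ==>
   PE A q (\<lambda>X. set vs \<subseteq> ends X \<and> B X) <= e*prod_list (map s vs)"
  and e0: "0 <= e"
 defines "mu \<equiv> sum s V"
 assumes mu: "0 < mu" and y: "0 < y" and l: "real l < (1 - y)*mu"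
 shows "PE A q (\<lambda>X. B X) <= (1/mu + 2*eta)/y^2 + e*(mu/((1 - y)*mu - real l))^Suc l"
proof -
 define Z where "Z X = real (card (ends X))" for X
 have Zsum: "Z X = (\<Sum>v\<in>V. of_bool (v \<in> ends X))" for X
 proof -
  have "(\<Sum>v\<in>V. of_bool (v \<in> ends X) :: real) = real (card (V \<inter> {v. v \<in> ends X}))"
   by (rule sum_of_bool_eq; rule V)
  also have "V \<inter> {v. v \<in> ends X} = ends X" using sub by blast
  finally show ?thesis by (simp add: Z_def)
 qed
 have EZ: "Ex A q Z = (\<Sum>v\<in>V. PE A q (\<lambda>X. v \<in> ends X))"
  unfolding Zsum Ex_sum ..
 have EZlow: "(1 - eta)*mu <= Ex A q Z"
  unfolding EZ mu_def sum_distrib_left by (intro sum_mono low)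
 have EZZ: "Ex A q (\<lambda>X. Z X*Z X) <= mu^2 + mu"
 proof -
  have "Ex A q (\<lambda>X. Z X*Z X) = (\<Sum>v\<in>V. \<Sum>w\<in>V. Ex A q (\<lambda>X. of_bool (v \<in> ends X) * of_bool (w \<in> ends X)))"
   unfolding Zsum sum_product Ex_sum ..
  also have "... <= (\<Sum>v\<in>V. \<Sum>w\<in>V. s v * s w + (if v = w then s v else 0))"
  proof (intro sum_mono)
   fix v w assume vw: "v \<in> V" "w \<in> V"
   show "Ex A q (\<lambda>X. of_bool (v \<in> ends X) * of_bool (w \<in> ends X)) <= s v * s w + (if v = w then s v else 0)"
   proof (cases "v = w")
    case True
    have "Ex A q (\<lambda>X. of_bool (v \<in> ends X) * of_bool (w \<in> ends X)) = PE A q (\<lambda>X. v \<in> ends X)"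
     using True by (intro Ex_cong) simp
    with one[OF vw(1)] True s0[of v] show ?thesis by (simp add: add_increasing)
   next
    case False
    with two[OF vw False] show ?thesis by (simp only: of_bool_conj) simp
   qed
  qed
  also have "... = mu^2 + mu"
   using V by (simp add: sum.distrib power2_eq_square mu_def sum_product)
  finally show ?thesis .
 qed
 \<comment> \<open>With at least \<open>(1 - y) * mu\<close> ends there are at least
   \<open>c\<close> ordered lists of \<open>l + 1\<close> distinct ones, so dividing by
   \<open>c\<close> turns the expected number of bad lists into a probability.\<close>
 define c where "c = ((1 - y)*mu - real l)^Suc l"
 have c0: "0 < c" using l by (simp add: c_def)
 let ?L = "{vs. set vs \<subseteq> V \<and> length vs = Suc l \<and> distinct vs}"
 have finL: "finite {vs. set vs \<subseteq> V \<and> length vs = Suc l}" using V by (rule finite_lists_length_eq)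
 have finL': "finite ?L" by (rule finite_subset[OF _ finL]) auto
 have point: "of_bool (B X) <= (Z X - mu)*(Z X - mu)*(1/(y*mu)^2) + (\<Sum>vs\<in>?L. of_bool (set vs \<subseteq> ends X \<and> B X))*(1/c)" for X
 proof (cases "B X")
  case False
  thus ?thesis by simp
 next
  case B: True
  have nn: "0 <= (\<Sum>vs\<in>?L. of_bool (set vs \<subseteq> ends X \<and> B X))*(1/c)"
   using c0 by (intro mult_nonneg_nonneg sum_nonneg) auto
  show ?thesis
  proof (cases "Z X < (1 - y)*mu")
   case True
   have "(y*mu)^2 <= (mu - Z X)^2"
    using True y mu by (intro power_mono) (auto simp: algebra_simps)
   hence "1 <= (Z X - mu)*(Z X - mu)*(1/(y*mu)^2)"
    using y mu by (simp add: field_simps power2_eq_square)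
   with nn B show ?thesis by simp
  next
   case False
   have fe: "finite (ends X)" using sub V finite_subset by blast
   have le: "Suc l <= card (ends X)" using False l by (simp add: Z_def)
   let ?M = "{vs. length vs = Suc l \<and> distinct vs \<and> set vs \<subseteq> ends X}"
   have "?M \<subseteq> ?L" using sub by blast
   hence "card ?M <= card {vs \<in> ?L. set vs \<subseteq> ends X}"
    by (intro card_mono finite_subset[OF _ finL']) auto
   moreover have "card ?M = \<Prod>{card (ends X) - Suc l + 1..card (ends X)}"
    by (rule card_lists_distinct_length_eq[OF fe le])
   ultimately have "real (\<Prod>{card (ends X) - Suc l + 1..card (ends X)}) <= real (card {vs \<in> ?L. set vs \<subseteq> ends X})"
    by (simp only: of_nat_le_iff)
   with prod_interval_lower[OF le] have "(Z X - real l)^Suc l <= real (card {vs \<in> ?L. set vs \<subseteq> ends X})"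
    by (simp add: Z_def del: power_Suc)
   moreover have "c <= (Z X - real l)^Suc l"
    unfolding c_def using False l by (intro power_mono) auto
   moreover have "real (card {vs \<in> ?L. set vs \<subseteq> ends X}) = (\<Sum>vs\<in>?L. of_bool (set vs \<subseteq> ends X \<and> B X))"
   proof -
    have "(\<Sum>vs\<in>?L. of_bool (set vs \<subseteq> ends X \<and> B X) :: real) = (\<Sum>vs\<in>?L. if set vs \<subseteq> ends X then 1 else 0)"
     using B by (intro sum.cong) auto
    also have "... = (\<Sum>vs\<in>{vs \<in> ?L. set vs \<subseteq> ends X}. 1)"
     using finL' by (subst sum.inter_filter[symmetric]) auto
    finally show ?thesis by simp
   qed
   ultimately have "c <= (\<Sum>vs\<in>?L. of_bool (set vs \<subseteq> ends X \<and> B X))" by linarith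
   hence "1 <= (\<Sum>vs\<in>?L. of_bool (set vs \<subseteq> ends X \<and> B X))*(1/c)"
    using c0 by (simp add: field_simps)
   moreover have "0 <= (Z X - mu)*(Z X - mu)*(1/(y*mu)^2)"
    by (intro mult_nonneg_nonneg[of "(Z X - mu)*(Z X - mu)"] zero_le_square) simp
   moreover have "of_bool (B X) = (1::real)" using B by simp
   ultimately show ?thesis by linarith
  qed
 qed
 have "PE A q (\<lambda>X. B X) <= Ex A q (\<lambda>X. (Z X - mu)*(Z X - mu)*(1/(y*mu)^2)
   + (\<Sum>vs\<in>?L. of_bool (set vs \<subseteq> ends X \<and> B X))*(1/c))"
  by (rule Ex_mono[OF q]) (rule point)
 also have "... = Ex A q (\<lambda>X. (Z X - mu)*(Z X - mu))*(1/(y*mu)^2)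
   + (\<Sum>vs\<in>?L. PE A q (\<lambda>X. set vs \<subseteq> ends X \<and> B X))*(1/c)"
  by (simp only: Ex_add Ex_multc Ex_sum)
 also have "... <= (mu + 2*eta*mu^2)*(1/(y*mu)^2) + (e*mu^Suc l)*(1/c)"
 proof (intro add_mono mult_right_mono)
  have "Ex A q (\<lambda>X. (Z X - mu)*(Z X - mu)) = Ex A q (\<lambda>X. (Z X*Z X - 2*mu*Z X) + mu^2)"
   by (rule Ex_cong) (simp add: algebra_simps power2_eq_square)
  also have "... = Ex A q (\<lambda>X. Z X*Z X) - 2*mu*Ex A q Z + mu^2"
   unfolding Ex_add Ex_diff Ex_cmult using A by simp
  also have "... <= mu^2 + mu - 2*mu*((1 - eta)*mu) + mu^2"
   using EZZ EZlow mu by (intro add_mono diff_mono mult_left_mono) auto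
  also have "... = mu + 2*eta*mu^2" by (simp add: algebra_simps power2_eq_square)
  finally show "Ex A q (\<lambda>X. (Z X - mu)*(Z X - mu)) <= mu + 2*eta*mu^2" .
  have "(\<Sum>vs\<in>?L. PE A q (\<lambda>X. set vs \<subseteq> ends X \<and> B X)) <= (\<Sum>vs\<in>?L. e*prod_list (map s vs))"
   by (intro sum_mono many) auto
  also have "... <= (\<Sum>vs\<in>{vs. set vs \<subseteq> V \<and> length vs = Suc l}. e*prod_list (map s vs))"
   using e0 s0 by (intro sum_mono2[OF finL]) (auto intro!: mult_nonneg_nonneg prod_list_nonneg)
  also have "... = e*mu^Suc l"
   unfolding sum_distrib_left[symmetric] sum_prod_lists[OF V] mu_def ..
  finally show "(\<Sum>vs\<in>?L. PE A q (\<lambda>X. set vs \<subseteq> ends X \<and> B X)) <= e*mu^Suc l" .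
 qed (use c0 in auto)
 also have "(mu + 2*eta*mu^2)*(1/(y*mu)^2) = (1/mu + 2*eta)/y^2"
  using mu y by (simp add: field_simps power2_eq_square)
 also have "(e*mu^Suc l)*(1/c) = e*(mu/((1 - y)*mu - real l))^Suc l"
  by (simp add: c_def power_divide)
 finally show ?thesis .
qed

lemma St_sub:
 assumes S: "St k E V v C N" and sub: "insert v C \<subseteq> W" "W \<subseteq> V"
 shows "St k E W v C (nb E {v} (W - insert v C))"
 unfolding St_def
proof (intro conjI refl)
 show "v \<in> W" "C \<subseteq> W - {v}" using sub St_vC(1)[OF S] by auto
 show "Sh k E v C" by (rule St_vC(4)[OF S])
 have "nb E C (W - insert v C) \<subseteq> nb E C (V - insert v C)" using sub(2) by (auto simp: nb_def)
 thus "nb E C (W - insert v C) = {}" using S by (simp add: St_def)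
qed

text \<open>Disjointness keeps the branches of later ends intact when earlier ends are removed,
  while the neighbour sets can only shrink.\<close>

lemma ends_tup0_aux:
 assumes V: "finite V" and e: "\<And>v. v \<in> S ==> is_end k M J E V v (C v) (N v)"
  and "distinct (us @ vs)" "set (us @ vs) \<subseteq> S"
 shows "tup0 k M J E (V - (\<Union>u\<in>set us. insert u (C u))) vs"
 using assms(3,4)
proof (induction vs arbitrary: us)
 case (Cons v vs)
 let ?W = "V - (\<Union>u\<in>set us. insert u (C u))"
 let ?N = "nb E {v} (?W - insert v (C v))"
 have ev: "is_end k M J E V v (C v) (N v)" using Cons.prems by (intro e) auto
 have S: "St k E V v (C v) (N v)" using ev by (simp add: is_end_def)
 have dj: "insert v (C v) \<inter> insert u (C u) = {}" if "u \<in> set us" for u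
  by (rule end_disjoint(1)[OF ev _ V]) (use that Cons.prems in \<open>auto intro: e\<close>)
 have sub: "insert v (C v) \<subseteq> ?W" using dj St_vC(2,3)[OF S] by blast
 have "St k E ?W v (C v) ?N" by (rule St_sub[OF S sub]) auto
 moreover have "card (C v) <= M" using ev by (simp add: is_end_def)
 moreover have "card ?N <= J"
 proof -
  have "?N \<subseteq> N v" using S by (auto simp: nb_def St_def)
  moreover have "finite (N v)" using S V by (intro finite_subset[of "N v" V]) (auto simp: St_def nb_def)
  ultimately have "card ?N <= card (N v)" by (intro card_mono)
  with ev show ?thesis by (simp add: is_end_def)
 qed
 moreover have "C v \<inter> set vs = {}"
 proof -
  have "w \<notin> C v" if "w \<in> set vs" for w
   by (rule end_not_inside[OF ev _ V]) (use that Cons.prems in \<open>auto intro: e\<close>)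
  thus ?thesis by blast
 qed
 moreover have "tup0 k M J E (?W - insert v (C v)) vs"
 proof -
  have "?W - insert v (C v) = V - (\<Union>u\<in>set (us @ [v]). insert u (C u))" by auto
  thus ?thesis using Cons.IH[of "us @ [v]"] Cons.prems by simp
 qed
 ultimately show ?case unfolding tup0.simps by blast
qed simp

text \<open>As long as no overlap occurs, removals do not affect the neighbour sets, so the
  collected sets are exactly the \<open>N v\<close>; at the first overlap
  \<open>ends_tup0_aux\<close> takes over.\<close>

lemma ends_tupB_aux:
 assumes V: "finite V" and e: "\<And>v. v \<in> S ==> is_end k M J E V v (C v) (N v)"
  and "distinct (us @ vs)" "set (us @ vs) \<subseteq> S"
  and "\<And>u. u \<in> set us ==> N u \<inter> set vs = {}"
  and "acc_ok J (map N us) (V - (\<Union>u\<in>set us. insert u (C u)))"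
  and Bad: "acc_ok J (map N (us @ vs)) (V - (\<Union>u\<in>set (us @ vs). insert u (C u)))
   ==> Bad (map N (us @ vs)) (V - (\<Union>u\<in>set (us @ vs). insert u (C u)))
     (E \<inter> pr (V - (\<Union>u\<in>set (us @ vs). insert u (C u))))"
 shows "tupB k M J Bad E (V - (\<Union>u\<in>set us. insert u (C u))) vs (map N us)"
 using assms(3-7)
proof (induction vs arbitrary: us)
 case Nil
 thus ?case by simp
next
 case (Cons v vs)
 let ?W = "V - (\<Union>u\<in>set us. insert u (C u))"
 have W': "?W - insert v (C v) = V - (\<Union>u\<in>set (us @ [v]). insert u (C u))" by auto
 have ev: "is_end k M J E V v (C v) (N v)" using Cons.prems by (intro e) auto
 have S: "St k E V v (C v) (N v)" using ev by (simp add: is_end_def)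
 have eu: "is_end k M J E V u (C u) (N u)" "u \<noteq> v" if "u \<in> set us" for u
  using that Cons.prems by (auto intro: e)
 have dj: "insert v (C v) \<inter> insert u (C u) = {}" "N v \<inter> C u = {}" "N u \<inter> C v = {}" if "u \<in> set us" for u
  using end_disjoint[OF ev eu(1)[OF that] V] end_disjoint(2)[OF eu(1)[OF that] ev V] eu(2)[OF that] by auto
 have sub: "insert v (C v) \<subseteq> ?W" using dj St_vC(2,3)[OF S] by blast
 \<comment> \<open>Adjacency of two ends is symmetric: an earlier \<open>u\<close> in
   \<open>N v\<close> would put \<open>v\<close> into \<open>N u\<close>, an overlap already
   excluded for \<open>u\<close>.\<close>
 have notin: "u \<notin> N v" if "u \<in> set us" for u
 proof
  assume "u \<in> N v"
  hence uv: "{u, v} \<in> E" using St_nbr[OF S, of u] by simp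
  have Su: "St k E V u (C u) (N u)" using eu(1)[OF that] by (simp add: is_end_def)
  have "v \<in> N u"
   using St_nbr[OF Su, of v] uv dj(1)[OF that] St_vC(3)[OF S] eu(2)[OF that] by (auto simp: insert_commute)
  with Cons.prems(3)[OF that] show False by auto
 qed
 have NW: "N v \<subseteq> ?W - insert v (C v)"
 proof
  fix x assume x: "x \<in> N v"
  hence "x \<in> V - insert v (C v)" using S by (auto simp: St_def nb_def)
  moreover have "x \<notin> insert u (C u)" if "u \<in> set us" for u
   using x dj(2)[OF that] notin[OF that] by auto
  ultimately show "x \<in> ?W - insert v (C v)" by auto
 qed
 have N: "nb E {v} (?W - insert v (C v)) = N v"
  using NW S by (auto simp: St_def nb_def)
 have "St k E ?W v (C v) (N v)" using St_sub[OF S sub] unfolding N by auto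
 moreover have "card (C v) <= M" "card (N v) <= J" "N v \<noteq> {}" using ev by (auto simp: is_end_def)
 moreover have "C v \<inter> (set vs \<union> \<Union>(set (map N us))) = {}"
 proof -
  have "w \<notin> C v" if "w \<in> set vs" for w
   by (rule end_not_inside[OF ev _ V]) (use that Cons.prems in \<open>auto intro: e\<close>)
  with dj(3) show ?thesis by auto
 qed
 moreover have "if N v \<inter> (set vs \<union> \<Union>(set (map N us))) = {} then N v \<noteq> {} \<and> tupB k M J Bad E (?W - insert v (C v)) vs (map N us @ [N v])
    else tup0 k M J E (?W - insert v (C v)) vs"
 proof (cases "N v \<inter> (set vs \<union> \<Union>(set (map N us))) = {}")
  case True
  have ac: "acc_ok J (map N (us @ [v])) (V - (\<Union>u\<in>set (us @ [v]). insert u (C u)))"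
   unfolding acc_ok_def
  proof (intro conjI ballI allI impI)
   fix X assume "X \<in> set (map N (us @ [v]))"
   then consider "X = N v" | u where "u \<in> set us" "X = N u" by auto
   hence "X \<subseteq> V - (\<Union>u\<in>set (us @ [v]). insert u (C u)) \<and> X \<noteq> {} \<and> card X <= J"
   proof (cases)
    case 1
    thus ?thesis using NW ev unfolding W' by (auto simp: is_end_def)
   next
    case 2
    have *: "N u \<subseteq> ?W" "N u \<noteq> {}" "card (N u) <= J" using Cons.prems(4) 2 by (auto simp: acc_ok_def)
    have "v \<notin> N u" using Cons.prems(3)[OF 2(1)] by auto
    with * dj(3)[OF 2(1)] 2 show ?thesis unfolding W'[symmetric] by auto
   qed
   thus "X \<subseteq> V - (\<Union>u\<in>set (us @ [v]). insert u (C u))" "X \<noteq> {}" "card X <= J" by auto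
  next
   fix i j assume ij: "i < length (map N (us @ [v]))" "j < i"
   show "map N (us @ [v]) ! i \<inter> map N (us @ [v]) ! j = {}"
   proof (cases "i = length us")
    case True
    have "j < length us" using ij True by simp
    hence "map N (us @ [v]) ! j \<in> set (map N us)" by (simp add: nth_append)
    thus ?thesis using \<open>N v \<inter> _ = {}\<close> True by (auto simp: nth_append)
   next
    case False
    hence "i < length us" "j < length us" using ij by auto
    thus ?thesis using Cons.prems(4) ij by (auto simp: acc_ok_def nth_append)
   qed
  qed
  have "tupB k M J Bad E (V - (\<Union>u\<in>set (us @ [v]). insert u (C u))) vs (map N (us @ [v]))"
  proof (rule Cons.IH, goal_cases)
   case 1 show ?case using Cons.prems(1) by auto
  next
   case 2 show ?case using Cons.prems(2) by auto
  next
   case (3 u) thus ?case using True Cons.prems(3) by auto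
  next
   case 4 show ?case by (rule ac)
  next
   case 5 thus ?case using Cons.prems(5) by simp
  qed
  thus ?thesis using True ev unfolding W' by (simp add: is_end_def)
 next
  case False
  have "tup0 k M J E (V - (\<Union>u\<in>set (us @ [v]). insert u (C u))) vs"
   by (rule ends_tup0_aux[OF V e]) (use Cons.prems(1,2) in auto)
  with False show ?thesis unfolding W' by (simp only: if_False)
 qed
 ultimately show ?case unfolding tupB.simps by blast
qed

lemma alive_Int_pr: "u \<in> U ==> alive M (E \<inter> pr U) U u = alive M E U u"
 unfolding alive_def by (subst lev_Int_pr) auto

lemma Ex_empty_set:
 assumes "finite U"
 shows "PE U p (\<lambda>N. N = {}) = (1 - p)^card U"
proof -
 have "PE U p (\<lambda>N. N = {}) = PE U p (\<lambda>N. N \<inter> U = {})"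
  by (rule Ex_cong) (simp add: Int_absorb2)
 thus ?thesis using Ex_disjoint[OF assms subset_refl] by simp
qed

text \<open>Given the branches \<open>C\<close>, the vertex \<open>v\<close> fails to be an end only
  if it has more than \<open>J\<close> further neighbours, or none (at most \<open>e0\<close>), or a
  dead one (at most \<open>J * qd\<close>). The sum over \<open>C\<close> is a probability because
  ends have unique branches.\<close>

lemma end_prob_lower:
 assumes V: "finite V" "v \<in> V" and p: "0 <= p" "p < 1"
  and dead: "\<And>U u. U \<subseteq> V - {v} ==> card (V - U) <= Suc M ==> u \<in> U ==>
   PE (pr U) p (\<lambda>E. \<not> alive M E U u) <= qd"
  and iso: "\<And>U. U \<subseteq> V - {v} ==> card (V - U) <= Suc M ==> (1 - p)^card U <= e0"
  and J: "real J*qd <= 1" "0 <= qd"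
 shows "sig k M p V v * (tau p J V*(1 - real J*qd) - e0)
  <= PE (pr V) p (\<lambda>E. \<exists>C N. is_end k M J E V v C N)"
proof -
 let ?I = "{C. C \<subseteq> V - {v} \<and> card C <= M}"
 have p1: "p <= 1" using p by simp
 have fin: "finite ?I" by (rule finite_subset[of _ "Pow V"]) (use V in auto)
 define F where "F C N E = (of_bool (N \<noteq> {} \<and> card N <= J \<and> (\<forall>u\<in>N. alive M E (V - insert v C) u)) :: real)" for C N E
 define Q where "Q C E \<longleftrightarrow> is_end k M J E V v C (nb E {v} (V - insert v C))" for C E
 have QF: "of_bool (Q C E) = of_bool (Sh k E v C \<and> nb E C (V - insert v C) = {})*F C (nb E {v} (V - insert v C)) (E \<inter> pr (V - insert v C))"
  if "C \<in> ?I" for C E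
 proof -
  have "(\<forall>u\<in>nb E {v} (V - insert v C). alive M (E \<inter> pr (V - insert v C)) (V - insert v C) u)
    = (\<forall>u\<in>nb E {v} (V - insert v C). alive M E (V - insert v C) u)"
   using alive_Int_pr nb_subset by (metis (no_types, lifting) subsetD)
  thus ?thesis using that V by (auto simp: Q_def F_def is_end_def St_def)
 qed
 have "sig k M p V v * (tau p J V*(1 - real J*qd) - e0)
  = (\<Sum>C\<in>?I. gsh k p v C*(1 - p)^(card C*card (V - insert v C))*(tau p J V*(1 - real J*qd) - e0))"
  by (simp add: sig_def sum_distrib_right)
 also have "... <= (\<Sum>C\<in>?I. PE (pr V) p (\<lambda>E. Q C E))"
 proof (rule sum_mono)
  fix C assume C: "C \<in> ?I"
  let ?U = "V - insert v C"
  have fU: "finite ?U" using V by simp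
  have cU: "card (V - ?U) <= Suc M" using card_Diff_step[of V V C M v] C V by auto
  have "PE (pr V) p (\<lambda>E. Q C E) = Ex (pr V) p (\<lambda>E. of_bool (Sh k E v C \<and> nb E C ?U = {})*F C (nb E {v} ?U) (E \<inter> pr ?U))"
   by (rule Ex_cong) (rule QF[OF C])
  also have "... = gsh k p v C*(1 - p)^(card C*card ?U)*Ex ?U p (\<lambda>N. Ex (pr ?U) p (F C N))"
   by (rule peel_end) (use V C in auto)
  finally have eq: "PE (pr V) p (\<lambda>E. Q C E) = gsh k p v C*(1 - p)^(card C*card ?U)*Ex ?U p (\<lambda>N. Ex (pr ?U) p (F C N))" .
  have "tau p J V*(1 - real J*qd) - e0
    <= PE ?U p (\<lambda>N. card N <= J)*(1 - real J*qd) - PE ?U p (\<lambda>N. N = {})"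
   unfolding Ex_empty_set[OF fU]
   using J by (intro diff_mono mult_right_mono tau_sub[OF V(1) _ p] iso cU) auto
  also have "... = Ex ?U p (\<lambda>N. of_bool (card N <= J)*(1 - real J*qd) - of_bool (N = {}))"
   by (simp only: Ex_diff Ex_multc)
  also have "... <= Ex ?U p (\<lambda>N. Ex (pr ?U) p (F C N))"
  proof (rule Ex_mono[OF p(1) p1])
   fix N assume N: "N \<subseteq> ?U"
   have F0: "0 <= Ex (pr ?U) p (F C N)" using p by (intro Ex_nonneg) (auto simp: F_def)
   show "of_bool (card N <= J)*(1 - real J*qd) - of_bool (N = {}) <= Ex (pr ?U) p (F C N)"
   proof (cases "N = {} \<or> \<not> card N <= J")
    case True
    have "0 <= real J*qd" using J by simp
    with True F0 show ?thesis by (auto simp: of_bool_def)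
   next
    case False
    have finN: "finite N" using N fU finite_subset by blast
    have "(1::real) - real J*qd <= 1 - (\<Sum>u\<in>N. qd)"
     using False J by (simp add: mult_right_mono)
    also have "... <= 1 - (\<Sum>u\<in>N. PE (pr ?U) p (\<lambda>E. \<not> alive M E ?U u))"
     using N cU by (intro diff_left_mono sum_mono dead) auto
    also have "... = Ex (pr ?U) p (\<lambda>E. 1 - (\<Sum>u\<in>N. of_bool (\<not> alive M E ?U u)))"
     using fU by (simp only: Ex_diff Ex_sum Ex_const finite_pr)
    also have "... <= Ex (pr ?U) p (F C N)"
    proof (rule Ex_mono[OF p(1) p1])
     fix E
     show "1 - (\<Sum>u\<in>N. of_bool (\<not> alive M E ?U u)) <= F C N E"
     proof (cases "\<forall>u\<in>N. alive M E ?U u")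
      case True
      thus ?thesis using False by (simp add: F_def)
     next
      case na: False
      then obtain u where u: "u \<in> N" "\<not> alive M E ?U u" by blast
      have "of_bool (\<not> alive M E ?U u) <= (\<Sum>u\<in>N. of_bool (\<not> alive M E ?U u) :: real)"
       using u finN by (intro member_le_sum) auto
      hence "1 <= (\<Sum>u\<in>N. of_bool (\<not> alive M E ?U u) :: real)" using u by simp
      moreover have "0 <= F C N E" by (simp add: F_def)
      ultimately show ?thesis by linarith
     qed
    qed
    finally show ?thesis using False by simp
   qed
  qed
  finally show "gsh k p v C*(1 - p)^(card C*card ?U)*(tau p J V*(1 - real J*qd) - e0)
   <= PE (pr V) p (\<lambda>E. Q C E)"
   unfolding eq using p by (intro mult_left_mono mult_nonneg_nonneg gsh_nonneg) auto
 qed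
 also have "... = Ex (pr V) p (\<lambda>E. \<Sum>C\<in>?I. of_bool (Q C E))" by (simp add: Ex_sum)
 also have "... <= PE (pr V) p (\<lambda>E. \<exists>C N. is_end k M J E V v C N)"
 proof (rule Ex_mono[OF p(1) p1])
  fix E
  show "(\<Sum>C\<in>?I. of_bool (Q C E)) <= (of_bool (\<exists>C N. is_end k M J E V v C N) :: real)"
  proof (cases "\<exists>C0\<in>?I. Q C0 E")
   case True
   then obtain C0 where C0: "C0 \<in> ?I" "Q C0 E" by blast
   \<comment> \<open>Uniqueness makes the indicators for different \<open>C\<close> exclusive; this
     is what turns the expected number \<open>sig\<close> into a lower bound for a
     probability.\<close>
   have "Q C E \<longleftrightarrow> C = C0" if "C \<in> ?I" for C
    using end_unique[OF _ _ V(1)] C0(2) unfolding Q_def by blast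
   hence "(\<Sum>C\<in>?I. of_bool (Q C E) :: real) = (\<Sum>C\<in>?I. if C = C0 then 1 else 0)"
    by (intro sum.cong) auto
   also have "... = 1" using fin C0 by simp
   finally show ?thesis using C0(2) unfolding Q_def by auto
  next
   case False
   thus ?thesis by (auto intro: sum_nonpos)
  qed
 qed
 finally show ?thesis .
qed

section \<open>Lower bound for the branch weight\<close>

lemma lev_nonempty_card:
 assumes "finite U"
 shows "lv E T U t \<noteq> {} ==> t <= card (U - rs E T U t)"
proof (induction t)
 case (Suc t)
 let ?L = "lv E T U t" and ?R = "rs E T U t"
 have ne: "nb E ?L ?R \<noteq> {}" using Suc.prems by (simp add: lev_Suc_back del: lev.simps)
 hence "?L \<noteq> {}" by auto
 hence IH: "t <= card (U - ?R)" by (rule Suc.IH)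
 have sub: "?R \<subseteq> U" "nb E ?L ?R \<subseteq> ?R" by (rule lev_sub(2), rule nb_subset)
 hence "U - rs E T U (Suc t) = (U - ?R) \<union> nb E ?L ?R"
  by (auto simp: lev_Suc_back simp del: lev.simps)
 moreover have "card ((U - ?R) \<union> nb E ?L ?R) = card (U - ?R) + card (nb E ?L ?R)"
  using assms sub by (intro card_Un_disjoint) (auto intro: finite_subset)
 moreover have "0 < card (nb E ?L ?R)"
  using ne sub assms finite_subset[of "nb E ?L ?R" U] by (auto simp: card_gt_0_iff)
 ultimately show ?case using IH by (simp del: lev.simps)
qed simp

text \<open>A dead vertex has found fewer than \<open>M\<close> vertices, so its level
  \<open>M\<close> is empty while at least \<open>u0\<close> vertices are unexplored. This is
  \<open>Run_pow\<close> at \<open>z = 0\<close>, where \<open>0 ^ card\<close> is the indicator of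
  extinction.\<close>

lemma dead_prob:
 assumes U: "finite U" "u \<in> U" and p: "0 <= p" "p <= 1"
  and off: "offspring_lb p k m u0" and m: "1 <= m" "card U <= u0 + m" "u0 + M <= card U"
 shows "PE (pr U) p (\<lambda>E. \<not> alive M E U u) <= zit k 0 M"
proof -
 have Uu: "{u} \<union> (U - {u}) = U" using U by auto
 have "PE (pr U) p (\<lambda>E. \<not> alive M E U u)
  <= Ex (pr U) p (\<lambda>E. of_bool (u0 <= card (rs E {u} (U - {u}) M))*0^card (lv E {u} (U - {u}) M))"
 proof (rule Ex_mono[OF p])
  fix E
  let ?L = "lv E {u} (U - {u}) M" and ?R = "rs E {u} (U - {u}) M"
  show "of_bool (\<not> alive M E U u) <= (of_bool (u0 <= card ?R)*0^card ?L :: real)"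
  proof (cases "alive M E U u")
   case False
   hence c: "card (U - {u} - ?R) < M" by (simp add: alive_def)
   have "?L = {}" using lev_nonempty_card[of "U - {u}" E "{u}" M] U c by fastforce
   moreover have "u0 <= card ?R"
   proof -
    have R: "?R \<subseteq> U - {u}" by (rule lev_sub(2))
    hence "card (U - {u} - ?R) = card (U - {u}) - card ?R"
     using U finite_subset[OF R] by (intro card_Diff_subset) auto
    thus ?thesis using c m U by simp
   qed
   ultimately show ?thesis by simp
  qed simp
 qed
 also have "... = Run p M (\<lambda>T U. of_bool (u0 <= card U)*0^card T) {u} (U - {u})"
  using Run_ex'[of "{u}" "U - {u}" p "\<lambda>T U. of_bool (u0 <= card U)*0^card T" M] Uu U by simp
 also have "... <= zit k 0 M^card {u}"
  by (rule Run_pow[OF off p]) (use U m in auto)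
 finally show ?thesis by simp
qed

lemma lev_Diff:
 assumes "X \<subseteq> rs E T U t"
 shows "lev E T (U - X) t = (lv E T U t, rs E T U t - X)"
 using assms
proof (induction t)
 case (Suc t)
 let ?L = "lv E T U t" and ?R = "rs E T U t"
 have X: "X \<subseteq> ?R - nb E ?L ?R" using Suc.prems by (simp add: lev_Suc_back del: lev.simps)
 hence IH: "lev E T (U - X) t = (?L, ?R - X)" by (intro Suc.IH) auto
 have n: "nb E ?L (?R - X) = nb E ?L ?R" using X by (auto simp: nb_def)
 show ?case unfolding lev_Suc_back IH fst_conv snd_conv n by auto
qed simp

text \<open>A vertex explored by time \<open>t\<close> has been asked for its neighbours by time
  \<open>t + 1\<close>, so whatever is still unexplored then is not adjacent to it. Used both to
  close off branches and for the Lipschitz property of depth.\<close>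

lemma lev_no_edge:
 "w \<in> rs E T U (Suc t) ==> a \<in> T \<union> (U - rs E T U t) ==> {w, a} \<notin> E"
proof (induction t)
 case 0
 thus ?case by (auto simp: nb_def)
next
 case (Suc t)
 let ?L = "lv E T U (Suc t)" and ?R = "rs E T U (Suc t)"
 have w: "w \<in> ?R" "w \<notin> nb E ?L ?R"
  using Suc.prems(1) unfolding lev_Suc_back[of E T U "Suc t"] by auto
 show ?case
 proof (cases "a \<in> T \<union> (U - rs E T U t)")
  case True
  with Suc.IH w show ?thesis by blast
 next
  case False
  hence "a \<in> rs E T U t" "a \<notin> ?R" using Suc.prems(2) by blast+
  hence "a \<in> ?L" unfolding lev_Suc_back[of E T U t] by simp
  with w show ?thesis by (auto simp: nb_def)
 qed
qed

text \<open>If level \<open>k\<close> is a single vertex without unexplored neighbours, the explored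
  part is the component of \<open>v\<close> and serves as \<open>C\<close>, with \<open>v\<close>
  having no further neighbours. Isolating the top vertex on the left and isolating \<open>v\<close>
  on the right cost nearly the same power of \<open>1 - p\<close>; only
  \<open>(1 - p) ^ (M + 1)\<close> is left after cancellation.\<close>

lemma sig_lower:
 assumes V: "finite V" "v \<in> V" and p: "0 <= p" "p < 1" and M: "M < card V"
 shows "Run p k (\<lambda>T U. of_bool (card T = 1 \<and> card V - 1 - M <= card U)) {v} (V - {v})*(1 - p)^(M + 1)
  <= sig k M p V v"
proof -
 let ?c = "card V - 1 - M"
 have p1: "p <= 1" using p by simp
 have Vv: "{v} \<union> (V - {v}) = V" using V by auto
 define G where "G T U E = (of_bool (card T = 1 \<and> ?c <= card U \<and> nb E T U = {}) :: real)" for T U :: "'a set" and E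
 have "Run p k (\<lambda>T U. of_bool (card T = 1 \<and> ?c <= card U)) {v} (V - {v})*(1 - p)^card V
  = Run p k (\<lambda>T U. (1 - p)^card V * of_bool (card T = 1 \<and> ?c <= card U)) {v} (V - {v})"
  unfolding Run_cmult by simp
 also have "... <= Run p k (\<lambda>T U. Ex (pr (T \<union> U)) p (G T U)) {v} (V - {v})"
 proof (rule Run_mono[OF p(1) p1])
  fix T U assume TU: "T \<subseteq> {v} \<union> (V - {v})" "U \<subseteq> V - {v}" "T \<inter> U = {}"
  have fin: "finite T" "finite U" using TU V by (auto intro: finite_subset)
  show "(1 - p)^card V * of_bool (card T = 1 \<and> ?c <= card U) <= Ex (pr (T \<union> U)) p (G T U)"
  proof (cases "card T = 1 \<and> ?c <= card U")
   case True
   have "Ex (pr (T \<union> U)) p (G T U) = PE (pr (T \<union> U)) p (\<lambda>E. nb E T U = {})"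
    by (rule Ex_cong) (use True in \<open>simp add: G_def\<close>)
   also have "... = Ex U (1 - (1 - p)^card T) (\<lambda>S. PE (pr U) p (\<lambda>_. S = {}))"
    by (rule peel[OF fin TU(3)])
   also have "... = (1 - p)^card U"
    using fin True by (simp add: Ex_empty_set)
   also have "(1 - p)^card V <= (1 - p)^card U"
    using p TU(2) V by (intro power_decreasing card_mono) auto
   finally show ?thesis using True by simp
  next
   case False
   have "0 <= Ex (pr (T \<union> U)) p (G T U)" using p by (intro Ex_nonneg) (auto simp: G_def)
   with False show ?thesis by auto
  qed
 qed auto
 also have "... = Ex (pr V) p (\<lambda>E. G (lv E {v} (V - {v}) k) (rs E {v} (V - {v}) k) (E \<inter> pr (lv E {v} (V - {v}) k \<union> rs E {v} (V - {v}) k)))"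
  using Run_ex[of "{v}" "V - {v}" p G k] V Vv by simp
 also have "... <= PE (pr V) p (\<lambda>E. \<exists>C. C \<subseteq> V - {v} \<and> card C <= M \<and> Sh k E v C \<and> nb E C (V - insert v C) = {}
    \<and> nb E {v} (V - insert v C) = {})"
 proof (rule Ex_mono[OF p(1) p1])
  fix E
  let ?L = "lv E {v} (V - {v}) k" and ?R = "rs E {v} (V - {v}) k"
  have d: "?L \<inter> ?R = {}" by (rule lev_sub(3)) auto
  have nbL: "nb (E \<inter> pr (?L \<union> ?R)) ?L ?R = nb E ?L ?R" by (rule nb_Int_pr[OF d]) simp
  have "\<exists>C. C \<subseteq> V - {v} \<and> card C <= M \<and> Sh k E v C \<and> nb E C (V - insert v C) = {}
    \<and> nb E {v} (V - insert v C) = {}" if g: "card ?L = 1 \<and> ?c <= card ?R \<and> nb E ?L ?R = {}"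
  proof (intro exI[of _ "V - {v} - ?R"] conjI)
   let ?C = "V - {v} - ?R"
   have R: "?R \<subseteq> V - {v}" by (rule lev_sub(2))
   show "?C \<subseteq> V - {v}" by auto
   have "card ?C = card V - 1 - card ?R"
    using card_Diff_subset[OF _ R] R V finite_subset[OF R] by simp
   thus "card ?C <= M" using g M by linarith
   show "Sh k E v ?C" unfolding Sh_def lev_Diff[OF subset_refl] using g by auto
   have VC: "V - insert v ?C = ?R" using R by auto
   have "rs E {v} (V - {v}) (Suc k) = ?R" unfolding lev_Suc_back using g by simp
   hence no: "{w, a} \<notin> E" if "w \<in> ?R" "a \<in> {v} \<union> ?C" for w a
    using lev_no_edge[of w E "{v}" "V - {v}" k a] that by simp
   show "nb E ?C (V - insert v ?C) = {}" "nb E {v} (V - insert v ?C) = {}"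
    unfolding VC using no by (auto simp: nb_def)
  qed
  thus "G ?L ?R (E \<inter> pr (?L \<union> ?R)) <= of_bool (\<exists>C. C \<subseteq> V - {v} \<and> card C <= M \<and> Sh k E v C \<and> nb E C (V - insert v C) = {}
    \<and> nb E {v} (V - insert v C) = {})"
   unfolding G_def nbL by (rule of_bool_le)
 qed
 also have "... <= sig k M p V v * (1 - p)^?c"
 proof (rule Ex_St_le[OF V p(1) p1, where R = "\<lambda>C N E. N = {}"])
  fix C assume C: "C \<subseteq> V - {v}" "card C <= M"
  let ?U = "V - insert v C"
  have fU: "finite ?U" using V by simp
  have "V - ?U = insert v C" using C V by auto
  hence "card (V - ?U) <= Suc M" using C V by (simp add: card_insert_if finite_subset)
  moreover have "card (V - ?U) = card V - card ?U" using V by (intro card_Diff_subset) auto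
  ultimately have "?c <= card ?U" by linarith
  hence "(1 - p)^card ?U <= (1 - p)^?c" using p by (intro power_decreasing) auto
  thus "Ex ?U p (\<lambda>N. PE (pr ?U) p (\<lambda>E. N = {})) <= (1 - p)^?c"
   using fU by (simp add: Ex_empty_set)
 qed
 finally have *: "Run p k (\<lambda>T U. of_bool (card T = 1 \<and> ?c <= card U)) {v} (V - {v})*(1 - p)^card V
   <= sig k M p V v * (1 - p)^?c" .
 have "(1 - p)^card V = (1 - p)^(M + 1)*(1 - p)^?c"
 proof -
  have "card V = (M + 1) + ?c" using M by simp
  thus ?thesis using power_add[of "1 - p" "M + 1" ?c] by metis
 qed
 with * p show ?thesis by (simp add: mult.assoc[symmetric])
qed

lemma half_le_exp: "(1/2 :: real) <= exp (- (1/2))"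
 using exp_half_le2 by (simp add: exp_minus field_simps)

text \<open>On the lost tail \<open>card S > m\<close> the indicator is at most
  \<open>(1/2) ^ m * 2 ^ (card S - 1)\<close>. This replaces \<open>y\<close> by
  \<open>2 * y\<close> in the generating function at a cost of \<open>exp (m/5)\<close>, which is
  still beaten by \<open>(1/2) ^ m\<close>.\<close>

lemma truncated_mean:
 assumes U: "finite U" and q: "0 <= q" "q <= 1/2" and y: "0 <= y" "y <= 1"
  and m: "q*y*real (card U) <= real m/10"
 shows "real (card U)*q*(1 - q + q*y)^(card U - 1)*(1 - exp (- (real m/4)))
  <= Ex U q (\<lambda>S. of_bool (card S <= m)*(real (card S)*y^(card S - 1)))"
proof -
 let ?u = "card U"
 have b: "1/2 <= 1 - q + q*y" using q y by (simp add: add_increasing2)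
 have "(1 - q + q*(2*y))^(?u - 1) <= ((1 - q + q*y)*exp (2*(q*y)))^(?u - 1)"
 proof (rule power_mono)
  have "0 <= 1 - q + q*(2*y)" using q y by (simp add: add_nonneg_nonneg)
  thus "0 <= 1 - q + q*(2*y)" .
  have "1/2*(2*(q*y)) <= (1 - q + q*y)*(2*(q*y))"
   using b q y by (intro mult_right_mono) auto
  hence "1 - q + q*(2*y) <= (1 - q + q*y)*(1 + 2*(q*y))"
   by (simp add: algebra_simps)
  also have "... <= (1 - q + q*y)*exp (2*(q*y))"
   using b by (intro mult_left_mono exp_ge_add_one_self) auto
  finally show "1 - q + q*(2*y) <= (1 - q + q*y)*exp (2*(q*y))" .
 qed
 also have "... = (1 - q + q*y)^(?u - 1)*exp (real (?u - 1)*(2*(q*y)))"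
  by (simp add: power_mult_distrib exp_of_nat_mult)
 also have "... <= (1 - q + q*y)^(?u - 1)*exp (real m/5)"
 proof -
  have "real (?u - 1)*(2*(q*y)) <= real ?u*(2*(q*y))"
   using q y by (intro mult_right_mono) auto
  also have "... <= real m/5" using m by (simp add: mult_ac)
  finally show ?thesis using b by (intro mult_left_mono) auto
 qed
 finally have tail: "(1 - q + q*(2*y))^(?u - 1) <= (1 - q + q*y)^(?u - 1)*exp (real m/5)" .
 have h: "(1/2)^m*exp (real m/5) <= exp (- (real m/4))"
 proof -
  have "(1/2 :: real)^m <= exp (- (1/2))^m" using half_le_exp by (intro power_mono) auto
  hence "(1/2)^m*exp (real m/5) <= exp (- (1/2))^m*exp (real m/5)" by simp
  also have "... = exp (- (real m/2) + real m/5)"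
   by (simp add: exp_of_nat_mult[symmetric] exp_add[symmetric])
  also have "... <= exp (- (real m/4))" by simp
  finally show ?thesis .
 qed
 have c: "0 <= real ?u*q*(1 - q + q*y)^(?u - 1)" using q b by simp
 have "real ?u*q*(1 - q + q*y)^(?u - 1)*(1 - exp (- (real m/4)))
  <= real ?u*q*(1 - q + q*y)^(?u - 1)*(1 - (1/2)^m*exp (real m/5))"
  using c h by (intro mult_left_mono) auto
 also have "... = real ?u*q*(1 - q + q*y)^(?u - 1) - (1/2)^m*(real ?u*q*((1 - q + q*y)^(?u - 1)*exp (real m/5)))"
  by (simp add: algebra_simps)
 also have "... <= real ?u*q*(1 - q + q*y)^(?u - 1) - (1/2)^m*(real ?u*q*(1 - q + q*(2*y))^(?u - 1))"
  using tail q by (intro diff_left_mono mult_left_mono) auto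
 also have "... = Ex U q (\<lambda>S. real (card S)*y^(card S - 1) - (1/2)^m*(real (card S)*(2*y)^(card S - 1)))"
  unfolding Ex_diff Ex_cmult Ex_card_pow[OF U] ..
 also have "... <= Ex U q (\<lambda>S. of_bool (card S <= m)*(real (card S)*y^(card S - 1)))"
 proof (rule Ex_mono)
  fix S
  show "real (card S)*y^(card S - 1) - (1/2)^m*(real (card S)*(2*y)^(card S - 1))
   <= of_bool (card S <= m)*(real (card S)*y^(card S - 1))"
  proof (cases "card S <= m")
   case True
   thus ?thesis using y by simp
  next
   case False
   hence "m <= card S - 1" by simp
   hence "(2::real)^m <= 2^(card S - 1)" by (intro power_increasing) auto
   hence "1 <= (1/2)^m*(2::real)^(card S - 1)" by (simp add: power_divide field_simps)
   hence "1*(real (card S)*y^(card S - 1)) <= ((1/2)^m*2^(card S - 1))*(real (card S)*y^(card S - 1))"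
    using y by (intro mult_right_mono) auto
   thus ?thesis using False by (simp add: power_mult_distrib mult_ac)
  qed
 qed (use q in auto)
 finally show ?thesis .
qed

lemma Run_nonneg:
 assumes "0 <= p" "p <= 1" "\<And>T U. 0 <= H T U"
 shows "0 <= Run p t H T U"
 by (induction t arbitrary: T U) (use assms step_prob[OF assms(1,2)] in \<open>auto intro!: Ex_nonneg\<close>)

text \<open>For the Poisson branching process the derivative at 0 of the \<open>k\<close>-th iterate
  of the generating function is \<open>lam ^ k\<close> times the product of the
  \<open>zit lam 0 i\<close>, and it is the probability that generation \<open>k\<close> is a single
  individual. Here \<open>cc\<close> replaces \<open>lam\<close>: its factors pay for depletion, for
  \<open>1 - (1 - p) ^ a\<close> against \<open>a * p\<close>, for the second-order term of a
  logarithm and for truncating levels at \<open>m\<close>.\<close>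

lemma Run_thin_lower:
 fixes n m u1 :: nat
 assumes p: "0 <= p" "p <= 1" "real m*p <= 1/2" and lam: "lam = real n*p" "1 <= m"
  and small: "\<And>i. lam*zit lam 0 i <= 1/10"
 defines "cc \<equiv> real u1*p*(1 - real m*p)*exp (- (2*real n*(real m*p)^2))*(1 - exp (- (real m/4)))"
 assumes "finite U" "card T <= m" "u1 + k*m <= card U" "card U <= n"
 shows "cc^k*(\<Prod>i\<in>{0<..k}. zit lam 0 i)*(real (card T)*zit lam 0 k^(card T - 1))
  <= Run p k (\<lambda>T U. of_bool (card T = 1 \<and> u1 <= card U)) T U"
 using assms(8-11)
proof (induction k arbitrary: T U)
 case 0
 thus ?case by (cases "card T") (auto simp: power_0_left)
next
 case (Suc k)
 let ?H = "\<lambda>T U. of_bool (card T = 1 \<and> u1 <= card U) :: real"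
 let ?y = "zit lam 0 k"
 let ?a = "real (card T)"
 let ?q = "1 - (1 - p)^card T"
 define B where "B = cc^k*(\<Prod>i\<in>{0<..k}. zit lam 0 i)"
 have lam0: "0 <= lam" using lam p by simp
 note y01 = zit_01[OF lam0 order_refl zero_le_one]
 have mp: "real m*p <= 1" using p by simp
 have cc0: "0 <= cc" unfolding cc_def using p mp lam by (intro mult_nonneg_nonneg) auto
 have B0: "0 <= B" unfolding B_def using cc0 y01 by (intro mult_nonneg_nonneg prod_nonneg) auto
 have q: "0 <= ?q" "?q <= 1" "?q <= ?a*p" using step_prob[OF p(1,2)] by auto
 have am: "?a*p <= real m*p" using Suc.prems p by (intro mult_right_mono) auto
 have q2: "?q <= 1/2" using q am p by linarith
 have un: "u1 <= card U" using Suc.prems by simp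
 have main: "cc*(?a*zit lam 0 (Suc k)^card T) <= Ex U ?q (\<lambda>S. of_bool (card S <= m)*(real (card S)*?y^(card S - 1)))"
 proof -
  have qlow: "?a*p*(1 - real m*p) <= ?q"
  proof -
   have "(1 - p)^card T*(1 + ?a*p) <= (1 - p)^card T*(1 + p)^card T"
    using p Bernoulli_inequality[of p "card T"] by (intro mult_left_mono) auto
   also have "... = ((1 - p)*(1 + p))^card T" by (simp add: power_mult_distrib)
   also have "... <= 1" using p mult_le_one[of p p] by (intro power_le_one) (auto simp: algebra_simps)
   finally have "(1 - p)^card T*(1 + ?a*p) <= 1" .
   hence "?a*p <= ?q*(1 + ?a*p)" by (simp add: algebra_simps)
   moreover have "?q*(1 + ?a*p) <= ?q + (?a*p)*(?a*p)"
    using q p mult_right_mono[OF q(3), of "?a*p"] by (simp add: algebra_simps)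
   moreover have "(?a*p)*(?a*p) <= (?a*p)*(real m*p)"
    using am p by (intro mult_left_mono) auto
   ultimately show ?thesis by (simp add: algebra_simps)
  qed
  define x where "x = ?a*p*(1 - ?y)"
  have x: "0 <= x" "x <= real m*p"
  proof -
   show "0 <= x" using p y01 by (simp add: x_def)
   have "x <= ?a*p*1" unfolding x_def using p y01[of k] by (intro mult_left_mono) auto
   with am show "x <= real m*p" by simp
  qed
  have base: "exp (- lam*(1 - ?y))^card T*exp (- (2*real n*(real m*p)^2)) <= (1 - ?q + ?q*?y)^(card U - 1)"
  proof -
   have "- x - 2*x^2 <= ln (1 - x)" using x p by (intro ln_one_minus_pos_lower_bound) auto
   hence "exp (- x - 2*x^2) <= 1 - x"
    using x p by (subst ln_ge_iff[symmetric]) linarith+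
   also have "1 - x <= 1 - ?q + ?q*?y"
    using mult_right_mono[OF q(3), of "1 - ?y"] y01 by (simp add: x_def algebra_simps)
   finally have e: "exp (- x - 2*x^2) <= 1 - ?q + ?q*?y" .
   have b1: "1 - ?q + ?q*?y <= 1" using mult_left_le[OF y01(2)[of k] q(1)] by linarith
   have "exp (- x - 2*x^2)^n <= (1 - ?q + ?q*?y)^n" using e by (intro power_mono) auto
   also have "... <= (1 - ?q + ?q*?y)^(card U - 1)"
    using b1 Suc.prems e by (intro power_decreasing) (auto intro: order_trans[OF exp_ge_zero])
   finally have "exp (- x - 2*x^2)^n <= (1 - ?q + ?q*?y)^(card U - 1)" .
   moreover have "exp (- lam*(1 - ?y))^card T*exp (- (2*real n*(real m*p)^2)) <= exp (- x - 2*x^2)^n"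
   proof -
    have "x^2 <= (real m*p)^2" using x by (intro power_mono) auto
    hence "real n*(2*x^2) <= 2*real n*(real m*p)^2" by (simp add: mult_left_mono)
    moreover have "real n*x = ?a*(lam*(1 - ?y))" by (simp add: x_def lam)
    ultimately show ?thesis
     by (simp add: exp_of_nat_mult[symmetric] exp_add[symmetric] algebra_simps)
   qed
   ultimately show ?thesis by linarith
  qed
  have e1: "exp (- (real m/4)) <= 1" by simp
  have "cc*(?a*zit lam 0 (Suc k)^card T)
    = (real u1*(?a*p*(1 - real m*p)))*(exp (- lam*(1 - ?y))^card T*exp (- (2*real n*(real m*p)^2)))*(1 - exp (- (real m/4)))"
   by (simp add: cc_def mult_ac)
  also have "... <= (real (card U)*?q)*(1 - ?q + ?q*?y)^(card U - 1)*(1 - exp (- (real m/4)))"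
   using un qlow base q e1 p mp y01
   by (intro mult_right_mono mult_mono) (auto intro!: mult_nonneg_nonneg simp: add_nonneg_nonneg)
  also have "... <= Ex U ?q (\<lambda>S. of_bool (card S <= m)*(real (card S)*?y^(card S - 1)))"
  proof (rule truncated_mean[OF Suc.prems(1) q(1) q2 y01])
   have "?q*?y*real (card U) <= (?a*p)*?y*real n"
    using q y01 Suc.prems p by (intro mult_mono mult_nonneg_nonneg) auto
   also have "... = ?a*(lam*?y)" by (simp add: lam)
   also have "... <= real m*(1/10)" using small[of k] Suc.prems lam0 y01 by (intro mult_mono) auto
   finally show "?q*?y*real (card U) <= real m/10" by simp
  qed
  finally show ?thesis .
 qed
 have "cc^Suc k*(\<Prod>i\<in>{0<..Suc k}. zit lam 0 i)*(?a*zit lam 0 (Suc k)^(card T - 1))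
   = B*(cc*(?a*zit lam 0 (Suc k)^card T))"
 proof -
  have "{0<..Suc k} = insert (Suc k) {0<..k}" by auto
  hence "(\<Prod>i\<in>{0<..Suc k}. zit lam 0 i) = zit lam 0 (Suc k)*(\<Prod>i\<in>{0<..k}. zit lam 0 i)" by simp
  thus ?thesis by (cases "card T") (simp_all add: B_def mult_ac del: zit.simps)
 qed
 also have "... <= B*Ex U ?q (\<lambda>S. of_bool (card S <= m)*(real (card S)*?y^(card S - 1)))"
  by (rule mult_left_mono[OF main B0])
 also have "... = Ex U ?q (\<lambda>S. B*(of_bool (card S <= m)*(real (card S)*?y^(card S - 1))))"
  by (rule Ex_cmult[symmetric])
 also have "... <= Run p (Suc k) ?H T U"
  unfolding Run.simps
 proof (rule Ex_mono[OF q(1,2)])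
  fix S assume S: "S \<subseteq> U"
  show "B*(of_bool (card S <= m)*(real (card S)*?y^(card S - 1))) <= Run p k ?H S (U - S)"
  proof (cases "card S <= m")
   case True
   have "card (U - S) = card U - card S"
    using S Suc.prems by (simp add: card_Diff_subset finite_subset)
   with True Suc.prems Suc.IH[of "U - S" S] show ?thesis by (simp add: B_def mult_ac)
  next
   case False
   have "0 <= Run p k ?H S (U - S)" by (rule Run_nonneg[OF p(1,2)]) simp
   with False show ?thesis by simp
  qed
 qed
 finally show ?case .
qed

section \<open>Exploring from several ends\<close>

lemma Ex_markov:
 assumes "0 <= q" "q <= 1" "0 < c" "\<And>X. X \<subseteq> A ==> 0 <= f X"
 shows "PE A q (\<lambda>X. c <= f X) <= Ex A q f/c"
proof -
 have "PE A q (\<lambda>X. c <= f X) <= Ex A q (\<lambda>X. f X*(1/c))"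
 proof (rule Ex_mono[OF assms(1,2)])
  fix X assume "X \<subseteq> A"
  thus "of_bool (c <= f X) <= f X*(1/c)" using assms(3) assms(4)[of X] by (auto simp: of_bool_def)
 qed
 thus ?thesis unfolding Ex_multc by simp
qed

text \<open>The sets \<open>B i\<close> are disjoint, so the events of missing them are independent
  and the variance of their number is at most its mean \<open>y\<close>; Chebyshev at distance
  \<open>y/2\<close> gives \<open>4/y\<close>.\<close>

lemma miss_chebyshev:
 assumes U: "finite U" and I: "finite I" and q: "0 <= q" "q <= 1"
  and B: "\<And>i. i \<in> I ==> B i \<subseteq> U" "\<And>i j. i \<in> I ==> j \<in> I ==> i \<noteq> j ==> B i \<inter> B j = {}"
 defines "y \<equiv> \<Sum>i\<in>I. (1 - q)^card (B i)"
 assumes y: "0 < y"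
 shows "PE U q (\<lambda>S. real (card {i \<in> I. S \<inter> B i = {}}) < y/2) <= 4/y"
proof -
 define Z where "Z S = (\<Sum>i\<in>I. of_bool (S \<inter> B i = {}) :: real)" for S
 have Zc: "real (card {i \<in> I. S \<inter> B i = {}}) = Z S" for S
 proof -
  have "{i \<in> I. S \<inter> B i = {}} = I \<inter> {i. S \<inter> B i = {}}" by auto
  thus ?thesis unfolding Z_def by (simp add: sum_of_bool_eq I)
 qed
 have EZ: "Ex U q Z = y" unfolding Z_def y_def Ex_sum
  by (intro sum.cong refl Ex_disjoint U B)
 have EZZ: "Ex U q (\<lambda>S. Z S*Z S) <= y^2 + y"
 proof -
  have "Ex U q (\<lambda>S. Z S*Z S) = (\<Sum>i\<in>I. \<Sum>j\<in>I. Ex U q (\<lambda>S. of_bool (S \<inter> B i = {}) * of_bool (S \<inter> B j = {})))"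
   unfolding Z_def sum_product Ex_sum ..
  also have "... <= (\<Sum>i\<in>I. \<Sum>j\<in>I. (1 - q)^card (B i)*(1 - q)^card (B j) + (if i = j then (1 - q)^card (B i) else 0))"
  proof (intro sum_mono)
   fix i j assume ij: "i \<in> I" "j \<in> I"
   show "Ex U q (\<lambda>S. of_bool (S \<inter> B i = {}) * of_bool (S \<inter> B j = {}))
    <= (1 - q)^card (B i)*(1 - q)^card (B j) + (if i = j then (1 - q)^card (B i) else 0)"
   proof (cases "i = j")
    case True
    have "Ex U q (\<lambda>S. of_bool (S \<inter> B i = {}) * of_bool (S \<inter> B j = {})) = PE U q (\<lambda>S. S \<inter> B i = {})"
     using True by (intro Ex_cong) simp
    also have "... = (1 - q)^card (B i)" by (rule Ex_disjoint[OF U B(1)[OF ij(1)]])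
    finally show ?thesis using True q by simp
   next
    case False
    have "Ex U q (\<lambda>S. of_bool (S \<inter> B i = {}) * of_bool (S \<inter> B j = {})) = PE U q (\<lambda>S. S \<inter> (B i \<union> B j) = {})"
     by (intro Ex_cong) (auto simp: of_bool_def)
    also have "... = (1 - q)^card (B i \<union> B j)" using B ij by (intro Ex_disjoint U) auto
    also have "card (B i \<union> B j) = card (B i) + card (B j)"
     using B ij False U by (intro card_Un_disjoint) (auto intro: finite_subset)
    finally show ?thesis using False by (simp add: power_add)
   qed
  qed
  also have "... = y^2 + y"
   using I by (simp add: sum.distrib power2_eq_square y_def sum_product)
  finally show ?thesis .
 qed
 have "PE U q (\<lambda>S. real (card {i \<in> I. S \<inter> B i = {}}) < y/2) <= Ex U q (\<lambda>S. ((Z S*Z S - 2*y*Z S) + y^2)*(4/y^2))"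
  unfolding Zc
 proof (rule Ex_mono[OF q])
  fix S
  have eq: "(Z S*Z S - 2*y*Z S) + y^2 = (y - Z S)^2" by (simp add: power2_eq_square algebra_simps)
  show "of_bool (Z S < y/2) <= ((Z S*Z S - 2*y*Z S) + y^2)*(4/y^2)"
   unfolding eq
  proof (cases "Z S < y/2")
   case True
   hence "(y/2)^2 <= (y - Z S)^2" using y by (intro power_mono) auto
   hence "1 <= (y - Z S)^2*(4/y^2)" using y by (simp add: field_simps power2_eq_square)
   thus "of_bool (Z S < y/2) <= (y - Z S)^2*(4/y^2)" using True by simp
  qed simp
 qed
 also have "... = (Ex U q (\<lambda>S. Z S*Z S) - 2*y*Ex U q Z + y^2)*(4/y^2)"
  unfolding Ex_multc Ex_add Ex_diff Ex_cmult using U by simp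
 also have "... <= y*(4/y^2)"
  using EZZ EZ y by (intro mult_right_mono) (auto simp: power2_eq_square)
 also have "... = 4/y" using y by (simp add: power2_eq_square)
 finally show ?thesis .
qed

lemma geo_sum_le:
 fixes lam :: real
 assumes "2 <= lam"
 shows "(\<Sum>i<t. lam^i) <= lam^t"
proof (induction t)
 case (Suc t)
 have "(\<Sum>i<Suc t. lam^i) <= 2*lam^t" using Suc by simp
 also have "... <= lam*lam^t" using assms by (intro mult_right_mono) auto
 finally show ?case by simp
qed simp

lemma geo_sum_le2:
 fixes lam :: real
 assumes "2 <= lam"
 shows "lam*(\<Sum>i<t. lam^i) <= 2*lam^t"
proof (cases t)
 case (Suc t')
 have "(\<Sum>i<Suc t'. lam^i) <= 2*lam^t'" using geo_sum_le[OF assms, of t'] by simp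
 hence "lam*(\<Sum>i<Suc t'. lam^i) <= lam*(2*lam^t')" using assms by (intro mult_left_mono) auto
 thus ?thesis by (simp add: Suc)
qed simp

lemma hit_prob:
 assumes "finite T" "finite U" "T \<inter> U = {}" "0 <= p" "p <= 1" "real (card U)*p <= lam" "2 <= lam" "Q \<subseteq> U"
 shows "Ex (pr (T \<union> U)) p (\<lambda>E. real (card (Q - rs E T U t))) <= real (card Q)*real (card T)*p*(\<Sum>i<t. lam^i)"
  and "PE (pr (T \<union> U)) p (\<lambda>E. \<not> Q \<subseteq> rs E T U t) <= real (card Q)*real (card T)*p*lam^t"
proof -
 have "Ex (pr (T \<union> U)) p (\<lambda>E. real (card (Q - rs E T U t))) = Run p t (\<lambda>_ U'. real (card (Q - U'))) T U"
  by (rule Run_ex'[OF assms(1-3)])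
 also have "... <= real (card Q)*real (card T)*p*(\<Sum>i<t. lam^i)"
  by (rule Run_hit) (use assms in auto)
 finally show A: "Ex (pr (T \<union> U)) p (\<lambda>E. real (card (Q - rs E T U t))) <= real (card Q)*real (card T)*p*(\<Sum>i<t. lam^i)" .
 also have "... <= real (card Q)*real (card T)*p*lam^t"
  using assms by (intro mult_left_mono geo_sum_le) auto
 finally have *: "Ex (pr (T \<union> U)) p (\<lambda>E. real (card (Q - rs E T U t))) <= real (card Q)*real (card T)*p*lam^t" .
 have finQ: "finite Q" using assms finite_subset by auto
 have "PE (pr (T \<union> U)) p (\<lambda>E. \<not> Q \<subseteq> rs E T U t) <= Ex (pr (T \<union> U)) p (\<lambda>E. real (card (Q - rs E T U t)))"
 proof (rule Ex_mono[OF assms(4,5)])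
  fix E
  show "of_bool (\<not> Q \<subseteq> rs E T U t) <= real (card (Q - rs E T U t))"
  proof (cases "Q \<subseteq> rs E T U t")
   case False
   hence "0 < card (Q - rs E T U t)" using finQ by (auto simp: card_gt_0_iff)
   thus ?thesis by simp
  qed simp
 qed
 with * show "PE (pr (T \<union> U)) p (\<lambda>E. \<not> Q \<subseteq> rs E T U t) <= real (card Q)*real (card T)*p*lam^t"
  by linarith
qed

lemma rs_mono_time: "T \<inter> U = {} ==> t <= t' ==> rs E T U t' \<subseteq> rs E T U t"
 by (simp add: lev_char(1)) (auto intro: order_trans)

text \<open>The triangle inequality: centres more than \<open>2 * t\<close> apart have disjoint
  balls of radius \<open>t\<close>.\<close>

lemma balls_disjoint:
 assumes N: "A \<subseteq> U" "B \<subseteq> U" "B \<subseteq> rs E A (U - A) (2*t)"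
 shows "(U - rs E A (U - A) t) \<inter> (U - rs E B (U - B) t) = {}"
proof (rule ccontr)
 assume "\<not> ?thesis"
 then obtain u where u: "u \<in> U" "u \<notin> rs E A (U - A) t" "u \<notin> rs E B (U - B) t" by blast
 define R where "R = adj_rel (E \<inter> pr U)"
 have near: "\<exists>k\<le>t. \<exists>v\<in>X. (v, u) \<in> R ^^ k" if X: "X \<subseteq> U" "u \<notin> rs E X (U - X) t" for X
 proof (cases "u \<in> X")
  case True
  hence "0 <= t \<and> (\<exists>v\<in>X. (v, u) \<in> R ^^ 0)" by simp
  thus ?thesis by blast
 next
  case False
  have XU: "X \<union> (U - X) = U" using X(1) by auto
  have dj: "X \<inter> (U - X) = {}" by simp
  have "rs E X (U - X) t = {u \<in> U - X. \<forall>k\<le>t. \<forall>v\<in>X. (v, u) \<notin> R ^^ k}"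
   using lev_char(1)[OF dj, of E t] unfolding XU R_def .
  with X(2) u(1) False show ?thesis by blast
 qed
 obtain k v where k: "k <= t" "v \<in> A" "(v, u) \<in> R ^^ k" using near[OF N(1) u(2)] by blast
 obtain j w where j: "j <= t" "w \<in> B" "(w, u) \<in> R ^^ j" using near[OF N(2) u(3)] by blast
 have "(v, w) \<in> R ^^ (k + j)"
 proof (rule relpow_add_I[OF k(3)])
  show "(u, w) \<in> R ^^ j" using j(3) unfolding R_def by (rule relpow_adj_sym)
 qed
 moreover have "k + j <= 2*t" using k j by simp
 moreover have "w \<in> rs E A (U - A) (2*t)" using N(3) j by blast
 moreover have "rs E A (U - A) (2*t) = {u \<in> U - A. \<forall>k\<le>2*t. \<forall>v\<in>A. (v, u) \<notin> R ^^ k}"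
 proof -
  have AU: "A \<union> (U - A) = U" using N(1) by auto
  have dj: "A \<inter> (U - A) = {}" by simp
  show ?thesis using lev_char(1)[OF dj, of E "2*t"] unfolding AU R_def .
 qed
 ultimately show False using k(2) by blast
qed

lemma rs_Int_pr: "N \<subseteq> U ==> rs (E \<inter> pr U) N (U - N) t = rs E N (U - N) t"
 by (subst lev_Int_pr) auto

text \<open>Index 0 is reserved for the set explored first, and \<open>S\<close> will be the level
  following its \<open>t1\<close> levels. That the ball of \<open>acc ! i\<close> also avoids the
  other \<open>acc ! m\<close> is what keeps the remaining ends out of the way in
  \<open>far_pair\<close>.\<close>

definition miss_cnt :: "nat => nat => 'a set list => 'a set => 'a set => 'a set set => nat set" where
 "miss_cnt t2 l acc S U E = {i \<in> {1..l}. (\<forall>m\<in>{1..l} - {i}. acc ! m \<subseteq> rs E (acc ! i) (U - acc ! i) t2)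
   \<and> S \<inter> (U - rs E (acc ! i) (U - acc ! i) t2) = {}}"

text \<open>Three causes for few misses: two of the sets are within \<open>2 * t2\<close> of each
  other (first moment), half of the balls exceed \<open>b\<close> vertices (Markov twice), or the
  disjoint small balls are hit too often although each is missed with probability at least
  \<open>rho\<close> (Chebyshev). The level after \<open>T\<close> depends on pairs leaving
  \<open>T\<close>, the balls on pairs inside \<open>U\<close>, so the two are independent.\<close>

lemma miss_inner:
 assumes fin: "finite T" "finite U" "T \<inter> U = {}" and p: "0 <= p" "p < 1" and lam: "real (card U)*p <= lam" "2 <= lam"
  and acc: "\<And>i. i \<in> {1..l} ==> acc ! i \<subseteq> U" "\<And>i. i \<in> {1..l} ==> card (acc ! i) <= J"
  and dis: "\<And>i m. i \<in> {1..l} ==> m \<in> {1..l} ==> i \<noteq> m ==> acc ! m \<inter> acc ! i = {}"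
  and T: "card T <= a" and l: "1 <= l" and b: "1 <= b"
 defines "rho \<equiv> (1 - p)^(a * b)"
 shows "PE (pr (T \<union> U)) p (\<lambda>E. real (card (miss_cnt t2 l acc (nb E T U) U E)) < real l*rho/4)
  <= real l^2*real J^2*p*lam^(2*t2) + 2*(real J + 2*real J*lam^t2)/real b + 8/(real l*rho)" (is "_ <= ?rhs")
proof -
 let ?pi = "1 - (1 - p)^card T"
 let ?c = "real l*rho/4"
 let ?few = "\<lambda>S E. real (card (miss_cnt t2 l acc S U E)) < ?c" and ?rs = "\<lambda>E i. rs E (acc ! i) (U - acc ! i)"
 have p1: "p <= 1" using p by simp
 have pi: "0 <= ?pi" "?pi <= 1" using step_prob[OF p(1) p1] by auto
 have rho: "0 < rho" using p by (simp add: rho_def)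
 have finacc: "finite (acc ! i)" if "i \<in> {1..l}" for i using acc(1)[OF that] fin(2) finite_subset by blast
 define R2 where "R2 E i = ?rs E i t2" for E i
 define bad where "bad E \<longleftrightarrow> (\<exists>i\<in>{1..l}. \<exists>m\<in>{1..l} - {i}. \<not> acc ! m \<subseteq> ?rs E i (2*t2))" for E
 define tame where "tame E = {i \<in> {1..l}. card (U - R2 E i) <= b}" for E
 have one: "PE U ?pi (\<lambda>S. ?few S E) <= 8/(real l*rho)"
  if ok: "\<not> bad E" "real l/2 <= real (card (tame E))" for E
 proof -
  let ?B = "\<lambda>i. U - R2 E i"
  define y where "y = (\<Sum>i\<in>tame E. (1 - ?pi)^card (?B i))"
  have I: "finite (tame E)" "tame E \<subseteq> {1..l}" by (auto simp: tame_def)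
  have Bd: "?B i \<inter> ?B j = {}" if "i \<in> tame E" "j \<in> tame E" "i \<noteq> j" for i j
  proof -
   have ij: "i \<in> {1..l}" "j \<in> {1..l}" using that I(2) by blast+
   have "acc ! j \<subseteq> ?rs E i (2*t2)"
    using ok(1) ij that(3) unfolding bad_def by blast
   with ij show ?thesis unfolding R2_def by (intro balls_disjoint acc(1))
  qed
  have each: "rho <= (1 - ?pi)^card (?B i)" if "i \<in> tame E" for i
  proof -
   have "card T*card (?B i) <= a * b" using that T by (intro mult_mono) (auto simp: tame_def)
   hence "(1 - p)^(a * b) <= (1 - p)^(card T*card (?B i))" using p by (intro power_decreasing) auto
   thus ?thesis by (simp add: rho_def power_mult)
  qed
  have "real (card (tame E))*rho <= y"
   unfolding y_def using sum_mono[of "tame E" "\<lambda>_. rho", OF each] by simp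
  moreover have "real l/2*rho <= real (card (tame E))*rho" using ok(2) rho by (intro mult_right_mono) auto
  ultimately have ylow: "real l*rho/2 <= y" by simp
  have y0: "0 < y" using ylow rho l by (intro less_le_trans[OF _ ylow]) auto
  have "PE U ?pi (\<lambda>S. ?few S E)
   <= PE U ?pi (\<lambda>S. real (card {i \<in> tame E. S \<inter> ?B i = {}}) < y/2)"
  proof (rule Ex_mono[OF pi], rule of_bool_le)
   fix S assume less: "?few S E"
   have "{i \<in> tame E. S \<inter> ?B i = {}} \<subseteq> miss_cnt t2 l acc S U E"
   proof
    fix i assume i: "i \<in> {i \<in> tame E. S \<inter> ?B i = {}}"
    have "acc ! m \<subseteq> ?rs E i t2" if "m \<in> {1..l} - {i}" for m
    proof -
     have "acc ! m \<subseteq> ?rs E i (2*t2)"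
      using ok(1) i that by (auto simp: bad_def tame_def)
     also have "... \<subseteq> ?rs E i t2" by (rule rs_mono_time) auto
     finally show ?thesis .
    qed
    with i show "i \<in> miss_cnt t2 l acc S U E" by (auto simp: miss_cnt_def tame_def R2_def)
   qed
   hence "card {i \<in> tame E. S \<inter> ?B i = {}} <= card (miss_cnt t2 l acc S U E)"
    by (intro card_mono) (auto simp: miss_cnt_def)
   with less ylow show "real (card {i \<in> tame E. S \<inter> ?B i = {}}) < y/2" by linarith
  qed
  also have "... <= 4/y"
   unfolding y_def
   by (rule miss_chebyshev[OF fin(2) I(1) pi]) (use Bd y0 in \<open>auto simp: y_def\<close>)
  also have "... <= 4/(real l*rho/2)" using ylow y0 rho l by (intro divide_left_mono) auto
  finally show ?thesis by simp
 qed
 have "PE (pr (T \<union> U)) p (\<lambda>E. ?few (nb E T U) E)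
  = PE (pr (T \<union> U)) p (\<lambda>E. ?few (nb E T U) (E \<inter> pr U))"
 proof (rule Ex_cong)
  fix E
  have "miss_cnt t2 l acc S U (E \<inter> pr U) = miss_cnt t2 l acc S U E" for S
   unfolding miss_cnt_def using rs_Int_pr[OF acc(1), of _ E t2] by (intro Collect_cong conj_cong) simp_all
  thus "of_bool (?few (nb E T U) E)
   = (of_bool (?few (nb E T U) (E \<inter> pr U)) :: real)" by simp
 qed
 also have "... = Ex U ?pi (\<lambda>S. PE (pr U) p (\<lambda>E. ?few S E))"
  by (rule peel[OF fin])
 also have "... = Ex (pr U) p (\<lambda>E. PE U ?pi (\<lambda>S. ?few S E))"
  by (rule Ex_swap)
 also have "... <= Ex (pr U) p (\<lambda>E. of_bool (bad E) + of_bool (real l/2 <= real (card ({1..l} - tame E))) + 8/(real l*rho))"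
 proof (rule Ex_mono[OF p(1) p1])
  fix E
  have le1: "PE U ?pi (\<lambda>S. ?few S E) <= 1"
   by (rule Ex_le_const[OF fin(2) pi]) auto
  have nn: "0 <= 8/(real l*rho)" using rho by simp
  show "PE U ?pi (\<lambda>S. ?few S E)
   <= of_bool (bad E) + of_bool (real l/2 <= real (card ({1..l} - tame E))) + 8/(real l*rho)"
  proof (cases "bad E \<or> real l/2 <= real (card ({1..l} - tame E))")
   case True
   hence "(1::real) <= of_bool (bad E) + of_bool (real l/2 <= real (card ({1..l} - tame E)))"
    by (auto simp: of_bool_def)
   with le1 nn show ?thesis by linarith
  next
   case False
   have "card ({1..l} - tame E) = l - card (tame E)"
   proof -
    have "tame E \<subseteq> {1..l}" by (auto simp: tame_def)
    thus ?thesis using card_Diff_subset[of "tame E" "{1..l}"] finite_subset[of "tame E" "{1..l}"] by simp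
   qed
   moreover have "card (tame E) <= l"
   proof -
    have "tame E \<subseteq> {1..l}" by (auto simp: tame_def)
    hence "card (tame E) <= card {1..l}" by (rule card_mono[rotated]) simp
    thus ?thesis by simp
   qed
   ultimately have "real l/2 <= real (card (tame E))" using False by (simp add: of_nat_diff)
   with one[of E] False show ?thesis by simp
  qed
 qed
 also have "... = PE (pr U) p (\<lambda>E. bad E) + PE (pr U) p (\<lambda>E. real l/2 <= real (card ({1..l} - tame E))) + 8/(real l*rho)"
  unfolding Ex_add using fin by simp
 also have "... <= ?rhs"
 proof (intro add_mono order_refl)
  have hit: "Ex (pr U) p (\<lambda>E. real (card (Q - ?rs E i t))) <= real (card Q)*real J*p*(\<Sum>i<t. lam^i)"
   "PE (pr U) p (\<lambda>E. \<not> Q \<subseteq> ?rs E i t) <= real (card Q)*real J*p*lam^t"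
   if i: "i \<in> {1..l}" and Q: "Q \<subseteq> U - acc ! i" for Q i t
  proof -
   have N: "acc ! i \<union> (U - acc ! i) = U" using acc(1)[OF i] by auto
   have "real (card (U - acc ! i))*p <= real (card U)*p"
    using p fin(2) by (intro mult_right_mono) (auto intro: card_mono)
   hence L: "real (card (U - acc ! i))*p <= lam" using lam(1) by linarith
   have "real (card Q)*real (card (acc ! i))*p*lam^t <= real (card Q)*real J*p*lam^t"
    using acc(2)[OF i] p lam by (intro mult_right_mono mult_left_mono) auto
   moreover have "real (card Q)*real (card (acc ! i))*p*(\<Sum>i<t. lam^i) <= real (card Q)*real J*p*(\<Sum>i<t. lam^i)"
    using acc(2)[OF i] p lam by (intro mult_right_mono mult_left_mono sum_nonneg) auto
   ultimately show "Ex (pr U) p (\<lambda>E. real (card (Q - ?rs E i t))) <= real (card Q)*real J*p*(\<Sum>i<t. lam^i)"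
   "PE (pr U) p (\<lambda>E. \<not> Q \<subseteq> ?rs E i t) <= real (card Q)*real J*p*lam^t"
    using hit_prob[of "acc ! i" "U - acc ! i" p lam Q t] finacc[OF i] fin(2) p L lam(2) Q unfolding N by auto
  qed
  have "PE (pr U) p (\<lambda>E. bad E) <= (\<Sum>i\<in>{1..l}. \<Sum>m\<in>{1..l} - {i}. PE (pr U) p (\<lambda>E. \<not> acc ! m \<subseteq> ?rs E i (2*t2)))"
   unfolding bad_def
   by (intro order_trans[OF Ex_Bex_le[OF _ p(1) p1]] sum_mono Ex_Bex_le[OF _ p(1) p1]) auto
  also have "... <= (\<Sum>i\<in>{1..l}. \<Sum>m\<in>{1..l} - {i}. real J*real J*p*lam^(2*t2))"
  proof (intro sum_mono)
   fix i m assume im: "i \<in> {1..l}" "m \<in> {1..l} - {i}"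
   show "PE (pr U) p (\<lambda>E. \<not> acc ! m \<subseteq> ?rs E i (2*t2)) <= real J*real J*p*lam^(2*t2)"
   proof -
    have "PE (pr U) p (\<lambda>E. \<not> acc ! m \<subseteq> ?rs E i (2*t2)) <= real (card (acc ! m))*real J*p*lam^(2*t2)"
     using im acc(1)[of m] dis[of i m] by (intro hit(2)) auto
    also have "... <= real J*real J*p*lam^(2*t2)"
     using acc(2)[of m] im p lam by (intro mult_right_mono) auto
    finally show ?thesis .
   qed
  qed
  also have "... <= (\<Sum>i\<in>{1..l}. \<Sum>m\<in>{1..l}. real J*real J*p*lam^(2*t2))"
   using p lam by (intro sum_mono sum_mono2) auto
  also have "... = real l^2*real J^2*p*lam^(2*t2)" by (simp add: power2_eq_square)
  finally show "PE (pr U) p (\<lambda>E. bad E) <= real l^2*real J^2*p*lam^(2*t2)" .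
  show "PE (pr U) p (\<lambda>E. real l/2 <= real (card ({1..l} - tame E))) <= 2*(real J + 2*real J*lam^t2)/real b"
  proof -
   let ?d = "(real J + 2*real J*lam^t2)/real b"
   have each: "PE (pr U) p (\<lambda>E. i \<notin> tame E) <= ?d" if i: "i \<in> {1..l}" for i
   proof -
    let ?X = "\<lambda>E. (U - acc ! i) - R2 E i"
    have "PE (pr U) p (\<lambda>E. i \<notin> tame E) <= PE (pr U) p (\<lambda>E. real b <= real J + real (card (?X E)))"
    proof (rule Ex_mono[OF p(1) p1], rule of_bool_le)
     fix E assume "i \<notin> tame E"
     hence "b < card (U - R2 E i)" using i by (simp add: tame_def)
     also have "... <= card (acc ! i \<union> ?X E)" using fin(2) finacc[OF i] by (intro card_mono) auto
     also have "... <= card (acc ! i) + card (?X E)" by (rule card_Un_le)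
     finally show "real b <= real J + real (card (?X E))" using acc(2)[OF i] by linarith
    qed
    also have "... <= Ex (pr U) p (\<lambda>E. real J + real (card (?X E)))/real b"
     using p b by (intro Ex_markov) auto
    also have "Ex (pr U) p (\<lambda>E. real J + real (card (?X E))) = real J + Ex (pr U) p (\<lambda>E. real (card (?X E)))"
     unfolding Ex_add using fin by simp
    also have "Ex (pr U) p (\<lambda>E. real (card (?X E))) <= real (card (U - acc ! i))*real J*p*(\<Sum>i<t2. lam^i)"
     unfolding R2_def by (rule hit(1)[OF i]) simp
    also have "... <= real (card U)*real J*p*(\<Sum>i<t2. lam^i)"
     using fin(2) p lam by (intro mult_right_mono sum_nonneg) (auto intro: card_mono)
    also have "... = (real (card U)*p)*(real J*(\<Sum>i<t2. lam^i))" by (simp add: mult_ac)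
    also have "... <= lam*(real J*(\<Sum>i<t2. lam^i))"
     using lam by (intro mult_right_mono mult_nonneg_nonneg sum_nonneg) auto
    also have "... = real J*(lam*(\<Sum>i<t2. lam^i))" by (simp add: mult_ac)
    also have "... <= real J*(2*lam^t2)" by (intro mult_left_mono geo_sum_le2 lam) auto
    finally show ?thesis using b by (simp add: divide_right_mono mult_ac)
   qed
   have cnt: "real (card ({1..l} - tame E)) = (\<Sum>i\<in>{1..l}. of_bool (i \<notin> tame E))" for E
   proof -
    have "{1..l} - tame E = {1..l} \<inter> {i. i \<notin> tame E}" by auto
    thus ?thesis by (simp add: sum_of_bool_eq)
   qed
   have "PE (pr U) p (\<lambda>E. real l/2 <= real (card ({1..l} - tame E)))
    <= Ex (pr U) p (\<lambda>E. real (card ({1..l} - tame E)))/(real l/2)"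
    using p l by (intro Ex_markov) auto
   also have "Ex (pr U) p (\<lambda>E. real (card ({1..l} - tame E))) = (\<Sum>i\<in>{1..l}. PE (pr U) p (\<lambda>E. i \<notin> tame E))"
    unfolding cnt Ex_sum ..
   also have "... <= (\<Sum>i\<in>{1..l}. ?d)" by (rule sum_mono) (rule each)
   also have ".../(real l/2) = 2*(real J + 2*real J*lam^t2)/real b" using l by simp
   finally show ?thesis using l by (simp add: divide_right_mono)
  qed
 qed
 finally show ?thesis .
qed

text \<open>The missed set must in addition be connected to \<open>acc ! 0\<close>, since pairs at
  infinite distance do not count for the diameter.\<close>

definition core_good :: "nat => nat => nat => 'a set list => 'a set => 'a set set => bool" where
 "core_good t1 t2 l acc W E \<longleftrightarrow> (let L = lv E (acc ! 0) (W - acc ! 0) t1; R = rs E (acc ! 0) (W - acc ! 0) t1 in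
   (\<forall>m\<in>{1..l}. acc ! m \<subseteq> R) \<and> (\<exists>i\<in>miss_cnt t2 l acc (nb E L R) R E.
    \<exists>u\<in>acc ! 0. \<exists>u'\<in>acc ! i. (u, u') \<in> (adj_rel (E \<inter> pr W))\<^sup>*))"

text \<open>Added to \<open>miss_inner\<close> are the events that the first exploration runs into
  another set or grows beyond \<open>a\<close>, and that too many indices are disconnected from
  index 0. The latter number is compared with the guaranteed \<open>l * rho / 4\<close> missed
  indices, whence the factor \<open>4 / rho\<close>.\<close>

lemma core_bound:
 assumes W: "finite W" and p: "0 <= p" "p < 1" and lam: "real (card W)*p <= lam" "2 <= lam"
  and acc: "acc_ok J acc W" "length acc = Suc l" and l: "1 <= l" and ab: "1 <= a" "1 <= b"
  and dd: "\<And>u u'. u \<in> W ==> u' \<in> W ==> u \<noteq> u' ==>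
   PE (pr W) p (\<lambda>E. (u, u') \<notin> (adj_rel (E \<inter> pr W))\<^sup>*) <= dd"
 defines "rho \<equiv> (1 - p)^(a * b)"
 shows "PE (pr W) p (\<lambda>E. \<not> core_good t1 t2 l acc W E)
  <= real l*real J^2*p*lam^t1 + lam^t1*real J/real a
   + (real l^2*real J^2*p*lam^(2*t2) + 2*(real J + 2*real J*lam^t2)/real b + 8/(real l*rho))
   + 4*dd/rho"
proof -
 let ?N = "acc ! 0"
 let ?L = "\<lambda>E. lv E ?N (W - ?N) t1" and ?R = "\<lambda>E. rs E ?N (W - ?N) t1"
 let ?Q = "\<Union>m\<in>{1..l}. acc ! m"
 let ?K = "real l^2*real J^2*p*lam^(2*t2) + 2*(real J + 2*real J*lam^t2)/real b + 8/(real l*rho)"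
 let ?c = "real l*rho/4"
 let ?G = "\<lambda>E. ?Q \<subseteq> ?R E \<and> card (?L E) <= a \<and> real (card (miss_cnt t2 l acc (nb E (?L E) (?R E)) (?R E) E)) < ?c"
 have p1: "p <= 1" using p by simp
 have rho: "0 < rho" using p by (simp add: rho_def)
 have c0: "0 < ?c" using rho l by simp
 have accm: "acc ! m \<subseteq> W" "acc ! m \<noteq> {}" "card (acc ! m) <= J" if "m <= l" for m
  using acc that by (auto simp: acc_ok_def)
 have accd: "acc ! m \<inter> acc ! i = {}" if "i <= l" "m <= l" "i \<noteq> m" for i m
 proof (cases "i < m")
  case True
  thus ?thesis using acc that unfolding acc_ok_def by auto
 next
  case False
  hence "m < i" using that by simp
  hence "acc ! i \<inter> acc ! m = {}" using acc that unfolding acc_ok_def by auto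
  thus ?thesis by (simp add: Int_commute)
 qed
 have NW: "?N \<union> (W - ?N) = W" using accm[of 0] by auto
 have fin: "finite ?N" "finite (W - ?N)" using W accm(1)[of 0] finite_subset by auto
 have QW: "?Q \<subseteq> W - ?N" using accm accd[of 0] by (fastforce simp: Int_commute)
 have cQ: "card ?Q <= l*J"
 proof -
  have "card ?Q <= (\<Sum>m\<in>{1..l}. card (acc ! m))" by (rule card_UN_le) simp
  also have "... <= (\<Sum>m\<in>{1..l}. J)" by (intro sum_mono accm(3)) simp
  finally show ?thesis by simp
 qed
 have cWN: "real (card (W - ?N))*p <= lam"
 proof -
  have "real (card (W - ?N))*p <= real (card W)*p" using W p by (intro mult_right_mono) (auto intro: card_mono)
  with lam show ?thesis by linarith
 qed
 have K0: "0 <= ?K" using p lam rho by (intro add_nonneg_nonneg) auto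
 define disc where "disc E = {i \<in> {1..l}. \<forall>u\<in>?N. \<forall>u'\<in>acc ! i. (u, u') \<notin> (adj_rel (E \<inter> pr W))\<^sup>*}" for E
 have b1: "PE (pr W) p (\<lambda>E. \<not> ?Q \<subseteq> ?R E) <= real l*real J^2*p*lam^t1"
 proof -
  have "PE (pr W) p (\<lambda>E. \<not> ?Q \<subseteq> ?R E) <= real (card ?Q)*real (card ?N)*p*lam^t1"
   using hit_prob(2)[OF fin _ p(1) p1 cWN lam(2) QW, of t1] unfolding NW by simp
  also have "... <= real (l*J)*real J*p*lam^t1"
  proof -
   have "0 <= lam^t1" using lam by simp
   thus ?thesis
    using cQ accm(3)[of 0] p by (intro mult_right_mono mult_mono) (auto simp only: of_nat_le_iff of_nat_0_le_iff)
  qed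
  finally show ?thesis by (simp add: power2_eq_square mult_ac)
 qed
 have b2: "PE (pr W) p (\<lambda>E. real a <= real (card (?L E))) <= lam^t1*real J/real a"
 proof -
  have "PE (pr W) p (\<lambda>E. real a <= real (card (?L E))) <= Ex (pr W) p (\<lambda>E. real (card (?L E)))/real a"
   using p ab by (intro Ex_markov) auto
  also have "Ex (pr W) p (\<lambda>E. real (card (?L E))) = Run p t1 (\<lambda>T _. real (card T)) ?N (W - ?N)"
   using Run_ex'[OF fin, of p "\<lambda>T _. real (card T)" t1] unfolding NW by simp
  also have "... <= lam^t1*real (card ?N)" by (rule Run_card_level[OF p(1) p1 fin(2) cWN])
  also have "... <= lam^t1*real J" using accm(3)[of 0] lam by (intro mult_left_mono) auto
  finally show ?thesis using ab by (simp add: divide_right_mono)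
 qed
 have b3: "PE (pr W) p (\<lambda>E. ?G E) <= ?K"
 proof -
  define G where "G T U E = (of_bool (?Q \<subseteq> U \<and> card T <= a \<and> real (card (miss_cnt t2 l acc (nb E T U) U E)) < ?c) :: real)" for T U E
  have "PE (pr W) p (\<lambda>E. ?G E)
   = Ex (pr W) p (\<lambda>E. G (?L E) (?R E) (E \<inter> pr (?L E \<union> ?R E)))"
  proof (rule Ex_cong)
   fix E
   have d: "?L E \<inter> ?R E = {}" by (rule lev_sub(3)) auto
   have n: "nb (E \<inter> pr (?L E \<union> ?R E)) (?L E) (?R E) = nb E (?L E) (?R E)" using d by (intro nb_Int_pr) auto
   have m: "miss_cnt t2 l acc S (?R E) (E \<inter> pr (?L E \<union> ?R E)) = miss_cnt t2 l acc S (?R E) E" if Q: "?Q \<subseteq> ?R E" for S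
   proof -
    have "rs (E \<inter> pr (?L E \<union> ?R E)) (acc ! i) (?R E - acc ! i) t2 = rs E (acc ! i) (?R E - acc ! i) t2" if "i \<in> {1..l}" for i
    proof -
     have "acc ! i \<subseteq> ?R E" using Q that by blast
     thus ?thesis by (subst lev_Int_pr) auto
    qed
    thus ?thesis unfolding miss_cnt_def by (intro Collect_cong conj_cong) simp_all
   qed
   show "of_bool (?G E)
    = G (?L E) (?R E) (E \<inter> pr (?L E \<union> ?R E))"
    unfolding G_def n using m by (intro arg_cong[where f = of_bool] conj_cong refl) simp
  qed
  also have "... = Run p t1 (\<lambda>T U. Ex (pr (T \<union> U)) p (G T U)) ?N (W - ?N)"
   using Run_ex[OF fin, of p G t1] unfolding NW by simp
  also have "... <= Run p t1 (\<lambda>_ _. ?K) ?N (W - ?N)"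
  proof (rule Run_mono[OF p(1) p1])
   fix T U assume TU: "T \<subseteq> ?N \<union> (W - ?N)" "U \<subseteq> W - ?N" "T \<inter> U = {}"
   have f: "finite T" "finite U" using TU fin by (auto intro: finite_subset)
   show "Ex (pr (T \<union> U)) p (G T U) <= ?K"
   proof (cases "?Q \<subseteq> U \<and> card T <= a")
    case False
    hence no: "(?Q \<subseteq> U \<and> card T <= a \<and> X) = False" for X by blast
    have "G T U = (\<lambda>_. 0)" unfolding G_def no by simp
    with K0 f show ?thesis by simp
   next
    case True
    have "real (card U)*p <= real (card W)*p"
     using TU W p by (intro mult_right_mono) (auto intro: card_mono)
    hence cU: "real (card U)*p <= lam" using lam by linarith
    have "Ex (pr (T \<union> U)) p (G T U) = PE (pr (T \<union> U)) p (\<lambda>E. real (card (miss_cnt t2 l acc (nb E T U) U E)) < ?c)"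
     using True by (intro Ex_cong) (simp add: G_def)
    also have "... <= ?K"
     unfolding rho_def
    proof (rule miss_inner[OF f TU(3) p cU lam(2)])
     show "acc ! i \<subseteq> U" if "i \<in> {1..l}" for i using True that by blast
     show "card (acc ! i) <= J" if "i \<in> {1..l}" for i using accm(3)[of i] that by simp
     show "acc ! m \<inter> acc ! i = {}" if "i \<in> {1..l}" "m \<in> {1..l}" "i \<noteq> m" for i m
      using accd[of i m] that by simp
    qed (use True l ab in auto)
    finally show ?thesis .
   qed
  qed auto
  also have "... = ?K" by (rule Run_const[OF fin(2)])
  finally show ?thesis .
 qed
 have b4: "PE (pr W) p (\<lambda>E. ?c <= real (card (disc E))) <= 4*dd/rho"
 proof -
  have "PE (pr W) p (\<lambda>E. ?c <= real (card (disc E))) <= Ex (pr W) p (\<lambda>E. real (card (disc E)))/?c"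
   using p c0 by (intro Ex_markov) auto
  also have "Ex (pr W) p (\<lambda>E. real (card (disc E))) <= real l*dd"
  proof -
   define Pd where "Pd i E \<longleftrightarrow> (\<forall>u\<in>?N. \<forall>u'\<in>acc ! i. (u, u') \<notin> (adj_rel (E \<inter> pr W))\<^sup>*)" for i E
   have dc: "real (card (disc E)) = (\<Sum>i\<in>{1..l}. of_bool (Pd i E))" for E
   proof -
    have "disc E = {1..l} \<inter> {i. Pd i E}" by (auto simp: disc_def Pd_def)
    thus ?thesis by (simp add: sum_of_bool_eq)
   qed
   have "Ex (pr W) p (\<lambda>E. real (card (disc E))) = (\<Sum>i\<in>{1..l}. PE (pr W) p (\<lambda>E. Pd i E))"
    unfolding dc Ex_sum ..
   also have "... <= (\<Sum>i\<in>{1..l}. dd)"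
   proof (rule sum_mono)
    fix i assume i: "i \<in> {1..l}"
    obtain u where u: "u \<in> ?N" using accm(2)[of 0] by auto
    obtain u' where u': "u' \<in> acc ! i" using accm(2)[of i] i by auto
    have ne: "u \<noteq> u'" using accd[of i 0] i u u' by auto
    have "PE (pr W) p (\<lambda>E. Pd i E) <= PE (pr W) p (\<lambda>E. (u, u') \<notin> (adj_rel (E \<inter> pr W))\<^sup>*)"
     by (rule Ex_mono[OF p(1) p1], rule of_bool_le) (use u u' in \<open>auto simp: Pd_def\<close>)
    also have "... <= dd" using accm(1)[of 0] accm(1)[of i] i u u' ne by (intro dd) auto
    finally show "PE (pr W) p (\<lambda>E. Pd i E) <= dd" .
   qed
   finally show ?thesis by simp
  qed
  also have "real l*dd/?c = 4*dd/rho" using l rho by simp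
  finally show ?thesis using c0 by (simp add: divide_right_mono)
 qed
 have "PE (pr W) p (\<lambda>E. \<not> core_good t1 t2 l acc W E)
  <= Ex (pr W) p (\<lambda>E. of_bool (\<not> ?Q \<subseteq> ?R E) + of_bool (real a <= real (card (?L E)))
    + of_bool (?G E)
    + of_bool (?c <= real (card (disc E))))"
 proof (rule Ex_mono[OF p(1) p1])
  fix E
  let ?X = "miss_cnt t2 l acc (nb E (?L E) (?R E)) (?R E) E"
  have "core_good t1 t2 l acc W E" if "?Q \<subseteq> ?R E" "\<not> real (card ?X) < ?c" "\<not> ?c <= real (card (disc E))"
  proof -
   have "card (disc E) < card ?X" using that by linarith
   moreover have "finite (disc E)" by (simp add: disc_def)
   ultimately have "\<not> ?X \<subseteq> disc E" using card_mono by (metis leD)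
   then obtain i where i: "i \<in> ?X" "i \<notin> disc E" by blast
   hence "i \<in> {1..l}" by (simp add: miss_cnt_def)
   with i(2) obtain u u' where "u \<in> ?N" "u' \<in> acc ! i" "(u, u') \<in> (adj_rel (E \<inter> pr W))\<^sup>*"
    unfolding disc_def by blast
   moreover have "\<forall>m\<in>{1..l}. acc ! m \<subseteq> ?R E" using that(1) by blast
   ultimately show ?thesis unfolding core_good_def Let_def using i(1) by blast
  qed
  thus "of_bool (\<not> core_good t1 t2 l acc W E) <= (of_bool (\<not> ?Q \<subseteq> ?R E) + of_bool (real a <= real (card (?L E)))
    + of_bool (?Q \<subseteq> ?R E \<and> card (?L E) <= a \<and> real (card ?X) < ?c) + of_bool (?c <= real (card (disc E))) :: real)"
   by (cases "?Q \<subseteq> ?R E"; cases "real a <= real (card (?L E))"; cases "real (card ?X) < ?c"; cases "?c <= real (card (disc E))") auto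
 qed
 also have "... <= real l*real J^2*p*lam^t1 + lam^t1*real J/real a + ?K + 4*dd/rho"
  unfolding Ex_add by (intro add_mono b1 b2 b3 b4)
 finally show ?thesis .
qed

text \<open>If the components differ, the explorations never meet. So a sphere stays below its
  threshold (extinction included), or an exploration uses too many vertices, or two large spheres
  have no edge between them.\<close>

lemma disc_prob:
 fixes m s s' :: nat and p k lam h h' A A' :: real
 assumes W: "finite W" "x \<in> W" "y \<in> W" "x \<noteq> y" and p: "0 <= p" "p <= 1"
  and m: "1 <= m" "2*m <= card W" and off: "offspring_lb p k (2*m) (card W - 2*m)"
  and lam: "real (card W)*p <= lam" "1 <= lam" and h: "0 <= h" "0 <= h'" and A: "0 <= A" "0 <= A'"
 shows "PE (pr W) p (\<lambda>E. (x, y) \<notin> (adj_rel (E \<inter> pr W))\<^sup>*)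
  <= exp (h*A)*zit k (exp (- h)) s + exp (1 - real (m - 1)/(4*lam)^s)
   + (exp (h'*A')*zit k (exp (- h')) s' + exp (1 - real (m - 1)/(4*lam)^s') + exp (- (p*A*A')))"
proof -
 let ?w = "card W"
 let ?u0 = "?w - 2*m"
 define Z where "Z h s = zit k (exp (- h)) s" for h s
 define cp where "cp s = exp (1 - real (m - 1)/(4*lam)^s)" for s
 define P where "P T U \<longleftrightarrow> A <= real (card T) \<and> ?w - m <= card U" for T U :: "'a set"
 have k0: "0 <= k" using off by (simp add: offspring_lb_def)
 have Z0: "0 <= Z h s" if "0 <= h" for h s
  unfolding Z_def using zit_01(1)[OF k0, of "exp (- h)"] that by simp
 have cp0: "0 <= cp s" for s by (simp add: cp_def)
 have small: "Run p s (\<lambda>T U. of_bool (real (card T) < A \<and> ?u0 <= card U)) {z} U <= exp (h*A)*Z h s"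
  if "0 <= h" "finite U" "card U <= ?w" for z :: 'a and U A h s
 proof -
  have pw: "of_bool (real (card T) < A \<and> ?u0 <= card U) <= exp (h*A)*(of_bool (?u0 <= card U)*exp (- h)^card T)"
   for T U :: "'a set"
  proof (cases "real (card T) < A \<and> ?u0 <= card U")
   case True
   hence "0 <= h*(A - real (card T))" using that by auto
   hence "1 <= exp (h*A)*exp (- h)^card T"
    by (simp add: exp_of_nat_mult[symmetric] exp_add[symmetric] algebra_simps)
   thus ?thesis using True by simp
  qed auto
  have "Run p s (\<lambda>T U. of_bool (real (card T) < A \<and> ?u0 <= card U)) T U
    <= Run p s (\<lambda>T U. exp (h*A)*(of_bool (?u0 <= card U)*exp (- h)^card T)) T U" for T U :: "'a set"
  proof (induction s arbitrary: T U)
   case 0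
   show ?case unfolding Run.simps by (rule pw)
  next
   case (Suc s)
   thus ?case unfolding Run.simps by (intro Ex_mono) (use step_prob[OF p] in auto)
  qed
  hence "Run p s (\<lambda>T U. of_bool (real (card T) < A \<and> ?u0 <= card U)) {z} U
    <= Run p s (\<lambda>T U. exp (h*A)*(of_bool (?u0 <= card U)*exp (- h)^card T)) {z} U" .
  also have "... = exp (h*A) * Run p s (\<lambda>T U. of_bool (?u0 <= card U)*exp (- h)^card T) {z} U"
   by (rule Run_cmult)
  also have "Run p s (\<lambda>T U. of_bool (?u0 <= card U)*exp (- h)^card T) {z} U <= zit k (exp (- h)) s^card {z}"
   by (rule Run_pow[OF off p]) (use that m in auto)
  finally show ?thesis by (simp add: Z_def)
 qed
 have pU: "real (card U)*p <= lam" if "U \<subseteq> W" for U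
 proof -
  have "real (card U)*p <= real ?w*p" using that W p by (intro mult_right_mono) (auto intro: card_mono)
  with lam show ?thesis by linarith
 qed
 have Wx: "{x} \<union> (W - {x}) = W" using W by auto
 have cWx: "card (W - {x}) = ?w - 1" using W by simp
 define Y where "Y = exp (h'*A')*Z h' s' + cp s' + exp (- (p*A*A'))"
 have Y0: "0 <= Y" unfolding Y_def using Z0[OF h(2)] cp0 by (intro add_nonneg_nonneg mult_nonneg_nonneg) auto
 let ?L = "\<lambda>E. lv E {x} (W - {x}) s" and ?R = "\<lambda>E. rs E {x} (W - {x}) s"
 let ?Q = "\<lambda>E. P (?L E) (?R E) \<and> y \<in> ?R E
    \<and> True \<and> nb E (?L E) (?R E) \<inter> lv E {y} (?R E - {y}) s' = {}"
 have b1: "PE (pr W) p (\<lambda>E. real (card (?L E)) < A \<and> ?u0 <= card (?R E))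
   <= exp (h*A)*Z h s"
  using Run_ex'[of "{x}" "W - {x}" p "\<lambda>T U. of_bool (real (card T) < A \<and> ?u0 <= card U)" s]
   small[OF h(1), of "W - {x}" s A x] W Wx cWx by simp
 have b2: "PE (pr W) p (\<lambda>E. card (?R E) < ?w - m) <= cp s"
 proof -
  have "Run p s (\<lambda>_ U. of_bool (card U < ?w - m)) {x} (W - {x}) <= exp (real (card {x}) - real (m - 1)/(4*lam)^s)"
   by (rule Run_cap[OF p _ pU lam(2)]) (use W cWx m in auto)
  thus ?thesis
   using Run_ex'[of "{x}" "W - {x}" p "\<lambda>_ U. of_bool (card U < ?w - m)" s] W Wx by (simp add: cp_def)
 qed
 have b3: "PE (pr W) p (\<lambda>E. ?Q E) <= Y"
 proof -
  have "PE (pr W) p (\<lambda>E. ?Q E)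
   = Run p s (\<lambda>T U. of_bool (P T U \<and> y \<in> U) *
    Run p s' (\<lambda>T' U'. of_bool True*((1 - p)^card T)^card T') {y} (U - {y})) {x} (W - {x})"
   by (rule pair_Run[OF W(1,2), where P' = "\<lambda>_ _. True"])
  also have "... <= Run p s (\<lambda>_ _. Y) {x} (W - {x})"
  proof (rule Run_mono[OF p])
   fix T U assume U: "U \<subseteq> W - {x}"
   have fU: "finite U" using U W finite_subset by blast
   show "of_bool (P T U \<and> y \<in> U) * Run p s' (\<lambda>T' U'. of_bool True*((1 - p)^card T)^card T') {y} (U - {y}) <= Y"
   proof (cases "P T U \<and> y \<in> U")
    case False thus ?thesis using Y0 by auto
   next
    case True
    have cU: "card (U - {y}) = card U - 1" "1 <= card U" using True fU by (auto simp: Suc_le_eq card_gt_0_iff)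
    have "Run p s' (\<lambda>T' U'. of_bool True*((1 - p)^card T)^card T') {y} (U - {y})
     <= Run p s' (\<lambda>T' U'. (of_bool (real (card T') < A' \<and> ?u0 <= card U') + of_bool (card U' < ?u0)) + exp (- (p*A*A'))) {y} (U - {y})"
    proof (rule Run_mono[OF p])
     fix T' U' :: "'a set"
     have le1: "((1 - p)^card T)^card T' <= 1" using p by (intro power_le_one) auto
     show "of_bool True*((1 - p)^card T)^card T'
      <= (of_bool (real (card T') < A' \<and> ?u0 <= card U') + of_bool (card U' < ?u0)) + exp (- (p*A*A'))"
     proof (cases "card U' < ?u0 \<or> real (card T') < A'")
      case True
      hence "(1::real) <= of_bool (real (card T') < A' \<and> ?u0 <= card U') + of_bool (card U' < ?u0)"
       by (auto simp: of_bool_def)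
      with le1 exp_ge_zero[of "- (p*A*A')"]
      have "((1 - p)^card T)^card T'
       <= (of_bool (real (card T') < A' \<and> ?u0 <= card U') + of_bool (card U' < ?u0)) + exp (- (p*A*A'))"
       by linarith
      thus ?thesis by (simp only: of_bool_eq mult_1)
     next
      case False
      have "(1 - p)^(card T*card T') <= exp (- (p*(real (card T)*real (card T'))))"
       using one_minus_pow_le[OF p, of "card T*card T'"] by (simp add: mult_ac)
      also have "... <= exp (- (p*(A*A')))"
      proof -
       have "A*A' <= real (card T)*real (card T')"
        using True False A by (intro mult_mono) (auto simp: P_def)
       hence "p*(A*A') <= p*(real (card T)*real (card T'))" using p by (intro mult_left_mono) auto
       thus ?thesis by simp
      qed
      finally show ?thesis using False by (simp add: power_mult mult.assoc)
     qed
    qed auto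
    also have "... = Run p s' (\<lambda>T' U'. of_bool (real (card T') < A' \<and> ?u0 <= card U')) {y} (U - {y})
      + Run p s' (\<lambda>T' U'. of_bool (card U' < ?u0)) {y} (U - {y}) + exp (- (p*A*A'))"
     using fU by (simp add: Run_add Run_const)
    also have "... <= exp (h'*A')*Z h' s' + cp s' + exp (- (p*A*A'))"
    proof (intro add_mono order_refl)
     have "card (U - {y}) <= ?w" using U W by (intro card_mono) auto
     thus "Run p s' (\<lambda>T' U'. of_bool (real (card T') < A' \<and> ?u0 <= card U')) {y} (U - {y}) <= exp (h'*A')*Z h' s'"
      using fU by (intro small h) auto
     have "Run p s' (\<lambda>_ U'. of_bool (card U' < ?u0)) {y} (U - {y}) <= exp (real (card {y}) - real (m - 1)/(4*lam)^s')"
     proof (rule Run_cap[OF p _ pU lam(2)])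
      have "?w - m <= card U" using True by (simp add: P_def)
      hence "?u0 + (m - 1) <= card U - 1" using m by linarith
      thus "real ?u0 + real (m - 1) <= real (card (U - {y}))"
       unfolding cU(1) by (metis of_nat_add of_nat_le_iff)
     qed (use U fU in auto)
     thus "Run p s' (\<lambda>T' U'. of_bool (card U' < ?u0)) {y} (U - {y}) <= cp s'" by (simp add: cp_def)
    qed
    finally show ?thesis using True by (simp add: Y_def)
   qed
  qed auto
  also have "... = Y" using W by (simp add: Run_const)
  finally show ?thesis .
 qed
 have "PE (pr W) p (\<lambda>E. (x, y) \<notin> (adj_rel (E \<inter> pr W))\<^sup>*)
  <= Ex (pr W) p (\<lambda>E. of_bool (real (card (?L E)) < A \<and> ?u0 <= card (?R E))
    + of_bool (card (?R E) < ?w - m)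
    + of_bool (?Q E))"
 proof (rule Ex_mono[OF p])
  fix E
  let ?L = "?L E" and ?R = "?R E"
  let ?Adj = "adj_rel (E \<inter> pr W)"
  have far: "y \<in> ?R \<and> nb E ?L ?R \<inter> lv E {y} (?R - {y}) s' = {}" if n: "(x, y) \<notin> ?Adj\<^sup>*"
  proof -
   have dx: "{x} \<inter> (W - {x}) = {}" by simp
   have R: "?R = {u \<in> W - {x}. \<forall>k\<le>s. \<forall>v\<in>{x}. (v, u) \<notin> ?Adj ^^ k}"
    and L: "?L = {u \<in> W. (\<exists>v\<in>{x}. (v, u) \<in> ?Adj ^^ s) \<and> (\<forall>k<s. \<forall>v\<in>{x}. (v, u) \<notin> ?Adj ^^ k)}"
    using lev_char(1)[OF dx, of E s] lev_char(2)[OF dx, of E s] unfolding Wx by blast+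
   have "(x, y) \<notin> ?Adj ^^ k" for k using n relpow_imp_rtrancl[of "(x, y)" k ?Adj] by blast
   hence yR: "y \<in> ?R" unfolding R using W(3,4) by simp
   have dy: "{y} \<inter> (?R - {y}) = {}" by simp
   have yRe: "{y} \<union> (?R - {y}) = ?R" using yR by auto
   have L': "lv E {y} (?R - {y}) s' \<subseteq> {u. (y, u) \<in> adj_rel (E \<inter> pr ?R) ^^ s'}"
    using lev_char(2)[OF dy, of E s'] unfolding yRe by auto
   have sub: "adj_rel (E \<inter> pr ?R) \<subseteq> ?Adj" using lev_sub(2)[of E "{x}" "W - {x}" s] by (auto simp: adj_rel_pr)
   have "nb E ?L ?R \<inter> lv E {y} (?R - {y}) s' = {}"
   proof (rule ccontr)
    assume "nb E ?L ?R \<inter> lv E {y} (?R - {y}) s' \<noteq> {}"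
    then obtain u where u: "u \<in> nb E ?L ?R" "u \<in> lv E {y} (?R - {y}) s'" by blast
    then obtain w where w: "u \<in> ?R" "w \<in> ?L" "{u, w} \<in> E" unfolding nb_def by blast
    have "?L \<inter> ?R = {}" by (rule lev_sub(3)[OF dx])
    hence "w \<noteq> u" using w by blast
    hence "(w, u) \<in> ?Adj" using w L R unfolding adj_rel_pr by (simp add: insert_commute)
    moreover have "(x, w) \<in> ?Adj\<^sup>*" using w(2) unfolding L using relpow_imp_rtrancl by auto
    ultimately have xu: "(x, u) \<in> ?Adj\<^sup>*" by simp
    have "(y, u) \<in> adj_rel (E \<inter> pr ?R) ^^ s'" using u(2) L' by blast
    hence "(u, y) \<in> adj_rel (E \<inter> pr ?R) ^^ s'" by (rule relpow_adj_sym)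
    hence "(u, y) \<in> (adj_rel (E \<inter> pr ?R))\<^sup>*" by (rule relpow_imp_rtrancl)
    hence "(u, y) \<in> ?Adj\<^sup>*" using rtrancl_mono[OF sub] by blast
    from rtrancl_trans[OF xu this] n show False by simp
   qed
   with yR show ?thesis by blast
  qed
  show "of_bool ((x, y) \<notin> ?Adj\<^sup>*) <= (of_bool (real (card ?L) < A \<and> ?u0 <= card ?R) + of_bool (card ?R < ?w - m)
    + of_bool (P ?L ?R \<and> y \<in> ?R \<and> True \<and> nb E ?L ?R \<inter> lv E {y} (?R - {y}) s' = {}) :: real)"
  proof (cases "(x, y) \<notin> ?Adj\<^sup>*")
   case True
   show ?thesis
   proof (cases "card ?R < ?w - m")
    case False
    hence "?u0 <= card ?R" by simp
    thus ?thesis using far[OF True] False by (cases "real (card ?L) < A") (auto simp: P_def)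
   qed (use True in simp)
  qed simp
 qed
 also have "... <= exp (h*A)*Z h s + cp s + Y"
  unfolding Ex_add by (intro add_mono b1 b2 b3)
 finally show ?thesis by (simp add: Z_def cp_def Y_def)
qed

text \<open>The breadth-first depth of \<open>u\<close>, truncated at \<open>t + 1\<close>.\<close>

definition depth :: "'a set set => 'a set => 'a set => nat => 'a => nat" where
 "depth E T U t u = card {s. s <= t \<and> u \<in> rs E T U s}"

section \<open>A Lipschitz potential separating two tips\<close>

lemma depth_finite: "finite {s. s <= t \<and> u \<in> rs E T U s}"
 by (rule finite_subset[of _ "{..t}"]) auto

lemma depth_root:
 assumes "u \<in> T" "T \<inter> U = {}"
 shows "depth E T U t u = 0"
proof -
 have "u \<notin> rs E T U s" for s using lev_sub(2)[of E T U s] assms by blast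
 thus ?thesis by (simp add: depth_def)
qed

lemma depth_rs:
 assumes "T \<inter> U = {}" "u \<in> rs E T U t"
 shows "depth E T U t u = Suc t"
proof -
 have "u \<in> rs E T U s" if "s <= t" for s
  using rs_mono_time[OF assms(1) that] assms(2) by blast
 hence "{s. s <= t \<and> u \<in> rs E T U s} = {..t}" by blast
 thus ?thesis by (simp add: depth_def)
qed

lemma depth_not_rs:
 assumes "u \<notin> rs E T U t"
 shows "depth E T U t u <= t"
proof -
 have "s \<in> {..<t}" if "s <= t" "u \<in> rs E T U s" for s
  using that assms by (cases "s = t") simp_all
 hence "{s. s <= t \<and> u \<in> rs E T U s} \<subseteq> {..<t}" by blast
 hence "depth E T U t u <= card {..<t}" unfolding depth_def by (intro card_mono) auto
 thus ?thesis by simp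
qed

lemma lv_in_rs:
 assumes "T \<inter> U = {}" "u \<in> lv E T U t" "s < t"
 shows "u \<in> rs E T U s"
proof (cases t)
 case 0
 with assms(3) show ?thesis by simp
next
 case (Suc t')
 have "u \<in> lv E T U (Suc t')" using assms(2) by (simp only: Suc)
 hence "u \<in> nb E (lv E T U t') (rs E T U t')" by (simp only: lev_Suc_back[of E T U t'] fst_conv)
 hence "u \<in> rs E T U t'" by (rule subsetD[OF nb_subset])
 moreover have "rs E T U t' \<subseteq> rs E T U s"
  by (rule rs_mono_time[OF assms(1)]) (use assms(3) Suc in simp)
 ultimately show ?thesis by (rule subsetD[rotated])
qed

lemma depth_lv:
 assumes "T \<inter> U = {}" "u \<in> lv E T U t"
 shows "depth E T U t u = t"
proof -
 have nt: "u \<notin> rs E T U t" using lev_sub(3)[OF assms(1), of E t] assms(2) by blast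
 have "s <= t \<and> u \<in> rs E T U s \<longleftrightarrow> s < t" for s
  using lv_in_rs[OF assms, of s] nt by (cases "s = t") auto
 hence "{s. s <= t \<and> u \<in> rs E T U s} = {..<t}" by blast
 thus ?thesis by (simp add: depth_def)
qed

text \<open>If \<open>w\<close> is unexplored at time \<open>s + 1\<close>, its neighbour
  \<open>u\<close> is unexplored at time \<open>s\<close>. So the times counted for \<open>w\<close>
  are, apart from 0, successors of times counted for \<open>u\<close>.\<close>

lemma depth_lip:
 assumes "{u, w} \<in> E" "u \<in> T \<union> U"
 shows "depth E T U t w <= depth E T U t u + 1"
proof -
 let ?A = "{s. s <= t \<and> u \<in> rs E T U s}" and ?B = "{s. s <= t \<and> w \<in> rs E T U s}"
 have "?B \<subseteq> insert 0 (Suc ` ?A)"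
 proof
  fix s assume s: "s \<in> ?B"
  show "s \<in> insert 0 (Suc ` ?A)"
  proof (cases s)
   case (Suc s')
   have w: "w \<in> rs E T U (Suc s')" and st: "Suc s' <= t" using s unfolding Suc by blast+
   have "u \<in> rs E T U s'"
   proof (rule ccontr)
    assume "u \<notin> rs E T U s'"
    hence "u \<in> T \<union> (U - rs E T U s')" using assms(2) by blast
    with w have "{w, u} \<notin> E" by (rule lev_no_edge)
    with assms(1) show False by (simp add: insert_commute)
   qed
   hence "s' \<in> ?A" using st by simp
   thus ?thesis unfolding Suc by blast
  qed simp
 qed
 hence "card ?B <= card (insert 0 (Suc ` ?A))" using depth_finite by (intro card_mono) auto
 also have "... <= Suc (card (Suc ` ?A))" using depth_finite by (simp add: card_insert_if)
 also have "card (Suc ` ?A) <= card ?A" using depth_finite by (intro card_image_le) auto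
 finally show ?thesis by (simp add: depth_def)
qed

lemma relpow_lip:
 fixes f :: "'a => int"
 assumes "\<And>a b. (a, b) \<in> R ==> f b <= f a + 1" "(x, y) \<in> R ^^ j"
 shows "f y <= f x + int j"
 using assms(2)
proof (induction j arbitrary: y)
 case (Suc j)
 then obtain z where "(x, z) \<in> R ^^ j" "(z, y) \<in> R" by auto
 with Suc.IH[of z] assms(1)[of z y] show ?case by simp
qed simp

text \<open>From tip to tip one needs \<open>k\<close> steps in the first branch, 1 to its neighbour
  set, \<open>t1\<close> levels, 1 to the next level, at least \<open>t2 + 1\<close> from there to
  the other neighbour set because its ball is missed, then 1 and \<open>k\<close> again:
  \<open>2 * k + t1 + t2 + 4\<close> in total. The potential also handles walks that wander through
  the other ends.\<close>

lemma far_pair: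
 fixes C N :: "'a => 'a set"
 assumes V: "finite V" and E: "E \<subseteq> pr V"
  and ends: "\<And>v. v \<in> set vs ==> is_end k M J E V v (C v) (N v)"
  and vs: "distinct vs" "length vs = Suc l"
 defines "W \<equiv> V - (\<Union>u\<in>set vs. insert u (C u))"
 assumes acc: "acc_ok J (map N vs) W" and good: "core_good t1 t2 l (map N vs) W (E \<inter> pr W)"
 shows "2*(k + 1) + (t1 + t2 + 1) < diam V E"
proof -
 define v0 where "v0 = vs ! 0"
 define N0 where "N0 = N v0"
 define L where "L = lv E N0 (W - N0) t1"
 define R where "R = rs E N0 (W - N0) t1"
 have accN: "map N vs ! m = N (vs ! m)" if "m <= l" for m using that vs by simp
 have NW: "N (vs ! m) \<subseteq> W" if "m <= l" for m using acc that vs by (auto simp: acc_ok_def)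
 have N0W: "N0 \<subseteq> W" using NW[of 0] by (simp add: N0_def v0_def)
 have dN0: "N0 \<inter> (W - N0) = {}" "N0 \<union> (W - N0) = W" using N0W by auto
 have lev_eq: "lev (E \<inter> pr W) N0 (W - N0) t1 = lev E N0 (W - N0) t1"
  using dN0 by (intro lev_Int_pr) auto
 have RW: "R \<subseteq> W" "L \<subseteq> W" unfolding R_def L_def using lev_sub(1,2)[of E N0 "W - N0" t1] dN0 by auto
 have LR: "L \<inter> R = {}" unfolding R_def L_def by (rule lev_sub(3)[OF dN0(1)])
 have nbLR: "nb (E \<inter> pr W) L R = nb E L R" using RW LR by (intro nb_Int_pr) auto
 have map0: "map N vs ! 0 = N0" using accN[of 0] by (simp add: N0_def v0_def)
 have L': "lv (E \<inter> pr W) N0 (W - N0) t1 = L" "rs (E \<inter> pr W) N0 (W - N0) t1 = R"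
  unfolding lev_eq L_def R_def by auto
 have g: "\<forall>m\<in>{1..l}. map N vs ! m \<subseteq> R"
  "\<exists>i\<in>miss_cnt t2 l (map N vs) (nb E L R) R (E \<inter> pr W). \<exists>u\<in>N0. \<exists>u'\<in>map N vs ! i. (u, u') \<in> (adj_rel (E \<inter> pr W))\<^sup>*"
  using good unfolding core_good_def Let_def map0 L' nbLR by (auto simp: Int_assoc)
 then obtain i u0 u1 where i: "i \<in> miss_cnt t2 l (map N vs) (nb E L R) R (E \<inter> pr W)"
  and u: "u0 \<in> N0" "u1 \<in> map N vs ! i" "(u0, u1) \<in> (adj_rel (E \<inter> pr W))\<^sup>*" by blast
 have il: "1 <= i" "i <= l" using i by (auto simp: miss_cnt_def)
 define vi where "vi = vs ! i"
 define Ni where "Ni = N vi"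
 define R' where "R' = rs E Ni (R - Ni) t2"
 have mapi: "map N vs ! i = Ni" using accN[OF il(2)] by (simp add: Ni_def vi_def)
 have NR: "N (vs ! m) \<subseteq> R" if "1 <= m" "m <= l" for m using g(1) that accN by auto
 have NiR: "Ni \<subseteq> R" using NR[OF il] by (simp add: Ni_def vi_def)
 have dNi: "Ni \<inter> (R - Ni) = {}" "Ni \<union> (R - Ni) = R" using NiR by auto
 have R'eq: "rs (E \<inter> pr W) Ni (R - Ni) t2 = R'"
  unfolding R'_def using dNi RW by (subst lev_Int_pr) auto
 have NmR': "N (vs ! m) \<subseteq> R'" if "1 <= m" "m <= l" "m \<noteq> i" for m
 proof -
  have "map N vs ! m \<subseteq> rs (E \<inter> pr W) (map N vs ! i) (R - map N vs ! i) t2"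
   using i that unfolding miss_cnt_def by simp
  thus ?thesis unfolding mapi R'eq accN[OF that(2)] .
 qed
 have nbR': "nb E L R \<inter> (R - R') = {}" 
 proof -
  have "nb E L R \<inter> (R - rs (E \<inter> pr W) (map N vs ! i) (R - map N vs ! i) t2) = {}"
   using i unfolding miss_cnt_def by simp
  thus ?thesis unfolding mapi R'eq .
 qed
 have mem: "v0 \<in> set vs" "vi \<in> set vs" "v0 \<noteq> vi"
  using vs il by (auto simp: v0_def vi_def nth_eq_iff_index_eq)
 
 have St: "St k E V v (C v) (N v)" if "v \<in> set vs" for v using ends[OF that] by (simp add: is_end_def)
 have Ddis: "insert v (C v) \<inter> insert w (C w) = {}" if "v \<in> set vs" "w \<in> set vs" "v \<noteq> w" for v w
  by (rule end_disjoint(1)[OF ends[OF that(1)] ends[OF that(2)] V that(3)])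
 have WD: "W \<inter> insert v (C v) = {}" if "v \<in> set vs" for v unfolding W_def using that by blast
 
 have D_edge: "b \<in> insert v (C v) \<or> (a = v \<and> b \<in> N v)" if "v \<in> set vs" "a \<in> insert v (C v)" "(a, b) \<in> adj_rel E" for v a b
 proof -
  have ab: "{a, b} \<in> E" "b \<in> V" "a \<noteq> b" using that(3) E by (auto simp: adj_rel_def pr_def)
  show ?thesis
  proof (cases "a = v")
   case True
   thus ?thesis using St_nbr[OF St[OF that(1)], of b] ab by (auto simp: insert_commute)
  next
   case False
   thus ?thesis using St_stay[OF St[OF that(1)] _ ab(2,1)] that(2) by auto
  qed
 qed
 define d0 where "d0 u = int (depth E {v0} (C v0) k u)" for u
 define di where "di u = int (depth E {vi} (C vi) k u)" for u
 define e0 where "e0 u = int (depth E N0 (W - N0) t1 u)" for u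
 define ei where "ei u = int (depth E Ni (R - Ni) t2 u)" for u
 define K where "K = int k"
 (* 1-Lipschitz along edges, 0 at the tip of the first branch and largest at the tip of the other one *)
 define f where "f u = (if u \<in> insert v0 (C v0) then K - d0 u
   else if u \<in> insert vi (C vi) then K + int t1 + int t2 + 4 + di u
   else if u \<in> R then K + int t1 + 2 + (int t2 + 1 - ei u)
   else if u \<in> W then K + 1 + e0 u
   else K + int t1 + 2)" for u
 have fD0: "f u = K - d0 u" if "u \<in> insert v0 (C v0)" for u using that by (simp add: f_def)
 have fDi: "f u = K + int t1 + int t2 + 4 + di u" if "u \<in> insert vi (C vi)" for u
 proof -
  have "u \<notin> insert v0 (C v0)" using that Ddis[OF mem] by blast
  thus ?thesis using that unfolding f_def by simp
 qed
 have nWD: "u \<notin> insert v0 (C v0)" "u \<notin> insert vi (C vi)" if "u \<in> W" for u using WD[OF mem(1)] WD[OF mem(2)] that by blast+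
 have fR: "f u = K + int t1 + 2 + (int t2 + 1 - ei u)" if "u \<in> R" for u
 proof -
  have "u \<in> W" using that RW by blast
  thus ?thesis using nWD[of u] that unfolding f_def by simp
 qed
 have fW: "f u = K + 1 + e0 u" if "u \<in> W" "u \<notin> R" for u using that nWD[of u] unfolding f_def by simp
 \<comment> \<open>The other ends get a constant. It equals the value on \<open>R'\<close>, where
   \<open>miss_cnt\<close> places their neighbour sets, so they offer no shortcut.\<close>
 have fD: "f u = K + int t1 + 2" if "u \<in> insert v (C v)" "v \<in> set vs" "v \<noteq> v0" "v \<noteq> vi" for u v
 proof -
  have "u \<notin> insert v0 (C v0)" "u \<notin> insert vi (C vi)" "u \<notin> W"
   using Ddis[OF that(2) mem(1) that(3)] Ddis[OF that(2) mem(2) that(4)] WD[OF that(2)] that(1) by blast+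
  moreover from this have "u \<notin> R" using RW by blast
  ultimately show ?thesis unfolding f_def by simp
 qed
 have dv0: "{v0} \<inter> C v0 = {}" "{vi} \<inter> C vi = {}" using St_vC(1)[OF St[OF mem(1)]] St_vC(1)[OF St[OF mem(2)]] by auto
 have d00: "d0 v0 = 0" "di vi = 0" unfolding d0_def di_def using depth_root[OF _ dv0(1)] depth_root[OF _ dv0(2)] by auto
 have e00: "e0 u = 0" if "u \<in> N0" for u unfolding e0_def using depth_root[OF that dN0(1)] by simp
 have ei0: "ei u = 0" if "u \<in> Ni" for u unfolding ei_def using depth_root[OF that dNi(1)] by simp
 have eiR': "ei u = int t2 + 1" if "u \<in> R'" for u unfolding ei_def using depth_rs[OF dNi(1)] that by (simp add: R'_def)
 have e0_le: "e0 u <= int t1" if "u \<notin> R" for u using depth_not_rs[of u E N0 "W - N0" t1] that by (simp add: e0_def R_def)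
 have e0_R: "e0 u = int t1 + 1" if "u \<in> R" for u unfolding e0_def using depth_rs[OF dN0(1)] that by (simp add: R_def)
 have fnbr: "\<bar>f b - f v\<bar> <= 1" if "v \<in> set vs" "b \<in> N v" for v b
 proof -
  consider "v = v0" | "v = vi" | "v \<noteq> v0" "v \<noteq> vi" by blast
  thus ?thesis
  proof cases
   case 1
   hence b: "b \<in> N0" using that by (simp add: N0_def)
   hence "b \<notin> R" using lev_sub(2)[of E N0 "W - N0" t1] by (auto simp: R_def)
   thus ?thesis using fW[of b] e00[OF b] fD0[of v0] d00 N0W b 1 by auto
  next
   case 2
   hence b: "b \<in> Ni" using that by (simp add: Ni_def)
   thus ?thesis using fR[of b] ei0[OF b] fDi[of vi] d00 NiR 2 by auto
  next
   case 3
   have vin: "v \<in> set vs" by (rule that(1))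
   obtain m where m': "m < length vs" "vs ! m = v" using vin by (auto simp: in_set_conv_nth)
   hence m: "m <= l" "v = vs ! m" using vs(2) by simp_all
   have "m \<noteq> 0" using 3(1) m(2) by (cases "m = 0") (simp_all add: v0_def)
   have "m \<noteq> i" using 3(2) m(2) by (cases "m = i") (simp_all add: vi_def)
   have "b \<in> N (vs ! m)" using that(2) m(2) by (simp only:)
   hence "b \<in> R'" using NmR'[of m] m(1) \<open>m \<noteq> 0\<close> \<open>m \<noteq> i\<close> by (simp add: subset_iff)
   hence "b \<in> R" using lev_sub(2)[of E Ni "R - Ni" t2] by (auto simp: R'_def)
   thus ?thesis using fR[of b] eiR'[OF \<open>b \<in> R'\<close>] fD[of v v] 3 that by simp
  qed
 qed
 have fD_in: "\<bar>f b - f a\<bar> <= 1" if v: "v \<in> set vs" "a \<in> insert v (C v)" "b \<in> insert v (C v)" "{a, b} \<in> E" for v a b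
 proof -
  have ba: "{b, a} \<in> E" using v(4) by (simp add: insert_commute)
  consider "v = v0" | "v = vi" | "v \<noteq> v0" "v \<noteq> vi" by blast
  thus ?thesis
  proof cases
   case 1
   have "d0 b <= d0 a + 1" "d0 a <= d0 b + 1"
    using depth_lip[OF v(4), of "{v0}" "C v0" k] depth_lip[OF ba, of "{v0}" "C v0" k] v 1 by (auto simp: d0_def)
   thus ?thesis using fD0 v 1 by auto
  next
   case 2
   have "di b <= di a + 1" "di a <= di b + 1"
    using depth_lip[OF v(4), of "{vi}" "C vi" k] depth_lip[OF ba, of "{vi}" "C vi" k] v 2 by (auto simp: di_def)
   thus ?thesis using fDi v 2 by auto
  next
   case 3
   thus ?thesis using fD[of a v] fD[of b v] v by simp
  qed
 qed
 \<comment> \<open>\<open>R\<close> is entered from \<open>W - R\<close> only through the next level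
   \<open>nb E L R\<close>, and \<open>nbR'\<close> puts this level into \<open>R'\<close>, where
   \<open>ei\<close> has its truncation value \<open>t2 + 1\<close>.\<close>
 have cross: "f b = f a + 1" if "a \<in> W" "a \<notin> R" "b \<in> R" "{a, b} \<in> E" for a b
 proof -
  have "a \<in> L"
  proof (cases t1)
   case 0
   thus ?thesis using that(1,2) by (auto simp: L_def R_def)
  next
   case (Suc s)
   have "a \<in> rs E N0 (W - N0) s"
   proof (rule ccontr)
    assume "a \<notin> rs E N0 (W - N0) s"
    hence "a \<in> N0 \<union> ((W - N0) - rs E N0 (W - N0) s)" using that(1) by blast
    moreover have "b \<in> rs E N0 (W - N0) (Suc s)" using that(3) Suc by (simp add: R_def)
    ultimately have "{b, a} \<notin> E" by (rule lev_no_edge[rotated])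
    with that(4) show False by (simp add: insert_commute)
   qed
   thus ?thesis using that(2) unfolding L_def R_def Suc lev_Suc_back by auto
  qed
  moreover have "{b, a} \<in> E" using that(4) by (simp add: insert_commute)
  ultimately have "b \<in> nb E L R" using that(3) unfolding nb_def by blast
  hence "b \<in> R'" using nbR' that(3) by blast
  have "e0 a = int t1"
  proof -
   have "e0 b <= e0 a + 1" using depth_lip[OF that(4), of N0 "W - N0" t1] that(1) dN0 by (auto simp: e0_def)
   with e0_R[OF that(3)] e0_le[OF that(2)] show ?thesis by simp
  qed
  thus ?thesis using fW[OF that(1,2)] fR[OF that(3)] eiR'[OF \<open>b \<in> R'\<close>] by simp
 qed
 have abE: "{a, b} \<in> E" "{b, a} \<in> E" "a \<in> V" "b \<in> V" "(b, a) \<in> adj_rel E"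
  if ab: "(a, b) \<in> adj_rel E" for a b
 proof -
  show e: "{a, b} \<in> E" using ab by (simp add: adj_rel_def)
  thus "{b, a} \<in> E" by (simp add: insert_commute)
  have "{a, b} \<in> pr V" using e E by (rule subsetD[rotated])
  hence "{a, b} \<subseteq> V" by (simp add: pr_def)
  thus "a \<in> V" "b \<in> V" by simp_all
  show "(b, a) \<in> adj_rel E" using ab by (simp add: adj_rel_def insert_commute eq_commute)
 qed
 have lipD: "\<bar>f b - f a\<bar> <= 1" if v: "v \<in> set vs" "a \<in> insert v (C v)" and ab: "(a, b) \<in> adj_rel E" for v a b
  using D_edge[OF v ab]
 proof
  assume "b \<in> insert v (C v)"
  thus ?thesis by (rule fD_in[OF v _ abE(1)[OF ab]])
 next
  assume "a = v \<and> b \<in> N v"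
  thus ?thesis using fnbr[OF v(1), of b] by (simp only:)
 qed
 have lipW: "f b <= f a + 1" if ab: "(a, b) \<in> adj_rel E" and W: "a \<in> W" "b \<in> W" for a b
 proof -
  consider "a \<in> R" "b \<in> R" | "a \<notin> R" "b \<notin> R" | "a \<notin> R" "b \<in> R" | "a \<in> R" "b \<notin> R" by blast
  thus ?thesis
  proof cases
   case 1
   have "b \<in> Ni \<union> (R - Ni)" using 1 dNi(2) by simp
   from depth_lip[OF abE(2)[OF ab] this, of t2] have "ei a <= ei b + 1" by (simp add: ei_def)
   thus ?thesis using fR[OF 1(1)] fR[OF 1(2)] by linarith
  next
   case 2
   have "a \<in> N0 \<union> (W - N0)" using W dN0(2) by simp
   from depth_lip[OF abE(1)[OF ab] this, of t1] have "e0 b <= e0 a + 1" by (simp add: e0_def)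
   thus ?thesis using fW[OF W(1) 2(1)] fW[OF W(2) 2(2)] by linarith
  next
   case 3
   thus ?thesis using cross[OF W(1) 3 abE(1)[OF ab]] by linarith
  next
   case 4
   thus ?thesis using cross[OF W(2) 4(2,1) abE(2)[OF ab]] by linarith
  qed
 qed
 have lip: "f b <= f a + 1" if ab: "(a, b) \<in> adj_rel E" for a b
 proof (cases "a \<in> W \<and> b \<in> W")
  case True
  thus ?thesis using lipW[OF ab] by blast
 next
  case False
  hence "(\<exists>v\<in>set vs. a \<in> insert v (C v)) \<or> (\<exists>v\<in>set vs. b \<in> insert v (C v))"
   using abE(3,4)[OF ab] unfolding W_def by blast
  thus ?thesis
  proof
   assume "\<exists>v\<in>set vs. a \<in> insert v (C v)"
   then obtain v where "v \<in> set vs" "a \<in> insert v (C v)" by (rule bexE)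
   from lipD[OF this ab] show ?thesis by linarith
  next
   assume "\<exists>v\<in>set vs. b \<in> insert v (C v)"
   then obtain v where "v \<in> set vs" "b \<in> insert v (C v)" by (rule bexE)
   from lipD[OF this abE(5)[OF ab]] show ?thesis by linarith
  qed
 qed
 have top: "\<exists>x. x \<in> insert v (C v) \<and> depth E {v} (C v) k x = k \<and> (v, x) \<in> (adj_rel E)\<^sup>*" if v: "v \<in> set vs" for v
 proof -
  have d: "{v} \<inter> C v = {}" using St_vC(1)[OF St[OF v]] by auto
  obtain x where x: "x \<in> lv E {v} (C v) k" using St_vC(4)[OF St[OF v]] by (auto simp: Sh_def)
  have xin: "x \<in> insert v (C v)" using lev_sub(1)[of E "{v}" "C v" k] x by auto
  have "(v, x) \<in> adj_rel (E \<inter> pr (insert v (C v))) ^^ k" using x lev_char(2)[OF d, of E k] by auto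
  hence "(v, x) \<in> (adj_rel (E \<inter> pr (insert v (C v))))\<^sup>*" by (rule relpow_imp_rtrancl)
  moreover have "adj_rel (E \<inter> pr (insert v (C v))) \<subseteq> adj_rel E" by (auto simp: adj_rel_def)
  ultimately have "(v, x) \<in> (adj_rel E)\<^sup>*" using rtrancl_mono by blast
  with xin depth_lv[OF d x] show ?thesis by blast
 qed
 obtain x where x: "x \<in> insert v0 (C v0)" "depth E {v0} (C v0) k x = k" "(v0, x) \<in> (adj_rel E)\<^sup>*" using top[OF mem(1)] by blast
 obtain y where y: "y \<in> insert vi (C vi)" "depth E {vi} (C vi) k y = k" "(vi, y) \<in> (adj_rel E)\<^sup>*" using top[OF mem(2)] by blast
 have fx: "f x = 0" using fD0[OF x(1)] x(2) by (simp add: d0_def K_def)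
 have fy: "f y = 2*int k + int t1 + int t2 + 4" using fDi[OF y(1)] y(2) by (simp add: di_def K_def)
 have xv: "(x, v0) \<in> (adj_rel E)\<^sup>*"
 proof -
  have "sym (adj_rel E)" by (rule symI) (rule abE(5))
  hence "sym ((adj_rel E)\<^sup>*)" by (rule sym_rtrancl)
  thus ?thesis using x(3) by (rule symD)
 qed
 have e1: "(v0, u0) \<in> adj_rel E"
 proof -
  have "{u0, v0} \<in> E" "u0 \<noteq> v0" using St_nbr[OF St[OF mem(1)], of u0] u(1) by (auto simp: N0_def)
  thus ?thesis by (auto simp: adj_rel_def insert_commute)
 qed
 have e2: "(u1, vi) \<in> adj_rel E"
 proof -
  have "{u1, vi} \<in> E" "u1 \<noteq> vi" using St_nbr[OF St[OF mem(2)], of u1] u(2) mapi by (auto simp: Ni_def)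
  thus ?thesis by (auto simp: adj_rel_def)
 qed
 have e3: "(u0, u1) \<in> (adj_rel E)\<^sup>*"
 proof -
  have "adj_rel (E \<inter> pr W) \<subseteq> adj_rel E" by (auto simp: adj_rel_def)
  thus ?thesis using u(3) rtrancl_mono by blast
 qed
 have "(x, y) \<in> (adj_rel E)\<^sup>*"
  using xv e1 e3 e2 y(3) by (meson rtrancl_trans r_into_rtrancl)
 then obtain j where j: "(x, y) \<in> adj_rel E ^^ j" using rtrancl_imp_relpow by blast
 have xyV: "x \<in> V" "y \<in> V"
  using x(1) y(1) St_vC(2,3)[OF St[OF mem(1)]] St_vC(2,3)[OF St[OF mem(2)]] by blast+
 have far: "(x, y) \<notin> adj_rel E ^^ i" if i: "i <= 2*(k + 1) + (t1 + t2 + 1)" for i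
 proof
  assume "(x, y) \<in> adj_rel E ^^ i"
  hence "f y <= f x + int i" by (rule relpow_lip[rotated]) (rule lip)
  moreover have "int i <= 2*(int k + 1) + (int t1 + int t2 + 1)"
   using i unfolding of_nat_le_iff[where ?'a = int, symmetric] by (simp only: of_nat_add of_nat_mult of_nat_numeral of_nat_1)
  ultimately show False unfolding fx fy by presburger
 qed
 show ?thesis by (rule diam_gtI[OF V xyV j far])
qed

text \<open>\<open>list_moment\<close> for the set of ends, with \<open>B\<close> the failure of the
  large diameter. By \<open>far_pair\<close>, under this failure every list of \<open>l + 1\<close>
  ends either has overlapping neighbour sets or leaves a graph in which \<open>core_good\<close>
  fails; \<open>tupB_bound\<close> estimates exactly this.\<close>

lemma far_pair_prob:
 fixes V :: "'a set" and x l :: nat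
 assumes V: "finite V" and p: "0 <= p" "p < 1" and x: "Suc l * Suc M + 1 <= x" and e0: "0 <= e0"
  and core: "\<And>acc W. acc_ok J acc W ==> W \<subseteq> V ==> card (V - W) <= x ==> length acc = Suc l
    ==> PE (pr W) p (\<lambda>E. \<not> core_good t1 t2 l acc W E) <= e0"
  and low: "\<And>v. v \<in> V ==> (1 - eta) * swt k M J x p V v
    <= PE (pr V) p (\<lambda>E. \<exists>C N. is_end k M J E V v C N)"
 defines "mu \<equiv> sum (swt k M J x p V) V"
 assumes mu: "0 < mu" and y: "0 < y" and l: "1 <= l" "real l < (1 - y)*mu"
 shows "PE (pr V) p (\<lambda>E. \<not> 2*(k + 1) + (t1 + t2 + 1) < diam V E)
  <= (1/mu + 2*eta)/y^2
   + (e0 + real (Suc l)*(real (Suc l * Suc J)*p))*(mu/((1 - y)*mu - real l))^Suc l"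
proof -
 define ends where "ends E = {v \<in> V. \<exists>C N. is_end k M J E V v C N}" for E
 define e where "e = e0 + real (Suc l)*(real (Suc l * Suc J)*p)"
 have e: "0 <= e" unfolding e_def using e0 p by simp
 have finA: "finite (pr V)" using V by (rule finite_pr)
 have p1: "p <= 1" using p by simp
 have sel: "\<exists>C N. \<forall>v\<in>ends E. is_end k M J E V v (C v) (N v)" for E
 proof -
  have "\<forall>v\<in>ends E. \<exists>CN. is_end k M J E V v (fst CN) (snd CN)" by (auto simp: ends_def)
  then obtain CN where "\<forall>v\<in>ends E. is_end k M J E V v (fst (CN v)) (snd (CN v))"
   unfolding bchoice_iff by (rule exE)
  thus ?thesis by (intro exI[of _ "\<lambda>v. fst (CN v)"] exI[of _ "\<lambda>v. snd (CN v)"])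
 qed
 have tup: "tup0 k M J E V vs" if vs: "distinct vs" "set vs \<subseteq> ends E" for vs E
 proof -
  obtain C N where CN: "\<forall>v\<in>ends E. is_end k M J E V v (C v) (N v)" using sel by blast
  have "tup0 k M J E (V - (\<Union>u\<in>set []. insert u (C u))) vs"
   by (rule ends_tup0_aux[OF V, of "ends E" k M J E C N]) (use CN vs in simp_all)
  thus ?thesis by simp
 qed
 have t0: "PE (pr V) p (\<lambda>E. set vs \<subseteq> ends E) <= prod_list (map (swt k M J x p V) vs)"
  if vs: "distinct vs" "set vs \<subseteq> V" "length vs <= Suc l" for vs
 proof -
  have "length vs * Suc M <= Suc l * Suc M" using vs(3) by (rule mult_le_mono1)
  hence lx: "card (V - V) + length vs * Suc M + 1 <= x" using x by simp
  have "PE (pr V) p (\<lambda>E. set vs \<subseteq> ends E) <= PE (pr V) p (\<lambda>E. tup0 k M J E V vs)"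
   by (intro Ex_mono p p1 of_bool_le tup vs(1))
  also have "... <= prod_list (map (swt k M J x p V) vs)"
   by (rule tup0_bound[OF V p order_refl vs(1,2) lx])
  finally show ?thesis .
 qed
 have "PE (pr V) p (\<lambda>E. \<not> 2*(k + 1) + (t1 + t2 + 1) < diam V E)
  <= (1/sum (swt k M J x p V) V + 2*eta)/y^2
   + e*(sum (swt k M J x p V) V/((1 - y) * sum (swt k M J x p V) V - real l))^Suc l"
 proof (rule list_moment[OF finA p(1) p1 V])
  show "ends E \<subseteq> V" for E by (auto simp: ends_def)
  show "0 <= swt k M J x p V v" for v using p by (intro swt_nonneg)
  show "PE (pr V) p (\<lambda>E. v \<in> ends E) <= swt k M J x p V v" if "v \<in> V" for v
   using t0[of "[v]"] that by simp
  show "(1 - eta) * swt k M J x p V v <= PE (pr V) p (\<lambda>E. v \<in> ends E)" if "v \<in> V" for v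
   using low[OF that] that by (simp add: ends_def)
  show "PE (pr V) p (\<lambda>E. v \<in> ends E \<and> w \<in> ends E) <= swt k M J x p V v * swt k M J x p V w"
   if "v \<in> V" "w \<in> V" "v \<noteq> w" for v w
   using t0[of "[v, w]"] that l(1) by simp
  show "0 <= e" by (rule e)
  show "0 < sum (swt k M J x p V) V" "0 < y" "real l < (1 - y) * sum (swt k M J x p V) V"
   using mu y l(2) unfolding mu_def by simp_all
  fix vs assume vs: "distinct vs" "length vs = Suc l" "set vs \<subseteq> V"
  have lx: "card (V - V) + length vs * Suc M + 1 <= x" using x vs(2) by simp
  define Bad where "Bad = (\<lambda>(acc :: 'a set list) W E. \<not> core_good t1 t2 l acc W E)"
  have "PE (pr V) p (\<lambda>E. set vs \<subseteq> ends E \<and> \<not> 2*(k + 1) + (t1 + t2 + 1) < diam V E)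
    <= PE (pr V) p (\<lambda>E. tupB k M J Bad E V vs [])"
  proof (rule Ex_mono[OF p(1) p1], rule of_bool_le)
   fix E assume EV: "E \<subseteq> pr V" and "set vs \<subseteq> ends E \<and> \<not> 2*(k + 1) + (t1 + t2 + 1) < diam V E"
   hence a: "set vs \<subseteq> ends E" and nd: "\<not> 2*(k + 1) + (t1 + t2 + 1) < diam V E" by blast+
   obtain C N where CN: "\<forall>v\<in>ends E. is_end k M J E V v (C v) (N v)" using sel by blast
   have CN': "is_end k M J E V v (C v) (N v)" if "v \<in> set vs" for v using CN a that by blast
   have "tupB k M J Bad E (V - (\<Union>u\<in>set []. insert u (C u))) vs (map N [])"
   proof (rule ends_tupB_aux[OF V, of "set vs"])
    show "is_end k M J E V v (C v) (N v)" if "v \<in> set vs" for v using that by (rule CN')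
    show "acc_ok J (map N []) (V - (\<Union>u\<in>set []. insert u (C u)))" by (simp add: acc_ok_def)
    assume "acc_ok J (map N ([] @ vs)) (V - (\<Union>u\<in>set ([] @ vs). insert u (C u)))"
    hence ac: "acc_ok J (map N vs) (V - (\<Union>u\<in>set vs. insert u (C u)))" by (simp only: append_Nil)
    show "Bad (map N ([] @ vs)) (V - (\<Union>u\<in>set ([] @ vs). insert u (C u)))
     (E \<inter> pr (V - (\<Union>u\<in>set ([] @ vs). insert u (C u))))"
     unfolding Bad_def append_Nil
    proof
     assume "core_good t1 t2 l (map N vs) (V - (\<Union>u\<in>set vs. insert u (C u)))
      (E \<inter> pr (V - (\<Union>u\<in>set vs. insert u (C u))))"
     from far_pair[OF V EV CN' vs(1,2) ac this] nd show False by blast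
    qed
   qed (use vs in simp_all)
   thus "tupB k M J Bad E V vs []" by simp
  qed
  also have "... <= prod_list (map (swt k M J x p V) vs)*(e0 + real (length vs)*(real (Suc l * Suc J)*p))"
  proof (rule tupB_bound[OF V p e0 _ order_refl vs(1,3) lx])
   show "PE (pr W) p (\<lambda>E. Bad acc W E) <= e0"
    if "acc_ok J acc W" "W \<subseteq> V" "card (V - W) <= x" "length acc = Suc l" for acc and W :: "'a set"
    unfolding Bad_def using that by (rule core)
  qed (simp_all add: vs(2) acc_ok_def)
  also have "... = e*prod_list (map (swt k M J x p V) vs)" unfolding e_def vs(2) by simp
  finally show "PE (pr V) p (\<lambda>E. set vs \<subseteq> ends E \<and> \<not> 2*(k + 1) + (t1 + t2 + 1) < diam V E)
   <= e*prod_list (map (swt k M J x p V) vs)" .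
 qed
 thus ?thesis unfolding mu_def e_def .
qed

section \<open>The upper bound for large \<open>n\<close>\<close>

text \<open>Cap on explored vertices: well above \<open>n powr (61/100)\<close>, the bound for
  \<open>(4 * L) ^ (K + s)\<close> in \<open>cap_small\<close>, yet so small that losing
  \<open>3 * mb n\<close> vertices changes the offspring mean by less than
  \<open>1 / (8 * ln n)\<close>.\<close>

definition mb :: "nat => nat" where "mb n = nat \<lceil>real n powr (3/4)\<rceil>"

text \<open>An offspring mean valid as long as at most \<open>3 * mb n\<close> vertices are explored.\<close>

definition kap :: "nat => real => real" where "kap n L = L - 1/(8*ln (real n))"

text \<open>The standing hypotheses at a single \<open>n\<close>, with \<open>L\<close> for
  \<open>lam n\<close> and \<open>S\<close> for \<open>lam_star n\<close>; the growth condition is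
  put in polynomial form.\<close>

definition base :: "nat => real => real => bool" where
 "base n L S \<longleftrightarrow> L^1000 <= real n \<and> 0 < S \<and> S < 1 \<and> S*exp (- S) = L*exp (- L)"

text \<open>Large \<open>L\<close> forces large \<open>n\<close> through
  \<open>L ^ 1000 <= n\<close>. Asymptotic facts in \<open>n\<close> thereby enter statements that
  are uniform in \<open>n\<close> for large \<open>L\<close>.\<close>

lemma ev_n:
 assumes "eventually P sequentially"
 shows "\<forall>\<^sub>F L in at_top. \<forall>n. (L::real)^1000 <= real n --> P n"
proof -
 obtain N where N: "\<And>n. N <= n ==> P n" using assms by (auto simp: eventually_sequentially)
 show ?thesis
 proof (rule eventually_mono[OF eventually_ge_at_top[of "max 1 (real N)"]])
  fix L :: real assume L: "max 1 (real N) <= L"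
  show "\<forall>n. L^1000 <= real n --> P n"
  proof (intro allI impI N)
   fix n assume n: "L^1000 <= real n"
   have "L^1 <= L^1000" using L by (intro power_increasing) auto
   hence "real N <= real n" using L n by simp
   thus "N <= n" by simp
  qed
 qed
qed

lemma le_powr_if:
 assumes "1 <= (L::real)" "L^1000 <= real n"
 shows "L <= real n powr (1/1000)" "1000*ln L <= ln (real n)" "1 <= real n"
proof -
 have p1: "1 <= L^1000" using assms by (intro one_le_power) auto
 thus n: "1 <= real n" using assms by linarith
 have "ln (L^1000) <= ln (real n)" using assms p1 by (intro ln_mono) auto
 thus l: "1000*ln L <= ln (real n)" using assms by (simp add: ln_realpow)
 have "exp (ln L) <= exp (ln (real n)/1000)" using l by simp
 thus "L <= real n powr (1/1000)" using assms n by (simp add: powr_def)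
qed

text \<open>For \<open>a * p > 1\<close> the left side is at most 1/2, the maximum of
  \<open>t * (1 - t/2)\<close>, and the right side at least 1/2.\<close>

lemma one_minus_pow_lower:
 assumes "0 <= p" "p <= (1::real)"
 shows "real a*p*(1 - real a*p/2) <= 1 - (1 - p)^a"
proof (cases "real a*p <= 1")
 case True
 define t where "t = real a*p"
 have t: "0 <= t" "t <= 1" using assms True by (auto simp: t_def)
 have "(1 - p)^a <= exp (- t)" using one_minus_pow_le[OF assms] by (simp add: t_def)
 also have "... <= 1 - t + t^2/2"
 proof -
  have "1 + t + t^2/2 <= exp t" using exp_lower_Taylor_quadratic[OF t(1)] by simp
  moreover have "(1 - t + t^2/2)*(1 + t + t^2/2) = 1 + (t^2)^2/4" by (simp add: field_simps power2_eq_square)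
  moreover have "0 <= 1 - t + t^2/2" using t by simp
  ultimately have "1 <= (1 - t + t^2/2)*exp t"
   by (smt (verit) mult_left_mono zero_le_power2 divide_nonneg_pos)
  thus ?thesis by (simp add: exp_minus field_simps)
 qed
 finally show ?thesis by (simp add: t_def field_simps power2_eq_square)
next
 case False
 define t where "t = real a*p"
 have t: "1 < t" using False by (simp add: t_def)
 have "(1 - p)^a <= exp (- t)" using one_minus_pow_le[OF assms] by (simp add: t_def)
 also have "... <= exp (- 1)" using t by simp
 also have "... <= 1/2" using exp_ge_add_one_self[of 1] by (simp add: exp_minus field_simps)
 finally have "(1 - p)^a <= 1/2" .
 moreover have "t*(1 - t/2) <= 1/2" using zero_le_power2[of "t - 1"] by (simp add: power2_eq_square field_simps)
 ultimately show ?thesis by (simp add: t_def)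
qed

text \<open>Depletion of \<open>u\<close> and the quadratic term in \<open>a\<close> lose relative
  amounts \<open>x\<close> and \<open>y\<close> of order \<open>n powr (- 1/4)\<close> up to small
  powers of \<open>n\<close>, far below what \<open>kap\<close> grants. The range
  \<open>3 * mb n\<close> rather than \<open>2 * mb n\<close> leaves room for vertex sets that
  already miss \<open>mb n\<close> vertices.\<close>

lemma offspring_base:
 "\<forall>\<^sub>F L in at_top. \<forall>n u0. L^1000 <= real n --> n - 3*mb n <= u0 -->
   offspring_lb (L/real n) (kap n L) (2*mb n) u0 \<and> 3*mb n <= n \<and> 1 <= mb n \<and> L <= real n \<and> 3 <= ln (real n)" (is "\<forall>\<^sub>F L in _. \<forall>n u0. _ --> _ --> ?P L n u0")
proof -
 have "\<forall>\<^sub>F n::nat in sequentially. 8*ln (real n)*(real n powr (1/1000)*((3*(real n powr (3/4) + 1) + 1) + (real n powr (3/4) + 1)*real n powr (1/1000))) <= real n"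
  by real_asymp
 moreover have "\<forall>\<^sub>F n::nat in sequentially. 3*(real n powr (3/4) + 1) + 1 <= real n" by real_asymp
 moreover have "\<forall>\<^sub>F n::nat in sequentially. 3 <= ln (real n)" by real_asymp
 moreover have "\<forall>\<^sub>F n::nat in sequentially. real n powr (1/1000) <= real n" by real_asymp
 ultimately have ev: "\<forall>\<^sub>F n::nat in sequentially. 8*ln (real n)*(real n powr (1/1000)*((3*(real n powr (3/4) + 1) + 1) + (real n powr (3/4) + 1)*real n powr (1/1000))) <= real n
   \<and> 3*(real n powr (3/4) + 1) + 1 <= real n \<and> 3 <= ln (real n) \<and> real n powr (1/1000) <= real n"
  by (intro eventually_conj)
 show ?thesis
  using ev_n[OF ev] eventually_ge_at_top[of 2]
 proof eventually_elim
  case (elim L)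
  show ?case
  proof (intro allI impI)
   fix n u0 assume n: "L^1000 <= real n" and u0: "n - 3*mb n <= u0"
   define N where "N = real n"
   define B where "B = N powr (3/4) + 1"
   define D where "D = N powr (1/1000)"
   note e = elim(1)[rule_format, OF n]
   have LD: "L <= D" and N1: "1 <= N" using le_powr_if[of L n] elim(2) n by (auto simp: D_def N_def)
   have e1: "8*ln N*(D*((3*B + 1) + B*D)) <= N" and e2: "3*B + 1 <= N" and e3: "3 <= ln N" and e4: "D <= N"
    using e by (auto simp: N_def B_def D_def)
   have mB: "real (mb n) <= B" "1 <= real (mb n)"
   proof -
    show "real (mb n) <= B" unfolding mb_def B_def N_def by (simp add: of_nat_ceiling)
    have "0 < N powr (3/4)" using N1 by simp
    hence "0 < \<lceil>N powr (3/4)\<rceil>" by simp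
    thus "1 <= real (mb n)" unfolding mb_def N_def by linarith
   qed
   have B1: "1 <= B" using mB by linarith
   have m3: "3*real (mb n) + 1 <= N" using mB e2 by linarith
   hence m3n: "3*mb n + 1 <= n" unfolding N_def by linarith
   have LN: "L <= N" using LD e4 by linarith
   have p: "0 <= L/N" "L/N <= 1" using elim(2) LN N1 by auto
   have main: "kap n L <= (real u - 1)*(L/N)*(1 - real a*(L/N)/2)"
    if a: "a <= 2*mb n" and u: "u0 <= u" for a u
   proof -
    define x where "x = (3*real (mb n) + 1)/N"
    define y where "y = real (mb n)*L/N"
    have xy: "0 <= x" "0 <= y" using N1 elim(2) by (auto simp: x_def y_def)
    have "x + y <= ((3*B + 1) + B*D)/N" 
     unfolding x_def y_def add_divide_distrib[symmetric] using N1 mB LD elim(2)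
     by (intro divide_right_mono add_mono mult_mono) auto
    hence "L*(x + y) <= D*(((3*B + 1) + B*D)/N)" using LD elim(2) xy by (intro mult_mono) auto
    also have "... <= 1/(8*ln N)"
    proof -
     define Y where "Y = (3*B + 1) + B*D"
     have "D*Y*(8*ln N) <= N" using e1 unfolding Y_def by (simp only: mult_ac)
     hence "D*Y/N <= 1/(8*ln N)"
      using e3 N1 by (simp only: pos_divide_le_eq pos_le_divide_eq times_divide_eq_left mult_1)
     thus ?thesis unfolding Y_def by simp
    qed
    finally have k: "kap n L <= L*(1 - x - y)" by (simp add: kap_def N_def algebra_simps)
    have y1: "y <= 1"
    proof -
     have "real (mb n)*L*1 <= D*((3*B + 1) + B*D)*(8*ln N)"
     proof (rule mult_mono)
      show "1 <= 8*ln N" using e3 by simp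
      have "real (mb n)*L <= B*D" using mB LD elim(2) by (intro mult_mono) auto
      also have "... <= D*(3*B + 1)" using B1 LD elim(2) by (simp add: algebra_simps)
      also have "... <= D*((3*B + 1) + B*D)" using B1 LD elim(2) by (intro mult_left_mono) auto
      finally show "real (mb n)*L <= D*((3*B + 1) + B*D)" .
     qed (use LD elim(2) B1 in auto)
     also have "... <= N" using e1 by (simp add: mult_ac)
     finally show ?thesis using N1 by (simp add: y_def)
    qed
    have "n - 3*mb n <= u" using u u0 by linarith
    hence "real n - 3*real (mb n) <= real u" using m3n by linarith
    hence un: "N*(1 - x) <= real u - 1" 
    proof -
     have "N*x = 3*real (mb n) + 1" using N1 by (simp add: x_def)
     hence "N*(1 - x) = N - (3*real (mb n) + 1)" by (simp add: right_diff_distrib)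
     thus ?thesis using \<open>real n - 3 * real (mb n) <= real u\<close> by (simp add: N_def)
    qed
    have x1: "x <= 1" using m3 N1 by (simp add: x_def)
    have "real a <= 2*real (mb n)" using a by linarith
    hence "real a*(L/N) <= 2*real (mb n)*(L/N)" using p by (intro mult_right_mono) auto
    also have "... = 2*y" by (simp add: y_def)
    finally have ay: "1 - y <= 1 - real a*(L/N)/2" by (simp add: field_simps)
    have "L*(1 - x - y) <= L*((1 - x)*(1 - y))" using elim(2) xy by (intro mult_left_mono) (auto simp: algebra_simps)
    also have "... = (N*(1 - x))*(L/N)*(1 - y)" using N1 by simp
    also have "... <= (real u - 1)*(L/N)*(1 - real a*(L/N)/2)"
    proof -
     have "0 <= N*(1 - x)" using N1 x1 by simp
     hence u0: "0 <= real u - 1" using un by linarith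
     have m1: "0 <= (real u - 1)*(L/N)" by (rule mult_nonneg_nonneg[OF u0 p(1)])
     have m2: "(N*(1 - x))*(L/N) <= (real u - 1)*(L/N)" by (rule mult_right_mono[OF un p(1)])
     have m3: "0 <= 1 - y" using y1 by simp
     show ?thesis by (rule mult_mono[OF m2 ay m1 m3])
    qed
    finally show ?thesis using k by linarith
   qed
   have kap0: "0 <= kap n L" 
   proof -
    have "1/(8*ln N) <= 1" using e3 by (simp add: field_simps)
    thus ?thesis using elim(2) by (simp add: kap_def N_def)
   qed
   have "offspring_lb (L/real n) (kap n L) (2*mb n) u0"
    unfolding offspring_lb_def
   proof (intro conjI allI impI)
    show "1 <= u0" using u0 m3n by linarith
    fix a u assume au: "a <= 2*mb n" "u0 <= u"
    have u1: "0 <= real u - 1" using au u0 m3n by linarith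
    have "kap n L*real a <= (real u - 1)*(L/N)*(1 - real a*(L/N)/2)*real a"
     by (rule mult_right_mono[OF main[OF au]]) simp
    also have "... = (real u - 1)*(real a*(L/N)*(1 - real a*(L/N)/2))" by simp
    also have "... <= (real u - 1)*(1 - (1 - L/N)^a)"
     by (intro mult_left_mono one_minus_pow_lower p u1)
    finally show "kap n L*real a <= (real u - 1)*(1 - (1 - L/real n)^a)" by (simp add: N_def)
   qed (rule kap0)
   thus "?P L n u0"
    using m3n mB(2) LN e3 by (auto simp: N_def)
  qed
 qed
qed

text \<open>The \<open>s\<close> growing generations account for about \<open>sqrt n\<close> and the
  \<open>K\<close> thin ones for a vanishing power of \<open>n\<close>, so
  \<open>(4 * L) ^ (K + s)\<close> is at most \<open>n powr (61/100)\<close>. Against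
  \<open>mb n\<close> this leaves room for \<open>n powr (1/10)\<close> in the exponent.\<close>

lemma cap_small:
 "\<forall>\<^sub>F L in at_top. \<forall>n s K. L^1000 <= real n --> real K <= 2*ln (real n)/L + 1 -->
   2*real s*ln L <= ln (real n) + 4*ln L -->
   exp (1 - real (mb n - 1)/(4*L)^(K + s)) <= exp (- (real n powr (1/10)))"
proof -
 have "\<forall>\<^sub>F n::nat in sequentially. 10*(2 + ln (real n)/1000) <= (1/20)*ln (real n)" by real_asymp
 moreover have "\<forall>\<^sub>F n::nat in sequentially. (real n powr (1/10) + 1)*real n powr (61/100) + 1 <= real n powr (3/4)" by real_asymp
 ultimately have ev: "\<forall>\<^sub>F n::nat in sequentially. 10*(2 + ln (real n)/1000) <= (1/20)*ln (real n)
   \<and> (real n powr (1/10) + 1)*real n powr (61/100) + 1 <= real n powr (3/4)"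
  by (intro eventually_conj)
 have evL: "\<forall>\<^sub>F L in at_top. (2 + ln L)*(2/L + 1/(2*ln L)) <= (56/100::real)" by real_asymp
 show ?thesis
  using ev_n[OF ev] evL eventually_ge_at_top[of 3]
 proof eventually_elim
  case (elim L)
  show ?case
  proof (intro allI impI)
   fix n s K assume n: "L^1000 <= real n" and K: "real K <= 2*ln (real n)/L + 1"
    and s: "2*real s*ln L <= ln (real n) + 4*ln L"
   define N where "N = real n"
   define w where "w = ln N"
   have e1: "10*(2 + w/1000) <= (1/20)*w" and e2: "(N powr (1/10) + 1)*N powr (61/100) + 1 <= N powr (3/4)"
    using elim(1)[rule_format, OF n] by (auto simp: w_def N_def)
   have L: "3 <= L" "0 < ln L" "1000*ln L <= w" "1 <= N"
    using elim(3) le_powr_if[of L n] n by (auto simp: w_def N_def)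
   have sb: "real s <= w/(2*ln L) + 2" using s L by (simp add: w_def N_def field_simps)
   have ln4: "ln (4*L) <= 2 + ln L"
   proof -
    have "4 <= exp (2::real)" using exp_lower_Taylor_quadratic[of 2] by simp
    hence "ln 4 <= ln (exp (2::real))" by (intro ln_mono) auto
    thus ?thesis using L by (simp add: ln_mult)
   qed
   have "ln ((4*L)^(K + s)) = (real K + real s)*ln (4*L)"
    using L by (subst ln_realpow) auto
   also have "... <= ((2*w/L + 1) + (w/(2*ln L) + 2))*(2 + ln L)"
    using K sb ln4 L by (intro mult_mono add_mono) (auto simp: w_def N_def)
   also have "... = w*((2 + ln L)*(2/L + 1/(2*ln L))) + 3*(2 + ln L)" using L by (simp add: field_simps)
   also have "... <= w*(56/100) + 10*(2 + w/1000)"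
   proof -
    have "0 <= w" using L(2,3) by linarith
    hence "w*((2 + ln L)*(2/L + 1/(2*ln L))) <= w*(56/100)" by (rule mult_left_mono[OF elim(2)])
    moreover have "3*(2 + ln L) <= 10*(2 + w/1000)" using L(3) \<open>0 <= w\<close> by (simp add: algebra_simps)
    ultimately show ?thesis by linarith
   qed
   also have "... <= 61/100*w" using e1 L by linarith
   finally have "ln ((4*L)^(K + s)) <= 61/100*w" .
   hence "exp (ln ((4*L)^(K + s))) <= exp (61/100*w)" by simp
   hence P: "(4*L)^(K + s) <= N powr (61/100)" using L by (simp add: powr_def w_def)
   have mbl: "N powr (3/4) - 1 <= real (mb n - 1)"
   proof -
    have "N powr (3/4) <= real (mb n)" unfolding mb_def N_def by (simp add: real_nat_ceiling_ge)
    thus ?thesis by linarith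
   qed
   have Lp: "0 < (4*L)^(K + s)" using L by simp
   have "(N powr (1/10) + 1)*(4*L)^(K + s) <= (N powr (1/10) + 1)*N powr (61/100)"
    using P by (intro mult_left_mono) auto
   also have "... <= real (mb n - 1)" using e2 mbl by linarith
   finally have "N powr (1/10) + 1 <= real (mb n - 1)/(4*L)^(K + s)" using Lp by (simp add: field_simps)
   thus "exp (1 - real (mb n - 1)/(4*L)^(K + s)) <= exp (- (real n powr (1/10)))" by (simp add: N_def)
  qed
 qed
qed

text \<open>\<open>L * (1 - exp (- g))\<close> with relative losses of \<open>1 / sqrt L\<close>:
  the exponent obtained when about \<open>L\<close> children each contribute a transform
  \<open>exp (- g)\<close>. It behaves like \<open>L * g\<close> for small \<open>g\<close> and like
  \<open>L\<close> for large \<open>g\<close>.\<close>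

definition uu :: "real => real => real" where
 "uu L g = (1 - 1/sqrt L)*L*(1 - exp (- ((1 - 1/sqrt L)*g)))"

lemma kap_bounds:
 assumes "3 <= ln (real n)"
 shows "L - 1 <= kap n L" "kap n L <= L"
proof -
 have "1/(8*ln (real n)) <= 1" "0 <= 1/(8*ln (real n))" using assms by (auto simp: field_simps)
 thus "L - 1 <= kap n L" "kap n L <= L" by (auto simp: kap_def)
qed

lemma ev_ln3: "\<forall>\<^sub>F L in at_top. \<forall>n. (L::real)^1000 <= real n --> 3 <= ln (real n)"
 by (rule ev_n) real_asymp

text \<open>\<open>zit_saturate\<close>, with the initial Laplace parameter scaled so that it has
  grown to about \<open>g\<close> after \<open>s - 1\<close> generations.\<close>

lemma zit_front:
 "\<forall>\<^sub>F L in at_top. \<forall>n s g z. L^1000 <= real n --> 1 <= s --> 2*real s*ln L <= ln (real n) + 4*ln L -->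
   0 <= g --> g <= sqrt L/2 --> 0 <= z --> z <= exp (- (g/L^(s - 1))) -->
   zit (kap n L) z s <= exp (- uu L g)"
proof -
 have ev: "\<forall>\<^sub>F L in at_top. 1 - 1/sqrt L <= (1 - 1/L)*(1 - (sqrt L/2)/(L - 1))" by real_asymp
 have ev1: "\<forall>\<^sub>F L in at_top. 1 <= ln (L::real)" by real_asymp
 have ev2: "\<forall>\<^sub>F L in at_top. sqrt L/2 <= L - 1" by real_asymp
 show ?thesis
  using ev ev1 ev2 ev_ln3 eventually_ge_at_top[of 4]
 proof eventually_elim
  case (elim L)
  show ?case
  proof (intro allI impI)
   fix n s g z
   assume n: "L^1000 <= real n" and s: "1 <= s" "2*real s*ln L <= ln (real n) + 4*ln L"
    and g: "0 <= g" "g <= sqrt L/2" and z: "0 <= z" "z <= exp (- (g/L^(s - 1)))"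
   define k where "k = kap n L"
   define w where "w = ln (real n)"
   obtain l where l: "s = Suc l" using s(1) by (cases s) auto
   have w3: "3 <= w" using elim(4) n by (simp add: w_def)
   have k: "L - 1 <= k" "k <= L" "2 <= k" using kap_bounds[of n L] w3 elim(5) by (auto simp: k_def w_def)
   have wl: "1000*ln L <= w" using le_powr_if[of L n] elim(5) n by (simp add: w_def)
   have lw: "real l <= 8*w"
   proof -
    have "real s*(2*1) <= real s*(2*ln L)" using elim(2) by (intro mult_left_mono) auto
    hence "2*real s <= w + 4*ln L" using s(2) by (simp add: w_def mult_ac)
    hence "real s <= 8*w" using wl w3 by linarith
    thus ?thesis using l by simp
   qed
   \<comment> \<open>\<open>kap\<close> differs from \<open>L\<close> by
     \<open>1 / (8 * ln n)\<close> and \<open>l <= 8 * ln n\<close>, so by Bernoulli replacing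
     \<open>k\<close> by \<open>L\<close> in the power loses at most a relative
     \<open>1 / L\<close>.\<close>
   define c where "c = (k/L)^l"
   have c1: "c <= 1" "0 <= c" using k elim(5) by (auto simp: c_def intro!: power_le_one)
   have c2: "1 - 1/L <= c"
   proof -
    have kL: "k/L = 1 - 1/(8*w*L)" using elim(5) by (simp add: k_def kap_def w_def field_simps)
    have b: "0 <= 1/(8*w*L)" "1/(8*w*L) <= 1"
     using w3 elim(5) mult_mono[of 1 "8*w" 1 L] by auto
    have "1 - real l*(1/(8*w*L)) <= (1 - 1/(8*w*L))^l"
     using Bernoulli_inequality[of "- (1/(8*w*L))" l] b by simp
    moreover have "real l*(1/(8*w*L)) <= 8*w*(1/(8*w*L))" using lw b by (intro mult_right_mono) auto
    moreover have "8*w*(1/(8*w*L)) = 1/L" using w3 by simp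
    ultimately show ?thesis unfolding c_def kL by linarith
   qed
   have hk: "k^l*(g/L^l) = c*g" by (simp add: c_def power_divide)
   have cg: "c*g <= g" using c1 g by (intro mult_left_le_one_le) auto
   have gk: "g <= k" using g elim(3) k by linarith
   define G where "G = (1 - 1/sqrt L)*g"
   have G: "G <= c*g*(1 - c*g/k)"
   proof -
    have "(1 - 1/sqrt L)*g <= ((1 - 1/L)*(1 - (sqrt L/2)/(L - 1)))*g"
     using elim(1) g by (intro mult_right_mono) auto
    also have "... = ((1 - 1/L)*g)*(1 - (sqrt L/2)/(L - 1))" by simp
    also have "... <= (c*g)*(1 - c*g/k)"
    proof (rule mult_mono)
     show "(1 - 1/L)*g <= c*g" using c2 g by (intro mult_right_mono) auto
     have "c*g/k <= (sqrt L/2)/(L - 1)" using cg g k elim(5) by (intro frac_le) auto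
     thus "1 - (sqrt L/2)/(L - 1) <= 1 - c*g/k" by simp
     show "0 <= c*g" using c1 g by simp
     show "0 <= 1 - (sqrt L/2)/(L - 1)" using elim(3,5) by simp
    qed
    finally show ?thesis by (simp add: G_def)
   qed
   have z1: "z <= 1"
   proof -
    have "0 <= g/L^(s - 1)" using g elim(5) by simp
    hence "exp (- (g/L^(s - 1))) <= 1" by simp
    with z show ?thesis by linarith
   qed
   have "zit k z (Suc l) <= exp (- (k*(1 - exp (- G))))"
   proof (rule zit_saturate[OF k(3) _ _ z(1) _ z1])
    show "0 <= g/L^l" using g elim(5) by simp
    show "k^l*(g/L^l) <= k" unfolding hk using cg gk by linarith
    show "z <= exp (- (g/L^l))" using z(2) l by simp
    show "G <= k^l*(g/L^l)*(1 - k^l*(g/L^l)/k)" unfolding hk by (rule G)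
   qed
   also have "... <= exp (- uu L g)"
   proof -
    have sL: "0 < sqrt L" "1 <= sqrt L" using elim(5) by auto
    have "sqrt L * sqrt L = L" using elim(5) by simp
    hence LL: "L/sqrt L = sqrt L" using sL by (simp add: field_simps)
    have "(1 - 1/sqrt L)*L = L - sqrt L" using LL by (simp add: algebra_simps)
    hence A: "(1 - 1/sqrt L)*L <= k" using k sL by linarith
    have "0 <= G" unfolding G_def using sL g by (intro mult_nonneg_nonneg) auto
    hence "0 <= 1 - exp (- G)" by simp
    with A have "(1 - 1/sqrt L)*L*(1 - exp (- G)) <= k*(1 - exp (- G))" by (rule mult_right_mono)
    thus ?thesis by (simp add: uu_def G_def)
   qed
   finally show "zit (kap n L) z s <= exp (- uu L g)" by (simp add: k_def l)
  qed
 qed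
qed

text \<open>\<open>S / L\<close> is the extinction probability of the Poisson branching process with
  mean \<open>L\<close>, and \<open>S\<close> is the mean of its dual: the equation defining
  \<open>lam_star\<close> is the fixed point equation.\<close>

lemma base_q:
 assumes "base n L S" "0 < L"
 defines "q \<equiv> S/L"
 shows "0 < q" "q = exp (- (L*(1 - q)))" "L*q = S"
proof -
 have S: "0 < S" "S*exp (- S) = L*exp (- L)" using assms by (auto simp: base_def)
 show "0 < q" using S assms by simp
 show Lq: "L*q = S" using assms by simp
 have "S = L*(exp (- L)*exp S)"
  using S(2) by (simp add: exp_minus field_simps)
 hence "q = exp (- L)*exp S" unfolding q_def using assms(2) by (simp add: field_simps)
 also have "... = exp (- (L*(1 - q)))" by (simp add: exp_add[symmetric] right_diff_distrib Lq)
 finally show "q = exp (- (L*(1 - q)))" .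
qed

text \<open>\<open>zit_prod_upper\<close> with \<open>q = S / L\<close>, so that one thin generation
  costs \<open>L * q = S\<close>.\<close>

lemma thinb_bound:
 "\<forall>\<^sub>F L in at_top. \<forall>n S s K z u. base n L S --> real K <= 2*ln (real n)/L + 1 --> 0 <= z --> z <= 1 -->
   zit (kap n L) z s <= exp (- u) --> 1 <= u --> thinb L (kap n L) K z s <= S^K*exp (1 - u + L*exp (- u))"
proof -
 have ev: "\<forall>\<^sub>F L in at_top. 2*L^2*exp (- (L - 1)/2) <= (1/4::real)" by real_asymp
 show ?thesis
  using ev ev_ln3 eventually_ge_at_top[of 8]
 proof eventually_elim
  case (elim L)
  show ?case
  proof (intro allI impI)
   fix n S s K z u
   assume b: "base n L S" and K: "real K <= 2*ln (real n)/L + 1" and z: "0 <= z" "z <= 1"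
    and zs: "zit (kap n L) z s <= exp (- u)" and u: "1 <= u"
   define k where "k = kap n L"
   define w where "w = ln (real n)"
   have w3: "3 <= w" using elim(2) b by (simp add: base_def w_def)
   have k: "L - 1 <= k" "k <= L" "2 <= k" using kap_bounds[of n L] w3 elim(3) by (auto simp: k_def w_def)
   have z0: "0 <= zit k z s" using zit_01(1)[of k z s] k z by simp
   have half: "zit k z s <= 1/2"
   proof -
    have "exp (- u) <= exp (- 1)" using u by simp
    also have "... <= 1/2" using exp_ge_add_one_self[of 1] by (simp add: exp_minus field_simps)
    finally show ?thesis using zs by (simp add: k_def)
   qed
   have q: "0 < S/L" "S/L = exp (- (L*(1 - S/L)))" "L*(S/L) = S" using base_q[OF b] elim(3) by auto
   have "(\<Prod>i\<in>{s<..s + K}. L*zit k z i) <= (L*(S/L))^K*exp (L*zit k z s + 1)"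
   proof (rule zit_prod_upper[OF k(3,2) z half q(1,2)])
    have "exp (- k/2) <= exp (- (L - 1)/2)" using k by simp
    hence "2*L^2*exp (- k/2) <= 2*L^2*exp (- (L - 1)/2)" by (intro mult_left_mono) auto
    with elim(1) show "2*L^2*exp (- k/2) <= 1/4" by linarith
    \<comment> \<open>The constant 8 in \<open>kap\<close> acts here: over
      \<open>2 * ln n / L + 1\<close> generations the deficit of the mean adds up to at most
      1/4.\<close>
    have "real K*(L - k) = real K*(1/(8*w))" by (simp add: k_def kap_def w_def)
    also have "... <= (2*w/L + 1)*(1/(8*w))" using K w3 by (intro mult_right_mono) (auto simp: w_def)
    also have "... = 1/(4*L) + 1/(8*w)" using w3 elim(3) by (simp add: field_simps)
    also have "... <= 1/32 + 1/24" using w3 elim(3) by (intro add_mono divide_left_mono) auto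
    finally show "real K*(L - k) <= 1/4" by simp
   qed
   hence "thinb L k K z s <= zit k z s*(S^K*exp (L*zit k z s + 1))"
    unfolding thinb_def q(3) using z0 by (intro mult_left_mono) auto
   also have "... <= exp (- u)*(S^K*exp (L*exp (- u) + 1))"
    using zs z0 elim(3) b by (intro mult_mono mult_left_mono) (auto simp: k_def base_def intro!: mult_left_mono)
   also have "... = S^K*exp (1 - u + L*exp (- u))" by (simp add: exp_add[symmetric] algebra_simps)
   finally show "thinb L (kap n L) K z s <= S^K*exp (1 - u + L*exp (- u))" by (simp add: k_def)
  qed
 qed
qed

text \<open>\<open>upper_main\<close> with \<open>M - 1\<close> split into nearly equal
  \<open>s\<close>, \<open>s'\<close> and with thresholds \<open>w * L ^ s\<close>,
  \<open>w * L ^ s'\<close>. The parameter \<open>g\<close> acts against spheres below the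
  threshold, \<open>g2\<close> is what the threshold of the opposite sphere provides in the pair
  event; they stay separate because different regimes need different choices.\<close>

lemma upper_asymp:
 "\<forall>\<^sub>F L in at_top. \<forall>n S K M g g2 w. base n L S --> real K <= 2*ln (real n)/L + 1 --> 3 <= M -->
   L^M <= real n*L^2 --> 0 <= g --> g <= sqrt L/2 --> 0 <= g2 --> g2 <= sqrt L/2 -->
   1 <= uu L g --> 1 <= uu L g2 --> 0 <= w --> 2*L*g2 <= w*(L^M/real n) -->
   PE (pairs n) (L/real n) (\<lambda>E. 2*K + M < diam {1..n} E)
    <= 2*(real n * S^K)*exp (g*w*L + (1 - uu L g + L*exp (- uu L g)))
     + (real n * S^K*exp (1 - uu L g2 + L*exp (- uu L g2)))^2 + 1/L"
proof -
 have "\<forall>\<^sub>F n::nat in sequentially. real n*(exp (- (real n powr (1/10))) + exp (- (real n powr (1/10)))) <= 1/real n powr (1/1000)"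
  by real_asymp
 note ev = ev_n[OF this]
 show ?thesis
  using ev ev_ln3 offspring_base cap_small zit_front thinb_bound eventually_ge_at_top[of 8]
 proof eventually_elim
  case (elim L)
  show ?case
  proof (intro allI impI)
   fix n S K M g g2 w
   assume b: "base n L S" and K: "real K <= 2*ln (real n)/L + 1" and M: "3 <= M" "L^M <= real n*L^2"
    and g: "0 <= g" "g <= sqrt L/2" "0 <= g2" "g2 <= sqrt L/2" and u: "1 <= uu L g" "1 <= uu L g2"
    and w: "0 <= w" "2*L*g2 <= w*(L^M/real n)"
   have nL: "L^1000 <= real n" and S0: "0 < S" using b by (auto simp: base_def)
   have n1: "1 <= real n" and Ln: "L <= real n powr (1/1000)" using le_powr_if[of L n] elim(7) nL by auto
   define s where "s = (M - 1) div 2"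
   define s' where "s' = M - 1 - s"
   have ss: "s + s' + 1 = M" "1 <= s" "1 <= s'" "2 * s <= M" "2 * s' <= M" using M by (auto simp: s_def s'_def)
   define k where "k = kap n L"
   define p where "p = L/real n"
   note off = elim(3)[rule_format, OF nL]
   have o1: "offspring_lb p k (2*mb n) (n - 2*mb n)" unfolding p_def k_def by (rule off[THEN conjunct1]) simp
   have o2: "3*mb n <= n" "1 <= mb n" "L <= real n" using off[of n] by auto
   have p: "0 <= p" "p <= 1" "real n*p = L" using o2 elim(7) n1 by (auto simp: p_def)
   have Mh: "real M*ln L <= ln (real n) + 2*ln L"
   proof -
    have "ln (L^M) <= ln (real n*L^2)" using M(2) elim(7) n1 by (intro ln_mono) auto
    thus ?thesis using elim(7) n1 by (simp add: ln_mult ln_realpow)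
   qed
   have lnL: "0 < ln L" using elim(7) by simp
   have sh: "2*real r*ln L <= ln (real n) + 4*ln L" if "2*r <= M" for r
   proof -
    have "2*real r <= real M" using that by linarith
    hence "2*real r*ln L <= real M*ln L" using lnL by (intro mult_right_mono) auto
    with Mh lnL show ?thesis by linarith
   qed
   define E where "E v = S^K*exp (1 - v + L*exp (- v))" for v
   have T: "thinb L k K z r <= E (uu L v)"
    if "1 <= r" "2*r <= M" "0 <= v" "v <= sqrt L/2" "1 <= uu L v" "0 <= z" "z <= exp (- (v / L^(r - 1)))" for z r v
   proof -
    have zz: "zit k z r <= exp (- uu L v)"
     unfolding k_def using elim(5)[rule_format, OF nL that(1) sh[OF that(2)] that(3,4,6,7)] .
    have "0 <= v / L^(r - 1)" using that elim(7) by simp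
    hence "exp (- (v / L^(r - 1))) <= 1" by simp
    hence z1: "z <= 1" using that(7) by linarith
    show ?thesis unfolding E_def k_def
     by (rule elim(6)[rule_format, OF b K that(6) z1 zz[unfolded k_def] that(5)])
   qed
   have LMp: "L^M = L^(s - 1)*L^s'*L^2"
   proof -
    have "M = (s - 1) + s' + 2" using ss by simp
    thus ?thesis by (simp only: power_add)
   qed
   have LMp': "L^M = L^(s' - 1)*L^s*L^2"
   proof -
    have "M = (s' - 1) + s + 2" using ss by simp
    thus ?thesis by (simp only: power_add)
   qed
   \<comment> \<open>The missing-edge factor is a Laplace transform at
     \<open>p * w * L ^ r' / 2\<close>. As \<open>L ^ M = L ^ (r - 1) * L ^ r' * L ^ 2\<close>, the
     condition on \<open>g2\<close> says exactly that this is at least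
     \<open>g2 / L ^ (r - 1)\<close>.\<close>
   have P: "exp (- (p*(w*L^r')/2)) <= exp (- (g2/L^(r - 1)))" if "L^M = L^(r - 1)*L^r'*L^2" for r r'
   proof -
    have "2*L*g2 <= w*(L^(r - 1)*L^r'*L^2/real n)" using w(2) that by simp
    also have "... = L*(2*L^(r - 1)*(p*(w*L^r')/2))" by (simp add: p_def power2_eq_square)
    finally have "L*(2*g2) <= L*(2*(L^(r - 1)*(p*(w*L^r')/2)))" by (simp add: mult_ac)
    hence "g2 <= L^(r - 1)*(p*(w*L^r')/2)" using elim(7) by simp
    hence "g2/L^(r - 1) <= p*(w*L^r')/2" using elim(7) by (simp add: pos_divide_le_eq mult.commute)
    thus ?thesis by simp
   qed
   have A: "0 <= w*L^r" "exp (g/L^(r - 1)*(w*L^r)) = exp (g*w*L)" if "1 <= r" for r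
   proof -
    show "0 <= w*L^r" using w elim(7) by simp
    have "L^r = L^(r - 1)*L" using that by (cases r) auto
    thus "exp (g/L^(r - 1)*(w*L^r)) = exp (g*w*L)" using elim(7) by simp
   qed
   have C: "exp (1 - real (mb n - 1)/(4*L)^(K + r)) <= exp (- (real n powr (1/10)))" if "2*r <= M" for r
    by (rule elim(4)[rule_format, OF nL K sh[OF that]])
   have KM: "2*K + s + s' + 1 = 2*K + M" using ss(1) by linarith
   have "PE (pairs n) p (\<lambda>E. 2*K + s + s' + 1 < diam {1..n} E)
    <= real n*(exp (g/L^(s - 1)*(w*L^s))*thinb L k K (exp (- (g/L^(s - 1)))) s
      + exp (g/L^(s' - 1)*(w*L^s'))*thinb L k K (exp (- (g/L^(s' - 1)))) s'
      + exp (1 - real (mb n - 1)/(4*L)^(K + s)) + exp (1 - real (mb n - 1)/(4*L)^(K + s')))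
     + real n^2*(thinb L k K (exp (- (p*(w*L^s')/2))) s*thinb L k K (exp (- (p*(w*L^s)/2))) s')"
    by (rule upper_main[OF p(1,2) _ _ o2(2) o1]) (use n1 o2 p(3) g elim(7) w in auto)
   also have "... <= real n*(exp (g*w*L)*E (uu L g) + exp (g*w*L)*E (uu L g)
      + exp (- (real n powr (1/10))) + exp (- (real n powr (1/10))))
     + real n^2*(E (uu L g2)*E (uu L g2))"
    unfolding A(2)[OF ss(2)] A(2)[OF ss(3)]
   proof (intro add_mono mult_left_mono mult_mono C ss(4,5))
    have k0: "0 <= k" using o1 by (simp add: offspring_lb_def)
    have L0: "0 <= L" using elim(7) by simp
    show "0 <= thinb L k K (exp (- (p*(w*L^s)/2))) s'"
     by (rule thinb_nonneg[OF k0]) (use L0 p w in auto)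
    show "0 <= E (uu L g2)" using S0 by (simp add: E_def)
   qed (auto intro!: T P ss g u LMp LMp')
   also have "... = 2*(real n * S^K)*exp (g*w*L + (1 - uu L g + L*exp (- uu L g)))
     + (real n * S^K*exp (1 - uu L g2 + L*exp (- uu L g2)))^2
     + real n*(exp (- (real n powr (1/10))) + exp (- (real n powr (1/10))))"
    unfolding E_def exp_add[of "g*w*L"] power2_eq_square by (simp add: algebra_simps)
   also have "... <= 2*(real n * S^K)*exp (g*w*L + (1 - uu L g + L*exp (- uu L g)))
     + (real n * S^K*exp (1 - uu L g2 + L*exp (- uu L g2)))^2 + 1/L"
   proof (rule add_left_mono)
    have "real n*(exp (- (real n powr (1/10))) + exp (- (real n powr (1/10)))) <= 1/real n powr (1/1000)"
     by (rule elim(1)[rule_format, OF nL])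
    also have "... <= 1/L" using Ln elim(7) by (intro frac_le) auto
    finally show "real n*(exp (- (real n powr (1/10))) + exp (- (real n powr (1/10)))) <= 1/L" .
   qed
   finally show "PE (pairs n) (L/real n) (\<lambda>E. 2*K + M < diam {1..n} E)
    <= 2*(real n * S^K)*exp (g*w*L + (1 - uu L g + L*exp (- uu L g)))
     + (real n * S^K*exp (1 - uu L g2 + L*exp (- uu L g2)))^2 + 1/L"
    unfolding p_def KM .
  qed
 qed
qed

section \<open>The lower bound for large \<open>n\<close>\<close>

text \<open>Size bound for branches and search length for aliveness. It exceeds height times level
  width, both at most of order \<open>ln n\<close>, while removing this much for each of about
  \<open>n powr (1/50)\<close> ends, up to logarithms, stays below \<open>mb n\<close>.\<close>

definition Mc :: "nat => nat" where "Mc n = nat \<lceil>real n powr (1/10)\<rceil>"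

lemma Mc_le: "real (Mc n) <= real n powr (1/10) + 1"
 unfolding Mc_def by (simp add: of_nat_ceiling)

lemma Mc_ge: "real n powr (1/10) <= real (Mc n)"
 unfolding Mc_def by (simp add: real_nat_ceiling_ge)

lemma mb_ge: "real n powr (3/4) <= real (mb n)"
 unfolding mb_def by (simp add: real_nat_ceiling_ge)

lemma card_cofinite:
 assumes "W \<subseteq> {1..n}" "card ({1..n} - W) <= c"
 shows "n <= card W + c" "card W <= n" "finite W"
proof -
 show f: "finite W" using assms(1) finite_subset by blast
 have "card ({1..n} - W) = n - card W" using assms(1) f by (simp add: card_Diff_subset)
 moreover show "card W <= n" using card_mono[OF _ assms(1)] by simp
 ultimately show "n <= card W + c" using assms(2) by linarith
qed

text \<open>The limiting constant is \<open>1 - exp (- 1)\<close>; \<open>55/100\<close> is the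
  \<open>1/2 + 1/20\<close> needed in \<open>disc_asymp\<close>.\<close>

lemma uu_one:
 assumes "10000 <= L"
 shows "55/100*L <= uu L 1"
proof -
 define x where "x = 1 - 1/sqrt L"
 have "sqrt (100^2) <= sqrt L" using assms by (intro real_sqrt_le_mono) simp
 hence "100 <= sqrt L" by simp
 hence "1/sqrt L <= 1/100" using assms by (intro divide_left_mono) auto
 hence x: "99/100 <= x" by (simp add: x_def)
 have "1 + x + x^2/2 <= exp x" using exp_lower_Taylor_quadratic[of x] x by simp
 moreover have "(99/100)^2 <= x^2" using x by (intro power_mono) auto
 ultimately have "248/100 <= exp x" using x by (simp add: power2_eq_square)
 hence "exp (- x) <= 100/248" by (simp add: exp_minus field_simps)
 hence "(99/100)*(148/248) <= x*(1 - exp (- x))" using x by (intro mult_mono) auto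
 hence "55/100 <= x*(1 - exp (- x))" by simp
 hence "55/100*L <= x*(1 - exp (- x))*L" using assms by (intro mult_right_mono) auto
 thus ?thesis by (simp add: uu_def x_def mult_ac)
qed

text \<open>With threshold \<open>A = L ^ s / 20\<close> and
  \<open>L ^ (2 * s) >= n * L ^ 2\<close>, a small sphere costs \<open>exp (L/20)\<close> times
  \<open>exp (- uu L 1)\<close>, and \<open>p * A * A\<close> is at least
  \<open>L ^ 3 / 400\<close>. Each of the five error terms of \<open>disc_prob\<close> is then at
  most \<open>exp (- L/2)\<close>.\<close>

lemma disc_asymp:
 "\<forall>\<^sub>F L in at_top. \<forall>n (W :: nat set) x y. L^1000 <= real n --> W \<subseteq> {1..n} --> card ({1..n} - W) <= mb n -->
   x \<in> W --> y \<in> W --> x \<noteq> y -->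
   PE (pr W) (L/real n) (\<lambda>E. (x, y) \<notin> (adj_rel (E \<inter> pr W))\<^sup>*) <= 5*exp (- (L/2))"
proof -
 have u1: "\<forall>\<^sub>F L in at_top. L/20 + L/2 <= uu L 1"
  using eventually_ge_at_top[of "10000::real"] 
 proof eventually_elim
  case (elim L)
  show ?case using uu_one[OF elim] by simp
 qed
 have "\<forall>\<^sub>F n::nat in sequentially. real n powr (1/1000) <= real n powr (1/10)" by real_asymp
 note ev = ev_n[OF this]
 show ?thesis
  using u1 ev ev_ln3 offspring_base cap_small zit_front eventually_ge_at_top[of 60]
 proof eventually_elim
  case (elim L)
  show ?case
  proof (intro allI impI)
   fix n and W :: "nat set" and x y
   assume n: "L^1000 <= real n" and W: "W \<subseteq> {1..n}" "card ({1..n} - W) <= mb n" and xy: "x \<in> W" "y \<in> W" "x \<noteq> y"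
   note cW = card_cofinite[OF W]
   define p where "p = L/real n"
   define w where "w = ln (real n)"
   define h where "h = ln L"
   define s where "s = Suc (nat \<lceil>w/(2*h)\<rceil>)"
   have w3: "3 <= w" using elim(3) n by (simp add: w_def)
   have n1: "1 <= real n" and Ln: "L <= real n powr (1/1000)" using le_powr_if[of L n] elim(7) n by auto
   have h: "0 < h" using elim(7) by (simp add: h_def)
   have sb: "w/(2*h) + 1 <= real s" "real s <= w/(2*h) + 2"
   proof -
    have "w/(2*h) <= real (nat \<lceil>w/(2*h)\<rceil>)" by (rule real_nat_ceiling_ge)
    thus "w/(2*h) + 1 <= real s" by (simp add: s_def)
    have "0 <= w/(2*h)" using w3 h by simp
    hence "real (nat \<lceil>w/(2*h)\<rceil>) <= w/(2*h) + 1" by (simp add: of_nat_ceiling)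
    thus "real s <= w/(2*h) + 2" by (simp add: s_def)
   qed
   have s2: "2*real s*h <= w + 4*h"
   proof -
    have "2*h*real s <= 2*h*(w/(2*h) + 2)" using sb h by (intro mult_left_mono) auto
    also have "... = w + 4*h" using h by (simp add: field_simps)
    finally show ?thesis by (simp add: mult_ac)
   qed
   have s3: "w + 2*h <= 2*h*real s"
   proof -
    have "2*h*(w/(2*h) + 1) <= 2*h*real s" using sb h by (intro mult_left_mono) auto
    moreover have "2*h*(w/(2*h) + 1) = w + 2*h" using h by (simp add: field_simps)
    ultimately show ?thesis by simp
   qed
   have Ls: "real n*L^2 <= L^s*L^s"
   proof -
    have "exp w = real n" "exp h = L" using n1 elim(7) by (simp_all add: w_def h_def)
    hence "real n*L^2 = exp (w + (h + h))" unfolding exp_add power2_eq_square by simp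
    also have "... <= exp (real s*h + real s*h)" using s3 by (simp add: mult_ac)
    also have "... = L^s*L^s" unfolding exp_add exp_of_nat_mult \<open>exp h = L\<close> ..
    finally show ?thesis .
   qed
   define A where "A = L^s/20"
   define hh where "hh = 1/L^(s - 1)"
   have hA: "hh*A = L/20" using elim(7) by (simp add: hh_def A_def s_def)
   have sq: "1 <= sqrt L/2"
   proof -
    have "sqrt 4 <= sqrt L" using elim(7) by (intro real_sqrt_le_mono) simp
    thus ?thesis by simp
   qed
   have s1: "1 <= s" by (simp add: s_def)
   have z: "zit (kap n L) (exp (- hh)) s <= exp (- uu L 1)"
    by (rule elim(6)[rule_format, OF n s1 s2[unfolded h_def w_def] _ sq]) (simp_all add: hh_def)
   have z': "exp (hh*A)*zit (kap n L) (exp (- hh)) s <= exp (- (L/2))"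
   proof -
    have "exp (hh*A)*zit (kap n L) (exp (- hh)) s <= exp (L/20)*exp (- uu L 1)"
     unfolding hA using z by (intro mult_left_mono) auto
    also have "... = exp (L/20 - uu L 1)" by (simp add: exp_add[symmetric])
    also have "... <= exp (- (L/2))" using elim(1) by simp
    finally show ?thesis .
   qed
   have c: "exp (1 - real (mb n - 1)/(4*L)^s) <= exp (- (L/2))"
   proof -
    have K0: "real 0 <= 2*ln (real n)/L + 1" using w3 elim(7) by (simp add: w_def)
    have "exp (1 - real (mb n - 1)/(4*L)^(0 + s)) <= exp (- (real n powr (1/10)))"
     by (rule elim(5)[rule_format, OF n K0 s2[unfolded h_def w_def]])
    also have "... <= exp (- (L/2))"
     using elim(2)[rule_format, OF n] Ln elim(7) by simp
    finally show ?thesis by simp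
   qed
   have e: "exp (- (p*A*A)) <= exp (- (L/2))"
   proof -
    have "L/2*400*real n <= L*(real n*L^2)"
    proof -
     have "200*1 <= L*L" using mult_mono[of 60 L 60 L] elim(7) by simp
     hence "(L*real n)*200 <= (L*real n)*(L*L)" using elim(7) by (intro mult_left_mono) auto
     thus ?thesis by (simp add: power2_eq_square mult_ac)
    qed
    also have "... <= L*(L^s*L^s)" using Ls elim(7) by (intro mult_left_mono) auto
    finally have "L/2 <= p*A*A" using n1 by (simp add: p_def A_def field_simps)
    thus ?thesis by simp
   qed
   note off = elim(4)[rule_format, OF n]
   have o2: "3*mb n <= n" "1 <= mb n" "L <= real n" using off[of n] by auto
   have p: "0 <= p" "p <= 1" using elim(7) o2 n1 by (auto simp: p_def)
   have o1: "offspring_lb p (kap n L) (2*mb n) (card W - 2*mb n)"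
    unfolding p_def by (rule off[THEN conjunct1]) (use cW in linarith)
   have cp: "real (card W)*p <= L"
   proof -
    have "real (card W)*p <= real n*p" using cW p by (intro mult_right_mono) auto
    thus ?thesis using n1 by (simp add: p_def)
   qed
   have "PE (pr W) p (\<lambda>E. (x, y) \<notin> (adj_rel (E \<inter> pr W))\<^sup>*)
    <= exp (hh*A)*zit (kap n L) (exp (- hh)) s + exp (1 - real (mb n - 1)/(4*L)^s)
     + (exp (hh*A)*zit (kap n L) (exp (- hh)) s + exp (1 - real (mb n - 1)/(4*L)^s) + exp (- (p*A*A)))"
    by (rule disc_prob[OF cW(3) xy p o2(2) _ o1 cp]) (use cW o2 elim(7) in \<open>auto simp: hh_def A_def\<close>)
   thus "PE (pr W) (L/real n) (\<lambda>E. (x, y) \<notin> (adj_rel (E \<inter> pr W))\<^sup>*) <= 5*exp (- (L/2))"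
    using z' c e unfolding p_def by linarith
  qed
 qed
qed

text \<open>The rate 3/4 is ample for dead neighbours: in \<open>lower_asymp\<close> the error gets
  multiplied by about \<open>exp (L/4)\<close> only, up to powers of \<open>L\<close> and
  \<open>ln L\<close>.\<close>

lemma dead_asymp:
 "\<forall>\<^sub>F L in at_top. \<forall>n (U :: nat set) u. L^1000 <= real n --> U \<subseteq> {1..n} --> card ({1..n} - U) <= Suc (Mc n) --> u \<in> U -->
   PE (pr U) (L/real n) (\<lambda>E. \<not> alive (Mc n) E U u) <= exp (1 - 3/4*L)
   \<and> (1 - L/real n)^card U <= 2*exp (- L)" (is "\<forall>\<^sub>F L in _. \<forall>n U u. _ --> _ --> _ --> _ --> ?P L n U u")
proof -
 have "\<forall>\<^sub>F n::nat in sequentially. 2*(real n powr (1/10) + 2) <= real n powr (3/4)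
   \<and> (real n powr (1/10) + 2)*(real n powr (1/1000)/real n) <= 1/2"
  by (intro eventually_conj; real_asymp)
 note ev = ev_n[OF this]
 show ?thesis
  using ev ev_ln3 offspring_base eventually_ge_at_top[of 8]
 proof eventually_elim
  case (elim L)
  show ?case
  proof (intro allI impI)
   fix n and U :: "nat set" and u
   assume n: "L^1000 <= real n" and U: "U \<subseteq> {1..n}" "card ({1..n} - U) <= Suc (Mc n)" and u: "u \<in> U"
   note cU = card_cofinite[OF U]
   define p where "p = L/real n"
   have n1: "1 <= real n" and Ln: "L <= real n powr (1/1000)" using le_powr_if[of L n] elim(4) n by auto
   note off = elim(3)[rule_format, OF n]
   have o2: "3*mb n <= n" "1 <= mb n" "L <= real n" using off[of n] by auto
   have o1: "offspring_lb p (kap n L) (2*mb n) (n - 2*mb n)"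
    unfolding p_def by (rule off[THEN conjunct1]) linarith
   have p: "0 <= p" "p <= 1" using elim(4) o2 n1 by (auto simp: p_def)
   have "2*(real (Mc n) + 1) <= real (mb n)"
   proof -
    have "2*(real (Mc n) + 1) <= 2*(real n powr (1/10) + 2)" using Mc_le[of n] by simp
    also have "... <= real n powr (3/4)" by (rule elim(1)[rule_format, OF n, THEN conjunct1])
    also have "... <= real (mb n)" by (rule mb_ge)
    finally show ?thesis .
   qed
   hence "real (2*(Mc n + 1)) <= real (mb n)" by simp
   hence Mm: "2*(Mc n + 1) <= mb n" unfolding of_nat_le_iff .
   have k: "L - 1 <= kap n L" using kap_bounds[of n L] elim(2) n by auto
   have "PE (pr U) p (\<lambda>E. \<not> alive (Mc n) E U u) <= zit (kap n L) 0 (Mc n)"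
   proof (rule dead_prob[OF cU(3) u p o1])
    have a: "n <= card U + Suc (Mc n)" "card U <= n" "2*Mc n + 2 <= mb n" "1 <= mb n" "3*mb n <= n"
     using cU Mm o2 by simp_all
    show "1 <= 2*mb n" "card U <= n - 2*mb n + 2*mb n" using a by simp_all
    show "n - 2*mb n + Mc n <= card U"
    proof -
     have "n - 2*mb n + 2*mb n = n" using a(5) by simp
     with a(1,3) show ?thesis by linarith
    qed
   qed
   also have "... <= exp (- (3/4 * kap n L))" by (rule zit0_small) (use k elim(4) in linarith)
   also have "... <= exp (1 - 3/4*L)" using k by simp
   finally have A: "PE (pr U) p (\<lambda>E. \<not> alive (Mc n) E U u) <= exp (1 - 3/4*L)" .
   have "(1 - p)^card U <= exp (- (real (card U)*p))" by (rule one_minus_pow_le[OF p])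
   also have "... <= exp (1/2 - L)"
   proof -
    have "real n - (real (Mc n) + 1) <= real (card U)" using cU by linarith
    hence "(real n - (real (Mc n) + 1))*p <= real (card U)*p" using p by (intro mult_right_mono) auto
    moreover have "(real n - (real (Mc n) + 1))*p = L - (real (Mc n) + 1)*p" 
    proof -
     have "real n*p = L" using n1 by (simp add: p_def)
     thus ?thesis unfolding left_diff_distrib by simp
    qed
    moreover have "(real (Mc n) + 1)*p <= (real n powr (1/10) + 2)*(real n powr (1/1000)/real n)"
     unfolding p_def using Mc_le[of n] Ln n1 elim(4) by (intro mult_mono divide_right_mono) auto
    ultimately have "L - 1/2 <= real (card U)*p"
     using elim(1)[rule_format, OF n, THEN conjunct2] by linarith
    thus ?thesis by simp
   qed
   also have "... = exp (1/2)*exp (- L)" by (simp add: exp_add[symmetric])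
   also have "... <= 2*exp (- L)"
   proof -
    have "(1/2::real) <= exp (- (1/2))" by (rule half_le_exp)
    hence "exp (1/2::real) <= 2" by (simp add: exp_minus field_simps)
    thus ?thesis by (intro mult_right_mono) auto
   qed
   finally show "?P L n U u" using A by (simp add: p_def)
  qed
 qed
qed

lemma prod4_ge:
 assumes "0 <= a" "a <= 1" "0 <= b" "b <= 1" "0 <= c" "c <= 1" "0 <= d" "d <= (1::real)"
 shows "1 - a - b - c - d <= (1 - a)*(1 - b)*(1 - c)*(1 - d)"
proof -
 have two: "1 - x - y <= (1 - x)*(1 - y)" if "0 <= x" "0 <= y" for x y :: real
  using mult_nonneg_nonneg[OF that] by (simp add: algebra_simps)
 have "1 - a - b - c - d <= (1 - a - b - c)*(1 - d)" using two[of "a + b + c" d] assms by (simp add: algebra_simps)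
 also have "1 - a - b - c <= (1 - a - b)*(1 - c)" using two[of "a + b" c] assms by (simp add: algebra_simps)
 also have "1 - a - b <= (1 - a)*(1 - b)" using two[of a b] assms by simp
 finally show ?thesis using assms by (simp add: mult_right_mono)
qed

text \<open>Level width for the truncation in \<open>Run_thin_lower\<close>:
  \<open>exp (- m0 n / 4)\<close> is at most \<open>n powr (- 5/2)\<close>, negligible even over
  \<open>ln n\<close> generations.\<close>

definition m0 :: "nat => nat" where "m0 n = nat \<lceil>10*ln (real n)\<rceil>"

text \<open>The defining equation reads \<open>S = L * exp (S - L)\<close>, and
  \<open>0 < S < 1\<close> determines the exponent up to 1.\<close>

lemma base_S_le:
 assumes "base n L S" "1 <= L"
 shows "L*exp (- L) <= S" "S <= L*exp (1 - L)" "ln S <= ln L + 1 - L" "ln L - L <= ln S"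
proof -
 have S: "0 < S" "S < 1" "S*exp (- S) = L*exp (- L)" using assms by (auto simp: base_def)
 have SE: "S = L*exp (S - L)" using S(3) by (simp add: exp_diff exp_minus field_simps)
 have "exp (- L) <= exp (S - L)" "exp (S - L) <= exp (1 - L)" using S by auto
 hence "L*exp (- L) <= L*exp (S - L)" "L*exp (S - L) <= L*exp (1 - L)"
  using assms(2) by (auto intro!: mult_left_mono)
 thus "L*exp (- L) <= S" "S <= L*exp (1 - L)" using SE by auto
 have "ln S = ln (L*exp (S - L))" by (rule arg_cong[OF SE])
 also have "... = ln L + (S - L)" using assms(2) by (simp add: ln_mult)
 finally show "ln S <= ln L + 1 - L" "ln L - L <= ln S" using S by auto
qed

text \<open>\<open>sig_lower\<close>, \<open>Run_thin_lower\<close> and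
  \<open>zit0_prod_lower\<close> combined: each of the at most \<open>ln n\<close> generations loses
  a relative \<open>de\<close>, and \<open>ln n * de <= 1/8\<close>.\<close>

lemma sig_asymp:
 "\<forall>\<^sub>F L in at_top. \<forall>n S k v. base n L S --> v \<in> {1..n} --> real k <= ln (real n) -->
   S^k/2 <= sig k (Mc n) (L/real n) {1..n} v"
proof -
 have "\<forall>\<^sub>F n::nat in sequentially. ln (real n)*(10*ln (real n) + 1) <= real n powr (1/10)
   \<and> ln (real n)*((2 + real n powr (1/10))/real n + (10*ln (real n) + 1)*(real n powr (1/1000)/real n)
    + 2*(real n*((10*ln (real n) + 1)*(real n powr (1/1000)/real n))^2) + real n powr (-5/2)) <= 1/8
   \<and> (real n powr (1/10) + 2)*(real n powr (1/1000)/real n) <= 1/8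
   \<and> (10*ln (real n) + 1)*(real n powr (1/1000)/real n) <= 1/2 \<and> real n powr (1/10) + 2 <= real n
   \<and> 3 <= ln (real n) \<and> real n powr (1/1000)/real n <= 1/2"
  by (intro eventually_conj; real_asymp)
 note ev = ev_n[OF this]
 have evL: "\<forall>\<^sub>F L in at_top. L*exp (1 - L) <= (1/20::real)" by real_asymp
 show ?thesis
  using ev evL eventually_ge_at_top[of 8]
 proof eventually_elim
  case (elim L)
  show ?case
  proof (intro allI impI)
   fix n S k v
   assume b: "base n L S" and v: "v \<in> {1..n}" and kb: "real k <= ln (real n)"
   have n: "L^1000 <= real n" and S0: "0 < S" using b by (auto simp: base_def)
   define N where "N = real n"
   define p where "p = L/N"
   define w where "w = ln N"
   define P where "P = N powr (1/1000)/N"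
   define c where "c = real (Mc n)"
   define m where "m = m0 n"
   have n1: "1 <= N" and Ln: "L <= N powr (1/1000)" using le_powr_if[of L n] elim(3) n by (auto simp: N_def)
   have e: "w*(10*w + 1) <= N powr (1/10)"
    "w*((2 + N powr (1/10))/N + (10*w + 1)*P + 2*(N*((10*w + 1)*P)^2) + N powr (-5/2)) <= 1/8"
    "(N powr (1/10) + 2)*P <= 1/8" "(10*w + 1)*P <= 1/2" "N powr (1/10) + 2 <= N" "3 <= w" "P <= 1/2"
    using elim(1)[rule_format, OF n] by (auto simp: N_def w_def P_def)
   have p0: "0 <= p" using elim(3) n1 by (simp add: p_def)
   have pP: "p <= P" using Ln n1 by (simp add: p_def P_def divide_right_mono)
   have p: "0 <= p" "p <= 1" "p < 1" using pP e(7) p0 by auto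
   have Np: "N*p = L" using n1 by (simp add: p_def)
   have mw: "real m <= 10*w + 1" "10*w <= real m"
   proof -
    have "0 <= 10*w" using e by simp
    thus "real m <= 10*w + 1" by (simp add: m_def m0_def w_def N_def of_nat_ceiling)
    show "10*w <= real m" by (simp add: m_def m0_def w_def N_def real_nat_ceiling_ge)
   qed
   have c: "c <= N powr (1/10) + 1" "N powr (1/10) <= c" using Mc_le Mc_ge by (auto simp: c_def N_def)
   have c0: "0 <= c" by (simp add: c_def)
   have mp: "real m*p <= (10*w + 1)*P" using mw pP p e by (intro mult_mono) auto
   have mp0: "0 <= real m*p" using p by simp
   have kw: "real k <= w" using kb by (simp add: w_def N_def)
   have km: "real k*real m <= c"
   proof -
    have "real k*real m <= w*(10*w + 1)" using kw mw e by (intro mult_mono) auto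
    thus ?thesis using e(1) c(2) by linarith
   qed
   have km': "k*m <= Mc n" using km unfolding c_def of_nat_mult[symmetric] of_nat_le_iff .
   have cN: "c + 1 <= N" using c e(5) by linarith
   hence cn: "Mc n + 1 <= n" unfolding c_def N_def by linarith
   define u1 where "u1 = n - 1 - Mc n"
   have u1: "real u1 = N - 1 - c" using cn by (simp add: u1_def N_def c_def of_nat_diff)
   define U where "U = {1..n} - {v}"
   have cU: "card U = n - 1" "finite U" using v by (auto simp: U_def)
   have q: "0 < S/L" "S/L = exp (- (L*(1 - S/L)))" "L*(S/L) = S" using base_q[OF b] elim(3) by auto
   have S20: "S <= 1/20" using base_S_le(2)[OF b] elim(2,3) by linarith
   define cc where "cc = real u1*p*(1 - real m*p)*exp (- (2*real n*(real m*p)^2))*(1 - exp (- (real m/4)))"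
   have R: "cc^k*(\<Prod>i\<in>{0<..k}. zit L 0 i)*(real (card {v})*zit L 0 k^(card {v} - 1))
    <= Run p k (\<lambda>T U. of_bool (card T = 1 \<and> u1 <= card U)) {v} U"
    unfolding cc_def
   proof (rule Run_thin_lower[OF p(1,2)])
    show "real m*p <= 1/2" using mp e(4) by linarith
    show "L = real n*p" using Np by (simp add: N_def)
    have "1 <= real m" using mw e by linarith
    thus m1: "1 <= m" by simp
    show "L*zit L 0 i <= 1/10" for i
    proof -
     have "zit L 0 i <= S/L" by (rule zit0_le_fixpoint[OF _ q(1,2)]) (use elim(3) in simp)
     hence "L*zit L 0 i <= L*(S/L)" using elim(3) by (intro mult_left_mono) auto
     thus ?thesis unfolding q(3) using S20 by linarith
    qed
    show "finite U" "card U <= n" using cU by auto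
    show "card {v} <= m" using m1 by simp
    show "u1 + k*m <= card U" unfolding cU u1_def using km' cn by linarith
   qed
   define da where "da = (1 + c)/N"
   define db where "db = real m*p"
   define dc where "dc = 2*real n*(real m*p)^2"
   define dd where "dd = exp (- (real m/4))"
   define de where "de = da + db + dc + dd"
   have dle: "de <= (2 + N powr (1/10))/N + (10*w + 1)*P + 2*(N*((10*w + 1)*P)^2) + N powr (-5/2)"
    unfolding de_def
   proof (intro add_mono)
    show "da <= (2 + N powr (1/10))/N" unfolding da_def using c n1 by (intro divide_right_mono) auto
    show "db <= (10*w + 1)*P" unfolding db_def by (rule mp)
    have "(real m*p)^2 <= ((10*w + 1)*P)^2" using mp mp0 by (intro power_mono) auto
    thus "dc <= 2*(N*((10*w + 1)*P)^2)" unfolding dc_def N_def by (simp add: mult_left_mono)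
    have "exp (- (real m/4)) <= exp (- (5/2)*w)" using mw by simp
    thus "dd <= N powr (-5/2)" using n1 by (simp add: dd_def powr_def w_def)
   qed
   have wde: "w*de <= 1/8"
   proof -
    have "w*de <= w*((2 + N powr (1/10))/N + (10*w + 1)*P + 2*(N*((10*w + 1)*P)^2) + N powr (-5/2))"
     using dle e(6) by (intro mult_left_mono) auto
    with e(2) show ?thesis by linarith
   qed
   have d0: "0 <= da" "0 <= db" "0 <= dc" "0 <= dd" using c0 n1 mp0 by (auto simp: da_def db_def dc_def dd_def)
   have de1: "de <= 1"
   proof -
    have "0 <= de" using d0 by (simp add: de_def)
    hence "1*de <= w*de" using e(6) by (intro mult_right_mono) auto
    with wde show ?thesis by linarith
   qed
   have d1: "da <= 1" "db <= 1" "dc <= 1" "dd <= 1" using d0 de1 by (auto simp: de_def)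
   have ccl: "L*(1 - de) <= cc"
   proof -
    have "N*p*(1 - da) = real u1*p" unfolding u1 da_def using n1 by (simp add: field_simps)
    hence up: "real u1*p = L*(1 - da)" unfolding Np by simp
    have "1 - de <= (1 - da)*(1 - db)*(1 - dc)*(1 - dd)"
     using prod4_ge[OF d0(1) d1(1) d0(2) d1(2) d0(3) d1(3) d0(4) d1(4)] by (simp add: de_def algebra_simps)
    also have "... <= (1 - da)*(1 - db)*exp (- dc)*(1 - dd)"
    proof -
     have "1 - dc <= exp (- dc)" using exp_ge_add_one_self[of "- dc"] by simp
     thus ?thesis using d0 d1 by (intro mult_right_mono mult_left_mono) auto
    qed
    finally have "L*(1 - de) <= L*((1 - da)*(1 - db)*exp (- dc)*(1 - dd))" using elim(3) by (intro mult_left_mono) auto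
    also have "... = cc" unfolding cc_def up dc_def[symmetric] unfolding db_def[symmetric] dd_def[symmetric] by (simp add: mult_ac)
    finally show ?thesis .
   qed
   have "7/8 <= 1 - real k*de"
   proof -
    have "real k*de <= w*de" using kw d0 by (intro mult_right_mono) (auto simp: de_def)
    with wde show ?thesis by linarith
   qed
   also have "... <= (1 - de)^k" using Bernoulli_inequality[of "- de" k] de1 by simp
   finally have "L^k*(7/8) <= L^k*(1 - de)^k" using elim(3) by (intro mult_left_mono) auto
   also have "... = (L*(1 - de))^k" by (simp add: power_mult_distrib)
   also have "... <= cc^k" using ccl de1 elim(3) by (intro power_mono) auto
   finally have cck: "L^k*(7/8) <= cc^k" .
   have pr: "(S/L)^k*exp (- (2*L*(S/L))) <= (\<Prod>i\<in>{0<..k}. zit L 0 i)"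
    by (rule zit0_prod_lower[OF _ q(1,2)]) (use elim(3) S20 q(3) in auto)
   have eS: "9/10 <= exp (- (2*L*(S/L)))"
   proof -
    have "1 + - (2 * S) <= exp (- (2 * S))" by (rule exp_ge_add_one_self)
    moreover have "2*L*(S/L) = 2 * S" using elim(3) by simp
    ultimately show ?thesis using S20 by simp
   qed
   have pr': "(S/L)^k*(9/10) <= (\<Prod>i\<in>{0<..k}. zit L 0 i)"
   proof -
    have "(S/L)^k*(9/10) <= (S/L)^k*exp (- (2*L*(S/L)))" using eS q(1) by (intro mult_left_mono) auto
    with pr show ?thesis by linarith
   qed
   have "S^k*(7/8*(9/10)) = (L^k*(7/8))*((S/L)^k*(9/10))"
    using elim(3) by (simp add: power_divide)
   also have "... <= cc^k*(\<Prod>i\<in>{0<..k}. zit L 0 i)"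
   proof (rule mult_mono[OF cck pr'])
    have "0 <= L^k*(7/8)" using elim(3) by simp
    thus "0 <= cc^k" using cck by linarith
    show "0 <= (S/L)^k*(9/10)" using q(1) by simp
   qed
   also have "... <= Run p k (\<lambda>T U. of_bool (card T = 1 \<and> u1 <= card U)) {v} U"
    using R by simp
   finally have R': "S^k*(63/80) <= Run p k (\<lambda>T U. of_bool (card T = 1 \<and> u1 <= card U)) {v} U" by simp
   have pc: "7/8 <= (1 - p)^(Mc n + 1)"
   proof -
    have "real (Mc n + 1)*p <= (N powr (1/10) + 2)*P"
     using c pP p by (intro mult_mono) (auto simp: c_def)
    hence "real (Mc n + 1)*p <= 1/8" using e(3) by linarith
    moreover have "1 + real (Mc n + 1)*(- p) <= (1 + (- p))^(Mc n + 1)" by (rule Bernoulli_inequality) (use p in simp)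
    ultimately show ?thesis by simp
   qed
   \<comment> \<open>The losses are 7/8 for \<open>cc ^ k\<close>, 9/10 for the product of iterates
     and 7/8 for cutting off the branch.\<close>
   have "S^k/2 <= (S^k*(63/80))*(7/8)" using S0 by simp
   also have "... <= Run p k (\<lambda>T U. of_bool (card T = 1 \<and> u1 <= card U)) {v} U*(1 - p)^(Mc n + 1)"
   proof (rule mult_mono[OF R' pc])
    have "0 <= S^k*(63/80)" using S0 by simp
    thus "0 <= Run p k (\<lambda>T U. of_bool (card T = 1 \<and> u1 <= card U)) {v} U" using R' by linarith
   qed simp
   also have "... <= sig k (Mc n) p {1..n} v"
   proof -
    have "u1 = card {1..n} - 1 - Mc n" by (simp add: u1_def)
    thus ?thesis unfolding U_def
     using sig_lower[OF _ v p(1,3), of "Mc n" k] cn by simp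
   qed
   finally show "S^k/2 <= sig k (Mc n) (L/real n) {1..n} v" by (simp add: p_def N_def)
  qed
 qed
qed

lemma one_minus_pow_ge:
 assumes "0 <= p" "p <= (1/2::real)"
 shows "exp (- (2*real N*p)) <= (1 - p)^N"
proof -
 have "exp (- (2*p)) <= 1 - p"
 proof -
  have "1 <= (1 - p)*(1 + 2*p)" using mult_nonneg_nonneg[of p "1 - 2*p"] assms by (simp add: algebra_simps)
  also have "... <= (1 - p)*exp (2*p)" using exp_ge_add_one_self[of "2*p"] assms by (intro mult_left_mono) auto
  finally show ?thesis by (simp add: exp_minus field_simps)
 qed
 hence "exp (- (2*p))^N <= (1 - p)^N" by (intro power_mono) auto
 thus ?thesis by (simp add: exp_of_nat_mult[symmetric] mult_ac)
qed

text \<open>\<open>a\<close> and \<open>b\<close> exceed the expected sphere and ball sizes by a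
  factor of order \<open>ln L\<close>, which makes the Markov errors of order
  \<open>1 / ln L\<close>. Then \<open>rho\<close> is at least \<open>exp (- X)\<close>, and
  \<open>l\<close> of order \<open>ln L * exp X\<close> makes \<open>l * rho\<close> at least
  \<open>ln L\<close>. The hypothesis \<open>X <= L/8\<close> keeps the disconnection error
  \<open>exp (- L/2) / rho\<close> small.\<close>

lemma core_asymp:
 "\<forall>\<^sub>F L in at_top. \<forall>n (W :: nat set) acc J l t1 t2 X. L^1000 <= real n --> W \<subseteq> {1..n} -->
   card ({1..n} - W) <= mb n --> acc_ok J acc W --> length acc = Suc l --> 1 <= J --> real J <= L^2 -->
   X = 3*(ln L)^2*(real J)^2*(L^(t1 + t2 + 1)/real n) --> X <= L/8 --> exp X <= real n powr (1/50) -->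
   L^t1 <= real n powr (4/5) --> L^(2*t2) <= real n powr (4/5) -->
   ln L*exp X <= real l --> real l <= 2*ln L*exp X -->
   PE (pr W) (L/real n) (\<lambda>E. \<not> core_good t1 t2 l acc W E) <= 18/ln L"
proof -
 have "\<forall>\<^sub>F n::nat in sequentially.
   2*ln (real n)*real n powr (1/50)*((real n powr (1/1000))^4)*(real n powr (1/1000)/real n)*real n powr (4/5) <= 1/ln (real n)
   \<and> (2*ln (real n)*real n powr (1/50))^2*((real n powr (1/1000))^4)*(real n powr (1/1000)/real n)*real n powr (4/5) <= 1/ln (real n)
   \<and> real n powr (1/1000)/real n <= 1/2"
  by (intro eventually_conj; real_asymp)
 note ev = ev_n[OF this]
 have evL: "\<forall>\<^sub>F L in at_top. 20*exp (L/8 - L/2) <= 1/ln (L::real)" by real_asymp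
 have evh: "\<forall>\<^sub>F L in at_top. 20 <= ln (L::real)" by real_asymp
 show ?thesis
  using ev evL evh disc_asymp eventually_ge_at_top[of 8]
 proof eventually_elim
  case (elim L)
  show ?case
  proof (intro allI impI)
   fix n and W :: "nat set" and acc J l t1 t2 X
   assume n: "L^1000 <= real n" and W: "W \<subseteq> {1..n}" "card ({1..n} - W) <= mb n"
    and acc: "acc_ok J acc W" "length acc = Suc l" and J: "1 <= J" "real J <= L^2"
    and X: "X = 3*(ln L)^2*(real J)^2*(L^(t1 + t2 + 1)/real n)" "X <= L/8" "exp X <= real n powr (1/50)"
    and t: "L^t1 <= real n powr (4/5)" "L^(2*t2) <= real n powr (4/5)"
    and l: "ln L*exp X <= real l" "real l <= 2*ln L*exp X"
   define h where "h = ln L"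
   define N where "N = real n"
   define p where "p = L/N"
   define w where "w = ln N"
   define D where "D = N powr (1/1000)"
   have e: "2*w*N powr (1/50)*(D^4)*(D/N)*N powr (4/5) <= 1/w"
    "(2*w*N powr (1/50))^2*(D^4)*(D/N)*N powr (4/5) <= 1/w" "D/N <= 1/2"
    using elim(1)[rule_format, OF n] by (auto simp: N_def w_def D_def)
   have n1: "1 <= N" and Ln: "L <= D" and hw: "1000*h <= w"
    using le_powr_if[of L n] elim(5) n by (auto simp: N_def D_def h_def w_def)
   have h: "20 <= h" using elim(3) by (simp add: h_def)
   have hw': "h <= w" "1/w <= 1/h" using hw h by (auto intro!: divide_left_mono)
   have pD: "p <= D/N" using Ln n1 by (simp add: p_def divide_right_mono)
   have p0: "0 <= p" using elim(5) n1 by (simp add: p_def)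
   have p: "0 <= p" "p < 1" "p <= 1/2" using pD e(3) p0 by linarith+
   have Np: "N*p = L" using n1 by (simp add: p_def)
   have L0: "0 < L" "2 <= L" "1 <= L" using elim(5) by auto
   have J2: "(real J)^2 <= D^4"
   proof -
    have "(real J)^2 <= (L^2)^2" using J by (intro power_mono) auto
    also have "... = L^4" by simp
    also have "... <= D^4" using Ln L0 by (intro power_mono) auto
    finally show ?thesis .
   qed
   define eX where "eX = exp X"
   have eX: "0 < eX" "1 <= eX" "eX <= N powr (1/50)"
   proof -
    have "0 <= X" unfolding X(1) using L0 by (intro mult_nonneg_nonneg) auto
    thus "1 <= eX" by (simp add: eX_def)
   qed (use X in \<open>auto simp: eX_def N_def\<close>)
   have lh: "h*eX <= real l" "real l <= 2*h*eX" using l by (auto simp: h_def eX_def)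
   have ln0: "real l <= 2*w*N powr (1/50)"
   proof -
    have "2*h*eX <= 2*w*N powr (1/50)" using hw' h eX by (intro mult_mono) auto
    with lh show ?thesis by linarith
   qed
   have heX: "20 <= h*eX" using mult_mono[of 20 h 1 eX] h eX by simp
   have l1: "1 <= l" using lh heX by (cases l) auto
   define A where "A = h*real J*L^t1"
   define B where "B = h*real J*L^t2"
   have AB: "20 <= A" "20 <= B"
   proof -
    have "20*1*1 <= h*real J*L^i" for i using h J L0 by (intro mult_mono one_le_power) auto
    thus "20 <= A" "20 <= B" by (auto simp: A_def B_def)
   qed
   define a where "a = nat \<lceil>A\<rceil>"
   define b where "b = nat \<lceil>B\<rceil>"
   have a: "A <= real a" "real a <= 21/20*A" "1 <= a"
   proof -
    show "A <= real a" unfolding a_def by (rule real_nat_ceiling_ge)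
    thus "1 <= a" using AB by (cases a) auto
    have "real a <= A + 1" unfolding a_def using AB by (simp add: of_nat_ceiling)
    thus "real a <= 21/20*A" using AB by linarith
   qed
   have b: "B <= real b" "real b <= 21/20*B" "1 <= b"
   proof -
    show "B <= real b" unfolding b_def by (rule real_nat_ceiling_ge)
    thus "1 <= b" using AB by (cases b) auto
    have "real b <= B + 1" unfolding b_def using AB by (simp add: of_nat_ceiling)
    thus "real b <= 21/20*B" using AB by linarith
   qed
   define rho where "rho = (1 - p)^(a * b)"
   have rho: "exp (- X) <= rho"
   proof -
    have "real (a * b) <= (21/20*A)*(21/20*B)" unfolding of_nat_mult using a b AB by (intro mult_mono) auto
    hence "2*real (a * b)*p <= 2*((21/20*A)*(21/20*B))*p" using p by (intro mult_right_mono mult_left_mono) auto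
    \<comment> \<open>Rounding up costs \<open>21/20\<close> twice and
      \<open>one_minus_pow_ge\<close> costs 2; the constant 3 in \<open>X\<close> covers the
      product.\<close>
    also have "... = (2*(21/20)*(21/20))*(h^2*(real J)^2*(L^(t1 + t2 + 1)/N))"
     by (simp add: A_def B_def p_def power2_eq_square power_add mult_ac)
    also have "... <= 3*(h^2*(real J)^2*(L^(t1 + t2 + 1)/N))"
     using L0 n1 by (intro mult_right_mono mult_nonneg_nonneg divide_nonneg_nonneg) auto
    also have "... = X" unfolding X(1) by (simp add: h_def N_def mult_ac)
    finally have "exp (- X) <= exp (- (2*real (a * b)*p))" by simp
    also have "... <= rho" unfolding rho_def using p by (intro one_minus_pow_ge) auto
    finally show ?thesis .
   qed
   have rho0: "0 < rho" using rho by (rule less_le_trans[OF exp_gt_zero])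
   have irho: "1/rho <= eX"
   proof -
    have "1/rho <= 1/exp (- X)" using rho rho0 by (intro divide_left_mono) auto
    moreover have "1/exp (- X) = eX" unfolding eX_def exp_minus by (simp add: divide_inverse)
    ultimately show ?thesis by simp
   qed
   have cW: "card W <= n" "finite W" using card_cofinite[OF W] by auto
   have cWp: "real (card W)*p <= L"
   proof -
    have "real (card W)*p <= N*p" using cW p by (intro mult_right_mono) (auto simp: N_def)
    thus ?thesis unfolding Np .
   qed
   have dd: "PE (pr W) p (\<lambda>E. (u, u') \<notin> (adj_rel (E \<inter> pr W))\<^sup>*) <= 5*exp (- (L/2))"
    if "u \<in> W" "u' \<in> W" "u \<noteq> u'" for u u'
    unfolding p_def N_def by (rule elim(4)[rule_format, OF n W that])
   have "PE (pr W) p (\<lambda>E. \<not> core_good t1 t2 l acc W E)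
    <= real l*real J^2*p*L^t1 + L^t1*real J/real a
     + (real l^2*real J^2*p*L^(2*t2) + 2*(real J + 2*real J*L^t2)/real b + 8/(real l*rho))
     + 4*(5*exp (- (L/2)))/rho"
    unfolding rho_def by (rule core_bound[OF cW(2) p(1,2) cWp L0(2) acc l1 a(3) b(3) dd])
   also have "... <= 1/h + 1/h + (1/h + 6/h + 8/h) + 1/h"
   proof (intro add_mono)
    have "real l*real J^2*p*L^t1 <= 2*w*N powr (1/50)*(D^4)*(D/N)*N powr (4/5)"
     using ln0 J2 pD t(1) p L0 hw' h n1 Ln unfolding N_def[symmetric]
     by (intro mult_mono mult_nonneg_nonneg) auto
    thus "real l*real J^2*p*L^t1 <= 1/h" using e(1) hw' by linarith
    have "L^t1*real J/real a <= L^t1*real J/A" using a AB L0 J by (intro divide_left_mono) auto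
    also have "... = 1/h" using L0 J h by (simp add: A_def)
    finally show "L^t1*real J/real a <= 1/h" .
    have "real l^2*real J^2*p*L^(2*t2) <= (2*w*N powr (1/50))^2*(D^4)*(D/N)*N powr (4/5)"
     using ln0 J2 pD t(2) p L0 hw' h n1 Ln unfolding N_def[symmetric]
     by (intro mult_mono mult_nonneg_nonneg power_mono) auto
    thus "real l^2*real J^2*p*L^(2*t2) <= 1/h" using e(2) hw' by linarith
    have Lt: "1 <= L^t2" using L0 by simp
    have "2*(real J + 2*real J*L^t2) <= 6*(real J*L^t2)"
     using mult_left_mono[OF Lt, of "real J"] by simp
    hence "2*(real J + 2*real J*L^t2)/real b <= 6*(real J*L^t2)/B"
     using b AB L0 J by (intro frac_le) auto
    also have "... = 6/h" using L0 J h by (simp add: B_def)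
    finally show "2*(real J + 2*real J*L^t2)/real b <= 6/h" .
    have "8/(real l*rho) = 8*(1/rho)/real l" by simp
    also have "... <= 8*eX/(h*eX)" using irho lh heX rho0 eX by (intro frac_le mult_left_mono) auto
    also have "... = 8/h" using eX by simp
    finally show "8/(real l*rho) <= 8/h" .
    have "4*(5*exp (- (L/2)))/rho = 20*exp (- (L/2))*(1/rho)" by simp
    also have "... <= 20*exp (- (L/2))*exp (L/8)"
     using irho X(2) eX by (intro mult_left_mono) (auto simp: eX_def intro: order_trans)
    also have "... = 20*exp (L/8 - L/2)" by (simp add: exp_add[symmetric])
    also have "... <= 1/h" using elim(2) by (simp add: h_def)
    finally show "4*(5*exp (- (L/2)))/rho <= 1/h" .
   qed
   also have "... = 18/h" by simp
   finally show "PE (pr W) (L/real n) (\<lambda>E. \<not> core_good t1 t2 l acc W E) <= 18/ln L"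
    by (simp add: p_def N_def h_def)
  qed
 qed
qed

lemma tau_pos_le_one:
 assumes "0 <= p" "p <= 1" "finite U"
 shows "tau p J U <= 1"
 unfolding tau_def using assms by (intro Ex_le_const) auto

text \<open>The expected number \<open>mu\<close> of ends has to beat the square of the list length:
  it is at least of order \<open>(ln L) ^ 4 * exp (2 * X)\<close>, while \<open>l\<close> is about
  \<open>ln L * exp X\<close>. This allows Chebyshev at relative distance
  \<open>1 / (4 * (l + 1))\<close>. The separate condition on \<open>tau\<close> makes vertices
  without outward neighbours negligible among those counted.\<close>

lemma lower_asymp:
 "\<forall>\<^sub>F L in at_top. \<forall>n S k J t1 t2 X. base n L S --> real k <= ln (real n) --> 1 <= J --> real J <= L^2 -->
   X = 3*(ln L)^2*(real J)^2*(L^(t1 + t2 + 1)/real n) --> X <= L/8 --> exp X <= real n powr (1/50) -->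
   L^t1 <= real n powr (4/5) --> L^(2*t2) <= real n powr (4/5) -->
   (ln L)^4*(exp X)^2 <= real n * S^k*tau (L/real n) J {1..n} -->
   (ln L)^4*(exp X)^2*exp (- L) <= tau (L/real n) J {1..n} -->
   PE (pairs n) (L/real n) (\<lambda>E. \<not> 2*(k + 1) + (t1 + t2 + 1) < diam {1..n} E) <= 1000/ln L"
proof -
 have "\<forall>\<^sub>F n::nat in sequentially.
   (3*ln (real n)*real n powr (1/50))^2*(2*(real n powr (1/1000))^2*(real n powr (1/1000)/real n)) <= 1/ln (real n)
   \<and> 32*(3*ln (real n)*real n powr (1/50))^2*((real n powr (1/10) + 2)*(3*ln (real n)*real n powr (1/50)*(real n powr (1/10) + 2) + 1)
     * (real n powr (1/1000)/real n)) <= 1/ln (real n)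
   \<and> (3*ln (real n)*real n powr (1/50)*(real n powr (1/10) + 2) + 1) <= real n powr (3/4)
   \<and> (real n powr (1/10) + 2)*(3*ln (real n)*real n powr (1/50)*(real n powr (1/10) + 2) + 1)*(real n powr (1/1000)/real n) <= 1/4
   \<and> real n powr (1/1000)/real n <= 1/2"
  by (intro eventually_conj; real_asymp)
 note ev = ev_n[OF this]
 have evL: "\<forall>\<^sub>F L in at_top. 32*(3*ln L*exp (L/8))^2*(L^2*exp (1 - 3/4*L)) <= 1/ln (L::real) \<and> L^2*exp (1 - 3/4*L) <= 1/4"
  by (intro eventually_conj; real_asymp)
 have evh: "\<forall>\<^sub>F L in at_top. 20 <= ln (L::real)" by real_asymp
 show ?thesis
  using ev evL evh dead_asymp sig_asymp core_asymp eventually_ge_at_top[of 8]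
 proof eventually_elim
  case (elim L)
  show ?case
  proof (intro allI impI)
   fix n S k J t1 t2 X
   assume bs: "base n L S" and kb: "real k <= ln (real n)" and J: "1 <= J" "real J <= L^2"
    and X: "X = 3*(ln L)^2*(real J)^2*(L^(t1 + t2 + 1)/real n)" "X <= L/8" "exp X <= real n powr (1/50)"
    and t: "L^t1 <= real n powr (4/5)" "L^(2*t2) <= real n powr (4/5)"
    and c1: "(ln L)^4*(exp X)^2 <= real n * S^k*tau (L/real n) J {1..n}"
    and c2: "(ln L)^4*(exp X)^2*exp (- L) <= tau (L/real n) J {1..n}"
   have n: "L^1000 <= real n" and S0: "0 < S" using bs by (auto simp: base_def)
   define h where "h = ln L"
   define N where "N = real n"
   define p where "p = L/N"
   define w where "w = ln N"
   define D where "D = N powr (1/1000)"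
   define F where "F = 3*w*N powr (1/50)"
   define m where "m = Mc n"
   define M where "M = N powr (1/10) + 2"
   define ta where "ta = tau p J {1..n}"
   have e: "F^2*(2*D^2*(D/N)) <= 1/w" "32*F^2*(M*(F*M + 1)*(D/N)) <= 1/w"
    "F*M + 1 <= N powr (3/4)" "M*(F*M + 1)*(D/N) <= 1/4" "D/N <= 1/2"
    using elim(1)[rule_format, OF n] unfolding N_def w_def D_def F_def M_def by blast+
   have n1: "1 <= N" and Ln: "L <= D" and hw: "1000*h <= w"
    using le_powr_if[of L n] elim(7) n by (auto simp: N_def D_def h_def w_def)
   have h: "20 <= h" using elim(3) by (simp add: h_def)
   have hw': "h <= w" "1/w <= 1/h" using hw h by (auto intro!: divide_left_mono)
   have pD: "p <= D/N" using Ln n1 by (simp add: p_def divide_right_mono)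
   have p0: "0 <= p" using elim(7) n1 by (simp add: p_def)
   have p: "0 <= p" "p < 1" "p <= 1/2" "p <= 1" using pD e(5) p0 by linarith+
   have Np: "N*p = L" using n1 by (simp add: p_def)
   have L0: "0 < L" "2 <= L" "1 <= L" using elim(7) by auto
   define eX where "eX = exp X"
   have eX: "0 < eX" "1 <= eX" "eX <= N powr (1/50)" "eX <= exp (L/8)"
   proof -
    have "0 <= X" unfolding X(1) using L0 by (intro mult_nonneg_nonneg) auto
    thus "1 <= eX" by (simp add: eX_def)
   qed (use X in \<open>auto simp: eX_def N_def\<close>)
   have heX: "20 <= h*eX" using mult_mono[of 20 h 1 eX] h eX by simp
   define l where "l = nat \<lceil>h*eX\<rceil>"
   have lh: "h*eX <= real l" "real l <= 2*h*eX" "real (Suc l) <= 3*h*eX"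
   proof -
    show "h*eX <= real l" unfolding l_def by (rule real_nat_ceiling_ge)
    have "real l <= h*eX + 1" unfolding l_def using heX by (simp add: of_nat_ceiling)
    thus "real l <= 2*h*eX" "real (Suc l) <= 3*h*eX" using heX by auto
   qed
   have l1: "1 <= l" using lh heX by (cases l) auto
   have slF: "real (Suc l) <= F"
   proof -
    have "3*h*eX <= F" unfolding F_def using hw' h eX by (intro mult_mono) auto
    with lh show ?thesis by linarith
   qed
   have F0: "0 <= F" using slF by linarith
   have sl2: "real (Suc l)^2 <= 9*h^2*eX^2"
   proof -
    have "real (Suc l)^2 <= (3*h*eX)^2" using lh(3) by (intro power_mono) auto
    thus ?thesis by (simp add: power_mult_distrib)
   qed
   have mM: "real (Suc m) <= M" using Mc_le[of n] by (simp add: m_def M_def N_def)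
   have M0: "0 <= M" using mM by linarith
   define x where "x = Suc l * Suc m + 1"
   have xF: "real x <= F*M + 1"
   proof -
    have "real (Suc l)*real (Suc m) <= F*M" using slF mM F0 by (intro mult_mono) auto
    thus ?thesis unfolding x_def of_nat_add of_nat_mult by simp
   qed
   have xmb: "x <= mb n"
   proof -
    have "real x <= real (mb n)" using xF e(3) mb_ge[of n] unfolding N_def by linarith
    thus ?thesis by simp
   qed
   have ta: "0 < ta" "ta <= 1"
   proof -
    have "0 < h^4*eX^2*exp (- L)" using h eX by simp
    thus "0 < ta" using c2 by (simp add: ta_def p_def N_def h_def eX_def)
    show "ta <= 1" unfolding ta_def by (rule tau_pos_le_one) (use p in auto)
   qed
   have hX: "0 < h^4*eX^2" using h eX by simp
   have c1': "h^4*eX^2 <= N * S^k*ta" and c2': "h^4*eX^2*exp (- L) <= ta"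
    using c1 c2 by (auto simp: ta_def p_def N_def h_def eX_def)
   define qd where "qd = exp (1 - 3/4*L)"
   \<comment> \<open>Relative losses in the probability of an end: \<open>e1\<close> from the
     denominator of \<open>swt\<close>, \<open>e2\<close> from dead neighbours, \<open>e3\<close>
     from an empty neighbour set.\<close>
   define e1 where "e1 = real (Suc m*x)*p"
   define e2 where "e2 = real J*qd"
   define e3 where "e3 = 2*exp (- L)/ta"
   have e1b: "e1 <= M*(F*M + 1)*(D/N)"
    unfolding e1_def of_nat_mult using mM xF pD p M0 F0 by (intro mult_mono mult_nonneg_nonneg) auto
   have e2b: "e2 <= L^2*qd" unfolding e2_def using J by (intro mult_right_mono) (auto simp: qd_def)
   have e3b: "e3 <= 2/(h^4*eX^2)"
   proof -
    have "(h^4*eX^2)*(2*exp (- L)) <= 2*ta" using c2' by simp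
    thus ?thesis unfolding e3_def using ta hX by (simp add: field_simps)
   qed
   have nn: "0 <= e1" "0 <= e2" "0 <= e3" using p ta by (auto simp: e1_def e2_def e3_def qd_def)
   have h4: "160000 <= h^4*eX^2"
   proof -
    have "20^4*1 <= h^4*eX^2" using h eX by (intro mult_mono power_mono one_le_power) auto
    thus ?thesis by simp
   qed
   have quarter: "e1 <= 1/4" "e2 <= 1/4" "e3 <= 1/4"
   proof -
    show "e1 <= 1/4" using e1b e(4) by linarith
    show "e2 <= 1/4" using e2b elim(2) by (simp add: qd_def)
    have "2/(h^4*eX^2) <= 2/160000" using h4 by (intro divide_left_mono) auto
    with e3b show "e3 <= 1/4" by linarith
   qed
   define eta where "eta = e1 + e2 + e3"
   have end_low: "(1 - eta) * swt k m J x p {1..n} v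
     <= PE (pr {1..n}) p (\<lambda>E. \<exists>C N. is_end k m J E {1..n} v C N)" if v: "v \<in> {1..n}" for v
   proof -
    have pw: "1 - e1 <= (1 - p)^(Suc m*x)"
     using Bernoulli_inequality[of "- p" "Suc m*x"] p by (simp add: e1_def)
    have pw0: "0 < (1 - p)^(Suc m*x)" using p by simp
    have s0: "0 <= sig k m p {1..n} v" using p by (intro sig_nonneg) auto
    have "1 - eta <= (1 - e1)*(1 - (e2 + e3))"
     using mult_nonneg_nonneg[OF nn(1) add_nonneg_nonneg[OF nn(2,3)]] by (simp add: eta_def algebra_simps)
    also have "... <= (1 - p)^(Suc m*x)*(1 - (e2 + e3))" using pw quarter by (intro mult_right_mono) auto
    finally have A: "1 - eta <= (1 - p)^(Suc m*x)*(1 - (e2 + e3))" .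
    have "(1 - eta) * swt k m J x p {1..n} v = (1 - eta)*(sig k m p {1..n} v * ta/(1 - p)^(Suc m*x))"
     by (simp add: swt_def ta_def)
    also have "... <= ((1 - p)^(Suc m*x)*(1 - (e2 + e3)))*(sig k m p {1..n} v * ta/(1 - p)^(Suc m*x))"
     using A s0 ta pw0 by (intro mult_right_mono) auto
    also have "... = sig k m p {1..n} v * (ta*(1 - (e2 + e3)))"
    proof -
     have "P*c*(s*ta/P) = s*(ta*c)" if "0 < P" for P c s :: real using that by simp
     from this[OF pw0] show ?thesis .
    qed
    also have "ta*(1 - (e2 + e3)) = ta*(1 - real J*qd) - 2*exp (- L)"
     using ta by (simp add: e2_def e3_def field_simps)
    also have "sig k m p {1..n} v * (ta*(1 - real J*qd) - 2*exp (- L))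
     <= PE (pr {1..n}) p (\<lambda>E. \<exists>C N. is_end k m J E {1..n} v C N)"
     unfolding ta_def
    proof (rule end_prob_lower[OF _ v p(1,2)])
     show "PE (pr U) p (\<lambda>E. \<not> alive m E U u) <= qd"
      if "U \<subseteq> {1..n} - {v}" "card ({1..n} - U) <= Suc m" "u \<in> U" for U u
      unfolding p_def N_def m_def qd_def
      by (rule elim(4)[rule_format, OF n _ that(2)[unfolded m_def] that(3), THEN conjunct1]) (use that(1) in blast)
     show "(1 - p)^card U <= 2*exp (- L)"
      if U: "U \<subseteq> {1..n} - {v}" "card ({1..n} - U) <= Suc m" for U
     proof (cases "U = {}")
      case False
      then obtain u where "u \<in> U" by blast
      thus ?thesis unfolding p_def N_def
       by (rule elim(4)[rule_format, OF n _ U(2)[unfolded m_def], THEN conjunct2, rotated]) (use U(1) in blast)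
     next
      case True
      have "N = real (card ({1..n} - U))" using True by (simp add: N_def)
      also have "... <= M" using U(2) mM by linarith
      finally have "N <= M" .
      have "1 <= real x" by (simp add: x_def)
      have "M*1*p <= M*(F*M + 1)*(D/N)"
       using M0 F0 pD p by (intro mult_mono) auto
      hence "M*p <= 1/4" using e(4) by linarith
      moreover have "N*p <= M*p" using \<open>N <= M\<close> p by (intro mult_right_mono) auto
      ultimately have False using Np L0 by linarith
      thus ?thesis ..
     qed
     show "real J*qd <= 1" using quarter(2) by (simp add: e2_def)
     show "0 <= qd" by (simp add: qd_def)
    qed simp
    finally show ?thesis .
   qed
   define mu where "mu = sum (swt k m J x p {1..n}) {1..n}"
   have mu: "h^4*eX^2/2 <= mu"
   proof -
    have "S^k/2*ta <= swt k m J x p {1..n} v" if "v \<in> {1..n}" for v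
    proof -
     have pw: "0 < (1 - p)^(Suc m*x)" "(1 - p)^(Suc m*x) <= 1" using p by (auto intro!: power_le_one)
     have "S^k/2*ta <= sig k m p {1..n} v * ta"
      using elim(5)[rule_format, OF bs that kb] ta by (intro mult_right_mono) (auto simp: p_def N_def m_def)
     also have "... <= sig k m p {1..n} v * ta/(1 - p)^(Suc m*x)"
     proof -
      have "0 <= sig k m p {1..n} v * ta" using p ta by (intro mult_nonneg_nonneg sig_nonneg) auto
      thus ?thesis using pw by (simp add: pos_le_divide_eq mult_left_le)
     qed
     finally show ?thesis by (simp add: swt_def ta_def)
    qed
    hence "(\<Sum>v\<in>{1..n}. S^k/2*ta) <= mu" unfolding mu_def by (intro sum_mono) auto
    hence "N * S^k*ta/2 <= mu" by (simp add: N_def)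
    with c1' show ?thesis by linarith
   qed
   have mu0: "0 < mu" using mu hX by linarith
   \<comment> \<open>With \<open>l <= y * mu\<close> the ratio in \<open>far_pair_prob\<close> is at
     most \<open>1 / (1 - 2 * y)\<close>, and Bernoulli keeps its power \<open>l + 1\<close> below
     2.\<close>
   define y where "y = 1/(4*real (Suc l))"
   have y0: "0 < y" by (simp add: y_def)
   have ly: "real l <= y*mu"
   proof -
    have "4*real (Suc l)*real l <= 4*(real (Suc l)^2)"
     unfolding power2_eq_square mult.assoc by (intro mult_left_mono) auto
    also have "... <= 36*(h^2*eX^2)" using sl2 by (simp add: mult_ac)
    also have "... <= (h^2/2)*(h^2*eX^2)"
    proof -
     have "20^2 <= h^2" using h by (intro power_mono) auto
     thus ?thesis using eX by (intro mult_right_mono) auto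
    qed
    also have "... = h^4*eX^2/2" by (simp add: power2_eq_square power4_eq_xxxx)
    finally have "4*real (Suc l)*real l <= mu" using mu by linarith
    thus ?thesis by (simp add: y_def field_simps)
   qed
   have y1: "2*y < 1" using l1 by (simp add: y_def)
   have lmu: "real l < (1 - y)*mu"
   proof -
    have "2*y*mu < 1*mu" using y1 mu0 by (intro mult_strict_right_mono) auto
    thus ?thesis using ly by (simp add: algebra_simps)
   qed
   have fac: "(mu/((1 - y)*mu - real l))^Suc l <= 2"
   proof -
    have "(1 - 2*y)*mu <= (1 - y)*mu - real l" using ly by (simp add: algebra_simps)
    hence "mu/((1 - y)*mu - real l) <= mu/((1 - 2*y)*mu)"
     using mu0 y1 lmu by (intro divide_left_mono mult_pos_pos) auto
    also have "... = 1/(1 - 2*y)" using mu0 by simp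
    finally have "(mu/((1 - y)*mu - real l))^Suc l <= (1/(1 - 2*y))^Suc l"
     using lmu mu0 by (intro power_mono) auto
    also have "... = 1/(1 - 2*y)^Suc l" by (simp add: power_divide)
    also have "... <= 1/(1/2)"
    proof (rule divide_left_mono)
     have "1 + real (Suc l)*(- (2*y)) <= (1 + (- (2*y)))^Suc l" by (rule Bernoulli_inequality) (use y1 in simp)
     moreover have "real (Suc l)*(- (2*y)) = - (1/2)" unfolding y_def by (simp add: field_simps)
     ultimately show "1/2 <= (1 - 2*y)^Suc l" by simp
    qed (use y1 in \<open>auto intro!: mult_pos_pos\<close>)
    finally show ?thesis by simp
   qed
   define ee where "ee = 18/h + real (Suc l)*(real (Suc l * Suc J)*p)"
   have ee: "ee <= 19/h"
   proof -
    have J2: "real (Suc J) <= 2*D^2"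
    proof -
     have "L^2 <= D^2" using Ln L0 by (intro power_mono) auto
     moreover have "real (Suc J) <= 2*real J" using J by simp
     ultimately show ?thesis using J(2) by linarith
    qed
    have "real (Suc l)*(real (Suc l * Suc J)*p) = real (Suc l)^2*(real (Suc J)*p)"
     unfolding of_nat_mult power2_eq_square by (simp only: mult_ac)
    also have "... <= F^2*(2*D^2*(D/N))"
     using slF J2 pD p F0 by (intro mult_mono power_mono mult_nonneg_nonneg) auto
    also have "... <= 1/h" using e(1) hw' by linarith
    finally have "ee <= 18/h + 1/h" unfolding ee_def by linarith
    thus ?thesis by simp
   qed
   have main: "(1/mu + 2*eta)/y^2 <= 900/h"
   proof -
    define s2 where "s2 = real (Suc l)^2"
    have s2: "0 <= s2" "s2 <= 9*h^2*eX^2" "s2 <= F^2" "s2 <= (3*h*exp (L/8))^2"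
    proof -
     show "s2 <= 9*h^2*eX^2" using sl2 by (simp add: s2_def)
     show "s2 <= F^2" unfolding s2_def using slF by (intro power_mono) auto
     have "3*h*eX <= 3*h*exp (L/8)" using eX h by (intro mult_left_mono) auto
     hence "real (Suc l) <= 3*h*exp (L/8)" using lh by linarith
     thus "s2 <= (3*h*exp (L/8))^2" unfolding s2_def by (intro power_mono) auto
    qed (simp add: s2_def)
    have iy: "1/y^2 = 16 * s2"
     unfolding y_def s2_def power_divide power_mult_distrib by (simp del: of_nat_Suc)
    have hh: "9*h^2*eX^2/(h^4*eX^2) = 9/h^2" using eX h by (simp add: power2_eq_square power4_eq_xxxx)
    have h2: "1/h^2 <= 1/(20*h)"
    proof -
     have "20*h <= h^2" unfolding power2_eq_square using h by (intro mult_right_mono) auto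
     thus ?thesis using h by (intro divide_left_mono) auto
    qed
    have a1: "16 * s2/mu <= 288*(1/h^2)"
    proof -
     have "16 * s2/mu <= 16*(9*h^2*eX^2)/(h^4*eX^2/2)" using s2 mu hX by (intro frac_le mult_left_mono) auto
     also have "... = 32*(9*h^2*eX^2/(h^4*eX^2))" by simp
     finally show ?thesis unfolding hh by simp
    qed
    have a2: "32 * s2*e1 <= 1/h"
    proof -
     have "32 * s2*e1 <= 32*F^2*(M*(F*M + 1)*(D/N))"
      using s2 e1b nn by (intro mult_mono mult_left_mono) auto
     thus ?thesis using e(2) hw' by linarith
    qed
    have a3: "32 * s2*e2 <= 1/h"
    proof -
     have "32 * s2*e2 <= 32*(3*h*exp (L/8))^2*(L^2*qd)"
      using s2 e2b nn by (intro mult_mono mult_left_mono) auto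
     also have "... <= 1/h" using elim(2)[THEN conjunct1] unfolding h_def qd_def .
     finally show ?thesis .
    qed
    have a4: "32 * s2*e3 <= 576*(1/h^2)"
    proof -
     have "32 * s2*e3 <= 32*(9*h^2*eX^2)*(2/(h^4*eX^2))"
      using s2 e3b nn by (intro mult_mono mult_left_mono) auto
     also have "... = 64*(9*h^2*eX^2/(h^4*eX^2))" by simp
     finally show ?thesis unfolding hh by simp
    qed
    have "(1/mu + 2*eta)/y^2 = (1/mu + 2*eta)*(1/y^2)" by simp
    also have "... = 16 * s2/mu + 32 * s2*e1 + 32 * s2*e2 + 32 * s2*e3"
     unfolding iy eta_def by (simp add: algebra_simps)
    also have "... <= 864*(1/(20*h)) + 2/h" using a1 a2 a3 a4 h2 by linarith
    also have "... <= 900/h" using h by (simp add: field_simps)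
    finally show ?thesis .
   qed
   have "PE (pr {1..n}) p (\<lambda>E. \<not> 2*(k + 1) + (t1 + t2 + 1) < diam {1..n} E)
    <= (1/mu + 2*eta)/y^2 + ee*(mu/((1 - y)*mu - real l))^Suc l"
    unfolding mu_def ee_def
   proof (rule far_pair_prob[OF _ p(1,2), where J = J and M = m and x = x])
    show "Suc l * Suc m + 1 <= x" by (simp add: x_def)
    show "0 <= 18/h" using h by simp
    show "PE (pr W) p (\<lambda>E. \<not> core_good t1 t2 l acc W E) <= 18/h"
     if W: "acc_ok J acc W" "W \<subseteq> {1..n}" "card ({1..n} - W) <= x" "length acc = Suc l" for acc W
     unfolding p_def N_def h_def
     by (rule elim(6)[rule_format, OF n W(2) _ W(1,4) J X t])
      (use W(3) xmb lh in \<open>auto simp: h_def eX_def\<close>)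
    show "(1 - eta) * swt k m J x p {1..n} v <= PE (pr {1..n}) p (\<lambda>E. \<exists>C N. is_end k m J E {1..n} v C N)"
     if "v \<in> {1..n}" for v by (rule end_low[OF that])
   qed (use mu0 y0 l1 lmu in \<open>auto simp: mu_def\<close>)
   also have "... <= 900/h + 19/h*2"
    using main ee fac lmu mu0 h by (intro add_mono mult_mono) auto
   also have "... <= 1000/h" using h by (simp add: field_simps)
   finally show "PE (pairs n) (L/real n) (\<lambda>E. \<not> 2*(k + 1) + (t1 + t2 + 1) < diam {1..n} E) <= 1000/ln L"
    by (simp add: p_def N_def h_def pairs_eq_pr)
  qed
 qed
qed

text \<open>The split is uneven because disjointness of the balls of radius \<open>t2\<close>
  involves radius \<open>2 * t2\<close>: a quarter of the levels goes to \<open>t2\<close>, the rest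
  to \<open>t1\<close>.\<close>

lemma split_levels:
 assumes "1 <= L" "1 <= M" "L^M <= real n" "1 <= real n"
 obtains t1 t2 where "t1 + t2 + 1 = M" "L^t1 <= real n powr (4/5)" "L^(2*t2) <= real n powr (4/5)"
proof -
 define t2 where "t2 = M div 4"
 define t1 where "t1 = M - 1 - t2"
 have root: "x <= real n powr (4/5)" if "0 <= x" "x^4 <= real n^3" for x :: real
 proof (rule ccontr)
  assume "\<not> x <= real n powr (4/5)"
  hence "(real n powr (4/5))^4 < x^4" by (intro power_strict_mono) auto
  moreover have "(real n powr (4/5))^4 = real n powr (16/5)" using assms(4) by (simp add: powr_power)
  moreover have "real n^3 = real n powr 3" using assms(4) by simp
  moreover have "real n powr 3 <= real n powr (16/5)" using assms(4) by (intro powr_mono) auto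
  ultimately show False using that(2) by linarith
 qed
 have M4: "4*t2 <= M" "M <= 4*t2 + 3" unfolding t2_def by simp_all
 hence "4*t1 <= 3*M" using assms(2) unfolding t1_def by linarith
 hence "(L^t1)^4 <= (L^M)^3"
  unfolding power_mult[symmetric] using assms(1) by (intro power_increasing) (auto simp: mult.commute)
 also have "... <= real n^3" using assms(1,3) by (intro power_mono) auto
 finally have 1: "L^t1 <= real n powr (4/5)" using assms(1) by (intro root) auto
 have "2*t2*4 <= M*3" using M4 by linarith
 hence "(L^(2*t2))^4 <= (L^M)^3"
  unfolding power_mult[symmetric] using assms(1) by (intro power_increasing) auto
 also have "... <= real n^3" using assms(1,3) by (intro power_mono) auto
 finally have 2: "L^(2*t2) <= real n powr (4/5)" using assms(1) by (intro root) auto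
 have "t1 + t2 + 1 = M" using assms(2) M4 unfolding t1_def by linarith
 with 1 2 show ?thesis by (rule that[rotated])
qed

lemma k_bound:
 assumes b: "base n L S" and L: "1 <= L" "ln L + 1 + c <= L" "1 <= c" and k: "exp (- d) <= real n * S^k" "d <= c"
 shows "real k*c <= ln (real n) + d" "0 < ln (1/S)"
proof -
 have S: "0 < S" and n: "L^1000 <= real n" using b by (auto simp: base_def)
 have n1: "1 <= real n" using le_powr_if[OF L(1) n] by simp
 have l: "ln S <= - c" using base_S_le(3)[OF b L(1)] L(2) by linarith
 thus "0 < ln (1/S)" 
 proof -
  have "ln (1/S) = - ln S" by (simp add: ln_div S)
  with l L(3) show ?thesis by linarith
 qed
 have "ln (exp (- d)) <= ln (real n * S^k)" using k(1) by (intro ln_mono) auto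
 hence "- d <= ln (real n) + real k*ln S" using S n1 by (simp add: ln_mult ln_realpow)
 moreover have "real k*ln S <= real k*(- c)" using l by (intro mult_left_mono) auto
 ultimately show "real k*c <= ln (real n) + d" by simp
qed

lemma tau_markov:
 assumes "0 <= p" "p <= 1" "finite U" "2*(real (card U)*p) <= real J" "1 <= J"
 shows "1/2 <= tau p J U"
proof -
 have "PE U p (\<lambda>N. real J <= real (card N)) <= Ex U p (\<lambda>N. real (card N))/real J"
  using assms by (intro Ex_markov) auto
 also have "... = real (card U)*p/real J" using assms(3) by (simp add: Ex_card)
 also have "... <= 1/2" using assms(4,5) by (simp add: field_simps)
 finally have A: "PE U p (\<lambda>N. real J <= real (card N)) <= 1/2" .
 have "1 = Ex U p (\<lambda>_. 1)" using assms(3) by simp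
 also have "... <= Ex U p (\<lambda>N. of_bool (card N <= J) + of_bool (real J <= real (card N)))"
  by (rule Ex_mono[OF assms(1,2)]) auto
 also have "... = tau p J U + PE U p (\<lambda>N. real J <= real (card N))" by (simp only: Ex_add tau_def)
 finally show ?thesis using A by linarith
qed

text \<open>Keep only sets of size exactly \<open>J\<close> and bound the binomial coefficient below
  by \<open>(card U / J) ^ J\<close>; up to constants this is the weight
  \<open>exp (- L) * (L / J) ^ J\<close>.\<close>

lemma tau_exact:
 assumes "0 <= p" "p <= 1" "finite U" "1 <= J" "J <= card U"
 shows "(real (card U)*p/real J)^J*(1 - p)^card U <= tau p J U"
proof -
 let ?A = "{X. X \<subseteq> U \<and> card X = J}"
 have "(real (card U)*p/real J)^J*(1 - p)^card U = (real (card U)/real J)^J*(p^J*(1 - p)^card U)"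
  by (simp add: power_divide power_mult_distrib)
 also have "... <= real (card U choose J)*(p^J*(1 - p)^card U)"
  using binomial_ge_n_over_k_pow_k[OF assms(5), where 'a = real] assms by (intro mult_right_mono) auto
 also have "... <= real (card U choose J)*(p^J*(1 - p)^(card U - J))"
  using assms by (intro mult_left_mono power_decreasing) auto
 also have "... = (\<Sum>X\<in>?A. p^J*(1 - p)^(card U - J))" using n_subsets[OF assms(3), of J] by simp
 also have "... = (\<Sum>X\<in>?A. p^card X*(1 - p)^card (U - X) * of_bool (card X <= J))"
 proof (rule sum.cong[OF refl])
  fix X assume X: "X \<in> ?A"
  hence "card (U - X) = card U - J" using assms(3) by (auto simp: card_Diff_subset finite_subset)
  thus "p^J*(1 - p)^(card U - J) = p^card X*(1 - p)^card (U - X) * of_bool (card X <= J)" using X by simp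
 qed
 also have "... <= (\<Sum>X\<in>Pow U. p^card X*(1 - p)^card (U - X) * of_bool (card X <= J))"
  using assms by (intro sum_mono2) auto
 also have "... = tau p J U" by (simp add: tau_def Ex_def)
 finally show ?thesis .
qed

section \<open>Lower bounds on the diameter near the critical height and level\<close>

definition pd :: "nat => real => (nat => bool) => real" where
 "pd n L Q = PE (pairs n) (L/real n) (\<lambda>E. Q (diam {1..n} E))"

text \<open>Typical ends: \<open>J\<close>, about \<open>ln L * L\<close>, is well above the mean
  degree, so restricting the neighbour set costs at most a factor 2. \<open>Y\<close> bounds, up to
  a constant, the exponent \<open>X\<close> in the probability that two balls miss each
  other.\<close>

lemma lower_large:
 "\<forall>\<^sub>F L in at_top. \<forall>n S k M Y. base n L S --> 1 <= M --> L^M <= real n -->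
   Y = (ln L)^4*L^2*(L^M/real n) --> 40*Y <= L --> sqrt L*exp (600*Y)/2 <= real n * S^k -->
   pd n L (\<lambda>d. \<not> 2*(k + 1) + M < d) <= 1000/ln L"
proof -
 have evL: "\<forall>\<^sub>F L in at_top. 20 <= ln L \<and> ln L*L + 1 <= L^2 \<and> 1/(ln L*L) <= 1/100 \<and> (ln L)^4 <= sqrt L/4
   \<and> (ln L)^4*exp (L/4 - L) <= 1/2 \<and> ln L + 1 + 1 <= (L::real) \<and> 4 <= sqrt L"
  by (intro eventually_conj; real_asymp)
 show ?thesis
  using evL lower_asymp eventually_ge_at_top[of 8]
 proof eventually_elim
  case (elim L)
  show ?case
  proof (intro allI impI)
   fix n S k M Y
   assume b: "base n L S" and M: "1 <= M" "L^M <= real n" and Y: "Y = (ln L)^4*L^2*(L^M/real n)" "40*Y <= L"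
    and k: "sqrt L*exp (600*Y)/2 <= real n * S^k"
   have n: "L^1000 <= real n" and S: "0 < S" "S < 1" using b by (auto simp: base_def)
   define h where "h = ln L"
   have L1: "1 <= L" using elim(3) by simp
   have e: "20 <= h" "h*L + 1 <= L^2" "1/(h*L) <= 1/100" "h^4 <= sqrt L/4"
     "h^4*exp (L/4 - L) <= 1/2" "h + 1 + 1 <= L" "4 <= sqrt L"
    using elim(1) by (auto simp: h_def)
   have n1: "1 <= real n" using le_powr_if[OF L1 n] by simp
   have hL0: "0 < h*L" using e(1) L1 by simp
   define J where "J = nat \<lceil>h*L\<rceil>"
   have J: "h*L <= real J" "real J <= h*L + 1" 
    unfolding J_def using hL0 by (simp_all add: real_nat_ceiling_ge of_nat_ceiling)
   have J1: "real J <= 101/100*(h*L)"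
   proof -
    have "1 <= 1/100*(h*L)" using e(3) hL0 by (simp add: field_simps)
    with J show ?thesis by linarith
   qed
   have J2: "1 <= J" using J(1) hL0 by (cases J) auto
   have Y0: "0 <= Y" unfolding Y(1) using L1 n1 by simp
   define X where "X = 3*(ln L)^2*(real J)^2*(L^M/real n)"
   have X: "X <= 4*Y"
   proof -
    have "(real J)^2 <= (101/100*(h*L))^2" using J1 by (intro power_mono) auto
    also have "... = (101/100)^2*(h^2*L^2)" by (simp only: power_mult_distrib)
    also have "... <= 4/3*(h^2*L^2)" by (intro mult_right_mono) (simp_all add: power2_eq_square)
    finally have "X <= 3*(ln L)^2*(4/3*(h^2*L^2))*(L^M/real n)"
     unfolding X_def using L1 n1 by (intro mult_right_mono mult_left_mono) auto
    also have "... = 4*Y" unfolding Y(1) h_def by (simp add: power4_eq_xxxx power2_eq_square)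
    finally show ?thesis .
   qed
   have Sk: "S^k <= 1" using S by (intro power_le_one) auto
   have E: "exp (600*Y) <= real n"
   proof -
    have "4*exp (600*Y) <= sqrt L*exp (600*Y)" using e(7) by (intro mult_right_mono) auto
    moreover have "real n * S^k <= real n*1" using Sk by (intro mult_left_mono) auto
    ultimately show ?thesis using k exp_ge_zero[of "600*Y"] by linarith
   qed
   have "ln (exp (600*Y)) <= ln (real n)" using E by (intro ln_mono) auto
   hence Yn: "600*Y <= ln (real n)" by simp
   have eX: "exp X <= real n powr (1/50)"
   proof -
    have "X <= ln (real n)/50" using X Yn Y0 by linarith
    thus ?thesis using n1 by (simp add: powr_def)
   qed
   have kn: "real k <= ln (real n)"
   proof -
    have "4*1 <= sqrt L*exp (600*Y)" using e(7) Y0 L1 by (intro mult_mono) auto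
    hence "exp (- 0) <= real n * S^k" using k by simp
    from k_bound(1)[OF b L1 _ _ this, of 1] e(6) show ?thesis by (simp add: h_def)
   qed
   obtain t1 t2 where t: "t1 + t2 + 1 = M" "L^t1 <= real n powr (4/5)" "L^(2*t2) <= real n powr (4/5)"
    by (rule split_levels[OF L1 M n1])
   have p: "0 <= L/real n" "L/real n <= 1"
   proof -
    have "L^1 <= L^1000" using L1 by (intro power_increasing) auto
    thus "0 <= L/real n" "L/real n <= 1" using L1 n n1 by auto
   qed
   have ta: "1/2 <= tau (L/real n) J {1..n}"
   proof (rule tau_markov[OF p _ _ J2])
    have "20*L <= h*L" using e(1) L1 by (intro mult_right_mono) auto
    hence "2*L <= real J" using J(1) L1 by linarith
    thus "2*(real (card {1..n})*(L/real n)) <= real J" using n1 by simp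
   qed simp
   have eX2: "(exp X)^2 <= exp (600*Y)"
   proof -
    have "(exp X)^2 = exp (X + X)" unfolding exp_add power2_eq_square ..
    also have "... <= exp (600*Y)" using X Y0 by simp
    finally show ?thesis .
   qed
   have c1: "h^4*(exp X)^2 <= real n * S^k*tau (L/real n) J {1..n}"
   proof -
    have "h^4*(exp X)^2 <= (sqrt L/4)*exp (600*Y)" using e(4) eX2 L1 by (intro mult_mono) auto
    also have "... = (sqrt L*exp (600*Y)/2)*(1/2)" by simp
    also have "... <= (real n * S^k)*tau (L/real n) J {1..n}"
     using k ta S L1 by (intro mult_mono) auto
    finally show ?thesis .
   qed
   have X8: "X <= L/8" using X Y(2) L1 by linarith
   have c2: "h^4*(exp X)^2*exp (- L) <= tau (L/real n) J {1..n}"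
   proof -
    have "(exp X)^2 = exp (X + X)" unfolding exp_add power2_eq_square ..
    also have "... <= exp (L/4)" using X8 by simp
    finally have "h^4*(exp X)^2*exp (- L) <= h^4*exp (L/4)*exp (- L)"
     by (intro mult_right_mono mult_left_mono) auto
    also have "... = h^4*exp (L/4 - L)" by (simp add: exp_add[symmetric] mult.assoc)
    finally show ?thesis using e(5) ta by linarith
   qed
   have JL: "real J <= L^2" using J(2) e(2) by linarith
   have "PE (pairs n) (L/real n) (\<lambda>E. \<not> 2*(k + 1) + (t1 + t2 + 1) < diam {1..n} E) <= 1000/ln L"
    by (rule elim(2)[rule_format, OF b kn J2 JL _ X8 eX t(2,3) c1[unfolded h_def] c2[unfolded h_def]]) (simp only: X_def t(1))
   thus "pd n L (\<lambda>d. \<not> 2*(k + 1) + M < d) <= 1000/ln L" unfolding pd_def t(1) .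
  qed
 qed
qed

text \<open>With \<open>m <= 10\<close> the number \<open>n\<close> would be below
  \<open>L ^ 1000\<close>. It ensures that later subtractions such as \<open>m - 3\<close> are
  genuine.\<close>

lemma level_large:
 assumes "1 <= L" "L^1000 <= real n" "inverse ((ln L)^6) <= L^m/real n" "(ln L)^6 < L^990" "0 < ln L"
 shows "10 < m"
proof (rule ccontr)
 assume "\<not> 10 < m"
 hence "L^m <= L^10" using assms(1) by (intro power_increasing) auto
 have n1: "1 <= real n" using le_powr_if[OF assms(1,2)] by simp
 have "real n <= L^m*(ln L)^6" using assms(3,5) n1 by (simp add: field_simps)
 also have "... <= L^10*(ln L)^6" using \<open>L ^ m <= L ^ 10\<close> assms(5) by (intro mult_right_mono) auto
 also have "... < L^10*L^990" using assms(1,4) by (intro mult_strict_left_mono) auto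
 also have "... = L^1000" by (simp add: power_add[symmetric])
 finally show False using assms(2) by linarith
qed

text \<open>With \<open>M = m - 3\<close> the exponent \<open>Y\<close> is at most
  \<open>1 / (ln L) ^ 2\<close>, so \<open>sqrt L\<close> ends suffice. The power 6 in the threshold
  for \<open>m\<close> is there to beat the \<open>(ln L) ^ 4\<close> in \<open>Y\<close>.\<close>

lemma lower1:
 "\<forall>\<^sub>F L in at_top. \<forall>n S k m. base n L S --> inverse ((ln L)^6) <= L^m/real n -->
   L^m/real n <= inverse ((ln L)^6)*L --> sqrt L <= real n * S^k -->
   pd n L (\<lambda>d. \<not> 2 * k + m - 1 < d) <= 1000/ln L"
proof -
 have evL: "\<forall>\<^sub>F L in at_top. (ln L)^6 < L^990 \<and> 1 <= ln L \<and> 600*inverse ((ln L)^2) <= ln 2 \<and> 40*inverse ((ln L)^2) <= (L::real)"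
  by (intro eventually_conj; real_asymp)
 show ?thesis
  using evL lower_large eventually_ge_at_top[of 8]
 proof eventually_elim
  case (elim L)
  show ?case
  proof (intro allI impI)
   fix n S k m
   assume b: "base n L S" and th: "inverse ((ln L)^6) <= L^m/real n" "L^m/real n <= inverse ((ln L)^6)*L"
    and k: "sqrt L <= real n * S^k"
   have n: "L^1000 <= real n" using b by (auto simp: base_def)
   have L1: "1 <= L" using elim(3) by simp
   have m: "10 < m" by (rule level_large[OF L1 n th(1)]) (use elim(1) in auto)
   have n1: "1 <= real n" using le_powr_if[OF L1 n] by simp
   have h: "1 <= ln L" using elim(1) by blast
   define M where "M = m - 3"
   have Lm: "L^m = L^M*L^3" unfolding M_def power_add[symmetric] using m by simp
   define Y where "Y = (ln L)^4*L^2*(L^M/real n)"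
   have LM: "L^2*(L^M/real n) <= inverse ((ln L)^6)"
   proof -
    have "(L^2*(L^M/real n))*L <= inverse ((ln L)^6)*L" using th(2) unfolding Lm by (simp add: power2_eq_square power3_eq_cube mult_ac)
    thus ?thesis by (rule mult_right_le_imp_le) (use elim(3) in simp)
   qed
   have YM: "Y <= inverse ((ln L)^2)"
   proof -
    have "Y <= (ln L)^4*inverse ((ln L)^6)" unfolding Y_def mult.assoc using LM by (intro mult_left_mono) auto
    also have "... = inverse ((ln L)^2)" using h by (simp add: field_simps flip: power_add)
    finally show ?thesis .
   qed
   have "pd n L (\<lambda>d. \<not> 2*(k + 1) + M < d) <= 1000/ln L"
   proof (rule elim(2)[rule_format, OF b _ _ Y_def])
    show "1 <= M" using m by (simp add: M_def)
    have "inverse ((ln L)^6) <= 1" using h by (simp add: inverse_le_1_iff)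
    hence "L^2*(L^M/real n) <= 1" using LM by linarith
    moreover have "1*(L^M/real n) <= L^2*(L^M/real n)" using L1 n1 by (intro mult_right_mono) auto
    ultimately have "L^M/real n <= 1" by linarith
    thus "L^M <= real n" using n1 by simp
    show "40*Y <= L" using YM elim(1) by linarith
    have "600*Y <= ln 2" using YM elim(1) by linarith
    hence "exp (600*Y) <= exp (ln 2)" by (simp only: exp_le_cancel_iff)
    hence "exp (600*Y) <= 2" by simp
    hence "sqrt L*exp (600*Y) <= sqrt L*2" using L1 by (intro mult_left_mono) auto
    thus "sqrt L*exp (600*Y)/2 <= real n * S^k" using k by linarith
   qed
   moreover have "2*(k + 1) + M = 2 * k + m - 1" using m by (simp add: M_def)
   ultimately show "pd n L (\<lambda>d. \<not> 2 * k + m - 1 < d) <= 1000/ln L" by (simp only:)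
  qed
 qed
qed

text \<open>One level more than \<open>lower1\<close>: with \<open>M = m - 2\<close> the exponent
  \<open>Y = (ln L) ^ 4 * (L ^ m / n)\<close> may be large, and the number of ends must supply the
  factor \<open>exp (600 * Y)\<close>.\<close>

lemma lower2:
 "\<forall>\<^sub>F L in at_top. \<forall>n S k m. base n L S --> inverse ((ln L)^6) <= L^m/real n -->
   L^m/real n <= inverse ((ln L)^6)*L --> sqrt L*exp (600*(ln L)^4*(L^m/real n)) <= real n * S^k -->
   pd n L (\<lambda>d. \<not> 2 * k + m < d) <= 1000/ln L"
proof -
 have evL: "\<forall>\<^sub>F L in at_top. (ln L)^6 < L^990 \<and> 1 <= ln L \<and> 40*(inverse ((ln L)^2)*L) <= (L::real)"
  by (intro eventually_conj; real_asymp)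
 show ?thesis
  using evL lower_large eventually_ge_at_top[of 8]
 proof eventually_elim
  case (elim L)
  show ?case
  proof (intro allI impI)
   fix n S k m
   assume b: "base n L S" and th: "inverse ((ln L)^6) <= L^m/real n" "L^m/real n <= inverse ((ln L)^6)*L"
    and k: "sqrt L*exp (600*(ln L)^4*(L^m/real n)) <= real n * S^k"
   have n: "L^1000 <= real n" using b by (auto simp: base_def)
   have L1: "1 <= L" using elim(3) by simp
   have m: "10 < m" by (rule level_large[OF L1 n th(1)]) (use elim(1) in auto)
   have n1: "1 <= real n" using le_powr_if[OF L1 n] by simp
   have h: "1 <= ln L" using elim(1) by blast
   define M where "M = m - 2"
   have Lm: "L^m = L^2*L^M"
   proof -
    have "m = 2 + M" using m by (simp add: M_def)
    thus ?thesis by (simp only: power_add)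
   qed
   define Y where "Y = (ln L)^4*L^2*(L^M/real n)"
   have YE: "Y = (ln L)^4*(L^m/real n)" unfolding Y_def Lm by simp
   have YM: "Y <= inverse ((ln L)^2)*L"
   proof -
    have "Y <= (ln L)^4*(inverse ((ln L)^6)*L)" unfolding YE using th(2) by (intro mult_left_mono) auto
    also have "... = inverse ((ln L)^2)*L" using h by (simp add: field_simps flip: power_add)
    finally show ?thesis .
   qed
   have "pd n L (\<lambda>d. \<not> 2*(k + 1) + M < d) <= 1000/ln L"
   proof (rule elim(2)[rule_format, OF b _ _ Y_def])
    show "1 <= M" using m by (simp add: M_def)
    have "inverse ((ln L)^6) <= 1" using h by (simp add: inverse_le_1_iff)
    hence "inverse ((ln L)^6)*L <= 1*L" using L1 by (intro mult_right_mono) auto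
    hence "L*(L*L^M/real n) <= L*1" using th(2) unfolding Lm by (simp add: power2_eq_square mult_ac)
    hence "L*L^M <= real n" using elim(3) n1 by (simp add: field_simps)
    moreover have "1*L^M <= L*L^M" using L1 by (intro mult_right_mono) auto
    ultimately show "L^M <= real n" by linarith
    show "40*Y <= L" using YM elim(1) by linarith
    have "0 <= sqrt L*exp (600*Y)" using L1 by simp
    moreover have "sqrt L*exp (600*Y) <= real n * S^k" using k unfolding YE by (simp add: mult.assoc)
    ultimately show "sqrt L*exp (600*Y)/2 <= real n * S^k" by linarith
   qed
   moreover have "2*(k + 1) + M = 2 * k + m" using m by (simp add: M_def)
   ultimately show "pd n L (\<lambda>d. \<not> 2 * k + m < d) <= 1000/ln L" by (simp only:)
  qed
 qed
qed

text \<open>Branches of height \<open>k + 1\<close> may be slightly too rare. Instead use height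
  \<open>k\<close> and at most about \<open>L powr (3/10)\<close> further neighbours: this costs
  about \<open>exp (- L)\<close> but gains \<open>(L / J) ^ J\<close>, more than the deficit
  \<open>exp (- L powr (3/10))\<close>; and the small \<open>J\<close> keeps \<open>X\<close> below
  \<open>L/8\<close> for one more level.\<close>

lemma lower3:
 "\<forall>\<^sub>F L in at_top. \<forall>n S k m. base n L S --> inverse ((ln L)^6) <= L^m/real n -->
   L^m/real n <= sqrt L --> exp (- (L powr (3/10))) <= real n * S^(k + 1) -->
   pd n L (\<lambda>d. \<not> 2 * k + m + 1 < d) <= 1000/ln L"
proof -
 have evL: "\<forall>\<^sub>F L in at_top. 20 <= ln L \<and> 3*(ln L)^2*(L powr (3/10) + 1)^2/sqrt L <= L/100
   \<and> L powr (3/10) + 1 <= L^2 \<and> L/2 <= L - ln L - 1 - L powr (3/10) \<and> ln L + 1 + (L powr (3/10) + 1) <= L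
   \<and> L powr (3/10) + 1 <= L powr (35/100)
   \<and> 4*ln (ln L) + 2*(3*(ln L)^2*(L powr (3/10) + 1)^2/sqrt L) <= 65/100*ln L*L powr (3/10) - L powr (3/10) - ln L - 2
   \<and> (ln L)^6 < (L::real)^990"
  by (intro eventually_conj; real_asymp)
 show ?thesis
  using evL lower_asymp eventually_ge_at_top[of 8]
 proof eventually_elim
  case (elim L)
  show ?case
  proof (intro allI impI)
   fix n S k m
   assume b: "base n L S" and th: "inverse ((ln L)^6) <= L^m/real n" "L^m/real n <= sqrt L"
    and k: "exp (- (L powr (3/10))) <= real n * S^(k + 1)"
   have n: "L^1000 <= real n" and S: "0 < S" "S < 1" using b by (auto simp: base_def)
   define h where "h = ln L"
   define a where "a = L powr (3/10)"
   define B where "B = 3*h^2*(a + 1)^2/sqrt L"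
   have L1: "1 <= L" using elim(3) by simp
   have e: "20 <= h" "B <= L/100" "a + 1 <= L^2" "L/2 <= L - h - 1 - a" "h + 1 + (a + 1) <= L"
     "a + 1 <= L powr (35/100)" "4*ln h + 2*B <= 65/100*h*a - a - h - 2" "h^6 < L^990"
    using elim(1) unfolding h_def a_def B_def by blast+
   have n1: "1 <= real n" using le_powr_if[OF L1 n] by simp
   have m: "10 < m" by (rule level_large[OF L1 n th(1)]) (use e in \<open>auto simp: h_def\<close>)
   have a1: "1 <= a" unfolding a_def using L1 by (intro ge_one_powr_ge_zero) auto
   define M where "M = m - 1"
   have Lm: "L^m = L*L^M" using m unfolding M_def by (cases m) auto
   define J where "J = nat \<lceil>a\<rceil>"
   have J: "a <= real J" "real J <= a + 1" "1 <= J"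
   proof -
    show "a <= real J" "real J <= a + 1" unfolding J_def using a1 by (simp_all add: real_nat_ceiling_ge of_nat_ceiling)
    thus "1 <= J" using a1 by (cases J) auto
   qed
   have LM: "L^M/real n <= 1/sqrt L"
   proof -
    have "sqrt L*(sqrt L*(L^M/real n)) <= sqrt L*1" using th(2) L1 unfolding Lm by (simp add: mult.assoc[symmetric])
    hence "sqrt L*(L^M/real n) <= 1" by (rule mult_left_le_imp_le) (use elim(3) in simp)
    thus ?thesis using elim(3) by (simp add: field_simps)
   qed
   have LMn: "L^M <= real n"
   proof -
    have "1/sqrt L <= 1" using L1 by simp
    hence "L^M/real n <= 1" using LM by linarith
    thus ?thesis using n1 by simp
   qed
   define X where "X = 3*(ln L)^2*(real J)^2*(L^M/real n)"
   have XB: "X <= B"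
   proof -
    have "(real J)^2 <= (a + 1)^2" using J by (intro power_mono) auto
    hence "X <= 3*(ln L)^2*(a + 1)^2*(1/sqrt L)"
     unfolding X_def using LM L1 n1 by (intro mult_mono mult_left_mono) auto
    thus ?thesis by (simp add: B_def h_def)
   qed
   have X8: "X <= L/8" using XB e(2) L1 by linarith
   have Sb: "S <= L*exp (1 - L)" "ln S <= h + 1 - L" using base_S_le[OF b L1] by (auto simp: h_def)
   have lnn: "L/2 <= ln (real n)"
   proof -
    have "S^(k + 1) <= S^1" using S by (intro power_decreasing) auto
    hence "real n * S^(k + 1) <= real n * S" using n1 by (intro mult_left_mono) auto
    hence "exp (- a) <= real n * S" using k unfolding a_def by linarith
    hence "ln (exp (- a)) <= ln (real n * S)" by (intro ln_mono) auto
    hence "- a <= ln (real n) + ln S" using n1 S by (simp add: ln_mult)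
    thus ?thesis using Sb(2) e(4) by linarith
   qed
   have eX: "exp X <= real n powr (1/50)"
   proof -
    have "X <= ln (real n)/50" using XB e(2) lnn by linarith
    thus ?thesis using n1 by (simp add: powr_def)
   qed
   have kn: "real k <= ln (real n)"
   proof -
    have "real (k + 1)*(a + 1) <= ln (real n) + a"
     by (rule k_bound(1)[OF b L1 _ _ k[folded a_def]]) (use e(5) a1 in \<open>auto simp: h_def\<close>)
    moreover have "real (k + 1)*(a + 1) = real k*(a + 1) + (a + 1)" by (simp add: algebra_simps)
    moreover have "real k*1 <= real k*(a + 1)" using a1 by (intro mult_left_mono) auto
    ultimately show ?thesis by linarith
   qed
   obtain t1 t2 where t: "t1 + t2 + 1 = M" "L^t1 <= real n powr (4/5)" "L^(2*t2) <= real n powr (4/5)"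
    by (rule split_levels[OF L1 _ LMn n1]) (use m in \<open>auto simp: M_def\<close>)
   have L3n: "2*L^2 <= real n"
   proof -
    have "2*L^2 <= L*L^2" using elim(3) by (intro mult_right_mono) auto
    also have "... = L^3" by (simp add: power3_eq_cube power2_eq_square)
    also have "... <= L^1000" using L1 by (intro power_increasing) auto
    finally show ?thesis using n by linarith
   qed
   have Ln2: "2*L <= real n"
   proof -
    have "2*L*1 <= 2*L*L" using L1 by (intro mult_left_mono) auto
    with L3n show ?thesis by (simp add: power2_eq_square)
   qed
   define p where "p = L/real n"
   have p: "0 <= p" "p <= 1/2" using L1 n1 Ln2 by (auto simp: p_def field_simps)
   have JL: "real J <= L^2" using J(2) e(3) by linarith
   have Jn: "J <= n"
   proof -
    have "L^2 <= real n" using L3n zero_le_power2[of L] by linarith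
    with JL show ?thesis by linarith
   qed
   have pn: "exp (- L - 1) <= (1 - p)^n"
   proof -
    have "- p - 2*p^2 <= ln (1 - p)" by (rule ln_one_minus_pos_lower_bound) (use p in auto)
    hence "real n*(- p - 2*p^2) <= real n*ln (1 - p)" by (intro mult_left_mono) auto
    moreover have "real n*(- p - 2*p^2) = - L - 2*L^2/real n" using n1 by (simp add: p_def field_simps power2_eq_square)
    moreover have "2*L^2/real n <= 1" using L3n n1 by simp
    ultimately have "- L - 1 <= real n*ln (1 - p)" by linarith
    hence "exp (- L - 1) <= exp (real n*ln (1 - p))" by simp
    also have "... = (1 - p)^n" using p by (simp add: exp_of_nat_mult)
    finally show ?thesis .
   qed
   \<comment> \<open>Since \<open>J <= L powr (35/100)\<close>, each of the \<open>J\<close> factors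
     is at least \<open>L powr (65/100)\<close>; the resulting \<open>ln L * a\<close> dominates the
     deficit \<open>a\<close>.\<close>
   have LJ: "exp (65/100*h*a) <= (real n*p/real J)^J"
   proof -
    have "L powr (65/100)*real J <= L powr (65/100)*L powr (35/100)"
     using J(2) e(6) by (intro mult_left_mono) auto
    also have "... = L" using L1 by (simp flip: powr_add)
    finally have "L powr (65/100) <= real n*p/real J" using J(3) n1 by (simp add: p_def field_simps)
    hence "(L powr (65/100))^J <= (real n*p/real J)^J" by (intro power_mono) auto
    moreover have "(L powr (65/100))^J = exp (65/100*h*real J)"
     using L1 by (simp add: powr_def h_def mult_ac flip: exp_of_nat_mult)
    moreover have "65/100*h*a <= 65/100*h*real J" using J(1) e(1) by (intro mult_left_mono) auto
    ultimately show ?thesis by (metis exp_le_cancel_iff order_trans)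
   qed
   define ta where "ta = tau p J {1..n}"
   have ta: "exp (65/100*h*a - L - 1) <= ta"
   proof -
    have "exp (65/100*h*a - L - 1) = exp (65/100*h*a)*exp (- L - 1)" by (simp add: exp_add[symmetric])
    also have "... <= (real n*p/real J)^J*(1 - p)^n"
     using LJ pn p L1 by (intro mult_mono) auto
    also have "... <= ta" unfolding ta_def using tau_exact[of p "{1..n}" J] p J(3) Jn by simp
    finally show ?thesis .
   qed
   have hX: "h^4*(exp X)^2 <= exp (65/100*h*a - a - h - 2)"
   proof -
    have "h^4 = exp (4*ln h)" using e(1) exp_of_nat_mult[of 4 "ln h"] by simp
    moreover have "(exp X)^2 = exp (2*X)" using exp_of_nat_mult[of 2 X] by simp
    ultimately have "h^4*(exp X)^2 = exp (4*ln h + 2*X)" by (simp add: exp_add)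
    thus ?thesis using XB e(7) by simp
   qed
   \<comment> \<open>Going back from height \<open>k + 1\<close> to \<open>k\<close> gains
     \<open>1 / S\<close>, at least \<open>exp (L - 1) / L\<close>.\<close>
   have nSk: "exp (L - a - h - 1) <= real n * S^k"
   proof -
    have "exp (L - a - h - 1)*(L*exp (1 - L)) = exp (- a)"
     using L1 by (simp add: h_def exp_diff exp_minus exp_add field_simps)
    also have "... <= real n * S^k * S" using k by (simp add: a_def mult_ac)
    also have "... <= real n * S^k*(L*exp (1 - L))" using Sb S by (intro mult_left_mono) auto
    finally show ?thesis by (rule mult_right_le_imp_le) (use elim(3) in simp)
   qed
   have c1: "h^4*(exp X)^2 <= real n * S^k*ta"
   proof -
    have "exp (65/100*h*a - a - h - 2) = exp (L - a - h - 1)*exp (65/100*h*a - L - 1)"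
     by (simp add: exp_add[symmetric])
    also have "... <= real n * S^k*ta" using nSk ta S by (intro mult_mono) auto
    finally show ?thesis using hX by linarith
   qed
   have c2: "h^4*(exp X)^2*exp (- L) <= ta"
   proof -
    have "h^4*(exp X)^2*exp (- L) <= exp (65/100*h*a - a - h - 2)*exp (- L)"
     using hX by (intro mult_right_mono) auto
    also have "... = exp (65/100*h*a - a - h - 2 - L)" by (simp add: exp_add[symmetric])
    also have "... <= exp (65/100*h*a - L - 1)" using a1 e(1) by simp
    finally show ?thesis using ta by linarith
   qed
   have "PE (pairs n) (L/real n) (\<lambda>E. \<not> 2*(k + 1) + (t1 + t2 + 1) < diam {1..n} E) <= 1000/ln L"
    by (rule elim(2)[rule_format, OF b kn J(3) JL _ X8 eX t(2,3) c1[unfolded h_def ta_def p_def] c2[unfolded h_def ta_def p_def]])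
     (simp only: X_def t(1))
   moreover have "2*(k + 1) + M = 2 * k + m + 1" using m by (simp add: M_def)
   ultimately show "pd n L (\<lambda>d. \<not> 2 * k + m + 1 < d) <= 1000/ln L" unfolding pd_def t(1) by (simp only:)
  qed
 qed
qed

section \<open>Matching upper bounds on the diameter\<close>

text \<open>One parameter \<open>g = 2 * ln L / L\<close> serves both error terms:
  \<open>uu L g\<close> is close to \<open>2 * ln L\<close>, so each thin factor contributes about
  \<open>1 / L ^ 2\<close>, against a number of beginnings that is at most \<open>L\<close> even
  after the Chernoff factor \<open>exp (2 * ln L * w)\<close>.\<close>

lemma upper_mild:
 "\<forall>\<^sub>F L in at_top. \<forall>n S K M w. base n L S --> real K <= 2*ln (real n)/L + 1 --> 3 <= M -->
   L^M <= real n*L^2 --> 0 <= w --> 4*ln L <= w*(L^M/real n) -->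
   real n * S^K <= sqrt L --> real n * S^K*exp (2*ln L*w) <= L -->
   pd n L (\<lambda>d. 2*K + M < d) <= 1/ln L"
proof -
 have evL: "\<forall>\<^sub>F L in at_top. 2*ln L/L <= sqrt L/2 \<and> 1 <= uu L (2*ln L/L)
   \<and> L*exp (1 - uu L (2*ln L/L) + L*exp (- uu L (2*ln L/L))) <= 1/(8*ln (L::real))
   \<and> 1/L <= 1/(4*ln L) \<and> 1 <= ln L"
  unfolding uu_def by (intro eventually_conj; real_asymp)
 show ?thesis
  using evL upper_asymp eventually_ge_at_top[of 8]
 proof eventually_elim
  case (elim L)
  show ?case
  proof (intro allI impI)
   fix n S K M w
   assume b: "base n L S" and K: "real K <= 2*ln (real n)/L + 1" and M: "3 <= M" "L^M <= real n*L^2"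
    and w: "0 <= w" "4*ln L <= w*(L^M/real n)"
    and nu: "real n * S^K <= sqrt L" "real n * S^K*exp (2*ln L*w) <= L"
   define h where "h = ln L"
   define g where "g = 2*h/L"
   define Q where "Q = exp (1 - uu L g + L*exp (- uu L g))"
   have e: "g <= sqrt L/2" "1 <= uu L g" "L*Q <= 1/(8*h)" "1/L <= 1/(4*h)" "1 <= h"
    using elim(1) unfolding Q_def g_def h_def by auto
   have L: "1 <= L" "0 < L" using elim(3) by auto
   have S0: "0 < S" using b by (simp add: base_def)
   have g0: "0 <= g" using e(5) L by (simp add: g_def)
   have Lg: "L*g = 2*h" using L by (simp add: g_def)
   have wg: "2*L*g <= w*(L^M/real n)" using w(2) Lg unfolding h_def by linarith
   have nn: "0 <= real n * S^K" using S0 by simp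
   have "pd n L (\<lambda>d. 2*K + M < d) <= 2*(real n * S^K)*exp (g*w*L + (1 - uu L g + L*exp (- uu L g)))
     + (real n * S^K*exp (1 - uu L g + L*exp (- uu L g)))^2 + 1/L"
    unfolding pd_def by (rule elim(2)[rule_format, OF b K M g0 e(1) g0 e(1) e(2) e(2) w(1) wg])
   also have "g*w*L = 2*h*w" using Lg by (simp add: mult_ac)
   also have "2*(real n * S^K)*exp (2*h*w + (1 - uu L g + L*exp (- uu L g)))
     = 2*((real n * S^K*exp (2*h*w))*Q)" by (simp add: Q_def exp_add)
   also have "real n * S^K*exp (1 - uu L g + L*exp (- uu L g)) = real n * S^K*Q" by (simp add: Q_def)
   also have "2*((real n * S^K*exp (2*h*w))*Q) + (real n * S^K*Q)^2 + 1/L <= 2*(1/(8*h)) + 1/(8*h) + 1/(4*h)"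
   proof (intro add_mono mult_left_mono e(4))
    have Q0: "0 <= Q" by (simp add: Q_def)
    have "real n * S^K*exp (2*h*w)*Q <= L*Q" using nu(2) Q0 by (intro mult_right_mono) (auto simp: h_def)
    thus "real n * S^K*exp (2*h*w)*Q <= 1/(8*h)" using e(3) by linarith
    have "sqrt L*1 <= sqrt L * sqrt L" using L by (intro mult_left_mono) auto
    hence "sqrt L <= L" using L by simp
    hence "real n * S^K*Q <= L*Q" using nu(1) Q0 by (intro mult_right_mono) auto
    hence c: "real n * S^K*Q <= 1/(8*h)" using e(3) by linarith
    have "1/(8*h) <= 1" using e(5) by simp
    hence c1: "real n * S^K*Q <= 1" using c by linarith
    have "(real n * S^K*Q)^2 <= (1/(8*h))*1"
     unfolding power2_eq_square by (rule mult_mono[OF c c1]) (use nn Q0 e(5) in auto)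
    thus "(real n * S^K*Q)^2 <= 1/(8*h)" by simp
   qed simp
   also have "... <= 1/h" using e(5) by (simp add: field_simps)
   finally show "pd n L (\<lambda>d. 2*K + M < d) <= 1/ln L" by (simp add: h_def)
  qed
 qed
qed

lemma uu_third:
 assumes "100 <= L" "0 <= g" "g <= 1"
 shows "L*g/3 <= uu L g"
proof -
 define x where "x = 1 - 1/sqrt L"
 have "sqrt (10^2) <= sqrt L" using assms by (intro real_sqrt_le_mono) simp
 hence "10 <= sqrt L" by simp
 hence "1/sqrt L <= 1/10" "0 <= 1/sqrt L" using assms by (auto intro!: divide_left_mono)
 hence x: "9/10 <= x" "x <= 1" by (auto simp: x_def)
 have xg: "0 <= x*g" "x*g <= 1" using x assms by (auto intro: mult_le_one)
 have "(1 - x*g/2)*exp (x*g) \<ge> (1 - x*g/2)*(1 + x*g)"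
  using xg exp_ge_add_one_self[of "x*g"] by (intro mult_left_mono) auto
 moreover have "(1 - x*g/2)*(1 + x*g) = 1 + (x*g)*(1 - x*g)/2" by (simp add: field_simps)
 moreover have "0 <= (x*g)*(1 - x*g)" by (rule mult_nonneg_nonneg) (use xg in simp_all)
 ultimately have "1 <= (1 - x*g/2)*exp (x*g)" by linarith
 hence A: "x*g/2 <= 1 - exp (- (x*g))" by (simp add: exp_minus field_simps)
 have "(9/10)*(9/10) <= x*x" using x by (intro mult_mono) auto
 hence "1/3*(L*g) <= (x*x/2)*(L*g)" using assms by (intro mult_right_mono) auto
 also have "... = x*L*(x*g/2)" by simp
 also have "... <= x*L*(1 - exp (- (x*g)))" using A x assms by (intro mult_left_mono) auto
 also have "... = uu L g" by (simp add: uu_def x_def)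
 finally show ?thesis by simp
qed

lemma neg_exp_mono:
 assumes "u0 <= u" "0 <= (L::real)"
 shows "exp (1 - u + L*exp (- u)) <= exp (1 - u0 + L*exp (- u0))"
proof -
 have "L*exp (- u) <= L*exp (- u0)" using assms by (intro mult_left_mono) auto
 thus ?thesis using assms by simp
qed

text \<open>The number of thin beginnings may carry the factor
  \<open>exp (600 * (ln L) ^ 4 * th)\<close> with \<open>th = L ^ m / n\<close>. Small spheres are
  beaten with \<open>g = 1\<close>. In the pair event \<open>g2 = min (th/20) 1\<close> gains at
  least \<open>L * th / 60\<close> when \<open>th <= 20\<close>, and this dominates because
  \<open>L\<close> exceeds every power of \<open>ln L\<close>.\<close>

lemma upper_steep:
 "\<forall>\<^sub>F L in at_top. \<forall>n S K m. base n L S --> real K <= 2*ln (real n)/L + 1 -->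
   inverse ((ln L)^6) <= L^m/real n --> L^m/real n <= inverse ((ln L)^6)*L -->
   real n * S^K <= sqrt L*exp (600*(ln L)^4*(L^m/real n)) -->
   pd n L (\<lambda>d. 2*K + m + 1 < d) <= 1/ln L"
proof -
 have evL: "\<forall>\<^sub>F L in at_top. (ln L)^6 < L^990 \<and> 1 <= ln L \<and> 1/L <= 1/(4*ln L)
   \<and> 1 <= sqrt L/2 \<and> inverse ((ln L)^6) <= 1 \<and> 3 <= L/20*inverse ((ln L)^6)
   \<and> 600*(ln L)^4 <= L/120
   \<and> 2*(sqrt L*exp (600*(inverse ((ln L)^2)*L) + L/10)*exp (1 - 55/100*L + L*exp (- (55/100*L)))) <= 1/(4*ln L)
   \<and> sqrt L*exp (1 - (L/120)*inverse ((ln L)^6) + L*exp (- (L/60*inverse ((ln L)^6)))) <= 1/(4*ln (L::real))"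
  by (intro eventually_conj; real_asymp)
 show ?thesis
  using evL upper_asymp eventually_ge_at_top[of 10000]
 proof eventually_elim
  case (elim L)
  show ?case
  proof (intro allI impI)
   fix n S K m
   assume b: "base n L S" and K: "real K <= 2*ln (real n)/L + 1"
    and th: "inverse ((ln L)^6) <= L^m/real n" "L^m/real n <= inverse ((ln L)^6)*L"
    and nu: "real n * S^K <= sqrt L*exp (600*(ln L)^4*(L^m/real n))"
   have n: "L^1000 <= real n" and S: "0 < S" using b by (auto simp: base_def)
   have L1: "1 <= L" "0 <= L" using elim(3) by auto
   have n1: "1 <= real n" using le_powr_if[OF L1(1) n] by simp
   define h where "h = ln L"
   define i where "i = inverse (h^6)"
   define th where "th = L^m/real n"
   define nu where "nu = real n * S^K"
   define T where "T = 600*h^4*th"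
   have e: "h^6 < L^990" "1 <= h" "1/L <= 1/(4*h)" "1 <= sqrt L/2" "i <= 1" "3 <= L/20*i"
     "600*h^4 <= L/120"
     "2*(sqrt L*exp (600*(inverse (h^2)*L) + L/10)*exp (1 - 55/100*L + L*exp (- (55/100*L)))) <= 1/(4*h)"
     "sqrt L*exp (1 - (L/120)*i + L*exp (- (L/60*i))) <= 1/(4*h)"
    using elim(1) unfolding h_def i_def by blast+
   have m: "10 < m" by (rule level_large[OF L1(1) n th(1)]) (use e in \<open>auto simp: h_def\<close>)
   have t: "i <= th" "th <= i*L" using th by (auto simp: th_def i_def h_def)
   have i0: "0 < i" using e(2) by (simp add: i_def)
   have th0: "0 <= th" using t(1) i0 by linarith
   have nub: "nu <= sqrt L*exp T" using nu by (simp add: nu_def T_def h_def th_def mult.assoc)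
   have nu0: "0 <= nu" using S by (simp add: nu_def)
   have TL: "T <= 600*(inverse (h^2)*L)"
   proof -
    have "600*h^4*th <= 600*h^4*(i*L)" using t(2) by (intro mult_left_mono) auto
    also have "... = 600*(inverse (h^2)*L)" using e(2) by (simp add: i_def field_simps flip: power_add)
    finally show ?thesis by (simp add: T_def)
   qed
   \<comment> \<open>The 20 matches the choice \<open>w = 1/10\<close> in the application of
     \<open>upper_asymp\<close>: then \<open>2 * L * g2 <= w * (L * th)\<close>.\<close>
   define g2 where "g2 = min (th/20) 1"
   have g2: "0 <= g2" "g2 <= 1" "g2 <= th/20" using th0 by (auto simp: g2_def)
   have LM: "L^(m + 1)/real n = L*th" by (simp add: th_def)
   have u1: "55/100*L <= uu L 1" by (rule uu_one) (use elim(3) in simp)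
   have g3: "L*g2/3 <= uu L g2" by (rule uu_third) (use elim(3) g2 in auto)
   have i20: "i/20 <= g2" using t(1) e(5) by (auto simp: g2_def)
   have u2: "1 <= uu L g2"
   proof -
    have "L*(i/20) <= L*g2" using i20 L1 by (intro mult_left_mono) auto
    thus ?thesis using g3 e(6) by simp
   qed
   define E1 where "E1 = exp (1 - uu L 1 + L*exp (- uu L 1))"
   define E2 where "E2 = exp (1 - uu L g2 + L*exp (- uu L g2))"
   have E1: "E1 <= exp (1 - 55/100*L + L*exp (- (55/100*L)))" unfolding E1_def by (rule neg_exp_mono[OF u1 L1(2)])
   have first: "2*(nu*exp (L/10)*E1) <= 1/(4*h)"
   proof -
    have "nu <= sqrt L*exp (600*(inverse (h^2)*L))"
    proof -
     have "sqrt L*exp T <= sqrt L*exp (600*(inverse (h^2)*L))" using TL L1 by (intro mult_left_mono) auto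
     with nub show ?thesis by linarith
    qed
    hence "nu*exp (L/10)*E1 <= sqrt L*exp (600*(inverse (h^2)*L))*exp (L/10)
      * exp (1 - 55/100*L + L*exp (- (55/100*L)))"
     using E1 nu0 L1 by (intro mult_mono) (auto simp: E1_def)
    thus ?thesis using e(8) unfolding exp_add[of "600*(inverse (h^2)*L)"] by (simp only: mult.assoc)
   qed
   have second: "nu*E2 <= 1/(4*h)"
   proof (cases "th <= 20")
    case True
    hence g2e: "g2 = th/20" by (simp add: g2_def)
    have T1: "T <= L*th/120" unfolding T_def using mult_right_mono[OF e(7) th0] by simp
    have "L*g2/3 = L*th/60" by (simp add: g2e)
    hence u: "L*th/60 <= uu L g2" using g3 by linarith
    have Li: "L*i <= L*th" using t(1) L1 by (intro mult_left_mono) auto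
    have "L*exp (- uu L g2) <= L*exp (- (L/60*i))"
    proof -
     have "L/60*i <= uu L g2" using u Li by linarith
     thus ?thesis using L1 by (intro mult_left_mono) simp_all
    qed
    hence "T + (1 - uu L g2 + L*exp (- uu L g2)) <= 1 - (L/120)*i + L*exp (- (L/60*i))"
    proof -
     have "L/120*i = L*i/120" by simp
     with T1 u Li \<open>L * exp (- uu L g2) <= L * exp (- (L / 60 * i))\<close> show ?thesis by linarith
    qed
    hence "sqrt L*exp (T + (1 - uu L g2 + L*exp (- uu L g2))) <= sqrt L*exp (1 - (L/120)*i + L*exp (- (L/60*i)))"
     using L1 by (intro mult_left_mono) auto
    moreover have "nu*E2 <= sqrt L*exp T*E2" using nub by (intro mult_right_mono) (auto simp: E2_def)
    moreover have "sqrt L*exp T*E2 = sqrt L*exp (T + (1 - uu L g2 + L*exp (- uu L g2)))" unfolding E2_def exp_add[of T] by (simp add: mult.assoc)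
    ultimately show ?thesis using e(9) by linarith
   next
    case False
    hence "E2 = E1" by (simp add: E1_def E2_def g2_def)
    moreover have "nu*1*E1 <= nu*exp (L/10)*E1"
     using nu0 L1 by (intro mult_right_mono mult_left_mono) (auto simp: E1_def)
    moreover have "0 <= nu*E1" using nu0 by (simp add: E1_def)
    ultimately show ?thesis using first by simp
   qed
   have M3: "3 <= m + 1" using m by simp
   have LMn: "L^(m + 1) <= real n*L^2"
   proof -
    have "th <= 1*L" using t(2) mult_right_mono[OF e(5) L1(2)] by linarith
    hence "L^m <= L*real n" using n1 by (simp add: th_def field_simps)
    hence "L*L^m <= L*(L*real n)" using L1 by (intro mult_left_mono) auto
    thus ?thesis by (simp add: power2_eq_square mult_ac)
   qed
   have w: "2*L*g2 <= 1/10*(L^(m + 1)/real n)"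
   proof -
    have "2*L*g2 <= 2*L*(th/20)" using g2(3) L1 by (intro mult_left_mono) auto
    thus ?thesis unfolding LM by simp
   qed
   have g2s: "g2 <= sqrt L/2" using g2(2) e(4) by linarith
   have u11: "1 <= uu L 1" using u1 elim(3) by linarith
   have "pd n L (\<lambda>d. 2*K + (m + 1) < d) <= 2*(real n * S^K)*exp (1*(1/10)*L + (1 - uu L 1 + L*exp (- uu L 1)))
     + (real n * S^K*exp (1 - uu L g2 + L*exp (- uu L g2)))^2 + 1/L"
    unfolding pd_def by (rule elim(2)[rule_format, OF b K M3 LMn _ e(4) g2(1) g2s u11 u2 _ w]) simp_all
   also have "... = 2*(nu*exp (L/10)*E1) + (nu*E2)^2 + 1/L"
    unfolding exp_add[of "1*(1/10)*L"] nu_def E1_def E2_def by simp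
   also have "... <= 1/(4*h) + 1/(4*h) + 1/(4*h)"
   proof (intro add_mono first e(3))
    have "1/(4*h) <= 1" using e(2) by simp
    hence "nu*E2 <= 1" using second by linarith
    hence "(nu*E2)*(nu*E2) <= (nu*E2)*1" using nu0 by (intro mult_left_mono) (auto simp: E2_def)
    thus "(nu*E2)^2 <= 1/(4*h)" using second by (simp add: power2_eq_square)
   qed
   also have "... <= 1/h" using e(2) by (simp add: field_simps)
   finally show "pd n L (\<lambda>d. 2*K + m + 1 < d) <= 1/ln L" by (simp add: h_def)
  qed
 qed
qed

text \<open>Choose \<open>g\<close> with \<open>exp (- g) = eps/4\<close>, so that
  \<open>uu L g\<close> exceeds \<open>(1 - eps/2) * L\<close>, and \<open>w\<close> with
  \<open>g * w = eps/4\<close>. The exponents \<open>1 - eps\<close>, \<open>eps/4\<close> and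
  \<open>- (1 - eps/2)\<close> then add up to \<open>- eps/4\<close>.\<close>

lemma upper_fractional:
 assumes eps: "0 < eps" "eps < (1::real)"
 shows "\<forall>\<^sub>F L in at_top. \<forall>n S K m. base n L S --> real K <= 2*ln (real n)/L + 1 --> 3 <= m -->
   L powr eps <= L^m/real n --> L^m/real n <= L --> real n * S^K <= exp ((1 - eps)*L) -->
   pd n L (\<lambda>d. 2*K + m + 1 < d) <= 1/ln L"
proof -
 define g where "g = ln (4/eps)"
 define w where "w = eps/(4*g)"
 have g: "0 < g" "exp (- g) = eps/4" using eps by (auto simp: g_def exp_minus)
 have w: "0 < w" "g*w = eps/4" using eps g by (auto simp: w_def)
 have lim: "((\<lambda>L::real. (1 - 1/sqrt L)*(1 - exp (- ((1 - 1/sqrt L)*g)))) \<longlongrightarrow> (1 - 0)*(1 - exp (- ((1 - 0)*g)))) at_top"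
 proof -
  have "((\<lambda>L::real. 1/sqrt L) \<longlongrightarrow> 0) at_top" by real_asymp
  thus ?thesis by (intro tendsto_intros)
 qed
 have "1 - eps/2 < (1 - 0)*(1 - exp (- ((1 - 0)*g)))" using g eps by simp
 hence ev1: "\<forall>\<^sub>F L::real in at_top. 1 - eps/2 < (1 - 1/sqrt L)*(1 - exp (- ((1 - 1/sqrt L)*g)))"
  by (rule order_tendstoD(1)[OF lim])
 have evg: "\<forall>\<^sub>F L in at_top. g <= sqrt L/2" "\<forall>\<^sub>F L in at_top. 2*g <= w*L powr eps"
  using g(1) w(1) eps by real_asymp+
 have evs: "\<forall>\<^sub>F L in at_top. 2*exp (2 - eps/4*L) <= 1/(4*ln (L::real))" using eps by real_asymp
 have evl: "\<forall>\<^sub>F L in at_top. L*exp (- ((1 - eps/2)*L)) <= (1::real)" "\<forall>\<^sub>F L in at_top. 1 <= (1 - eps/2)*(L::real)" 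
  using eps by real_asymp+
 have evL: "\<forall>\<^sub>F L in at_top. 1 <= ln L \<and> 1/L <= 1/(4*ln (L::real))"
  by (intro eventually_conj; real_asymp)
 show ?thesis
  using ev1 evg evs evl evL upper_asymp eventually_ge_at_top[of 2]
 proof eventually_elim
  case (elim L)
  show ?case
  proof (intro allI impI)
   fix n S K m
   assume b: "base n L S" and K: "real K <= 2*ln (real n)/L + 1" and m: "3 <= m"
    and th: "L powr eps <= L^m/real n" "L^m/real n <= L" and nu: "real n * S^K <= exp ((1 - eps)*L)"
   have n: "L^1000 <= real n" and S: "0 < S" using b by (auto simp: base_def)
   have L1: "1 <= L" "0 <= L" using elim(9) by auto
   have n1: "1 <= real n" using le_powr_if[OF L1(1) n] by simp
   define h where "h = ln L"
   define nu where "nu = real n * S^K"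
   define u where "u = uu L g"
   have h: "1 <= h" "1/L <= 1/(4*h)" using elim(7) by (auto simp: h_def)
   have u: "(1 - eps/2)*L <= u"
   proof -
    have "(1 - eps/2)*L <= (1 - 1/sqrt L)*(1 - exp (- ((1 - 1/sqrt L)*g)))*L" using elim(1) L1 by (intro mult_right_mono) auto
    thus ?thesis by (simp add: u_def uu_def mult_ac)
   qed
   define E where "E = exp (1 - u + L*exp (- u))"
   have E: "E <= exp (2 - (1 - eps/2)*L)"
   proof -
    have "E <= exp (1 - (1 - eps/2)*L + L*exp (- ((1 - eps/2)*L)))" unfolding E_def by (rule neg_exp_mono[OF u L1(2)])
    also have "... <= exp (2 - (1 - eps/2)*L)" using elim(5) by simp
    finally show ?thesis .
   qed
   have nu0: "0 <= nu" using S by (simp add: nu_def)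
   have first: "2*(nu*exp (eps/4*L)*E) <= 1/(4*h)"
   proof -
    have "nu*exp (eps/4*L)*E <= exp ((1 - eps)*L)*exp (eps/4*L)*exp (2 - (1 - eps/2)*L)"
     using nu E nu0 by (intro mult_mono) (auto simp: nu_def E_def)
    also have "... = exp (2 - eps/4*L)" by (simp add: exp_add[symmetric] algebra_simps)
    finally show ?thesis using elim(4) unfolding h_def by linarith
   qed
   have second: "nu*E <= 1/(4*h)"
   proof -
    have "nu*1*E <= nu*exp (eps/4*L)*E"
     using nu0 L1 eps by (intro mult_right_mono mult_left_mono) (auto simp: E_def)
    moreover have "0 <= nu*E" using nu0 by (simp add: E_def)
    ultimately show ?thesis using first by simp
   qed
   have LMn: "L^(m + 1) <= real n*L^2"
   proof -
    have "L^m <= L*real n" using th(2) n1 by (simp add: field_simps)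
    hence "L*L^m <= L*(L*real n)" using L1 by (intro mult_left_mono) auto
    thus ?thesis by (simp add: power2_eq_square mult_ac)
   qed
   have wg: "2*L*g <= w*(L^(m + 1)/real n)"
   proof -
    have "2*g <= w*(L^m/real n)"
    proof -
     have "w*L powr eps <= w*(L^m/real n)" using th(1) w(1) by (intro mult_left_mono) auto
     with elim(3) show ?thesis by linarith
    qed
    hence "L*(2*g) <= L*(w*(L^m/real n))" using L1 by (intro mult_left_mono) auto
    thus ?thesis by (simp add: mult_ac)
   qed
   have u1: "1 <= uu L g" using u elim(6) by (simp add: u_def)
   have M3: "3 <= m + 1" using m by simp
   have "pd n L (\<lambda>d. 2*K + (m + 1) < d) <= 2*(real n * S^K)*exp (g*w*L + (1 - uu L g + L*exp (- uu L g)))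
     + (real n * S^K*exp (1 - uu L g + L*exp (- uu L g)))^2 + 1/L"
    unfolding pd_def using g(1) w(1)
    by (intro elim(8)[rule_format, OF b K M3 LMn _ elim(2) _ elim(2) u1 u1 _ wg]) auto
   also have "... = 2*(nu*exp (eps/4*L)*E) + (nu*E)^2 + 1/L"
    unfolding w(2) exp_add[of "eps/4*L"] nu_def E_def u_def by simp
   also have "... <= 1/(4*h) + 1/(4*h) + 1/(4*h)"
   proof (intro add_mono first h(2))
    have "1/(4*h) <= 1" using h by simp
    hence "nu*E <= 1" using second by linarith
    hence "(nu*E)*(nu*E) <= (nu*E)*1" using nu0 by (intro mult_left_mono) (auto simp: E_def)
    thus "(nu*E)^2 <= 1/(4*h)" using second by (simp add: power2_eq_square)
   qed
   also have "... <= 1/h" using h by (simp add: field_simps)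
   finally show "pd n L (\<lambda>d. 2*K + m + 1 < d) <= 1/ln L" by (simp add: h_def)
  qed
 qed
qed

section \<open>Two-point concentration\<close>

text \<open>The extremal height and level in closed form, solved by taking logarithms as in
  \<open>scale_powers\<close>.\<close>

definition k0 :: "nat => real => real => nat" where
 "k0 n L S = nat \<lfloor>(ln (real n) - ln L/2)/ln (1/S)\<rfloor>"

definition mm :: "nat => real => nat" where
 "mm n L = nat \<lceil>(ln (real n) - 6*ln (ln L))/ln L\<rceil>"

lemma scale_powers:
 assumes b: "base n L S" and L: "1 <= L"
 shows "real n * S^k = exp (ln (real n) - real k*ln (1/S))"
  and "L^m/real n = exp (real m*ln L - ln (real n))"
proof -
 have S: "0 < S" and n: "L^1000 <= real n" using b by (auto simp: base_def)
 have n1: "1 <= real n" using le_powr_if[OF L n] by simp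
 have "ln (1/S) = - ln S" by (simp add: ln_div S)
 thus "real n * S^k = exp (ln (real n) - real k*ln (1/S))"
  using n1 S by (simp add: exp_add exp_of_nat_mult)
 show "L^m/real n = exp (real m*ln L - ln (real n))"
  using n1 L by (simp add: exp_diff exp_of_nat_mult)
qed

lemma ln_inv_star:
 assumes "base n L S" "1 <= L"
 shows "L - ln L - 1 <= ln (1/S)" "ln (1/S) <= L - ln L"
proof -
 have S: "0 < S" using assms by (auto simp: base_def)
 have "ln (1/S) = - ln S" by (simp add: ln_div S)
 thus "L - ln L - 1 <= ln (1/S)" "ln (1/S) <= L - ln L" using base_S_le(3,4)[OF assms] by linarith+
qed

text \<open>Besides the extremal properties, both numbers are within 2 of the corresponding ratios
  of logarithms, since the offsets \<open>ln L / 2\<close> and \<open>6 * ln (ln L)\<close> are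
  smaller than one step.\<close>

lemma params:
 "\<forall>\<^sub>F L in at_top. \<forall>n S. base n L S --> sqrt L <= real n * S^k0 n L S \<and> real n * S^(k0 n L S + 1) <= sqrt L
   \<and> inverse ((ln L)^6) <= L^mm n L/real n \<and> L^mm n L/real n <= inverse ((ln L)^6)*L
   \<and> real (k0 n L S) <= 2*ln (real n)/L
   \<and> \<bar>real (k0 n L S) - ln (real n)/ln (1/S)\<bar> <= 2 \<and> \<bar>real (mm n L) - ln (real n)/ln L\<bar> <= 2" (is "\<forall>\<^sub>F L in _. \<forall>n S. _ --> ?P L n S")
proof -
 have evL: "\<forall>\<^sub>F L in at_top. 1 <= ln L \<and> L/2 <= L - ln L - 1 \<and> ln L <= L/2 \<and> 6*ln (ln L) <= ln (L::real)"
  by (intro eventually_conj; real_asymp)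
 show ?thesis
  using evL eventually_ge_at_top[of 8]
 proof eventually_elim
  case (elim L)
  show ?case
  proof (intro allI impI)
   fix n S assume b: "base n L S"
   have n: "L^1000 <= real n" using b by (auto simp: base_def)
   define h where "h = ln L"
   define w where "w = ln (real n)"
   define r where "r = ln (1/S)"
   have e: "1 <= h" "L/2 <= L - h - 1" "h <= L/2" "6*ln h <= h" using elim(1) by (auto simp: h_def)
   have L1: "1 <= L" using elim(2) by simp
   have wh: "1000*h <= w" using le_powr_if[OF L1 n] by (simp add: w_def h_def)
   have r: "L/2 <= r" using ln_inv_star[OF b L1] e by (simp add: h_def r_def)
   have r0: "0 < r" using r elim(2) by linarith
   define x where "x = (w - h/2)/r"
   define y where "y = (w - 6*ln h)/h"
   have x0: "0 <= x" and y0: "0 <= y" using wh e r0 by (auto simp: x_def y_def)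
   define k where "k = k0 n L S"
   define m where "m = mm n L"
   have k: "real k <= x" "x <= real k + 1"
   proof -
    have "real k = of_int \<lfloor>x\<rfloor>" unfolding k_def k0_def using x0 by (simp add: x_def w_def h_def r_def)
    thus "real k <= x" "x <= real k + 1" by linarith+
   qed
   have m: "y <= real m" "real m <= y + 1"
   proof -
    have "0 <= \<lceil>y\<rceil>" using y0 by linarith
    hence "real m = of_int \<lceil>y\<rceil>" unfolding m_def mm_def by (simp add: y_def w_def h_def)
    thus "y <= real m" "real m <= y + 1" by linarith+
   qed
   have xr: "x*r = w - h/2" using r0 by (simp add: x_def)
   have yh: "y*h = w - 6*ln h" using e(1) by (simp add: y_def)
   have sq: "sqrt L = exp (h/2)" using L1 by (simp add: h_def ln_sqrt[symmetric])
   have h6: "inverse (h^6) = exp (- (6*ln h))" using e(1) exp_of_nat_mult[of 6 "ln h"] by (simp add: exp_minus)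
   have 1: "sqrt L <= real n * S^k"
   proof -
    have "real k*r <= x*r" using k r0 by (intro mult_right_mono) auto
    thus ?thesis unfolding sq scale_powers(1)[OF b L1] using xr by (simp add: w_def r_def)
   qed
   have 2: "real n * S^(k + 1) <= sqrt L"
   proof -
    have "x*r <= real (k + 1)*r" using k r0 by (intro mult_right_mono) auto
    thus ?thesis unfolding sq scale_powers(1)[OF b L1] using xr by (simp add: w_def r_def)
   qed
   have 3: "inverse (h^6) <= L^m/real n"
   proof -
    have "y*h <= real m*h" using m e(1) by (intro mult_right_mono) auto
    thus ?thesis unfolding h6 scale_powers(2)[OF b L1] using yh by (simp add: w_def h_def)
   qed
   have 4: "L^m/real n <= inverse (h^6)*L"
   proof -
    have "real m*h <= (y + 1)*h" using m e(1) by (intro mult_right_mono) auto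
    hence "real m*h - w <= - (6*ln h) + h" using yh by (simp add: algebra_simps)
    hence "exp (real m*h - w) <= exp (- (6*ln h) + h)" by simp
    also have "... = inverse (h^6)*L" unfolding exp_add h6 using L1 by (simp add: h_def)
    finally show ?thesis unfolding scale_powers(2)[OF b L1] by (simp add: w_def h_def)
   qed
   have wr: "w/r <= w/(L/2)" using r wh e(1) elim(2) by (intro divide_left_mono) auto
   have xw: "x = w/r - h/(2*r)" using r0 by (simp add: x_def diff_divide_distrib)
   have hr: "0 <= h/(2*r)" "h/(2*r) <= 1" using e r r0 by (auto simp: field_simps)
   have 5: "real k <= 2*w/L"
   proof -
    have "real k <= w/r" using k(1) xw hr by linarith
    also have "... <= w/(L/2)" by (rule wr)
    also have "... = 2*w/L" by simp
    finally show ?thesis .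
   qed
   have 6: "\<bar>real k - w/r\<bar> <= 2" using k xw hr by linarith
   have yw: "y = w/h - 6*ln h/h" by (simp add: y_def diff_divide_distrib)
   have lh: "0 <= 6*ln h/h" "6*ln h/h <= 1" using e by (auto simp: field_simps)
   have 7: "\<bar>real m - w/h\<bar> <= 2" using m yw lh by linarith
   show "?P L n S"
    using 1 2 3 4 5 6 7 by (simp add: k_def m_def h_def w_def r_def)
  qed
 qed
qed

lemma pd_interval:
 assumes "0 <= L" "L <= real n" "pd n L (\<lambda>d. \<not> a < d) <= x" "pd n L (\<lambda>d. b < d) <= y"
  and "\<And>d. a < d ==> d <= b ==> Q d"
 shows "pd n L (\<lambda>d. \<not> Q d) <= x + y"
proof -
 have p: "0 <= L/real n" "L/real n <= 1" using assms(1,2) by (auto simp: divide_le_eq_1)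
 have "pd n L (\<lambda>d. \<not> Q d) <= Ex (pairs n) (L/real n) (\<lambda>E. of_bool (\<not> a < diam {1..n} E) + of_bool (b < diam {1..n} E))"
  unfolding pd_def
 proof (rule Ex_mono[OF p])
  fix E
  show "(of_bool (\<not> Q (diam {1..n} E)) :: real) <= of_bool (\<not> a < diam {1..n} E) + of_bool (b < diam {1..n} E)"
  proof (cases "a < diam {1..n} E \<and> diam {1..n} E <= b")
   case True
   thus ?thesis using assms(5) by simp
  qed auto
 qed
 also have "... = pd n L (\<lambda>d. \<not> a < d) + pd n L (\<lambda>d. b < d)" unfolding pd_def Ex_add ..
 finally show ?thesis using assms(3,4) by linarith
qed

text \<open>The two values are \<open>2 * k0 + mm + shift\<close> and its successor.\<close>

definition shift :: "nat => real => real => nat" where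
 "shift n L S = (if L^mm n L/real n <= sqrt L \<and> exp (- (L powr (3/10))) <= real n * S^(k0 n L S + 1) then 2
   else if sqrt L*exp (600*(ln L)^4*(L^mm n L/real n)) <= real n * S^k0 n L S then 1 else 0)"

lemma base_le:
 assumes "base n L S" "1 <= L"
 shows "L <= real n"
proof -
 have "L^1 <= L^1000" using assms by (intro power_increasing) auto
 thus ?thesis using assms by (simp add: base_def)
qed

text \<open>For \<open>shift\<close> 2, \<open>lower3\<close> meets \<open>upper_mild\<close> at
  \<open>k + 1\<close>, \<open>m + 1\<close>; for 1, \<open>lower2\<close> meets
  \<open>upper_mild\<close> at \<open>k + 1\<close>, \<open>m\<close>; for 0, \<open>lower1\<close>
  meets \<open>upper_steep\<close> at \<open>k\<close>, \<open>m\<close>. Each time the strict lower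
  bound is two less than the upper bound.\<close>

lemma two_point:
 "\<forall>\<^sub>F L in at_top. \<forall>n S. base n L S -->
   pd n L (\<lambda>d. \<not> (d = 2 * k0 n L S + mm n L + shift n L S \<or> d = 2 * k0 n L S + mm n L + shift n L S + 1)) <= 1001/ln L" (is "\<forall>\<^sub>F L in _. \<forall>n S. _ --> ?P L n S")
proof -
 have evL: "\<forall>\<^sub>F L in at_top. (ln L)^6 < L^990 \<and> 1 <= ln L \<and> inverse ((ln L)^6) <= 1 \<and> 16*ln L <= sqrt L
   \<and> 16*ln L <= L*inverse ((ln L)^6) \<and> 4*ln L <= L powr (1/4)*inverse ((ln L)^6)
   \<and> 2*ln L*L powr (1/4) <= L powr (3/10::real)"
  by (intro eventually_conj; real_asymp)
 show ?thesis
  using evL params lower1 lower2 lower3 upper_mild upper_steep eventually_ge_at_top[of 8]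
 proof eventually_elim
  case (elim L)
  show ?case
  proof (intro allI impI)
   fix n S assume b: "base n L S"
   have n: "L^1000 <= real n" and S: "0 < S" using b by (auto simp: base_def)
   define h where "h = ln L"
   define k where "k = k0 n L S"
   define m where "m = mm n L"
   define th where "th = L^m/real n"
   define i where "i = inverse (h^6)"
   have L1: "1 <= L" "0 <= L" using elim(8) by auto
   have n1: "1 <= real n" using le_powr_if[OF L1(1) n] by simp
   have Ln: "L <= real n" by (rule base_le[OF b L1(1)])
   have e: "h^6 < L^990" "1 <= h" "i <= 1" "16*h <= sqrt L" "16*h <= L*i" "4*h <= L powr (1/4)*i"
    "2*h*L powr (1/4) <= L powr (3/10)" using elim(1) unfolding h_def i_def by blast+
   have P: "sqrt L <= real n * S^k" "real n * S^(k + 1) <= sqrt L" "i <= th" "th <= i*L" "real k <= 2*ln (real n)/L"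
    using elim(2)[rule_format, OF b] unfolding k_def m_def th_def i_def h_def by blast+
   have K: "real (k + 1) <= 2*ln (real n)/L + 1" using P(5) by simp
   have K': "real k <= 2*ln (real n)/L + 1" using P(5) by simp
   have m10: "10 < m" by (rule level_large[OF L1(1) n P(3)[unfolded th_def i_def h_def]]) (use e in \<open>auto simp: h_def\<close>)
   have t: "inverse ((ln L)^6) <= L^m/real n" "L^m/real n <= inverse ((ln L)^6)*L"
    using P(3,4) by (auto simp: th_def i_def h_def)
   have thL: "th <= L" using P(4) mult_right_mono[OF e(3) L1(2)] by linarith
   have LM: "L^(m + 1) <= real n*L^2" "L^m <= real n*L^2"
   proof -
    have a: "L^m <= L*real n" using thL n1 by (simp add: th_def field_simps)
    hence "L*L^m <= L*(L*real n)" using L1 by (intro mult_left_mono) auto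
    thus A: "L^(m + 1) <= real n*L^2" by (simp add: power2_eq_square mult_ac)
    have "L^m <= L^(m + 1)" using L1 by (intro power_increasing) auto
    thus "L^m <= real n*L^2" using A by linarith
   qed
   \<comment> \<open>For \<open>w = 1/4\<close> the Chernoff factor is
     \<open>exp (ln L / 2) = sqrt L\<close>, the same as the bound on the number of beginnings of
     height \<open>k + 1\<close>.\<close>
   have nu_quarter: "real n * S^(k + 1)*exp (2*ln L*(1/4)) <= L"
   proof -
    have "exp (2*ln L*(1/4)) = sqrt L" using L1 by (simp add: ln_sqrt[symmetric])
    hence "real n * S^(k + 1)*exp (2*ln L*(1/4)) = real n * S^(k + 1) * sqrt L" by (simp only:)
    also have "... <= sqrt L * sqrt L" by (rule mult_right_mono[OF P(2)]) (use L1 in simp)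
    also have "... = L" using L1 by simp
    finally show ?thesis .
   qed
   have res: "pd n L (\<lambda>d. \<not> (d = 2 * k + m + c \<or> d = 2 * k + m + c + 1)) <= 1001/h"
    if "pd n L (\<lambda>d. \<not> 2 * k + m + c - 1 < d) <= 1000/h" "pd n L (\<lambda>d. 2 * k + m + c + 1 < d) <= 1/h" for c
   proof -
    have "pd n L (\<lambda>d. \<not> (d = 2 * k + m + c \<or> d = 2 * k + m + c + 1)) <= 1000/h + 1/h"
     by (rule pd_interval[OF L1(2) Ln that]) (use m10 in linarith)
    thus ?thesis by simp
   qed
   have "pd n L (\<lambda>d. \<not> (d = 2 * k + m + shift n L S \<or> d = 2 * k + m + shift n L S + 1)) <= 1001/h"
   proof (cases "th <= sqrt L \<and> exp (- (L powr (3/10))) <= real n * S^(k + 1)")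
    case c1: True
    hence "shift n L S = 2" by (simp add: shift_def k_def m_def th_def)
    moreover have "pd n L (\<lambda>d. \<not> 2 * k + m + 2 - 1 < d) <= 1000/h"
    proof -
     have "pd n L (\<lambda>d. \<not> 2 * k + m + 1 < d) <= 1000/ln L"
      by (rule elim(5)[rule_format, OF b t(1)]) (use c1 in \<open>auto simp: th_def\<close>)
     moreover have "2 * k + m + 2 - 1 = 2 * k + m + 1" by simp
     ultimately show ?thesis by (simp only: h_def)
    qed
    moreover have "pd n L (\<lambda>d. 2 * k + m + 2 + 1 < d) <= 1/h"
    proof -
     have "pd n L (\<lambda>d. 2*(k + 1) + (m + 1) < d) <= 1/ln L"
     proof (rule elim(6)[rule_format, OF b K _ LM(1) _ _ P(2) nu_quarter])
      have "L*i <= L*th" using P(3) L1 by (intro mult_left_mono) auto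
      thus "4*ln L <= 1/4*(L^(m + 1)/real n)" using e(5) by (simp add: th_def h_def)
     qed (use m10 in auto)
     moreover have "2*(k + 1) + (m + 1) = 2 * k + m + 2 + 1" by simp
     ultimately show ?thesis by (simp only: h_def)
    qed
    ultimately show ?thesis using res[of 2] by (simp only:)
   next
    case c1: False
    have U3: "pd n L (\<lambda>d. 2 * k + m + 1 + 1 < d) <= 1/h"
    proof -
     have "pd n L (\<lambda>d. 2*(k + 1) + m < d) <= 1/ln L"
     proof (cases "th <= sqrt L")
      case False
      show ?thesis
      proof (rule elim(6)[rule_format, OF b K _ LM(2) _ _ P(2) nu_quarter])
       show "4*ln L <= 1/4*(L^m/real n)" using e(4) False by (simp add: th_def h_def)
      qed (use m10 in auto)
     next
      case True
      \<comment> \<open>For small \<open>th\<close> the larger \<open>w = L powr (1/4)\<close> is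
        required; the deficit \<open>exp (- L powr (3/10))\<close> pays for the Chernoff
        factor.\<close>
      hence nu: "real n * S^(k + 1) < exp (- (L powr (3/10)))" using c1 by simp
      show ?thesis
      proof (rule elim(6)[rule_format, OF b K _ LM(2) _ _ P(2)])
       have "L powr (1/4)*i <= L powr (1/4)*th" using P(3) by (intro mult_left_mono) auto
       thus "4*ln L <= L powr (1/4)*(L^m/real n)" using e(6) by (simp add: th_def h_def)
       have "real n * S^(k + 1)*exp (2*ln L*L powr (1/4)) <= exp (- (L powr (3/10)))*exp (L powr (3/10))"
        using nu e(7) by (intro mult_mono) (auto simp: h_def)
       also have "... = 1" by (simp add: exp_add[symmetric])
       finally show "real n * S^(k + 1)*exp (2*ln L*L powr (1/4)) <= L" using L1 by linarith
      qed (use m10 in auto)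
     qed
     moreover have "2*(k + 1) + m = 2 * k + m + 1 + 1" by simp
     ultimately show ?thesis by (simp only: h_def)
    qed
    show ?thesis
    proof (cases "sqrt L*exp (600*(ln L)^4*th) <= real n * S^k")
     case c2: True
     have "\<not> (L^mm n L/real n <= sqrt L \<and> exp (- (L powr (3/10))) <= real n * S^(k0 n L S + 1))"
      using c1 unfolding k_def m_def th_def .
     hence "shift n L S = 1" using c2 unfolding shift_def k_def m_def th_def by (simp only: if_False if_True)
     moreover have "pd n L (\<lambda>d. \<not> 2 * k + m + 1 - 1 < d) <= 1000/h"
     proof -
      have "pd n L (\<lambda>d. \<not> 2 * k + m < d) <= 1000/ln L"
       by (rule elim(4)[rule_format, OF b t c2[unfolded th_def]])
      thus ?thesis by (simp add: h_def)
     qed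
     ultimately show ?thesis using res[of 1] U3 by (simp only:)
    next
     case c2: False
     have "\<not> (L^mm n L/real n <= sqrt L \<and> exp (- (L powr (3/10))) <= real n * S^(k0 n L S + 1))"
      using c1 unfolding k_def m_def th_def .
     hence "shift n L S = 0" using c2 unfolding shift_def k_def m_def th_def by (simp only: if_False)
     moreover have "pd n L (\<lambda>d. \<not> 2 * k + m + 0 - 1 < d) <= 1000/h"
     proof -
      have "pd n L (\<lambda>d. \<not> 2 * k + m - 1 < d) <= 1000/ln L" by (rule elim(3)[rule_format, OF b t P(1)])
      thus ?thesis by (simp add: h_def)
     qed
     moreover have "pd n L (\<lambda>d. 2 * k + m + 0 + 1 < d) <= 1/h"
     proof -
      have "pd n L (\<lambda>d. 2 * k + m + 1 < d) <= 1/ln L"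
       by (rule elim(7)[rule_format, OF b K' t]) (use c2 in \<open>simp add: th_def\<close>)
      thus ?thesis by (simp add: h_def)
     qed
     ultimately show ?thesis using res[of 0] by (simp only:)
    qed
   qed
   thus "?P L n S"
    by (simp only: k_def m_def h_def)
  qed
 qed
qed

text \<open>Away from integers, \<open>n * S ^ k\<close> lies between
  \<open>exp (eps * (L - ln L - 1))\<close> and \<open>exp ((1 - eps) * L)\<close>, and
  \<open>L ^ m / n\<close> between \<open>L powr eps\<close> and \<open>L powr (1 - eps)\<close>,
  where \<open>k\<close> is the floor and \<open>m\<close> the ceiling. Then \<open>lower2\<close>
  and \<open>upper_fractional\<close> both apply and leave only
  \<open>2 * k + m + 1\<close>.\<close>

lemma one_point:
 assumes eps: "0 < eps" "eps < (1::real)"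
 shows "\<forall>\<^sub>F L in at_top. \<forall>n S. base n L S -->
   \<not> (\<exists>k::int. \<bar>ln (real n)/ln (1/S) - real_of_int k\<bar> <= eps) -->
   \<not> (\<exists>k::int. \<bar>ln (real n)/ln L - real_of_int k\<bar> <= eps) -->
   pd n L (\<lambda>d. \<not> int d = \<lceil>ln (real n)/ln L\<rceil> + 2*\<lfloor>ln (real n)/ln (1/S)\<rfloor> + 1) <= 1001/ln L" (is "\<forall>\<^sub>F L in _. \<forall>n S. _ --> _ --> _ --> ?P L n S")
proof -
 have evL: "\<forall>\<^sub>F L in at_top. (ln L)^6 < L^990 \<and> 1 <= ln L \<and> inverse ((ln L)^6) <= 1 \<and> L/2 <= L - ln (L::real) - 1"
  by (intro eventually_conj; real_asymp)
 have eve: "\<forall>\<^sub>F L in at_top. L powr (1 - eps) <= inverse ((ln L)^6)*L"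
  "\<forall>\<^sub>F L in at_top. sqrt L*exp (600*(ln L)^4*L powr (1 - eps)) <= exp (eps*(L - ln L - 1))"
  using eps by real_asymp+
 show ?thesis
  using evL eve lower2 upper_fractional[OF eps] eventually_ge_at_top[of 8]
 proof eventually_elim
  case (elim L)
  show ?case
  proof (intro allI impI)
   fix n S
   assume b: "base n L S" and far: "\<not> (\<exists>k::int. \<bar>ln (real n)/ln (1/S) - real_of_int k\<bar> <= eps)"
    "\<not> (\<exists>k::int. \<bar>ln (real n)/ln L - real_of_int k\<bar> <= eps)"
   have n: "L^1000 <= real n" using b by (auto simp: base_def)
   have L1: "1 <= L" "0 <= L" using elim(6) by auto
   have n1: "1 <= real n" using le_powr_if[OF L1(1) n] by simp
   have Ln: "L <= real n" by (rule base_le[OF b L1(1)])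
   define h where "h = ln L"
   define w where "w = ln (real n)"
   define r where "r = ln (1/S)"
   define x where "x = w/r"
   define y where "y = w/h"
   have h1: "1 <= h" using elim(1) by (simp add: h_def)
   have w0: "0 <= w" using n1 by (simp add: w_def)
   have r: "L - h - 1 <= r" "r <= L" "L/2 <= r" "0 < r"
    using ln_inv_star[OF b L1(1)] elim(1,6) h1 by (auto simp: r_def h_def)
   have x0: "0 <= x" and y0: "0 <= y" using w0 r h1 by (auto simp: x_def y_def)
   have xr: "x*r = w" and yh: "y*h = w" using r h1 by (auto simp: x_def y_def)
   have fx: "\<not> \<bar>x - real_of_int j\<bar> <= eps" and fy: "\<not> \<bar>y - real_of_int j\<bar> <= eps" for j
    using far by (auto simp: x_def y_def w_def r_def h_def)
   define k where "k = nat \<lfloor>x\<rfloor>"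
   define m where "m = nat \<lceil>y\<rceil>"
   have kx: "int k = \<lfloor>x\<rfloor>" "real k = of_int \<lfloor>x\<rfloor>" using x0 by (auto simp: k_def)
   have my: "int m = \<lceil>y\<rceil>" "real m = of_int \<lceil>y\<rceil>"
   proof -
    have "0 <= \<lceil>y\<rceil>" using y0 by linarith
    thus "int m = \<lceil>y\<rceil>" "real m = of_int \<lceil>y\<rceil>" by (auto simp: m_def)
   qed
   have xf: "eps <= x - real k" "x - real k <= 1 - eps"
    using fx[of "\<lfloor>x\<rfloor>"] fx[of "\<lfloor>x\<rfloor> + 1"] unfolding kx(2) by linarith+
   have yf: "eps <= real m - y" "real m - y <= 1 - eps"
    using fy[of "\<lceil>y\<rceil>"] fy[of "\<lceil>y\<rceil> - 1"] unfolding my(2) by linarith+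
   have nuE: "real n * S^k = exp ((x - real k)*r)"
   proof -
    have "(x - real k)*r = w - real k*r" by (simp add: left_diff_distrib xr)
    thus ?thesis unfolding scale_powers(1)[OF b L1(1)] by (simp only: w_def r_def)
   qed
   have thE: "L^m/real n = L powr (real m - y)"
    unfolding scale_powers(2)[OF b L1(1)] using L1 elim(6) yh by (simp add: powr_def left_diff_distrib w_def h_def)
   have th: "L powr eps <= L^m/real n" "L^m/real n <= L powr (1 - eps)"
    unfolding thE using yf L1 by (auto intro!: powr_mono)
   have th1: "1 <= L^m/real n"
   proof -
    have "1 <= L powr eps" using L1 eps by (intro ge_one_powr_ge_zero) auto
    with th show ?thesis by linarith
   qed
   have thl: "inverse ((ln L)^6) <= L^m/real n" using th1 elim(1) by linarith
   have thu: "L^m/real n <= inverse ((ln L)^6)*L" using th(2) elim(2) by linarith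
   have thL: "L^m/real n <= L"
   proof -
    have "L powr (1 - eps) <= L powr 1" using L1 eps by (intro powr_mono) auto
    thus ?thesis using th(2) L1 by simp
   qed
   have m10: "10 < m" by (rule level_large[OF L1(1) n thl]) (use elim(1) in auto)
   have nul: "exp (eps*(L - ln L - 1)) <= real n * S^k"
   proof -
    have "eps*(L - h - 1) <= eps*r" using r eps by (intro mult_left_mono) auto
    also have "... <= (x - real k)*r" using xf r by (intro mult_right_mono) auto
    finally show ?thesis unfolding nuE by (simp add: h_def)
   qed
   have nuu: "real n * S^k <= exp ((1 - eps)*L)"
   proof -
    have "(x - real k)*r <= (1 - eps)*r" using xf r by (intro mult_right_mono) auto
    also have "... <= (1 - eps)*L" using r eps by (intro mult_left_mono) auto
    finally show ?thesis unfolding nuE by simp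
   qed
   have K: "real k <= 2*ln (real n)/L + 1"
   proof -
    have "w/r <= w/(L/2)" using w0 r elim(6) by (intro divide_left_mono) auto
    also have "... = 2*w/L" by simp
    finally have "x <= 2*w/L" by (simp only: x_def)
    thus ?thesis using xf(1) eps unfolding w_def by linarith
   qed
   have nuE4: "sqrt L*exp (600*(ln L)^4*(L^m/real n)) <= real n * S^k"
   proof -
    have "600*(ln L)^4*(L^m/real n) <= 600*(ln L)^4*L powr (1 - eps)"
     using th(2) by (intro mult_left_mono) auto
    hence "sqrt L*exp (600*(ln L)^4*(L^m/real n)) <= sqrt L*exp (600*(ln L)^4*L powr (1 - eps))"
     using L1 by (intro mult_left_mono) auto
    thus ?thesis using elim(3) nul by linarith
   qed
   have lo: "pd n L (\<lambda>d. \<not> 2 * k + m < d) <= 1000/ln L" by (rule elim(4)[rule_format, OF b thl thu nuE4])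
   have m3: "3 <= m" using m10 by simp
   have up: "pd n L (\<lambda>d. 2 * k + m + 1 < d) <= 1/ln L" by (rule elim(5)[rule_format, OF b K m3 th(1) thL nuu])
   have "pd n L (\<lambda>d. \<not> int d = \<lceil>y\<rceil> + 2*\<lfloor>x\<rfloor> + 1) <= 1000/ln L + 1/ln L"
   proof (rule pd_interval[OF L1(2) Ln lo up])
    fix d assume "2 * k + m < d" "d <= 2 * k + m + 1"
    hence "d = m + 2 * k + 1" by linarith
    thus "int d = \<lceil>y\<rceil> + 2*\<lfloor>x\<rfloor> + 1" unfolding kx(1)[symmetric] my(1)[symmetric] by simp
   qed
   thus "?P L n S"
    by (simp add: x_def y_def w_def r_def h_def)
  qed
 qed
qed

lemma whp_from_pd:
 fixes lam lam_star :: "nat => real"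
 assumes lam: "filterlim lam at_top sequentially"
  and b: "\<forall>\<^sub>F n in sequentially. base n (lam n) (lam_star n)"
  and Q: "\<forall>\<^sub>F n in sequentially. pd n (lam n) (\<lambda>d. \<not> Q n d) <= 1001/ln (lam n)"
 shows "whp (\<lambda>n. gnp n (lam n/real n)) (\<lambda>n E. Q n (diam {1..n} E))"
 unfolding whp_def
proof (rule tendsto_sandwich)
 have "\<forall>\<^sub>F n in sequentially. 1 <= lam n" using lam by (simp add: filterlim_at_top)
 with b Q show "\<forall>\<^sub>F n in sequentially. 1 - 1001/ln (lam n) <= measure_pmf.prob (gnp n (lam n/real n)) {E. Q n (diam {1..n} E)}"
 proof eventually_elim
  case (elim n)
  have p: "0 <= lam n/real n" "lam n/real n <= 1"
   using base_le[OF elim(1,3)] elim(3) by (auto simp: divide_le_eq_1)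
  have "1 = Ex (pairs n) (lam n/real n) (\<lambda>_. 1)" by (simp add: pairs_eq_pr)
  also have "... = Ex (pairs n) (lam n/real n) (\<lambda>E. of_bool (Q n (diam {1..n} E)) + of_bool (\<not> Q n (diam {1..n} E)))"
   by (rule Ex_cong) simp
  also have "... = measure_pmf.prob (gnp n (lam n/real n)) {E. Q n (diam {1..n} E)} + pd n (lam n) (\<lambda>d. \<not> Q n d)"
   unfolding Ex_add prob_gnp[OF p] pd_def ..
  finally show ?case using elim(2) by linarith
 qed
 show "\<forall>\<^sub>F n in sequentially. measure_pmf.prob (gnp n (lam n/real n)) {E. Q n (diam {1..n} E)} <= 1"
  by (intro always_eventually allI measure_pmf.prob_le_1)
 have "((\<lambda>x. 1 - 1001/ln x) \<longlongrightarrow> (1::real)) at_top" by real_asymp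
 from filterlim_compose[OF this lam] show "(\<lambda>n. 1 - 1001/ln (lam n)) \<longlonglongrightarrow> 1" .
qed simp

theorem theorem1p2:
 fixes lam lam_star :: "nat \<Rightarrow> real"
 assumes "filterlim lam at_top sequentially"
  and "eventually (\<lambda>n. lam n \<le> real n powr (1/1000)) sequentially"
  and "eventually (\<lambda>n. lam_star n < 1 \<and>
      lam_star n*exp (- lam_star n) = lam n*exp (- lam n)) sequentially"
 shows "(\<exists>f :: nat \<Rightarrow> real \<Rightarrow> int.
      (\<lambda>n. real_of_int (f n (lam n))
         - (ln (real n)/ln (lam n) + 2*(ln (real n)/ln (1/lam_star n))))
       \<in> O(\<lambda>_. 1) \<and>
      whp (\<lambda>n. gnp n (lam n/real n))
        (\<lambda>n E. int (diam {1..n} E) \<in> {f n (lam n), f n (lam n) + 1}))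
    \<and> (\<forall>\<epsilon>::real. \<epsilon> > 0 \<longrightarrow>
      eventually (\<lambda>n.
       \<not> (\<exists>k::int. \<bar>ln (real n)/ln (1/lam_star n) - real_of_int k\<bar> \<le> \<epsilon>) \<and>
       \<not> (\<exists>k::int. \<bar>ln (real n)/ln (lam n) - real_of_int k\<bar> \<le> \<epsilon>)) sequentially \<longrightarrow>
      whp (\<lambda>n. gnp n (lam n/real n))
        (\<lambda>n E. int (diam {1..n} E) =
          \<lceil>ln (real n)/ln (lam n)\<rceil> + 2*\<lfloor>ln (real n)/ln (1/lam_star n)\<rfloor> + 1))"
proof -
 have lam1: "\<forall>\<^sub>F n in sequentially. 1 <= lam n" using assms(1) by (simp add: filterlim_at_top)
 have b: "\<forall>\<^sub>F n in sequentially. base n (lam n) (lam_star n)"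
  using assms(2,3) lam1 eventually_ge_at_top[of 1]
 proof eventually_elim
  case (elim n)
  have "0 < lam_star n*exp (- lam_star n)" using elim(2,3) by simp
  hence "0 < lam_star n" by (simp add: zero_less_mult_iff)
  moreover have "lam n^1000 <= (real n powr (1/1000))^1000" using elim(1,3) by (intro power_mono) auto
  moreover have "(real n powr (1/1000))^1000 = real n" using elim(4) by (simp add: powr_power)
  ultimately show ?case using elim(2) by (simp add: base_def)
 qed
 have ev: "\<forall>\<^sub>F n in sequentially. P (lam n)" if "\<forall>\<^sub>F L in at_top. P L" for P
  using assms(1) that unfolding filterlim_iff by blast
 \<comment> \<open>Only \<open>L = lam n\<close> matters, and there \<open>lam_star n\<close> is
   determined by \<open>L\<close> as the solution below 1 of the defining equation.\<close>
 define f :: "nat => real => int" where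
  "f n L = int (2 * k0 n L (lam_star n) + mm n L + shift n L (lam_star n))" for n L
 have part1: "(\<lambda>n. real_of_int (f n (lam n)) - (ln (real n)/ln (lam n) + 2*(ln (real n)/ln (1/lam_star n)))) \<in> O(\<lambda>_. 1)"
 proof (rule bigoI[where c = 10])
  show "\<forall>\<^sub>F n in sequentially. norm (real_of_int (f n (lam n)) - (ln (real n)/ln (lam n) + 2*(ln (real n)/ln (1/lam_star n)))) <= 10*norm (1::real)"
   using ev[OF params] b
  proof eventually_elim
   case (elim n)
   have 1: "\<bar>real (k0 n (lam n) (lam_star n)) - ln (real n)/ln (1/lam_star n)\<bar> <= 2"
    "\<bar>real (mm n (lam n)) - ln (real n)/ln (lam n)\<bar> <= 2"
    using elim(1)[rule_format, OF elim(2)] by blast+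
   have "real_of_int (f n (lam n)) = 2*real (k0 n (lam n) (lam_star n)) + real (mm n (lam n)) + real (shift n (lam n) (lam_star n))"
    by (simp add: f_def)
   moreover have "real (shift n (lam n) (lam_star n)) <= 2" by (simp add: shift_def)
   moreover have "0 <= real (shift n (lam n) (lam_star n))" by simp
   ultimately have "\<bar>real_of_int (f n (lam n)) - (ln (real n)/ln (lam n) + 2*(ln (real n)/ln (1/lam_star n)))\<bar> <= 10"
    using 1 by linarith
   thus ?case by simp
  qed
 qed
 have "\<forall>\<^sub>F n in sequentially. pd n (lam n) (\<lambda>d. \<not> int d \<in> {f n (lam n), f n (lam n) + 1}) <= 1001/ln (lam n)"
  using ev[OF two_point] b
 proof eventually_elim
  case (elim n)
  have eq: "int d \<in> {f n (lam n), f n (lam n) + 1} \<longleftrightarrow>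
   d = 2 * k0 n (lam n) (lam_star n) + mm n (lam n) + shift n (lam n) (lam_star n) \<or>
   d = 2 * k0 n (lam n) (lam_star n) + mm n (lam n) + shift n (lam n) (lam_star n) + 1" for d
   unfolding f_def by auto
  show ?case unfolding eq by (rule elim(1)[rule_format, OF elim(2)])
 qed
 from whp_from_pd[OF assms(1) b this]
 have part2: "whp (\<lambda>n. gnp n (lam n/real n)) (\<lambda>n E. int (diam {1..n} E) \<in> {f n (lam n), f n (lam n) + 1})" .
 have part3: "whp (\<lambda>n. gnp n (lam n/real n))
   (\<lambda>n E. int (diam {1..n} E) = \<lceil>ln (real n)/ln (lam n)\<rceil> + 2*\<lfloor>ln (real n)/ln (1/lam_star n)\<rfloor> + 1)"
  if e: "\<epsilon> > 0" and far: "\<forall>\<^sub>F n in sequentially.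
     \<not> (\<exists>k::int. \<bar>ln (real n)/ln (1/lam_star n) - real_of_int k\<bar> <= \<epsilon>) \<and>
     \<not> (\<exists>k::int. \<bar>ln (real n)/ln (lam n) - real_of_int k\<bar> <= \<epsilon>)" for \<epsilon> :: real
 proof -
  \<comment> \<open>\<open>one_point\<close> asks for a margin below 1; keeping distance \<epsilon>
    from the integers implies keeping the smaller distance.\<close>
  define d where "d = min \<epsilon> (1/2)"
  have d: "0 < d" "d < 1" "d <= \<epsilon>" using e by (auto simp: d_def)
  have "\<forall>\<^sub>F n in sequentially. pd n (lam n) (\<lambda>d. \<not> int d = \<lceil>ln (real n)/ln (lam n)\<rceil> + 2*\<lfloor>ln (real n)/ln (1/lam_star n)\<rfloor> + 1)
    <= 1001/ln (lam n)"
   using ev[OF one_point[OF d(1,2)]] b far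
  proof eventually_elim
   case (elim n)
   show ?case
    by (rule elim(1)[rule_format, OF elim(2)]) (use elim(3) d(3) in \<open>meson order_trans\<close>)+
  qed
  from whp_from_pd[OF assms(1) b this] show ?thesis .
 qed
 show ?thesis using part1 part2 part3 by blast
qed

end
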